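(* Let $\alpha\in(0,1)$ and $A>1$. Assume D.1, D.2, D.3, D.4 hold, let $C>2C_\Lambda\sqrt{1+\log(1/\alpha)/\log p}\vee[C_E\sqrt{1\vee[C_L+C_f+1/2]}]$, let the penalty level satisfy $\frac{c_0+3}{c_0-3}\Lambda(1-\alpha|X)\le\lambda\le C\,W_{\mathcal U}\sqrt{n\log p}$, and suppose $2C(1+c_0)W_{\mathcal U}A\sqrt{s\log(p\vee n)}<q\,\underline f^{1/2}\kappa_0\sqrt n$. Assume that $|\cup_{u\in\mathcal U}T_u|\le n$. Let $\varepsilon>0$ be arbitrary, and assume that D.5 holds with $\widetilde m=\widehat m:=\sup_{u\in\mathcal U}\|\hat\beta_{T_u^c}(u)\|_0$ with probability $1-\varepsilon$. Then there is a constant $C_\varepsilon$ such that the bounds $$\sup_{u\in\mathcal U}\|J_u^{1/2}(\widetilde\beta(u)-\beta(u))\|\le\frac{4C_\varepsilon\sqrt{\phi(\widehat m+s)}}{\underline f^{1/2}\widetilde\kappa_{\widehat m}}\sqrt{\frac{\widehat m\log(n\vee p)+s\log n}{n}}+\sup_{u\in\mathcal U}1\{T_u\not\subseteq\widehat T_u\}\cdot\frac{4\sqrt{2(1+c_0)A}}{\underline f^{1/2}\kappa_0}\cdot C\,W_{\mathcal U}\sqrt{\frac{s\log(n\vee p)}{n}},$$ $$\sup_{u\in\mathcal U}\sqrt{\mathrm E_x[x'(\widetilde\beta(u)-\beta(u))]^2}\le\sup_{u\in\mathcal U}\|J_u^{1/2}(\widetilde\beta(u)-\beta(u))\|/\underline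 f^{1/2},$$ $$\sup_{u\in\mathcal U}\|\widetilde\beta(u)-\beta(u)\|\le\sup_{u\in\mathcal U}\|J_u^{1/2}(\widetilde\beta(u)-\beta(u))\|/(\underline f^{1/2}\widetilde\kappa_{\widehat m})$$ hold with probability at least $1-\alpha-3\gamma-3p^{-A^2}-2\varepsilon$, provided that $s$ obeys the growth condition $$\widetilde q_{\widehat m}\frac{C_\varepsilon\sqrt{(\widehat m\log(n\vee p)+s\log n)\,\phi(\widehat m+s)}}{\sqrt n\,\underline f^{1/2}\widetilde\kappa_{\widehat m}}+\sup_{u\in\mathcal U}1\{T_u\not\subseteq\widehat T_u\}\,2A(1+c_0)\,C^2W_{\mathcal U}^2\,\frac{s\log(p\vee n)}{n\underline f\kappa_0^2}\le\widetilde q_{\widehat m}^{\,2}.$$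
   Context: Notation: $a\vee b=\max\{a,b\}$, $a\wedge b=\min\{a,b\}$; $\|\cdot\|,\|\cdot\|_1,\|\cdot\|_0$ are the $\ell_2$-norm, $\ell_1$-norm and number of non-zero components; $\mathbb E_n f(Z_i)=\frac1n\sum_{i=1}^n f(Z_i)$. For $T\subset\{1,\dots,p\}$, $\delta_T$ has components $\delta_j$ for $j\in T$ and $0$ otherwise. $\mathcal U\subset(0,1)$ is a compact set of quantile indices; $W_{\mathcal U}=\max_{u\in\mathcal U}1/\sqrt{u(1-u)}$. Model: the $u$-th conditional quantile of $y_i$ given $x_i\in\mathbb R^p$ is $x_i'\beta(u)$ for all $u\in\mathcal U$; $T_u=\mathrm{support}(\beta(u))$, $|T_u|\le s\le n/\log(n\vee p)$. $\rho_u(t)=(u-1\{t\le0\})t$, $\hat Q_u(\beta)=\mathbb E_n[\rho_u(y_i-x_i'\beta)]$, $Q_u(\beta)=\mathrm E[\rho_u(y_i-x_i'\beta)]$, $J_u=\mathrm E[f_{y_i|x_i}(x_i'\beta(u)|x_i)x_ix_i']$. Estimators: for penalty level $\lambda$ (possibly depending on $X=[x_1,\dots,x_n]'$), $\hat\beta(u)$ minimizes over $\beta\in\mathbb R^p$ the function $\hat Q_u(\beta)+\frac{\lambda\sqrt{u(1-u)}}n\sum_{j=1}^p\hat\sigma_j|\beta_j|$, $\hat\sigma_j^2=\mathbb E_n[x_{ij}^2]$; if the solution is not unique, $\hat\beta(u)$ is any optimal basic feasible solution of the equivalent linear program $\min \mathbb E_n[u\xi_i^++(1-u)\xi_i^-]+\frac{\lambda\sqrt{u(1-u)}}n\sum_j\hat\sigma_j(\beta_j^++\beta_j^-)$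 subject to $\xi_i^+-\xi_i^-=y_i-x_i'(\beta^+-\beta^-)$, all variables nonnegative, with $\hat\beta=\beta^+-\beta^-$. $\widehat T_u=\mathrm{support}(\hat\beta(u))$, and the post-penalized estimator is $\widetilde\beta(u)\in\arg\min_{\beta\in\mathbb R^p:\beta_{\widehat T_u^c}=0}\hat Q_u(\beta)$. $\mathrm E_x$ denotes expectation over $x$ (distributed as $x_i$) with the estimator held fixed, and $\mathrm E_x[x'\delta]^2$ means $\mathrm E_x[(x'\delta)^2]$. $\Lambda=n\sup_{u\in\mathcal U}\max_{1\le j\le p}|\mathbb E_n[x_{ij}(u-1\{u_i\le u\})/(\hat\sigma_j\sqrt{u(1-u)})]|$ with $u_1,\dots,u_n$ i.i.d. uniform$(0,1)$ independent of $X$; $\Lambda(1-\alpha|X)$ is its $(1-\alpha)$-quantile conditional on $X$. D.1: $(y_i,x_i')'$, $i=1,\dots,n$, are i.i.d. with the $u$-th conditional quantile of $y_i$ given $x_i$ equal to $x_i'\beta(u)$ for each $u\in\mathcal U$, first component of $x_i$ equal to one, $n\wedge p\ge3$. For each $x$ in the support of $x_i$, $f_{y_i|x_i}(y|x)$ is continuously differentiable in $y$ at each $y\in\mathbb R$; $f_{y_i|x_i}(y|x)$ and $\frac{\partial}{\partial y}f_{y_i|x_i}(y|x)$ are bounded in absolute value by constants $\bar f$ and $\bar f'$ uniformly in $y\in\mathbb R$ and $x$ in the support; and $f_{y_i|x_i}(x'\beta(u)|x)>\underline f>0$ uniformly in $u\in\mathcal U$ and $x$ in the support. D.2: $\sup_{u\in\mathcal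 U}\|\beta(u)\|_0\le s$, $\|\beta(u)-\beta(u')\|\le L|u-u'|$ for all $u,u'\in\mathcal U$, with $s\ge1$ and $\log L\le C_L\log(p\vee n)$ for some constant $C_L$. D.3: $\mathrm E[x_{ij}^2]=1$ for all $j$, and $P(\max_{1\le j\le p}|\hat\sigma_j-1|\le1/2)\ge1-\gamma\to1$ as $n\to\infty$. D.4: with $A_u=\{\delta\in\mathbb R^p:\|\delta_{T_u^c}\|_1\le c_0\|\delta_{T_u}\|_1,\ \|\delta_{T_u^c}\|_0\le n\}$ and $\overline T_u(\delta,m)\subset T_u^c$ the support of the $m$ largest in absolute value components of $\delta$ outside $T_u$ (empty if $m=0$), for some constants $m\ge0$ and $c_0\ge9$, $$\kappa_m^2:=\inf_{u\in\mathcal U}\inf_{\delta\in A_u,\delta\ne0}\frac{\delta'\mathrm E[x_ix_i']\delta}{\|\delta_{T_u\cup\overline T_u(\delta,m)}\|^2}>0,$$ $\log(\underline f\kappa_0^2)\le C_f\log(n\vee p)$ for some constant $C_f$ ($\kappa_0$ is $\kappa_m$ with $m=0$), and $$q:=\frac38\frac{\underline f^{3/2}}{\bar f'}\inf_{u\in\mathcal U}\inf_{\delta\in A_u,\delta\ne0}\frac{\mathrm E[|x_i'\delta|^2]^{3/2}}{\mathrm E[|x_i'\delta|^3]}>0.$$ D.5 (for a given $\widetilde m\ge0$): with $\widetilde A_u(\widetilde m)=\{\delta\in\mathbb R^p:\|\delta_{T_u^c}\|_0\le\widetilde m\}$, $$\widetilde\kappa_{\widetilde m}^2:=\inf_{u\in\mathcal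 U}\inf_{\delta\in\widetilde A_u(\widetilde m),\delta\ne0}\frac{\delta'\mathrm E[x_ix_i']\delta}{\delta'\delta}>0,\qquad\widetilde q_{\widetilde m}:=\frac38\frac{\underline f^{3/2}}{\bar f'}\inf_{u\in\mathcal U}\inf_{\delta\in\widetilde A_u(\widetilde m),\delta\ne0}\frac{\mathrm E[|x_i'\delta|^2]^{3/2}}{\mathrm E[|x_i'\delta|^3]}>0.$$ $\phi(k)=\sup_{\delta\ne0,\|\delta\|_0\le k}\left\{\frac{\mathbb E_n[(x_i'\delta)^2]}{\delta'\delta}\vee\frac{\mathrm E[(x_i'\delta)^2]}{\delta'\delta}\right\}$. Constants (their existence is established by separate results): $C_\Lambda$ is a universal constant such that $P(\Lambda\ge kC_\Lambda W_{\mathcal U}\sqrt{n\log p}\,|X)\le p^{-k^2+1}$ for $k\ge1$ and $\Lambda(1-\alpha|X)\le\sqrt{1+\log(1/\alpha)/\log p}\,C_\Lambda W_{\mathcal U}\sqrt{n\log p}$ with probability 1. $C_E$ is a universal constant such that under D.1–D.4, for any $t>0$ and $A>1$, with probability at least $1-3\gamma-3p^{-A^2}$, $$\sup_{u\in\mathcal U,\delta\in A_u,\|J_u^{1/2}\delta\|\le t}\left|\hat Q_u(\beta(u)+\delta)-Q_u(\beta(u)+\delta)-(\hat Q_u(\beta(u))-Q_u(\beta(u)))\right|\le t\,C_E\frac{(1+c_0)A}{\underline f^{1/2}\kappa_0}\sqrt{\frac{s\log(p\vee[L\underline f^{1/2}\kappa_0/t])}{n}}.$$ *)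

theory Defs
  imports "HOL-Probability.Probability"
begin

text \<open>
  Vectors in \<open>\<real>\<^sup>p\<close> and \<open>p \<times> p\<close> matrices are functions on \<open>nat\<close> of which only the
  components with index below \<open>p\<close> matter; indices start at \<open>0\<close>.
\<close>

definition dot :: "nat \<Rightarrow> (nat \<Rightarrow> real) \<Rightarrow> (nat \<Rightarrow> real) \<Rightarrow> real" where
  "dot p v w = (\<Sum>j<p. v j * w j)"

definition l1norm :: "nat \<Rightarrow> (nat \<Rightarrow> real) \<Rightarrow> real" where
  "l1norm p v = (\<Sum>j<p. \<bar>v j\<bar>)"

definition l2norm :: "nat \<Rightarrow> (nat \<Rightarrow> real) \<Rightarrow> real" where
  "l2norm p v = L2_set v {..<p}"

definition supp :: "nat \<Rightarrow> (nat \<Rightarrow> real) \<Rightarrow> nat set" where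
  "supp p v = {j. j < p \<and> v j \<noteq> 0}"

definition l0norm :: "nat \<Rightarrow> (nat \<Rightarrow> real) \<Rightarrow> nat" where
  "l0norm p v = card (supp p v)"

definition nonzero :: "nat \<Rightarrow> (nat \<Rightarrow> real) \<Rightarrow> bool" where
  "nonzero p v \<longleftrightarrow> (\<exists>j<p. v j \<noteq> 0)"

definition restr :: "nat set \<Rightarrow> (nat \<Rightarrow> real) \<Rightarrow> nat \<Rightarrow> real" where
  "restr T v = (\<lambda>j. if j \<in> T then v j else 0)"

definition matvec :: "nat \<Rightarrow> (nat \<Rightarrow> nat \<Rightarrow> real) \<Rightarrow> (nat \<Rightarrow> real) \<Rightarrow> nat \<Rightarrow> real" where
  "matvec p A v = (\<lambda>i. \<Sum>j<p. A i j * v j)"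

definition matmul :: "nat \<Rightarrow> (nat \<Rightarrow> nat \<Rightarrow> real) \<Rightarrow> (nat \<Rightarrow> nat \<Rightarrow> real) \<Rightarrow> nat \<Rightarrow> nat \<Rightarrow> real" where
  "matmul p A B = (\<lambda>i j. \<Sum>k<p. A i k * B k j)"

definition psd :: "nat \<Rightarrow> (nat \<Rightarrow> nat \<Rightarrow> real) \<Rightarrow> bool" where
  "psd p A \<longleftrightarrow> (\<forall>i<p. \<forall>j<p. A i j = A j i) \<and> (\<forall>v. 0 \<le> dot p v (matvec p A v))"

definition is_psd_root :: "nat \<Rightarrow> (nat \<Rightarrow> nat \<Rightarrow> real) \<Rightarrow> (nat \<Rightarrow> nat \<Rightarrow> real) \<Rightarrow> bool" where
  "is_psd_root p A S \<longleftrightarrow> psd p S \<and> (\<forall>i<p. \<forall>j<p. matmul p S S i j = A i j)"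

definition psd_root :: "nat \<Rightarrow> (nat \<Rightarrow> nat \<Rightarrow> real) \<Rightarrow> nat \<Rightarrow> nat \<Rightarrow> real" where
  "psd_root p A = (SOME S. is_psd_root p A S)"

text \<open>
  Existence of the root: for \<open>0 \<le> B \<le> I\<close>, the binomial series of \<open>(I - B)\<^sup>1\<^sup>/\<^sup>2\<close> converges.
\<close>

definition unit_vec :: "nat \<Rightarrow> nat \<Rightarrow> real" where
  "unit_vec i = (\<lambda>j. if j = i then 1 else 0)"

lemma dot_unit: "i < p \<Longrightarrow> dot p (unit_vec i) v = v i" "i < p \<Longrightarrow> dot p v (unit_vec i) = v i"
  by (simp_all add: dot_def unit_vec_def if_distrib[of "\<lambda>x. x * _"] if_distrib[of "\<lambda>x. _ * x"] cong: if_cong)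

lemma dot_commute: "dot p v w = dot p w v"
  by (simp add: dot_def mult.commute)

lemma dot_self_nonneg: "0 \<le> dot p v v"
  by (simp add: dot_def sum_nonneg)

lemma dot_add_right: "dot p v (\<lambda>j. w j + z j) = dot p v w + dot p v z"
  by (simp add: dot_def algebra_simps sum.distrib)

lemma dot_diff_right: "dot p v (\<lambda>j. w j - z j) = dot p v w - dot p v z"
  by (simp add: dot_def algebra_simps sum_subtractf)

lemma dot_add_left: "dot p (\<lambda>j. w j + z j) v = dot p w v + dot p z v"
  by (simp add: dot_def algebra_simps sum.distrib)

lemma dot_diff_left: "dot p (\<lambda>j. w j - z j) v = dot p w v - dot p z v"
  by (simp add: dot_def algebra_simps sum_subtractf)

lemma matvec_add: "matvec p B (\<lambda>j. v j + w j) = (\<lambda>i. matvec p B v i + matvec p B w i)"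
  by (simp add: matvec_def algebra_simps sum.distrib)

lemma matvec_diff: "matvec p B (\<lambda>j. v j - w j) = (\<lambda>i. matvec p B v i - matvec p B w i)"
  by (simp add: matvec_def algebra_simps sum_subtractf)

lemma dot_matvec_sym:
  assumes "\<forall>i<p. \<forall>j<p. B i j = B j i"
  shows "dot p v (matvec p B w) = dot p (matvec p B v) w"
proof -
  have "dot p v (matvec p B w) = (\<Sum>i<p. \<Sum>j<p. v i * B i j * w j)"
    by (simp add: dot_def matvec_def sum_distrib_left mult.assoc)
  also have "\<dots> = (\<Sum>j<p. \<Sum>i<p. v i * B i j * w j)"
    by (rule sum.swap)
  also have "\<dots> = (\<Sum>j<p. \<Sum>i<p. v i * B j i * w j)"
    using assms by (intro sum.cong refl) auto
  also have "\<dots> = dot p (matvec p B v) w"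
    unfolding dot_def matvec_def sum_distrib_right by (intro sum.cong refl) (simp add: mult_ac)
  finally show ?thesis .
qed

lemma dot_matvec_pow_sym:
  assumes "\<forall>i<p. \<forall>j<p. B i j = B j i"
  shows "dot p v ((matvec p B ^^ (a + b)) w) = dot p ((matvec p B ^^ a) v) ((matvec p B ^^ b) w)"
proof (induction a arbitrary: v)
  case (Suc a)
  have "dot p v ((matvec p B ^^ (Suc a + b)) w) = dot p (matvec p B v) ((matvec p B ^^ (a + b)) w)"
    using dot_matvec_sym[OF assms] by simp
  also have "\<dots> = dot p ((matvec p B ^^ a) (matvec p B v)) ((matvec p B ^^ b) w)"
    by (rule Suc.IH)
  finally show ?case by (simp add: funpow_swap1)
qed simp

lemma contraction_norm_le:
  assumes "psd p B" and le: "\<And>v. dot p v (matvec p B v) \<le> dot p v v"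
  shows "dot p (matvec p B v) (matvec p B v) \<le> dot p v (matvec p B v)"
proof -
  let ?B = "matvec p B"
  let ?w = "\<lambda>j. v j - ?B v j"
  have sym: "\<And>v w. dot p v (?B w) = dot p (?B v) w"
    using assms(1) dot_matvec_sym unfolding psd_def by blast
  have "0 \<le> dot p ?w (?B ?w)" using assms(1) by (auto simp: psd_def)
  moreover have "dot p ?w (?B ?w) =
      dot p v (?B v) - 2 * dot p (?B v) (?B v) + dot p (?B v) (?B (?B v))"
    by (simp add: matvec_diff dot_diff_left dot_diff_right sym[of v "?B v"])
  moreover have "dot p (?B v) (?B (?B v)) \<le> dot p (?B v) (?B v)" by (rule le)
  ultimately show ?thesis by simp
qed

lemma quad_pow_bounds:
  assumes "psd p B" and le: "\<And>v. dot p v (matvec p B v) \<le> dot p v v"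
  shows "0 \<le> dot p v ((matvec p B ^^ k) v) \<and> dot p v ((matvec p B ^^ k) v) \<le> dot p v v"
proof (induction k arbitrary: v rule: less_induct)
  case (less k)
  have sym: "\<forall>i<p. \<forall>j<p. B i j = B j i" using assms(1) by (simp add: psd_def)
  consider "k = 0" | "k = 1" | k' where "k = Suc (Suc k')"
    by (metis One_nat_def not0_implies_Suc)
  then show ?case
  proof cases
    case 1
    then show ?thesis by (simp add: dot_self_nonneg)
  next
    case 2
    then show ?thesis using assms by (simp add: psd_def)
  next
    case 3
    let ?w = "matvec p B v"
    have "dot p v ((matvec p B ^^ k) v) = dot p ?w ((matvec p B ^^ k') ?w)"
      using dot_matvec_sym[OF sym, of v "(matvec p B ^^ k') ?w"] by (simp add: 3 funpow_swap1)
    moreover have "dot p ?w ?w \<le> dot p v v"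
      using contraction_norm_le[OF assms, of v] le[of v] by linarith
    ultimately show ?thesis
      using less[of k' ?w] 3 by auto
  qed
qed

lemma funpow_matvec_add:
  "(matvec p B ^^ k) (\<lambda>j. v j + w j) = (\<lambda>j. (matvec p B ^^ k) v j + (matvec p B ^^ k) w j)"
  by (induction k) (simp_all add: matvec_add)

lemma funpow_matvec_diff:
  "(matvec p B ^^ k) (\<lambda>j. v j - w j) = (\<lambda>j. (matvec p B ^^ k) v j - (matvec p B ^^ k) w j)"
  by (induction k) (simp_all add: matvec_diff)

lemma bilinear_pow_bound:
  assumes "psd p B" and "\<And>v. dot p v (matvec p B v) \<le> dot p v v"
  shows "\<bar>dot p v ((matvec p B ^^ k) w)\<bar> \<le> dot p v v + dot p w w"
proof -
  let ?P = "matvec p B ^^ k"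
  have "\<forall>i<p. \<forall>j<p. B i j = B j i" using assms(1) by (simp add: psd_def)
  from dot_matvec_pow_sym[OF this, of w k 0 v]
  have s: "dot p w (?P v) = dot p v (?P w)" by (simp add: dot_commute)
  have 1: "dot p (\<lambda>j. v j + w j) (?P (\<lambda>j. v j + w j))
      = dot p v (?P v) + 2 * dot p v (?P w) + dot p w (?P w)"
    by (simp add: funpow_matvec_add dot_add_left dot_add_right s)
  have 2: "dot p (\<lambda>j. v j - w j) (?P (\<lambda>j. v j - w j))
      = dot p v (?P v) - 2 * dot p v (?P w) + dot p w (?P w)"
    by (simp add: funpow_matvec_diff dot_diff_left dot_diff_right s)
  note b = quad_pow_bounds[OF assms, where k = k]
  from 1 2 b[of "\<lambda>j. v j + w j"] b[of "\<lambda>j. v j - w j"] b[of v] b[of w]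
  show ?thesis by linarith
qed

definition root_coef :: "nat \<Rightarrow> real" where
  "root_coef k = (1 / 2 gchoose k) * (- 1) ^ k"

lemma gbinomial_Suc_step:
  fixes a :: real
  shows "a gchoose Suc k = (a gchoose k) * ((a - real k) / real (Suc k))"
proof -
  have "real (Suc k) * (a gchoose Suc k) = (a gchoose k) * (a - real k)"
    using gbinomial_mult_1[of a k] by (simp add: right_diff_distrib mult.commute del: of_nat_Suc)
  then show ?thesis by (simp add: nonzero_eq_divide_eq mult.commute del: of_nat_Suc)
qed

lemma root_coef_Suc: "root_coef (Suc k) = root_coef k * ((real k - 1 / 2) / real (Suc k))"
  unfolding root_coef_def gbinomial_Suc_step[of "1 / 2"]
  by (simp add: minus_divide_left[symmetric] algebra_simps diff_divide_distrib)

lemma root_coef_nonpos: "root_coef (Suc k) \<le> 0"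
proof (induction k)
  case 0
  show ?case by (simp add: root_coef_def)
next
  case (Suc k)
  then show ?case
    by (subst root_coef_Suc) (intro mult_nonpos_nonneg divide_nonneg_nonneg; simp)
qed

lemma root_coef_sum_nonneg: "0 \<le> (\<Sum>k\<le>n. root_coef k)"
proof -
  have *: "0 \<le> (- 1) ^ n * (- 1 / 2 gchoose n :: real)"
  proof (induction n)
    case (Suc n)
    have "(- 1) ^ Suc n * (- 1 / 2 gchoose Suc n :: real)
        = ((- 1) ^ n * (- 1 / 2 gchoose n)) * ((1 / 2 + real n) / real (Suc n))"
      unfolding gbinomial_Suc_step[of "- 1 / 2"]
      by (simp add: algebra_simps add_divide_distrib diff_divide_distrib)
    moreover have "0 \<le> (1 / 2 + real n) / real (Suc n)" by simp
    ultimately show ?case using Suc by (metis mult_nonneg_nonneg)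
  qed simp
  have "(\<Sum>k\<le>n. root_coef k) = (- 1) ^ n * (1 / 2 - 1 gchoose n :: real)"
    unfolding root_coef_def by (rule gbinomial_sum_lower_neg)
  also have "(1 / 2 - 1 :: real) = - 1 / 2" by simp
  finally show ?thesis using * by simp
qed

lemma root_coef_0: "root_coef 0 = 1"
  by (simp add: root_coef_def)

lemma summable_root_coef: "summable (\<lambda>k. \<bar>root_coef k\<bar>)"
proof -
  have "(\<Sum>k<n. \<bar>root_coef (Suc k)\<bar>) \<le> 1" for n
  proof -
    have "(\<Sum>k<n. \<bar>root_coef (Suc k)\<bar>) = - (\<Sum>k<n. root_coef (Suc k))"
      using root_coef_nonpos by (simp add: sum_negf[symmetric] abs_of_nonpos)
    moreover have "(\<Sum>k\<le>n. root_coef k) = root_coef 0 + (\<Sum>k<n. root_coef (Suc k))"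
      by (simp add: sum.atMost_shift)
    ultimately show ?thesis using root_coef_sum_nonneg[of n] by (simp add: root_coef_0)
  qed
  then have "summable (\<lambda>k. \<bar>root_coef (Suc k)\<bar>)"
    by (intro summableI_nonneg_bounded[where x = 1]) auto
  then show ?thesis by (rule summable_Suc_iff[THEN iffD1])
qed

lemma root_coef_convolution:
  "(\<Sum>i\<le>k. root_coef i * root_coef (k - i)) = (if k = 0 then 1 else if k = 1 then - 1 else 0)"
proof -
  have "(\<Sum>i\<le>k. root_coef i * root_coef (k - i))
      = (\<Sum>i\<le>k. (1 / 2 gchoose i) * (1 / 2 gchoose (k - i)) * (- 1) ^ k)"
    by (intro sum.cong refl)
       (simp add: root_coef_def power_add[symmetric])
  also have "\<dots> = (1 / 2 + 1 / 2 gchoose k) * (- 1) ^ k"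
    by (subst gbinomial_Vandermonde[symmetric]) (simp add: sum_distrib_right atMost_atLeast0)
  also have "(1 / 2 + 1 / 2 :: real) = of_nat 1" by simp
  also have "(of_nat 1 gchoose k :: real) = of_nat (1 choose k)"
    by (rule binomial_gbinomial[symmetric])
  finally show ?thesis by (cases k) (auto simp: binomial_eq_0)
qed

lemma psd_root_exists_contraction:
  assumes B: "psd p B" and le: "\<And>v. dot p v (matvec p B v) \<le> dot p v v"
  shows "\<exists>S. is_psd_root p (\<lambda>i j. unit_vec i j - B i j) S"
proof -
  let ?P = "\<lambda>k. matvec p B ^^ k"
  define b where "b k i j = ?P k (unit_vec j) i" for k i j
  define S where "S i j = (\<Sum>k. root_coef k * b k i j)" for i j
  have sym: "\<forall>i<p. \<forall>j<p. B i j = B j i" using B by (simp add: psd_def)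
  have bsym: "b k i j = ?P k (unit_vec i) j" if "i < p" "j < p" for k i j
    using dot_matvec_pow_sym[OF sym, of "unit_vec i" k 0 "unit_vec j"] that
    by (simp add: b_def dot_unit)
  have bb: "\<bar>b k i j\<bar> \<le> 2" if "i < p" "j < p" for k i j
    using bilinear_pow_bound[OF B le, of "unit_vec i" k "unit_vec j"] that
    by (simp add: b_def dot_unit) (simp add: unit_vec_def)
  have summ: "summable (\<lambda>k. norm (root_coef k * b k i j))" if "i < p" "j < p" for i j
  proof (rule summable_comparison_test')
    show "summable (\<lambda>k. \<bar>root_coef k\<bar> * 2)" by (intro summable_mult2 summable_root_coef)
    show "norm (norm (root_coef k * b k i j)) \<le> \<bar>root_coef k\<bar> * 2" if "0 \<le> k" for k
      using bb[OF \<open>i < p\<close> \<open>j < p\<close>, of k] by (simp add: abs_mult mult_left_mono)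
  qed
  have pw: "dot p v (?P k w) = (\<Sum>i<p. \<Sum>j<p. v i * b k i j * w j)" for v w k
  proof -
    have "?P k w i = (\<Sum>j<p. b k i j * w j)" if "i < p" for i
    proof -
      have "?P k w i = dot p (?P k (unit_vec i)) w"
        using dot_matvec_pow_sym[OF sym, of "unit_vec i" k 0 w] that by (simp add: dot_unit)
      then show ?thesis using bsym that by (simp add: dot_def)
    qed
    then show ?thesis by (simp add: dot_def sum_distrib_left mult.assoc)
  qed
  have quadS: "(\<lambda>k. root_coef k * dot p v (?P k v)) sums dot p v (matvec p S v)" for v
  proof -
    have "(\<lambda>k. \<Sum>i<p. \<Sum>j<p. v i * (root_coef k * b k i j) * v j)
        sums (\<Sum>i<p. \<Sum>j<p. v i * S i j * v j)"
      unfolding S_def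
      by (intro sums_sum sums_mult sums_mult2 summable_sums summable_norm_cancel[OF summ]) auto
    moreover have "(\<Sum>i<p. \<Sum>j<p. v i * (root_coef k * b k i j) * v j)
        = root_coef k * dot p v (?P k v)" for k
      unfolding pw sum_distrib_left by (intro sum.cong refl) (simp only: mult_ac)
    moreover have "(\<Sum>i<p. \<Sum>j<p. v i * S i j * v j) = dot p v (matvec p S v)"
      by (simp add: dot_def matvec_def sum_distrib_left mult.assoc)
    ultimately show ?thesis by simp
  qed
  have "psd p S"
    unfolding psd_def
  proof (intro conjI allI impI)
    show "S i j = S j i" if "i < p" "j < p" for i j
      using that bsym by (simp add: S_def b_def)
    show "0 \<le> dot p v (matvec p S v)" for v
    proof -
      have lim: "(\<lambda>n. \<Sum>k\<le>n. root_coef k * dot p v (?P k v)) \<longlonglongrightarrow> dot p v (matvec p S v)"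
        using quadS[of v] by (simp add: sums_def_le)
      have "0 \<le> (\<Sum>k\<le>n. root_coef k * dot p v (?P k v))" for n
      proof -
        have "0 \<le> (\<Sum>k\<le>n. root_coef k) * dot p v v"
          by (intro mult_nonneg_nonneg root_coef_sum_nonneg dot_self_nonneg)
        also have "\<dots> = (\<Sum>k\<le>n. root_coef k * dot p v v)" by (rule sum_distrib_right)
        also have "\<dots> \<le> (\<Sum>k\<le>n. root_coef k * dot p v (?P k v))"
        proof (rule sum_mono)
          fix k
          show "root_coef k * dot p v v \<le> root_coef k * dot p v (?P k v)"
            using quad_pow_bounds[OF B le, of v k] root_coef_nonpos
            by (cases k) (auto intro: mult_left_mono_neg)
        qed
        finally show ?thesis .
      qed
      with lim show ?thesis by (intro LIMSEQ_le_const) auto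
    qed
  qed
  moreover have "matmul p S S i j = unit_vec i j - B i j" if ij: "i < p" "j < p" for i j
  proof -
    have conv: "(\<Sum>l<p. b a i l * b c l j) = b (a + c) i j" for a c
    proof -
      have "(\<Sum>l<p. b a i l * b c l j) = dot p (?P a (unit_vec i)) (?P c (unit_vec j))"
        using bsym ij by (simp add: dot_def b_def[of c])
      also have "\<dots> = b (a + c) i j"
        using dot_matvec_pow_sym[OF sym, of "unit_vec i" a c "unit_vec j"] ij
        by (simp add: b_def dot_unit)
      finally show ?thesis .
    qed
    have "(\<lambda>k. \<Sum>l<p. \<Sum>a\<le>k. (root_coef a * b a i l) * (root_coef (k - a) * b (k - a) l j))
        sums (\<Sum>l<p. S i l * S l j)"
      unfolding S_def by (intro sums_sum Cauchy_product_sums summ) (use ij in auto)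
    moreover have "(\<Sum>l<p. \<Sum>a\<le>k. (root_coef a * b a i l) * (root_coef (k - a) * b (k - a) l j))
        = (if k = 0 then b 0 i j else if k = 1 then - b 1 i j else 0)" for k
    proof -
      have "(\<Sum>l<p. \<Sum>a\<le>k. (root_coef a * b a i l) * (root_coef (k - a) * b (k - a) l j))
          = (\<Sum>a\<le>k. \<Sum>l<p. (root_coef a * b a i l) * (root_coef (k - a) * b (k - a) l j))"
        by (rule sum.swap)
      also have "\<dots> = (\<Sum>a\<le>k. (root_coef a * root_coef (k - a)) * b k i j)"
      proof (rule sum.cong[OF refl])
        fix a assume "a \<in> {..k}"
        then have "(\<Sum>l<p. b a i l * b (k - a) l j) = b k i j" using conv[of a "k - a"] by simp
        then show "(\<Sum>l<p. (root_coef a * b a i l) * (root_coef (k - a) * b (k - a) l j))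
            = (root_coef a * root_coef (k - a)) * b k i j"
          by (simp add: mult_ac flip: sum_distrib_left)
      qed
      also have "\<dots> = (\<Sum>a\<le>k. root_coef a * root_coef (k - a)) * b k i j"
        by (simp add: sum_distrib_right)
      also have "\<dots> = (if k = 0 then b 0 i j else if k = 1 then - b 1 i j else 0)"
        by (simp add: root_coef_convolution)
      finally show ?thesis .
    qed
    moreover have "(\<lambda>k. if k = 0 then b 0 i j else if k = 1 then - b 1 i j else 0)
        sums (\<Sum>k<2::nat. if k = 0 then b 0 i j else if k = 1 then - b 1 i j else 0)"
      by (rule sums_finite) auto
    ultimately have "(\<Sum>l<p. S i l * S l j) = b 0 i j - b 1 i j"
      by (simp add: sums_unique2 numeral_2_eq_2)
    moreover have "b 1 i j = B i j"
      using ij by (simp add: b_def matvec_def unit_vec_def if_distrib[of "\<lambda>x. _ * x"] cong: if_cong)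
    moreover have "b 0 i j = unit_vec i j" by (simp add: b_def unit_vec_def)
    ultimately show ?thesis by (simp add: matmul_def)
  qed
  ultimately show ?thesis by (auto simp: is_psd_root_def)
qed

theorem psd_root_exists:
  assumes A: "psd p A"
  shows "\<exists>S. is_psd_root p A S"
proof -
  define c where "c = 1 + (\<Sum>i<p. \<Sum>j<p. \<bar>A i j\<bar>)"
  have c: "c > 0" unfolding c_def by (intro add_pos_nonneg sum_nonneg) auto
  have Ale: "dot p v (matvec p A v) \<le> c * dot p v v" for v
  proof -
    have "dot p v (matvec p A v) = (\<Sum>i<p. \<Sum>j<p. A i j * (v i * v j))"
      by (simp add: dot_def matvec_def sum_distrib_left mult_ac)
    also have "\<dots> \<le> (\<Sum>i<p. \<Sum>j<p. \<bar>A i j\<bar> * dot p v v)"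
    proof (intro sum_mono)
      fix i j assume ij: "i \<in> {..<p}" "j \<in> {..<p}"
      have sq: "(v l)\<^sup>2 \<le> dot p v v" if "l \<in> {..<p}" for l
        unfolding dot_def power2_eq_square[symmetric]
        by (rule member_le_sum[OF that]) auto
      have "\<bar>v i * v j\<bar> \<le> ((v i)\<^sup>2 + (v j)\<^sup>2) / 2"
        using sum_squares_bound[of "\<bar>v i\<bar>" "\<bar>v j\<bar>"] by (simp add: abs_mult)
      also have "\<dots> \<le> dot p v v" using sq[OF ij(1)] sq[OF ij(2)] by simp
      finally have "\<bar>v i * v j\<bar> \<le> dot p v v" .
      then have "\<bar>A i j\<bar> * \<bar>v i * v j\<bar> \<le> \<bar>A i j\<bar> * dot p v v" by (simp add: mult_left_mono)
      then show "A i j * (v i * v j) \<le> \<bar>A i j\<bar> * dot p v v"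
        by (metis abs_ge_self abs_mult order_trans)
    qed
    also have "\<dots> = (c - 1) * dot p v v" by (simp add: c_def sum_distrib_right)
    also have "\<dots> \<le> c * dot p v v" using dot_self_nonneg by (simp add: mult_right_mono)
    finally show ?thesis .
  qed
  define B where "B i j = unit_vec i j - A i j / c" for i j
  have mv: "dot p v (matvec p B v) = dot p v v - dot p v (matvec p A v) / c" for v
  proof -
    have "matvec p B v i = v i - matvec p A v i / c" if "i < p" for i
    proof -
      have "matvec p B v i = (\<Sum>j<p. unit_vec i j * v j) - (\<Sum>j<p. A i j * v j) / c"
        by (simp add: matvec_def B_def algebra_simps sum_subtractf sum_divide_distrib)
      then show ?thesis using dot_unit(1)[OF that, of v] by (simp add: dot_def matvec_def)
    qed
    then have "dot p v (matvec p B v) = (\<Sum>i<p. v i * (v i - matvec p A v i / c))"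
      by (simp add: dot_def)
    then show ?thesis
      by (simp add: dot_def algebra_simps sum_subtractf sum_divide_distrib)
  qed
  have "psd p B"
    unfolding psd_def
  proof (intro conjI allI impI)
    show "B i j = B j i" if "i < p" "j < p" for i j
      using A that by (simp add: B_def psd_def unit_vec_def)
    show "0 \<le> dot p v (matvec p B v)" for v
      using Ale[of v] c by (simp add: mv field_simps)
  qed
  moreover have "dot p v (matvec p B v) \<le> dot p v v" for v
    using A c by (simp add: mv psd_def)
  ultimately obtain R where R: "is_psd_root p (\<lambda>i j. unit_vec i j - B i j) R"
    using psd_root_exists_contraction by blast
  define S where "S i j = sqrt c * R i j" for i j
  have "matvec p S v = (\<lambda>i. sqrt c * matvec p R v i)" for v
    by (simp add: S_def matvec_def sum_distrib_left mult_ac)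
  then have "dot p v (matvec p S v) = sqrt c * dot p v (matvec p R v)" for v
    by (simp add: dot_def sum_distrib_left mult_ac)
  then have "psd p S" using R c by (simp add: is_psd_root_def psd_def S_def)
  moreover have "matmul p S S i j = A i j" if "i < p" "j < p" for i j
  proof -
    have "matmul p S S i j = (\<Sum>k<p. (sqrt c * sqrt c) * (R i k * R k j))"
      unfolding matmul_def S_def by (intro sum.cong refl) (simp only: mult_ac)
    also have "\<dots> = c * matmul p R R i j"
      using c by (simp add: matmul_def sum_distrib_left)
    also have "\<dots> = A i j" using R that c by (simp add: is_psd_root_def B_def)
    finally show ?thesis .
  qed
  ultimately show ?thesis by (auto simp: is_psd_root_def)
qed

lemma norm_psd_root:
  assumes "psd p A"
  shows "l2norm p (matvec p (psd_root p A) v) = sqrt (dot p v (matvec p A v))"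
proof -
  let ?S = "psd_root p A"
  have S: "is_psd_root p A ?S"
    unfolding psd_root_def using psd_root_exists[OF assms] by (rule someI_ex)
  have "dot p (matvec p ?S v) (matvec p ?S v) = dot p v (matvec p ?S (matvec p ?S v))"
    using S by (intro dot_matvec_sym[symmetric]) (simp add: is_psd_root_def psd_def)
  also have "\<dots> = dot p v (matvec p A v)"
  proof -
    have "matvec p ?S (matvec p ?S v) i = matvec p A v i" if "i < p" for i
    proof -
      have "matvec p ?S (matvec p ?S v) i = (\<Sum>k<p. \<Sum>j<p. ?S i k * ?S k j * v j)"
        by (simp add: matvec_def sum_distrib_left mult.assoc)
      also have "\<dots> = (\<Sum>j<p. \<Sum>k<p. ?S i k * ?S k j * v j)" by (rule sum.swap)
      also have "\<dots> = matvec p A v i"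
        using S that by (simp add: matvec_def is_psd_root_def matmul_def sum_distrib_right[symmetric])
      finally show ?thesis .
    qed
    then show ?thesis by (simp add: dot_def)
  qed
  finally show ?thesis
    by (simp add: l2norm_def L2_set_def dot_def power2_eq_square)
qed

text \<open>
  ``\<open>P\<close> holds with probability at least \<open>r\<close>'', without requiring the set of outcomes satisfying
  \<open>P\<close> to be measurable (estimators are arbitrary selections); for a measurable \<open>P\<close> this is
  \<open>r \<le> measure M {\<omega> \<in> space M. P \<omega>}\<close>.
\<close>

definition holds_with_prob :: "'a measure \<Rightarrow> real \<Rightarrow> ('a \<Rightarrow> bool) \<Rightarrow> bool" where
  "holds_with_prob M r P \<longleftrightarrow> (\<exists>E\<in>sets M. r \<le> measure M E \<and> (\<forall>\<omega>\<in>E. P \<omega>))"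

definition emp_mean :: "nat \<Rightarrow> (nat \<Rightarrow> real) \<Rightarrow> real" where
  "emp_mean n g = (1 / real n) * (\<Sum>i<n. g i)"

definition check_loss :: "real \<Rightarrow> real \<Rightarrow> real" where
  "check_loss u t = (u - of_bool (t \<le> 0)) * t"

definition emp_loss :: "nat \<Rightarrow> nat \<Rightarrow> (nat \<Rightarrow> real) \<Rightarrow> (nat \<Rightarrow> nat \<Rightarrow> real) \<Rightarrow> real \<Rightarrow> (nat \<Rightarrow> real) \<Rightarrow> real" where
  "emp_loss n p y X u b = emp_mean n (\<lambda>i. check_loss u (y i - dot p (X i) b))"

definition sigma_hat :: "nat \<Rightarrow> (nat \<Rightarrow> nat \<Rightarrow> real) \<Rightarrow> nat \<Rightarrow> real" where
  "sigma_hat n X j = sqrt (emp_mean n (\<lambda>i. (X i j)\<^sup>2))"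

definition pen_loss ::
  "nat \<Rightarrow> nat \<Rightarrow> (nat \<Rightarrow> real) \<Rightarrow> (nat \<Rightarrow> nat \<Rightarrow> real) \<Rightarrow> real \<Rightarrow> real \<Rightarrow> (nat \<Rightarrow> real) \<Rightarrow> real" where
  "pen_loss n p y X lam u b =
     emp_loss n p y X u b
     + lam * sqrt (u * (1 - u)) / real n * (\<Sum>j<p. sigma_hat n X j * \<bar>b j\<bar>)"

text \<open>The linear program has variables \<open>(\<xi>\<^sup>+, \<xi>\<^sup>-, \<beta>\<^sup>+, \<beta>\<^sup>-)\<close>.\<close>

type_synonym lp_point = "(nat \<Rightarrow> real) \<times> (nat \<Rightarrow> real) \<times> (nat \<Rightarrow> real) \<times> (nat \<Rightarrow> real)"

definition lp_objective ::
  "nat \<Rightarrow> nat \<Rightarrow> (nat \<Rightarrow> nat \<Rightarrow> real) \<Rightarrow> real \<Rightarrow> real \<Rightarrow> lp_point \<Rightarrow> real" where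
  "lp_objective n p X lam u = (\<lambda>(xip, xim, bp, bm).
     emp_mean n (\<lambda>i. u * xip i + (1 - u) * xim i)
     + lam * sqrt (u * (1 - u)) / real n * (\<Sum>j<p. sigma_hat n X j * (bp j + bm j)))"

definition lp_feasible ::
  "nat \<Rightarrow> nat \<Rightarrow> (nat \<Rightarrow> real) \<Rightarrow> (nat \<Rightarrow> nat \<Rightarrow> real) \<Rightarrow> lp_point \<Rightarrow> bool" where
  "lp_feasible n p y X = (\<lambda>(xip, xim, bp, bm).
     (\<forall>i<n. xip i - xim i = y i - dot p (X i) (\<lambda>j. bp j - bm j)) \<and>
     (\<forall>i<n. 0 \<le> xip i \<and> 0 \<le> xim i) \<and> (\<forall>j<p. 0 \<le> bp j \<and> 0 \<le> bm j))"

text \<open>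
  A feasible point is basic if the columns of the constraint matrix belonging to its non-zero
  variables are linearly independent: \<open>(a\<^sup>+, a\<^sup>-, c\<^sup>+, c\<^sup>-)\<close> below is the vector of coefficients
  of a vanishing linear combination of these columns.
\<close>

definition lp_basic :: "nat \<Rightarrow> nat \<Rightarrow> (nat \<Rightarrow> nat \<Rightarrow> real) \<Rightarrow> lp_point \<Rightarrow> bool" where
  "lp_basic n p X = (\<lambda>(xip, xim, bp, bm).
     \<forall>ap am cp cm.
       (\<forall>i<n. (xip i = 0 \<longrightarrow> ap i = 0) \<and> (xim i = 0 \<longrightarrow> am i = 0)) \<longrightarrow>
       (\<forall>j<p. (bp j = 0 \<longrightarrow> cp j = 0) \<and> (bm j = 0 \<longrightarrow> cm j = 0)) \<longrightarrow>
       (\<forall>i<n. ap i - am i + dot p (X i) (\<lambda>j. cp j - cm j) = 0) \<longrightarrow>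
       (\<forall>i<n. ap i = 0 \<and> am i = 0) \<and> (\<forall>j<p. cp j = 0 \<and> cm j = 0))"

definition penalized_estimate ::
  "nat \<Rightarrow> nat \<Rightarrow> (nat \<Rightarrow> real) \<Rightarrow> (nat \<Rightarrow> nat \<Rightarrow> real) \<Rightarrow> real \<Rightarrow> real \<Rightarrow> (nat \<Rightarrow> real) \<Rightarrow> bool" where
  "penalized_estimate n p y X lam u b \<longleftrightarrow>
     is_arg_min (pen_loss n p y X lam u) (\<lambda>_. True) b \<and>
     ((\<forall>b'. is_arg_min (pen_loss n p y X lam u) (\<lambda>_. True) b' \<longrightarrow> (\<forall>j<p. b' j = b j)) \<or>
      (\<exists>xip xim bp bm.
         is_arg_min (lp_objective n p X lam u) (lp_feasible n p y X) (xip, xim, bp, bm) \<and>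
         lp_basic n p X (xip, xim, bp, bm) \<and> (\<forall>j<p. b j = bp j - bm j)))"

definition post_estimate ::
  "nat \<Rightarrow> nat \<Rightarrow> (nat \<Rightarrow> real) \<Rightarrow> (nat \<Rightarrow> nat \<Rightarrow> real) \<Rightarrow> real \<Rightarrow> nat set \<Rightarrow> (nat \<Rightarrow> real) \<Rightarrow> bool" where
  "post_estimate n p y X u T b \<longleftrightarrow>
     is_arg_min (emp_loss n p y X u) (\<lambda>b. \<forall>j<p. j \<notin> T \<longrightarrow> b j = 0) b"

definition W_of :: "real set \<Rightarrow> real" where
  "W_of U = (SUP u\<in>U. 1 / sqrt (u * (1 - u)))"

definition Lambda_stat ::
  "real set \<Rightarrow> nat \<Rightarrow> nat \<Rightarrow> (nat \<Rightarrow> nat \<Rightarrow> real) \<Rightarrow> (nat \<Rightarrow> real) \<Rightarrow> real" where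
  "Lambda_stat U n p X v =
     real n * (SUP u\<in>U. MAX j\<in>{..<p}.
       \<bar>emp_mean n (\<lambda>i. X i j * (u - of_bool (v i \<le> u)) / (sigma_hat n X j * sqrt (u * (1 - u))))\<bar>)"

definition iid_uniform :: "nat \<Rightarrow> (nat \<Rightarrow> real) measure" where
  "iid_uniform n = (\<Pi>\<^sub>M i\<in>{..<n}. uniform_measure lborel {0<..<1})"

text \<open>
  Since \<open>u\<^sub>1, \<dots>, u\<^sub>n\<close> are independent of the design, conditional probabilities given the design
  are probabilities under \<open>iid_uniform\<close> for that fixed design.
\<close>

definition Lambda_quantile ::
  "real set \<Rightarrow> nat \<Rightarrow> nat \<Rightarrow> (nat \<Rightarrow> nat \<Rightarrow> real) \<Rightarrow> real \<Rightarrow> real" where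
  "Lambda_quantile U n p X r =
     Inf {t. r \<le> measure (iid_uniform n) {v \<in> space (iid_uniform n). Lambda_stat U n p X v \<le> t}}"

definition quantile_indices :: "real set \<Rightarrow> bool" where
  "quantile_indices U \<longleftrightarrow> compact U \<and> U \<noteq> {} \<and> U \<subseteq> {0<..<1}"

definition Lambda_constant :: "real \<Rightarrow> bool" where
  "Lambda_constant C \<longleftrightarrow>
     (\<forall>U n p X. quantile_indices U \<and> 3 \<le> min n p \<longrightarrow>
        (\<forall>k\<ge>1. measure (iid_uniform n)
             {v \<in> space (iid_uniform n).
                k * C * W_of U * sqrt (real n * ln (real p)) \<le> Lambda_stat U n p X v}
             \<le> real p powr (- k\<^sup>2 + 1)) \<and>
        (\<forall>\<alpha>. 0 < \<alpha> \<and> \<alpha> < 1 \<longrightarrow>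
           Lambda_quantile U n p X (1 - \<alpha>)
             \<le> sqrt (1 + ln (1 / \<alpha>) / ln (real p)) * C * W_of U * sqrt (real n * ln (real p))))"

text \<open>
  \<open>cdens x y\<close> is the conditional density \<open>f\<^bsub>y|x\<^esub>(y|x)\<close>; \<open>f_up\<close>, \<open>f_up'\<close> and \<open>f_lo\<close> are the bounds
  on the density, on its derivative and from below at the conditional quantiles; \<open>kap_m\<close> and
  \<open>cone_c\<close> are \<open>m\<close> and \<open>c\<^sub>0\<close> of the restricted eigenvalue condition. The failure probability
  \<open>gam\<close> is a function of the sample size.
\<close>

record 'a qr_model =
  Pr :: "'a measure"
  nobs :: nat
  dimp :: nat
  resp :: "nat \<Rightarrow> 'a \<Rightarrow> real"
  covar :: "nat \<Rightarrow> 'a \<Rightarrow> nat \<Rightarrow> real"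
  qset :: "real set"
  coef :: "real \<Rightarrow> nat \<Rightarrow> real"
  spars :: nat
  cdens :: "(nat \<Rightarrow> real) \<Rightarrow> real \<Rightarrow> real"
  f_up :: real
  f_up' :: real
  f_lo :: real
  Lip :: real
  C_L :: real
  C_f :: real
  gam :: "nat \<Rightarrow> real"
  kap_m :: nat
  cone_c :: real

definition log_np :: "'a qr_model \<Rightarrow> real" where
  "log_np D = ln (real (max (nobs D) (dimp D)))"

definition Tset :: "'a qr_model \<Rightarrow> real \<Rightarrow> nat set" where
  "Tset D u = supp (dimp D) (coef D u)"

definition responses :: "'a qr_model \<Rightarrow> 'a \<Rightarrow> nat \<Rightarrow> real" where
  "responses D \<omega> = (\<lambda>i\<in>{..<nobs D}. resp D i \<omega>)"

definition design :: "'a qr_model \<Rightarrow> 'a \<Rightarrow> nat \<Rightarrow> nat \<Rightarrow> real" where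
  "design D \<omega> = (\<lambda>i\<in>{..<nobs D}. covar D i \<omega>)"

definition qr_setting :: "'a qr_model \<Rightarrow> bool" where
  "qr_setting D \<longleftrightarrow>
     prob_space (Pr D) \<and> quantile_indices (qset D) \<and>
     (\<forall>u\<in>qset D. card (Tset D u) \<le> spars D) \<and>
     real (spars D) \<le> real (nobs D) / log_np D"

text \<open>
  Observations are identically distributed, so population quantities are written with the
  observation of index \<open>0\<close>.
\<close>

definition cov_space :: "'a qr_model \<Rightarrow> (nat \<Rightarrow> real) measure" where
  "cov_space D = (\<Pi>\<^sub>M j\<in>{..<dimp D}. borel)"

definition cov_support :: "'a qr_model \<Rightarrow> (nat \<Rightarrow> real) set" where
  "cov_support D =
     {x \<in> space (cov_space D). \<forall>e>0.
        0 < measure (Pr D) {\<omega> \<in> space (Pr D). \<forall>j<dimp D. \<bar>covar D 0 \<omega> j - x j\<bar> < e}}"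

definition cond_cdf :: "'a qr_model \<Rightarrow> (nat \<Rightarrow> real) \<Rightarrow> real \<Rightarrow> real" where
  "cond_cdf D x t = (LINT v:{..t}|lborel. cdens D x v)"

definition cond_quantile :: "'a qr_model \<Rightarrow> real \<Rightarrow> (nat \<Rightarrow> real) \<Rightarrow> real" where
  "cond_quantile D u x = Inf {t. u \<le> cond_cdf D x t}"

definition cond_D1 :: "'a qr_model \<Rightarrow> bool" where
  "cond_D1 D \<longleftrightarrow>
     3 \<le> min (nobs D) (dimp D) \<and>
     prob_space.indep_vars (Pr D) (\<lambda>_. borel \<Otimes>\<^sub>M cov_space D)
       (\<lambda>i \<omega>. (resp D i \<omega>, covar D i \<omega>)) {..<nobs D} \<and>
     (\<forall>i<nobs D.
        distr (Pr D) (borel \<Otimes>\<^sub>M cov_space D) (\<lambda>\<omega>. (resp D i \<omega>, covar D i \<omega>)) =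
        distr (Pr D) (borel \<Otimes>\<^sub>M cov_space D) (\<lambda>\<omega>. (resp D 0 \<omega>, covar D 0 \<omega>))) \<and>
     (\<forall>i<nobs D. AE \<omega> in Pr D. covar D i \<omega> 0 = 1) \<and>
     (\<forall>x y. 0 \<le> cdens D x y) \<and>
     distributed (Pr D) (distr (Pr D) (cov_space D) (covar D 0) \<Otimes>\<^sub>M lborel)
       (\<lambda>\<omega>. (covar D 0 \<omega>, resp D 0 \<omega>)) (\<lambda>(x, y). ennreal (cdens D x y)) \<and>
     (\<forall>u\<in>qset D. AE \<omega> in Pr D.
        cond_quantile D u (covar D 0 \<omega>) = dot (dimp D) (covar D 0 \<omega>) (coef D u)) \<and>
     (\<forall>x\<in>cov_support D.
        (cdens D x) C1_differentiable_on UNIV \<and>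
        (\<forall>y. \<bar>cdens D x y\<bar> \<le> f_up D \<and> \<bar>deriv (cdens D x) y\<bar> \<le> f_up' D)) \<and>
     0 < f_lo D \<and>
     (\<forall>u\<in>qset D. \<forall>x\<in>cov_support D. f_lo D < cdens D x (dot (dimp D) x (coef D u)))"

definition cond_D2 :: "'a qr_model \<Rightarrow> bool" where
  "cond_D2 D \<longleftrightarrow>
     (\<forall>u\<in>qset D. l0norm (dimp D) (coef D u) \<le> spars D) \<and>
     0 < Lip D \<and>
     (\<forall>u\<in>qset D. \<forall>u'\<in>qset D.
        l2norm (dimp D) (\<lambda>j. coef D u j - coef D u' j) \<le> Lip D * \<bar>u - u'\<bar>) \<and>
     1 \<le> spars D \<and> ln (Lip D) \<le> C_L D * log_np D"

definition cond_D3 :: "'a qr_model \<Rightarrow> bool" where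
  "cond_D3 D \<longleftrightarrow>
     (\<forall>j<dimp D. (\<integral>\<omega>. (covar D 0 \<omega> j)\<^sup>2 \<partial>Pr D) = 1) \<and>
     measure (Pr D)
       {\<omega> \<in> space (Pr D). (MAX j\<in>{..<dimp D}. \<bar>sigma_hat (nobs D) (design D \<omega>) j - 1\<bar>) \<le> 1 / 2}
       \<ge> 1 - gam D (nobs D) \<and>
     (\<lambda>k. 1 - gam D k) \<longlonglongrightarrow> 1"

definition gram :: "'a qr_model \<Rightarrow> nat \<Rightarrow> nat \<Rightarrow> real" where
  "gram D = (\<lambda>j k. \<integral>\<omega>. covar D 0 \<omega> j * covar D 0 \<omega> k \<partial>Pr D)"

definition abs_moment :: "'a qr_model \<Rightarrow> nat \<Rightarrow> (nat \<Rightarrow> real) \<Rightarrow> real" where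
  "abs_moment D k \<delta> = (\<integral>\<omega>. \<bar>dot (dimp D) (covar D 0 \<omega>) \<delta>\<bar> ^ k \<partial>Pr D)"

text \<open>
  The Bochner integral of a non-integrable function is \<open>0\<close> and \<open>x / 0 = 0\<close>, so the ratio below is
  \<open>0\<close> when the third moment is infinite, as it should be.
\<close>

definition moment_ratio :: "'a qr_model \<Rightarrow> (nat \<Rightarrow> real) \<Rightarrow> real" where
  "moment_ratio D \<delta> = abs_moment D 2 \<delta> powr (3 / 2) / abs_moment D 3 \<delta>"

definition A_cone :: "'a qr_model \<Rightarrow> real \<Rightarrow> (nat \<Rightarrow> real) set" where
  "A_cone D u =
     {\<delta>. l1norm (dimp D) (restr (- Tset D u) \<delta>) \<le> cone_c D * l1norm (dimp D) (restr (Tset D u) \<delta>) \<and>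
         l0norm (dimp D) (restr (- Tset D u) \<delta>) \<le> nobs D}"

text \<open>Ties in absolute value are broken by the index; they do not affect the norm it is used in.\<close>

definition T_largest :: "'a qr_model \<Rightarrow> real \<Rightarrow> (nat \<Rightarrow> real) \<Rightarrow> nat \<Rightarrow> nat set" where
  "T_largest D u \<delta> m =
     set (take m (sort_key (\<lambda>j. - \<bar>\<delta> j\<bar>) [j \<leftarrow> [0..<dimp D]. j \<notin> Tset D u \<and> \<delta> j \<noteq> 0]))"

text \<open>
  Infima are taken in \<open>ereal\<close>, so that the infimum over the empty set is \<open>\<infinity>\<close>. This occurs for
  \<open>kappa_sq\<close> only if every \<open>T\<^sub>u\<close> is empty; then the bound on \<open>log (f_lo * \<kappa>\<^sub>0\<^sup>2)\<close> in \<open>cond_D4\<close> fails,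
  which is expressed by \<open>kappa_sq D 0 < \<infinity>\<close>.
\<close>

definition kappa_sq :: "'a qr_model \<Rightarrow> nat \<Rightarrow> ereal" where
  "kappa_sq D m =
     (INF u\<in>qset D. INF \<delta>\<in>{\<delta> \<in> A_cone D u. nonzero (dimp D) \<delta>}.
        ereal (dot (dimp D) \<delta> (matvec (dimp D) (gram D) \<delta>)
               / (l2norm (dimp D) (restr (Tset D u \<union> T_largest D u \<delta> m) \<delta>))\<^sup>2))"

definition kappa0 :: "'a qr_model \<Rightarrow> real" where
  "kappa0 D = sqrt (real_of_ereal (kappa_sq D 0))"

definition q_const :: "'a qr_model \<Rightarrow> ereal" where
  "q_const D =
     ereal (3 / 8 * (f_lo D powr (3 / 2) / f_up' D)) *
     (INF u\<in>qset D. INF \<delta>\<in>{\<delta> \<in> A_cone D u. nonzero (dimp D) \<delta>}. ereal (moment_ratio D \<delta>))"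

definition cond_D4 :: "'a qr_model \<Rightarrow> bool" where
  "cond_D4 D \<longleftrightarrow>
     9 \<le> cone_c D \<and>
     0 < kappa_sq D (kap_m D) \<and>
     kappa_sq D 0 < \<infinity> \<and> ln (f_lo D * (kappa0 D)\<^sup>2) \<le> C_f D * log_np D \<and>
     0 < q_const D"

definition A_sparse :: "'a qr_model \<Rightarrow> real \<Rightarrow> nat \<Rightarrow> (nat \<Rightarrow> real) set" where
  "A_sparse D u m = {\<delta>. l0norm (dimp D) (restr (- Tset D u) \<delta>) \<le> m}"

definition kappa_sparse_sq :: "'a qr_model \<Rightarrow> nat \<Rightarrow> ereal" where
  "kappa_sparse_sq D m =
     (INF u\<in>qset D. INF \<delta>\<in>{\<delta> \<in> A_sparse D u m. nonzero (dimp D) \<delta>}.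
        ereal (dot (dimp D) \<delta> (matvec (dimp D) (gram D) \<delta>) / dot (dimp D) \<delta> \<delta>))"

definition q_sparse_const :: "'a qr_model \<Rightarrow> nat \<Rightarrow> ereal" where
  "q_sparse_const D m =
     ereal (3 / 8 * (f_lo D powr (3 / 2) / f_up' D)) *
     (INF u\<in>qset D. INF \<delta>\<in>{\<delta> \<in> A_sparse D u m. nonzero (dimp D) \<delta>}. ereal (moment_ratio D \<delta>))"

definition cond_D5 :: "'a qr_model \<Rightarrow> nat \<Rightarrow> bool" where
  "cond_D5 D m \<longleftrightarrow> 0 < kappa_sparse_sq D m \<and> 0 < q_sparse_const D m"

definition kappa_sparse :: "'a qr_model \<Rightarrow> nat \<Rightarrow> real" where
  "kappa_sparse D m = sqrt (real_of_ereal (kappa_sparse_sq D m))"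

definition q_sparse :: "'a qr_model \<Rightarrow> nat \<Rightarrow> real" where
  "q_sparse D m = real_of_ereal (q_sparse_const D m)"

definition J_mat :: "'a qr_model \<Rightarrow> real \<Rightarrow> nat \<Rightarrow> nat \<Rightarrow> real" where
  "J_mat D u = (\<lambda>j k. \<integral>\<omega>. cdens D (covar D 0 \<omega>) (dot (dimp D) (covar D 0 \<omega>) (coef D u))
                         * covar D 0 \<omega> j * covar D 0 \<omega> k \<partial>Pr D)"

definition J_norm :: "'a qr_model \<Rightarrow> real \<Rightarrow> (nat \<Rightarrow> real) \<Rightarrow> real" where
  "J_norm D u \<delta> = l2norm (dimp D) (matvec (dimp D) (psd_root (dimp D) (J_mat D u)) \<delta>)"

definition phi :: "'a qr_model \<Rightarrow> 'a \<Rightarrow> nat \<Rightarrow> real" where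
  "phi D \<omega> k =
     (SUP \<delta>\<in>{\<delta>. nonzero (dimp D) \<delta> \<and> l0norm (dimp D) \<delta> \<le> k}.
        max (emp_mean (nobs D) (\<lambda>i. (dot (dimp D) (covar D i \<omega>) \<delta>)\<^sup>2) / dot (dimp D) \<delta> \<delta>)
            ((\<integral>\<omega>'. (dot (dimp D) (covar D 0 \<omega>') \<delta>)\<^sup>2 \<partial>Pr D) / dot (dimp D) \<delta> \<delta>))"

text \<open>
  The increment \<open>Q\<^sub>u(\<beta>(u) + \<delta>) - Q\<^sub>u(\<beta>(u))\<close> is taken as the expectation of the increment of the loss,
  which is integrable even if the response (hence \<open>Q\<^sub>u\<close> itself) is not.
\<close>

definition loss_increment :: "'a qr_model \<Rightarrow> real \<Rightarrow> (nat \<Rightarrow> real) \<Rightarrow> real" where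
  "loss_increment D u \<delta> =
     (\<integral>\<omega>. check_loss u (resp D 0 \<omega> - dot (dimp D) (covar D 0 \<omega>) (\<lambda>j. coef D u j + \<delta> j))
         - check_loss u (resp D 0 \<omega> - dot (dimp D) (covar D 0 \<omega>) (coef D u)) \<partial>Pr D)"

definition emp_loss_increment :: "'a qr_model \<Rightarrow> 'a \<Rightarrow> real \<Rightarrow> (nat \<Rightarrow> real) \<Rightarrow> real" where
  "emp_loss_increment D \<omega> u \<delta> =
     emp_loss (nobs D) (dimp D) (responses D \<omega>) (design D \<omega>) u (\<lambda>j. coef D u j + \<delta> j)
     - emp_loss (nobs D) (dimp D) (responses D \<omega>) (design D \<omega>) u (coef D u)"

definition emp_error_bound :: "'a qr_model \<Rightarrow> real \<Rightarrow> real \<Rightarrow> real \<Rightarrow> bool" where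
  "emp_error_bound D C t A \<longleftrightarrow>
     holds_with_prob (Pr D) (1 - 3 * gam D (nobs D) - 3 * real (dimp D) powr (- A\<^sup>2))
       (\<lambda>\<omega>. \<forall>u\<in>qset D. \<forall>\<delta>\<in>A_cone D u. J_norm D u \<delta> \<le> t \<longrightarrow>
          \<bar>emp_loss_increment D \<omega> u \<delta> - loss_increment D u \<delta>\<bar>
          \<le> t * C * ((1 + cone_c D) * A / (sqrt (f_lo D) * kappa0 D)) *
             sqrt (real (spars D) * ln (max (real (dimp D)) (Lip D * sqrt (f_lo D) * kappa0 D / t))
                   / real (nobs D)))"

definition m_hat :: "'a qr_model \<Rightarrow> (real \<Rightarrow> nat \<Rightarrow> real) \<Rightarrow> nat" where
  "m_hat D b = (SUP u\<in>qset D. l0norm (dimp D) (restr (- Tset D u) (b u)))"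

text \<open>\<open>missed D b = 1\<close> if the model selected by \<open>b\<close> misses a component of \<open>T\<^sub>u\<close> for some \<open>u\<close>, else \<open>0\<close>.\<close>

definition missed :: "'a qr_model \<Rightarrow> (real \<Rightarrow> nat \<Rightarrow> real) \<Rightarrow> real" where
  "missed D b = (SUP u\<in>qset D. of_bool (\<not> Tset D u \<subseteq> supp (dimp D) (b u)))"

end

theory Submission
  imports Defs
begin

text \<open>
  Write \<open>\<delta>\<close> for an error \<open>\<beta> - \<beta>(u)\<close>. By the identity of Knight, the increment of the check loss is a
  linear functional of \<open>\<delta>\<close> integrated over indicators of halfspaces. Hence the deviation of the
  empirical from the expected loss increment, uniformly over \<open>u\<close> and over sparse \<open>\<delta>\<close>, is controlled by
  symmetrization relative to the second moment, the Sauer bound for traces of halfspaces, and a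
  finite net of directions; the outcome is at most \<open>K \<parallel>\<delta>\<parallel>\<close> with
  \<open>K\<^sup>2\<close> of order \<open>\<phi>(k + s) (k log (n \<or> p) + s log n) / n\<close>, on an event of probability \<open>1 - \<epsilon>\<close>.

  The penalized estimator is a basic solution, so it has at most \<open>n\<close> nonzero components and the
  above applies to it. The variables \<open>F(y\<^sub>i | x\<^sub>i)\<close> are uniform and independent of the design, hence
  \<open>\<lambda>\<close> dominates the score with probability \<open>1 - \<alpha>\<close>; the error of the penalized estimator then lies in
  the cone, and its empirical loss exceeds that of \<open>\<beta>(u)\<close> by at most a multiple of its \<open>J\<^sub>u\<close>-norm. The
  post-penalized estimator has no larger empirical loss, and none larger than \<open>\<beta>(u)\<close> if the support of
  \<open>\<beta>(u)\<close> was found. As the expected loss increment is at least the minimum of a quadratic and a linear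
  function of the \<open>J\<^sub>u\<close>-norm of the error, this bounds both errors in turn.
\<close>

subsection \<open>Traces of halfspaces\<close>

text \<open>The covariates are only known to have second moments, so no tail bound for them is
  available. Symmetrization is therefore done with the weights \<open>x'd\<close> frozen and with a
  threshold proportional to the pooled second moment; the random signs concentrate, and this
  self-normalization is what brings \<open>phi\<close> into the bound. For frozen weights only the
  halfspace varies, and linearity in the direction then leads from a grid to all directions. The
  size of the selected model is random, so a single event must serve every \<open>k \<le> n\<close>,
  with a bound that grows with \<open>k\<close>. A support is split into a subset of the union of
  all supports of the coefficients, which has at most \<open>n\<close> elements, and
  \<open>k\<close> further indices: hence \<open>s\<close> is multiplied by log n, and only
  \<open>k\<close> by log (n \<or> p). In \<open>80 * (16 + max 0 (ln (1 / \<epsilon>)))\<close>, 80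
  comes from the symmetrized exponent, 14 from counting supports, grid points and traces, and the
  remaining 2 with the logarithm from summing over \<open>k\<close>. One \<epsilon> pays for this
  event, the other for D.5.\<close>

lemma homogeneous_system_nontrivial:
  fixes a :: "'i \<Rightarrow> 'j \<Rightarrow> real"
  assumes "finite I" "finite J" "card I < card J"
  shows "\<exists>v. (\<exists>j\<in>J. v j \<noteq> 0) \<and> (\<forall>j. j \<notin> J \<longrightarrow> v j = 0) \<and> (\<forall>i\<in>I. (\<Sum>j\<in>J. a i j * v j) = 0)"
  using assms
proof (induction I arbitrary: a J rule: finite_induct)
  case empty
  then have "J \<noteq> {}" by auto
  then show ?case by (intro exI[of _ "\<lambda>j. if j \<in> J then 1 else 0"]) auto
next
  case (insert i I)
  show ?case
  proof (cases "\<forall>j\<in>J. a i j = 0")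
    case True
    have "card I < card J" using insert by simp
    then obtain v where v: "\<exists>j\<in>J. v j \<noteq> 0" "\<forall>j. j \<notin> J \<longrightarrow> v j = 0" "\<forall>i\<in>I. (\<Sum>j\<in>J. a i j * v j) = 0"
      using insert.IH[of J a] insert.prems by blast
    moreover have "(\<Sum>j\<in>J. a i j * v j) = 0" using True by simp
    ultimately show ?thesis by auto
  next
    case False
    then obtain k where k: "k \<in> J" "a i k \<noteq> 0" by blast
    let ?J = "J - {k}"
    \<comment> \<open>The system left after solving equation \<open>i\<close> for the unknown
      \<open>k\<close>: one equation and one unknown fewer, so the count in the hypothesis is
      preserved.\<close>
    let ?b = "\<lambda>l j. a l j - a l k * a i j / a i k"
    have "card I < card ?J" using insert k by simp
    then obtain v where v: "\<exists>j\<in>?J. v j \<noteq> 0" "\<forall>j. j \<notin> ?J \<longrightarrow> v j = 0"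
        "\<forall>l\<in>I. (\<Sum>j\<in>?J. ?b l j * v j) = 0"
      using insert.IH[of ?J ?b] insert.prems by blast
    define c where "c = - (\<Sum>j\<in>?J. a i j * v j) / a i k"
    define w where "w = v(k := c)"
    have split: "(\<Sum>j\<in>J. a l j * w j) = a l k * c + (\<Sum>j\<in>?J. a l j * v j)" for l
      using k insert.prems by (subst sum.remove[of _ k]) (auto simp: w_def intro!: sum.cong)
    have "(\<Sum>j\<in>J. a i j * w j) = 0" using k by (simp add: split c_def)
    moreover have "(\<Sum>j\<in>J. a l j * w j) = 0" if "l \<in> I" for l
    proof -
      have "(\<Sum>j\<in>?J. ?b l j * v j) = (\<Sum>j\<in>?J. a l j * v j) - a l k / a i k * (\<Sum>j\<in>?J. a i j * v j)"
        by (simp add: algebra_simps sum_subtractf sum_distrib_left)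
      then show ?thesis using v(3) that by (simp add: split c_def)
    qed
    moreover have "\<exists>j\<in>J. w j \<noteq> 0" using v(1) by (auto simp: w_def)
    moreover have "\<forall>j. j \<notin> J \<longrightarrow> w j = 0" using v(2) k by (auto simp: w_def)
    ultimately show ?thesis by (intro exI[of _ w]) auto
  qed
qed

definition shatters :: "'a set set \<Rightarrow> 'a set \<Rightarrow> bool" where
  "shatters F S \<longleftrightarrow> (\<forall>Y\<subseteq>S. \<exists>A\<in>F. A \<inter> S = Y)"

lemma shattersE:
  assumes "shatters F S" "Y \<subseteq> S"
  obtains A where "A \<in> F" "A \<inter> S = Y"
proof -
  have "\<exists>A\<in>F. A \<inter> S = Y" using assms by (simp add: shatters_def)
  then show thesis using that by (elim bexE)
qed

text \<open>Pajor's form of the Sauer-Shelah lemma, by induction on the ground set. Splitting at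
  \<open>x\<close> bounds \<open>card F\<close> by
  \<open>card (F0 \<union> F1) + card (F0 \<inter> F1)\<close>; what the union shatters is shattered
  by \<open>F\<close>, and what the intersection shatters is still shattered by \<open>F\<close>
  after adding \<open>x\<close>, so the two counts concern disjoint sets of shattered sets.\<close>

lemma card_le_card_shattered:
  assumes "finite X" "F \<subseteq> Pow X"
  shows "card F \<le> card {S. S \<subseteq> X \<and> shatters F S}"
  using assms
proof (induction X arbitrary: F rule: finite_induct)
  case empty
  then have "F = {} \<or> F = {{}}" by auto
  then show ?case
  proof
    assume F: "F = {{}}"
    then have "{S. S \<subseteq> {} \<and> shatters F S} = {{}}" by (auto simp: shatters_def)
    then show ?thesis using F by simp
  qed simp
next
  case (insert x X)
  define F0 where "F0 = {A\<in>F. x \<notin> A}"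
  define F1 where "F1 = {A. A \<subseteq> X \<and> insert x A \<in> F}"
  have sub: "F0 \<subseteq> Pow X" "F1 \<subseteq> Pow X" using insert by (auto simp: F0_def F1_def)
  have fin: "finite F0" "finite F1" using sub insert.hyps by (auto intro: finite_subset)
  have F: "F = F0 \<union> insert x ` F1"
  proof (intro equalityI subsetI)
    fix A assume A: "A \<in> F"
    show "A \<in> F0 \<union> insert x ` F1"
    proof (cases "x \<in> A")
      case True
      have "A - {x} \<in> F1" using A True insert.prems by (auto simp: F1_def insert_absorb)
      moreover have "A = insert x (A - {x})" using True by auto
      ultimately show ?thesis by blast
    qed (use A in \<open>auto simp: F0_def\<close>)
  qed (auto simp: F0_def F1_def)
  have inj: "inj_on (insert x) (Pow X)" using insert.hyps by (auto simp: inj_on_def)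
  have "card F \<le> card F0 + card (insert x ` F1)" unfolding F by (rule card_Un_le)
  also have "card (insert x ` F1) = card F1" by (rule card_image[OF inj_on_subset[OF inj]]) (use sub in simp)
  also have "card F0 + card F1 = card (F0 \<union> F1) + card (F0 \<inter> F1)" using fin by (rule card_Un_Int)
  also have "\<dots> \<le> card {S. S \<subseteq> X \<and> shatters (F0 \<union> F1) S} + card {S. S \<subseteq> X \<and> shatters (F0 \<inter> F1) S}"
    using sub by (intro add_mono insert.IH) auto
  also have "card {S. S \<subseteq> X \<and> shatters (F0 \<inter> F1) S} = card (insert x ` {S. S \<subseteq> X \<and> shatters (F0 \<inter> F1) S})"
    by (rule card_image[symmetric], rule inj_on_subset[OF inj]) auto
  also have "card {S. S \<subseteq> X \<and> shatters (F0 \<union> F1) S} + \<dots>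
      = card ({S. S \<subseteq> X \<and> shatters (F0 \<union> F1) S} \<union> insert x ` {S. S \<subseteq> X \<and> shatters (F0 \<inter> F1) S})"
    using insert.hyps by (intro card_Un_disjoint[symmetric]) auto
  also have "\<dots> \<le> card {S. S \<subseteq> insert x X \<and> shatters F S}"
  proof (intro card_mono subsetI)
    show "finite {S. S \<subseteq> insert x X \<and> shatters F S}" using insert.hyps by simp
    fix S assume S: "S \<in> {S. S \<subseteq> X \<and> shatters (F0 \<union> F1) S} \<union> insert x ` {S. S \<subseteq> X \<and> shatters (F0 \<inter> F1) S}"
    show "S \<in> {S. S \<subseteq> insert x X \<and> shatters F S}"
    proof (cases "S \<in> {S. S \<subseteq> X \<and> shatters (F0 \<union> F1) S}")
      case True
      then have 1: "S \<subseteq> X" "shatters (F0 \<union> F1) S" by simp_all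
      have "\<exists>A\<in>F. A \<inter> S = Y" if "Y \<subseteq> S" for Y
      proof -
        obtain A where A: "A \<in> F0 \<union> F1" "A \<inter> S = Y"
          using shattersE[OF 1(2) \<open>Y \<subseteq> S\<close>] .
        moreover have "insert x A \<inter> S = A \<inter> S" using 1(1) insert.hyps by auto
        ultimately have "insert x A \<inter> S = Y" by simp
        with A show ?thesis unfolding F by (cases "A \<in> F0") (metis UnCI, metis UnCI UnE imageI)
      qed
      then have "shatters F S" by (simp add: shatters_def)
      then show ?thesis using 1(1) by blast
    next
      case False
      then obtain S' where S': "S' \<in> {S. S \<subseteq> X \<and> shatters (F0 \<inter> F1) S}" and "S = insert x S'"
        using S by (meson UnE imageE)
      then have 2: "S' \<subseteq> X" "shatters (F0 \<inter> F1) S'" "S = insert x S'" by simp_all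
      have "\<exists>A\<in>F. A \<inter> S = Y" if "Y \<subseteq> S" for Y
      proof -
        have "Y - {x} \<subseteq> S'" using that 2 by auto
        then obtain A where "A \<in> F0 \<inter> F1" and A': "A \<inter> S' = Y - {x}"
          by (rule shattersE[OF 2(2)])
        then have A: "A \<in> F0" "A \<in> F1" "A \<inter> S' = Y - {x}" by simp_all
        have x: "x \<notin> A" using A by (simp add: F0_def)
        show ?thesis
        proof (cases "x \<in> Y")
          case True
          then have "insert x A \<inter> S = Y" using A(3) 2(3) by auto
          moreover have "insert x A \<in> F" using A(2) by (simp add: F1_def)
          ultimately show ?thesis by (rule bexI)
        next
          case False
          then have "A \<inter> S = Y" using A(3) 2(3) x by auto
          moreover have "A \<in> F" using A(1) by (simp add: F0_def)
          ultimately show ?thesis by (rule bexI)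
        qed
      qed
      then have "shatters F S" by (simp add: shatters_def)
      then show ?thesis using 2(1,3) by blast
    qed
  qed
  finally show ?case .
qed

text \<open>A set of size at most \<open>k\<close> is described by \<open>k\<close> choices, each an
  element or nothing (\<open>None\<close>). Only the order of the exponent matters later, so this
  crude count suffices.\<close>

lemma card_subsets_bounded:
  assumes "finite X"
  shows "card {S. S \<subseteq> X \<and> card S \<le> k} \<le> (card X + 1) ^ k"
proof (induction k)
  case 0
  have "{S. S \<subseteq> X \<and> card S \<le> 0} = {{}}" using assms by (auto dest: finite_subset)
  then show ?case by simp
next
  case (Suc k)
  let ?f = "\<lambda>(z, S). case z of None \<Rightarrow> S | Some x \<Rightarrow> insert x S"
  let ?D = "(insert None (Some ` X)) \<times> {S. S \<subseteq> X \<and> card S \<le> k}"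
  have sub: "{S. S \<subseteq> X \<and> card S \<le> Suc k} \<subseteq> ?f ` ?D"
  proof
    fix S assume "S \<in> {S. S \<subseteq> X \<and> card S \<le> Suc k}"
    then have S: "S \<subseteq> X" "card S \<le> Suc k" "finite S" using assms by (auto dest: finite_subset)
    show "S \<in> ?f ` ?D"
    proof (cases "S = {}")
      case True
      then show ?thesis by (intro image_eqI[of _ _ "(None, {})"]) auto
    next
      case False
      then obtain x where x: "x \<in> S" by auto
      have "card (S - {x}) \<le> k" using S x by simp
      then show ?thesis using S x
        by (intro image_eqI[of _ _ "(Some x, S - {x})"]) (auto simp: insert_absorb)
    qed
  qed
  have fin: "finite ?D" using assms by simp
  have "card {S. S \<subseteq> X \<and> card S \<le> Suc k} \<le> card ?D"
    using sub fin by (meson card_image_le card_mono finite_imageI le_trans)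
  also have "\<dots> = (card X + 1) * card {S. S \<subseteq> X \<and> card S \<le> k}"
    using assms by (simp add: card_cartesian_product card_image card_insert_if)
  also have "\<dots> \<le> (card X + 1) ^ Suc k" unfolding power_Suc using Suc by (rule mult_left_mono) simp
  finally show ?case .
qed

text \<open>Vectors of evaluations of a linear family lie in a space of dimension at most \<open>card K\<close>, so on
  more points some linear relation forbids one of the sign patterns.\<close>

lemma halfspace_shatter_le:
  fixes a :: "'i \<Rightarrow> 'k \<Rightarrow> real"
  assumes "finite K" "finite S"
    and sh: "shatters F S" and F: "\<And>A. A \<in> F \<Longrightarrow> \<exists>th. A \<inter> S = {i\<in>S. 0 \<le> (\<Sum>k\<in>K. a i k * th k)}"
  shows "card S \<le> card K"
proof (rule ccontr)
  assume "\<not> card S \<le> card K"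
  then obtain v where v: "\<exists>i\<in>S. v i \<noteq> 0" "\<forall>k\<in>K. (\<Sum>i\<in>S. a i k * v i) = 0"
    using homogeneous_system_nontrivial[of K S "\<lambda>k i. a i k"] assms by auto
  have zero: "(\<Sum>i\<in>S. w i * (\<Sum>k\<in>K. a i k * th k)) = 0"
    if "\<And>k. k \<in> K \<Longrightarrow> (\<Sum>i\<in>S. a i k * w i) = 0" for w th
  proof -
    have "(\<Sum>i\<in>S. w i * (\<Sum>k\<in>K. a i k * th k)) = (\<Sum>i\<in>S. \<Sum>k\<in>K. th k * (a i k * w i))"
      by (simp add: sum_distrib_left mult_ac)
    also have "\<dots> = (\<Sum>k\<in>K. th k * (\<Sum>i\<in>S. a i k * w i))"
      by (subst sum.swap) (simp add: sum_distrib_left)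
    finally show ?thesis using that by simp
  qed
  \<comment> \<open>The forbidden pattern is that of the relation itself. If some halfspace has the
    signs of \<open>w\<close>, every product of \<open>w\<close> with its linear form is
    nonnegative. The pattern uses the weak inequality, so strict positivity is only certain where
    \<open>w\<close> is negative; hence \<open>neg\<close>, arranged below by passing to
    \<open>- v\<close> if necessary.\<close>
  have main: False if neg: "\<exists>i\<in>S. w i < 0" and rel: "\<And>k. k \<in> K \<Longrightarrow> (\<Sum>i\<in>S. a i k * w i) = 0" for w
  proof -
    obtain A where A: "A \<in> F" "A \<inter> S = {i\<in>S. 0 \<le> w i}"
      using sh unfolding shatters_def by (metis (no_types, lifting) mem_Collect_eq subsetI)
    obtain th where th: "A \<inter> S = {i\<in>S. 0 \<le> (\<Sum>k\<in>K. a i k * th k)}" using F[OF A(1)] by blast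
    let ?h = "\<lambda>i. \<Sum>k\<in>K. a i k * th k"
    have iff: "0 \<le> w i \<longleftrightarrow> 0 \<le> ?h i" if "i \<in> S" for i
      using A(2) th that by blast
    have "0 < (\<Sum>i\<in>S. w i * ?h i)"
    proof -
      obtain i where i: "i \<in> S" "w i < 0" using neg by blast
      have pos: "0 < w i * ?h i" using iff[OF i(1)] i by (intro mult_neg_neg) auto
      have nonneg: "0 \<le> w j * ?h j" if "j \<in> S" for j
      proof (cases "0 \<le> w j")
        case True
        then show ?thesis using iff[OF that] by (intro mult_nonneg_nonneg) auto
      next
        case False
        then show ?thesis using iff[OF that] by (intro mult_nonpos_nonpos) auto
      qed
      show ?thesis
        using sum_pos2[of S i "\<lambda>i. w i * ?h i"] \<open>finite S\<close> i(1) pos nonneg by blast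
    qed
    then show False using zero[of w th] rel by simp
  qed
  obtain i where i: "i \<in> S" "v i \<noteq> 0" using v by blast
  show False
  proof (cases "v i < 0")
    case True
    then show False using main[of v] i v by blast
  next
    case False
    then have "- v i < 0" using i by auto
    then show False using main[of "\<lambda>i. - v i"] i v by (auto simp: sum_negf)
  qed
qed

text \<open>Sauer bound: the number of traces is polynomial in the number of points, with the number
  of parameters as degree. This is what makes a union bound over all halfspaces affordable.\<close>

lemma card_halfspace_traces:
  fixes a :: "'i \<Rightarrow> 'k \<Rightarrow> real"
  assumes "finite K" "finite X"
    and F: "\<And>A. A \<in> F \<Longrightarrow> \<exists>th. A = {i\<in>X. 0 \<le> (\<Sum>k\<in>K. a i k * th k)}"
  shows "card F \<le> (card X + 1) ^ card K"
proof -
  have "F \<subseteq> Pow X" using F by fast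
  then have "card F \<le> card {S. S \<subseteq> X \<and> shatters F S}"
    using assms(2) by (rule card_le_card_shattered[rotated])
  also have "\<dots> \<le> card {S. S \<subseteq> X \<and> card S \<le> card K}"
  proof (intro card_mono subsetI)
    show "finite {S. S \<subseteq> X \<and> card S \<le> card K}" using assms by simp
    fix S assume "S \<in> {S. S \<subseteq> X \<and> shatters F S}"
    then have S: "S \<subseteq> X" "shatters F S" "finite S" using assms by (auto dest: finite_subset)
    have "card S \<le> card K"
    proof (rule halfspace_shatter_le[OF assms(1) S(3,2)])
      fix A assume "A \<in> F"
      then obtain th where "A = {i\<in>X. 0 \<le> (\<Sum>k\<in>K. a i k * th k)}" using F by blast
      then show "\<exists>th. A \<inter> S = {i\<in>S. 0 \<le> (\<Sum>k\<in>K. a i k * th k)}" using S(1) by blast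
    qed
    then show "S \<in> {S. S \<subseteq> X \<and> card S \<le> card K}" using S by simp
  qed
  also have "\<dots> \<le> (card X + 1) ^ card K" using assms(2) by (rule card_subsets_bounded)
  finally show ?thesis .
qed

subsection \<open>Rademacher sums\<close>

lemma two_power_fact_le: "(2::real) ^ n * fact n \<le> fact (2 * n)"
proof (induction n)
  case (Suc n)
  have "(2::real) ^ Suc n * fact (Suc n) = (2 * real (Suc n)) * (2 ^ n * fact n)"
    by (simp add: algebra_simps)
  also have "\<dots> \<le> (2 * real (Suc n)) * fact (2 * n)" using Suc by (intro mult_left_mono) auto
  also have "\<dots> \<le> (real (2 * n + 2) * real (2 * n + 1)) * fact (2 * n)"
    by (intro mult_right_mono) auto
  also have "\<dots> = fact (2 * Suc n)" by (simp add: algebra_simps)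
  finally show ?case .
qed simp

text \<open>Termwise comparison of the power series, by \<open>two_power_fact_le\<close>.\<close>

lemma cosh_le_exp_half_square: "cosh (x::real) \<le> exp (x\<^sup>2 / 2)"
proof -
  \<comment> \<open>The series of \<open>exp (x\<^sup>2 / 2)\<close>, padded with zeros at the odd
    indices so that it is indexed like the series of \<open>cosh\<close>.\<close>
  let ?f = "\<lambda>n. if even n then (x\<^sup>2 / 2) ^ (n div 2) / fact (n div 2) else 0"
  have "(\<lambda>n. ?f (2 * n)) sums exp (x\<^sup>2 / 2)"
    using exp_converges[of "x\<^sup>2 / 2"] by (simp add: field_simps)
  then have e: "?f sums exp (x\<^sup>2 / 2)"
    by (subst (asm) sums_mono_reindex) (auto simp: strict_mono_def elim!: evenE)
  show ?thesis
  proof (rule sums_le[OF _ cosh_converges e])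
    fix n
    show "(if even n then x ^ n /\<^sub>R fact n else 0) \<le> ?f n"
    proof (cases "even n")
      case True
      then obtain k where n: "n = 2 * k" by (elim evenE)
      have "x ^ n / fact n \<le> x ^ n / (2 ^ k * fact k)"
        using two_power_fact_le[of k] by (intro divide_left_mono) (auto simp: n)
      also have "\<dots> = (x\<^sup>2 / 2) ^ k / fact k" by (simp add: n power_mult power_divide)
      finally show ?thesis using n by (simp add: field_simps)
    qed simp
  qed
qed

lemma sum_Pow_prod:
  fixes g h :: "'i \<Rightarrow> real"
  assumes "finite I"
  shows "(\<Sum>S\<in>Pow I. \<Prod>i\<in>I. if i \<in> S then g i else h i) = (\<Prod>i\<in>I. g i + h i)"
proof -
  have "(\<Prod>i\<in>I. g i + h i) = (\<Sum>S\<in>Pow I. prod g S * prod h (I - S))"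
    by (rule prod_add[OF assms])
  also have "\<dots> = (\<Sum>S\<in>Pow I. \<Prod>i\<in>I. if i \<in> S then g i else h i)"
  proof (rule sum.cong[OF refl])
    fix S assume "S \<in> Pow I"
    then have S: "S \<subseteq> I" by auto
    have "(\<Prod>i\<in>I. if i \<in> S then g i else h i)
        = (\<Prod>i\<in>I - S. if i \<in> S then g i else h i) * (\<Prod>i\<in>S. if i \<in> S then g i else h i)"
      by (rule prod.subset_diff[OF S assms])
    also have "\<dots> = prod h (I - S) * prod g S"
      by (intro arg_cong2[where f = "(*)"] prod.cong) auto
    finally show "prod g S * prod h (I - S) = (\<Prod>i\<in>I. if i \<in> S then g i else h i)"
      by (simp add: mult.commute)
  qed
  finally show ?thesis by simp
qed

text \<open>A Rademacher sum; the vector of signs is encoded by the set of the indices with sign -1,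
  so expectations over the signs are finite averages over \<open>Pow I\<close>.\<close>

definition signed_sum :: "'i set \<Rightarrow> ('i \<Rightarrow> real) \<Rightarrow> 'i set \<Rightarrow> real" where
  "signed_sum I a S = (\<Sum>i\<in>I. if i \<in> S then - a i else a i)"

text \<open>Independence of the signs appears as the factorization \<open>sum_Pow_prod\<close>; each
  factor is a \<open>cosh\<close>.\<close>

lemma signed_sum_mgf:
  assumes "finite I"
  shows "(\<Sum>S\<in>Pow I. exp (r * signed_sum I a S)) \<le> 2 ^ card I * exp (r\<^sup>2 * (\<Sum>i\<in>I. (a i)\<^sup>2) / 2)"
proof -
  have "exp (r * signed_sum I a S) = (\<Prod>i\<in>I. if i \<in> S then exp (- r * a i) else exp (r * a i))" for S
    unfolding signed_sum_def sum_distrib_left exp_sum[OF assms] by (intro prod.cong) auto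
  then have "(\<Sum>S\<in>Pow I. exp (r * signed_sum I a S)) = (\<Prod>i\<in>I. exp (- r * a i) + exp (r * a i))"
    using sum_Pow_prod[OF assms] by simp
  also have "\<dots> = (\<Prod>i\<in>I. 2 * cosh (r * a i))"
    by (intro prod.cong refl) (simp add: cosh_field_def)
  also have "\<dots> \<le> (\<Prod>i\<in>I. 2 * exp ((r * a i)\<^sup>2 / 2))"
    by (intro prod_mono) (use cosh_le_exp_half_square in auto)
  also have "\<dots> = 2 ^ card I * exp (\<Sum>i\<in>I. (r * a i)\<^sup>2 / 2)"
    by (simp add: prod.distrib exp_sum[OF assms])
  also have "(\<Sum>i\<in>I. (r * a i)\<^sup>2 / 2) = r\<^sup>2 * (\<Sum>i\<in>I. (a i)\<^sup>2) / 2"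
    by (simp add: power_mult_distrib sum_distrib_left sum_divide_distrib)
  finally show ?thesis .
qed

lemma signed_sum_tail:
  assumes "finite I" "0 < V" "(\<Sum>i\<in>I. (a i)\<^sup>2) \<le> V" "0 \<le> l"
  shows "real (card {S\<in>Pow I. l < \<bar>signed_sum I a S\<bar>}) \<le> 2 * 2 ^ card I * exp (- l\<^sup>2 / (2 * V))"
proof -
  \<comment> \<open>The Chernoff parameter minimizing
    \<open>r\<^sup>2 * V / 2 - r * l\<close>.\<close>
  define r where "r = l / V"
  have r: "0 \<le> r" using assms by (simp add: r_def)
  let ?B = "{S\<in>Pow I. l < \<bar>signed_sum I a S\<bar>}"
  have "real (card ?B) * exp (r * l) = (\<Sum>S\<in>?B. exp (r * l))" by simp
  also have "\<dots> \<le> (\<Sum>S\<in>?B. exp (r * signed_sum I a S) + exp (- r * signed_sum I a S))"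
  proof (rule sum_mono)
    fix S assume "S \<in> ?B"
    then have "r * l \<le> r * \<bar>signed_sum I a S\<bar>" using r by (intro mult_left_mono) auto
    then have "r * l \<le> r * signed_sum I a S \<or> r * l \<le> - r * signed_sum I a S"
      by (simp add: abs_if split: if_splits)
    then have "exp (r * l) \<le> exp (r * signed_sum I a S) \<or> exp (r * l) \<le> exp (- r * signed_sum I a S)"
      by simp
    then show "exp (r * l) \<le> exp (r * signed_sum I a S) + exp (- r * signed_sum I a S)"
      by (metis add_increasing add_increasing2 exp_ge_zero)
  qed
  also have "\<dots> \<le> (\<Sum>S\<in>Pow I. exp (r * signed_sum I a S) + exp (- r * signed_sum I a S))"
    using assms by (intro sum_mono2) (auto intro: add_nonneg_nonneg)
  also have "\<dots> \<le> 2 * (2 ^ card I * exp (r\<^sup>2 * (\<Sum>i\<in>I. (a i)\<^sup>2) / 2))"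
    using signed_sum_mgf[OF assms(1), of r a] signed_sum_mgf[OF assms(1), of "- r" a]
    by (simp add: sum.distrib)
  also have "\<dots> \<le> 2 * (2 ^ card I * exp (r\<^sup>2 * V / 2))"
    using assms by (intro mult_left_mono) (auto intro!: mult_left_mono)
  finally have "real (card ?B) \<le> 2 * 2 ^ card I * (exp (r\<^sup>2 * V / 2) / exp (r * l))"
    by (simp add: field_simps)
  also have "exp (r\<^sup>2 * V / 2) / exp (r * l) = exp (- l\<^sup>2 / (2 * V))"
    using assms by (simp add: exp_diff[symmetric] r_def power2_eq_square field_simps)
  finally show ?thesis .
qed

subsection \<open>Symmetrization\<close>

text \<open>The mixed terms of the square vanish by independence and centering, so the variances add
  up.\<close>

lemma PiM_sum_square:
  fixes g :: "'b \<Rightarrow> real"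
  assumes "prob_space M" "finite I" and [measurable]: "g \<in> borel_measurable M"
    and sq: "integrable M (\<lambda>z. (g z)\<^sup>2)" and mean: "(\<integral>z. g z \<partial>M) = 0"
  shows "integrable (PiM I (\<lambda>_. M)) (\<lambda>z. (\<Sum>i\<in>I. g (z i))\<^sup>2)" (is ?int)
    and "(\<integral>z. (\<Sum>i\<in>I. g (z i))\<^sup>2 \<partial>PiM I (\<lambda>_. M)) = real (card I) * (\<integral>z. (g z)\<^sup>2 \<partial>M)" (is ?eq)
proof -
  interpret M: prob_space M by fact
  interpret P: product_prob_space "\<lambda>_. M" I by unfold_locales
  let ?N = "PiM I (\<lambda>_. M)"
  have g: "integrable M g" by (rule M.square_integrable_imp_integrable[OF assms(3) sq])
  have 1: "integrable ?N (\<lambda>z. g (z i) * g (z j)) \<and>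
      (\<integral>z. g (z i) * g (z j) \<partial>?N) = (if i = j then \<integral>z. (g z)\<^sup>2 \<partial>M else 0)"
    if "i \<in> I" "j \<in> I" for i j
  proof (cases "i = j")
    case True
    have d: "distr ?N M (\<lambda>z. z i) = M" using that M.prob_space_axioms by (intro distr_PiM_component) auto
    have "integrable (distr ?N M (\<lambda>z. z i)) (\<lambda>z. (g z)\<^sup>2)" using sq d by simp
    then have a: "integrable ?N (\<lambda>z. (g (z i))\<^sup>2)"
      using that by (subst (asm) integrable_distr_eq) auto
    have "(\<integral>z. (g z)\<^sup>2 \<partial>distr ?N M (\<lambda>z. z i)) = (\<integral>z. (g (z i))\<^sup>2 \<partial>?N)"
      using that by (intro integral_distr) simp_all
    then have "(\<integral>z. (g (z i))\<^sup>2 \<partial>?N) = (\<integral>z. (g z)\<^sup>2 \<partial>M)" unfolding d by (rule sym)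
    then show ?thesis using a True by (simp add: power2_eq_square)
  next
    case False
    \<comment> \<open>Padding with the constant 1 writes the product of two coordinates as a product
      over all of \<open>I\<close>, to which the product formula for integrals applies.\<close>
    define f where "f k = (\<lambda>y. if k \<in> {i, j} then g y else 1)" for k
    have int: "integrable M (f k)" for k by (cases "k \<in> {i, j}") (simp_all add: f_def g)
    have eq: "(\<Prod>k\<in>I. f k (z k)) = g (z i) * g (z j)" for z
    proof -
      have "(\<Prod>k\<in>I. f k (z k)) = (\<Prod>k\<in>I \<inter> {i, j}. g (z k))"
        unfolding f_def by (rule prod.inter_restrict[symmetric]) fact
      also have "I \<inter> {i, j} = {i, j}" using that by auto
      finally show ?thesis using False by simp
    qed
    have "integrable ?N (\<lambda>z. \<Prod>k\<in>I. f k (z k))"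
      by (rule P.product_integrable_prod[OF assms(2) int])
    moreover have "(\<integral>z. (\<Prod>k\<in>I. f k (z k)) \<partial>?N) = (\<Prod>k\<in>I. integral\<^sup>L M (f k))"
      by (rule P.product_integral_prod[OF assms(2) int])
    moreover have "(\<Prod>k\<in>I. integral\<^sup>L M (f k)) = 0"
      using that assms(2) mean by (intro prod_zero bexI[of _ i]) (simp_all add: f_def)
    ultimately show ?thesis using False by (simp add: eq)
  qed
  have sq_eq: "(\<Sum>i\<in>I. g (z i))\<^sup>2 = (\<Sum>i\<in>I. \<Sum>j\<in>I. g (z i) * g (z j))" for z
    by (simp add: power2_eq_square sum_product)
  show ?int unfolding sq_eq using 1 by (intro Bochner_Integration.integrable_sum) blast
  have "(\<integral>z. (\<Sum>i\<in>I. g (z i))\<^sup>2 \<partial>?N) = (\<Sum>i\<in>I. \<Sum>j\<in>I. \<integral>z. g (z i) * g (z j) \<partial>?N)"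
    unfolding sq_eq
  proof (subst Bochner_Integration.integral_sum)
    show "integrable ?N (\<lambda>z. \<Sum>j\<in>I. g (z i) * g (z j))" if "i \<in> I" for i
      using 1 that by (intro Bochner_Integration.integrable_sum) blast
    show "(\<Sum>i\<in>I. \<integral>z. (\<Sum>j\<in>I. g (z i) * g (z j)) \<partial>?N) = (\<Sum>i\<in>I. \<Sum>j\<in>I. \<integral>z. g (z i) * g (z j) \<partial>?N)"
      using 1 by (intro sum.cong refl Bochner_Integration.integral_sum) blast
  qed
  also have "\<dots> = (\<Sum>i\<in>I. \<Sum>j\<in>I. if i = j then \<integral>z. (g z)\<^sup>2 \<partial>M else 0)"
    using 1 by (intro sum.cong refl) auto
  also have "\<dots> = real (card I) * (\<integral>z. (g z)\<^sup>2 \<partial>M)"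
    using assms(2) by simp
  finally show ?eq .
qed

lemma PiM_sum_expectation:
  fixes g :: "'b \<Rightarrow> real"
  assumes "prob_space M" and [measurable]: "g \<in> borel_measurable M"
    and int: "integrable M g"
  shows "integrable (PiM I (\<lambda>_. M)) (\<lambda>z. \<Sum>i\<in>I. g (z i))" (is ?int)
    and "(\<integral>z. (\<Sum>i\<in>I. g (z i)) \<partial>PiM I (\<lambda>_. M)) = real (card I) * (\<integral>z. g z \<partial>M)" (is ?eq)
proof -
  let ?N = "PiM I (\<lambda>_. M)"
  have 1: "integrable ?N (\<lambda>z. g (z i)) \<and> (\<integral>z. g (z i) \<partial>?N) = (\<integral>z. g z \<partial>M)" if "i \<in> I" for i
  proof -
    have d: "distr ?N M (\<lambda>z. z i) = M" using that assms(1) by (intro distr_PiM_component) auto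
    have "integrable (distr ?N M (\<lambda>z. z i)) g" using int d by simp
    then have a: "integrable ?N (\<lambda>z. g (z i))"
      using that by (subst (asm) integrable_distr_eq) auto
    have "(\<integral>z. g z \<partial>distr ?N M (\<lambda>z. z i)) = (\<integral>z. g (z i) \<partial>?N)"
      using that by (intro integral_distr) auto
    then show ?thesis using a by (simp add: d)
  qed
  show ?int using 1 by (intro Bochner_Integration.integrable_sum) auto
  show ?eq using 1 by (subst Bochner_Integration.integral_sum) auto
qed

text \<open>Two events of probability at most 1/4 are excluded: Chebyshev gives
  \<open>4 / (n * t\<^sup>2)\<close> for the deviation, which is where
  \<open>16 \<le> n * t\<^sup>2\<close> is used, and Markov gives 1/4 for the sum of squares
  exceeding four times its expectation.\<close>

lemma ghost_sample_half:
  fixes w :: "'b \<Rightarrow> real"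
  assumes "prob_space M" "finite J" "0 < card J" and [measurable]: "w \<in> borel_measurable M"
    and sq: "integrable M (\<lambda>z. (w z)\<^sup>2)" and [measurable]: "C \<in> sets M"
    and V: "V = (\<integral>z. (w z)\<^sup>2 \<partial>M)" "0 < V" and t: "0 < t" "16 \<le> real (card J) * t\<^sup>2"
  shows "1 / 2 \<le> measure (PiM J (\<lambda>_. M)) {z \<in> space (PiM J (\<lambda>_. M)).
           \<bar>(\<Sum>j\<in>J. w (z j) * indicator C (z j)) - real (card J) * (\<integral>z. w z * indicator C z \<partial>M)\<bar>
             < real (card J) * (t / 2) * sqrt V \<and>
           (\<Sum>j\<in>J. (w (z j))\<^sup>2) < 4 * real (card J) * V}"
proof -
  interpret M: prob_space M by fact
  interpret P: product_prob_space "\<lambda>_. M" J by unfold_locales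
  let ?N = "PiM J (\<lambda>_. M)" and ?n = "real (card J)"
  define f where "f z = w z * indicator C z" for z
  have [measurable]: "f \<in> borel_measurable M" unfolding f_def by measurable
  define \<mu> where "\<mu> = (\<integral>z. f z \<partial>M)"
  have f2: "(f z)\<^sup>2 \<le> (w z)\<^sup>2" for z by (simp add: f_def indicator_def)
  have fsq: "integrable M (\<lambda>z. (f z)\<^sup>2)"
    by (rule Bochner_Integration.integrable_bound[OF sq]) (use f2 in auto)
  have fint: "integrable M f" by (rule M.square_integrable_imp_integrable[OF _ fsq]) measurable
  define g where "g z = f z - \<mu>" for z
  have [measurable]: "g \<in> borel_measurable M" unfolding g_def by measurable
  have gmean: "(\<integral>z. g z \<partial>M) = 0"
    unfolding g_def using fint by (simp add: M.prob_space \<mu>_def)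
  have g2: "(g z)\<^sup>2 = (f z)\<^sup>2 - 2 * \<mu> * f z + \<mu>\<^sup>2" for z by (simp add: g_def power2_eq_square algebra_simps)
  have gsq: "integrable M (\<lambda>z. (g z)\<^sup>2)" unfolding g2 using fsq fint by auto
  have gV: "(\<integral>z. (g z)\<^sup>2 \<partial>M) \<le> V"
  proof -
    have "(\<integral>z. (g z)\<^sup>2 \<partial>M) = (\<integral>z. (f z)\<^sup>2 \<partial>M) - \<mu>\<^sup>2"
      unfolding g2 using fsq fint by (simp add: M.prob_space \<mu>_def[symmetric] power2_eq_square)
    also have "\<dots> \<le> (\<integral>z. (f z)\<^sup>2 \<partial>M)" by simp
    also have "\<dots> \<le> V" unfolding V(1) by (intro integral_mono fsq sq f2)
    finally show ?thesis .
  qed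
  have n: "0 < ?n" using assms by simp
  define a where "a = ?n * (t / 2) * sqrt V"
  have a: "0 < a" unfolding a_def using n t V by (intro mult_pos_pos) auto
  have "P.prob {z \<in> space ?N. a \<le> \<bar>\<Sum>j\<in>J. g (z j)\<bar>} \<le> P.expectation (\<lambda>z. (\<Sum>j\<in>J. g (z j))\<^sup>2) / a\<^sup>2"
    using a by (intro P.second_moment_method PiM_sum_square(1)[OF assms(1,2) _ gsq gmean]) auto
  also have "\<dots> = ?n * (\<integral>z. (g z)\<^sup>2 \<partial>M) / a\<^sup>2"
    using PiM_sum_square(2)[OF assms(1,2) _ gsq gmean] by simp
  also have "\<dots> \<le> ?n * V / a\<^sup>2" using gV a n by (intro divide_right_mono mult_left_mono) auto
  also have "\<dots> = 4 / (?n * t\<^sup>2)"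
    using n t V by (simp add: a_def power_mult_distrib power2_eq_square field_simps)
  also have "\<dots> \<le> 1 / 4" using t n by (simp add: field_simps)
  finally have 1: "P.prob {z \<in> space ?N. a \<le> \<bar>\<Sum>j\<in>J. g (z j)\<bar>} \<le> 1 / 4" .
  have 2: "P.prob {z \<in> space ?N. 4 * ?n * V \<le> (\<Sum>j\<in>J. (w (z j))\<^sup>2)} \<le> 1 / 4"
  proof -
    have "P.prob {z \<in> space ?N. 4 * ?n * V \<le> (\<Sum>j\<in>J. (w (z j))\<^sup>2)}
        \<le> P.expectation (\<lambda>z. \<Sum>j\<in>J. (w (z j))\<^sup>2) / (4 * ?n * V)"
      using n V by (intro integral_Markov_inequality_measure[where A = "{}"]
          PiM_sum_expectation(1)[OF assms(1) _ sq]) (auto intro!: sum_nonneg AE_I2)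
    also have "\<dots> = 1 / 4"
      using n V PiM_sum_expectation(2)[OF assms(1) _ sq, of J] by simp
    finally show ?thesis .
  qed
  let ?B1 = "{z \<in> space ?N. a \<le> \<bar>\<Sum>j\<in>J. g (z j)\<bar>}"
  let ?B2 = "{z \<in> space ?N. 4 * ?n * V \<le> (\<Sum>j\<in>J. (w (z j))\<^sup>2)}"
  have meas: "?B1 \<in> sets ?N" "?B2 \<in> sets ?N" by measurable
  have "P.prob (?B1 \<union> ?B2) \<le> 1 / 2"
    using measure_Un_le[OF meas] 1 2 by simp
  then have "1 / 2 \<le> P.prob (space ?N - (?B1 \<union> ?B2))"
    using meas by (subst P.prob_compl) auto
  also have "space ?N - (?B1 \<union> ?B2) = {z \<in> space ?N.
      \<bar>(\<Sum>j\<in>J. f (z j)) - ?n * \<mu>\<bar> < a \<and> (\<Sum>j\<in>J. (w (z j))\<^sup>2) < 4 * ?n * V}"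
    by (auto simp: g_def sum_subtractf)
  finally show ?thesis by (simp add: f_def a_def \<mu>_def)
qed

text \<open>Exchanges each sample point \<open>k \<in> S\<close> with its ghost
  \<open>n + k\<close>. The law of the double sample is invariant under this, which is how the
  random signs enter.\<close>

definition pair_swap :: "nat \<Rightarrow> nat set \<Rightarrow> nat \<Rightarrow> nat" where
  "pair_swap n S k = (if k < n then (if k \<in> S then n + k else k)
                      else (if k - n \<in> S then k - n else k))"

lemma distr_pair_swap:
  assumes "prob_space M" "S \<subseteq> {..<n}"
  shows "distr (PiM {..<2 * n} (\<lambda>_. M)) (PiM {..<2 * n} (\<lambda>_. M))
           (\<lambda>z. \<lambda>k\<in>{..<2 * n}. z (pair_swap n S k)) = PiM {..<2 * n} (\<lambda>_. M)"
proof (rule distr_PiM_reindex[where K = "{..<2 * n}" and M = "\<lambda>_. M"])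
  show "inj_on (pair_swap n S) {..<2 * n}"
    using assms(2) by (auto simp: inj_on_def pair_swap_def split: if_splits)
  show "pair_swap n S \<in> {..<2 * n} \<rightarrow> {..<2 * n}"
    using assms(2) by (auto simp: pair_swap_def)
qed (use assms in auto)

text \<open>The comparison threshold involves the second moment of the given sample, which
  is not exchangeable with that of the ghost sample; but for a fixed \<open>w\<close> the latter is at most four
  times its expectation with probability 3/4, so the threshold may be replaced by the pooled one.\<close>

theorem relative_deviation:
  fixes w :: "'b \<Rightarrow> real" and n G :: nat
  assumes "prob_space M" "0 < n" and [measurable]: "w \<in> borel_measurable M"
    and sq: "integrable M (\<lambda>z. (w z)\<^sup>2)"
    and \<C>: "countable \<C>" "\<C> \<subseteq> sets M"
    and G: "\<And>z. z \<in> {..<2 * n} \<rightarrow> space M \<Longrightarrow> card ((\<lambda>C. {k\<in>{..<2 * n}. z k \<in> C}) ` \<C>) \<le> G"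
    and t: "0 < t" "16 \<le> real n * t\<^sup>2"
  defines "V \<equiv> (\<integral>z. (w z)\<^sup>2 \<partial>M)"
  defines "E \<equiv> {z \<in> space (PiM {..<n} (\<lambda>_. M)). \<exists>C\<in>\<C>.
      t * sqrt (max (emp_mean n (\<lambda>i. (w (z i))\<^sup>2)) V)
      < \<bar>emp_mean n (\<lambda>i. w (z i) * indicator C (z i)) - (\<integral>z. w z * indicator C z \<partial>M)\<bar>}"
  shows "E \<in> sets (PiM {..<n} (\<lambda>_. M))"
    and "measure (PiM {..<n} (\<lambda>_. M)) E \<le> 4 * real G * exp (- real n * t\<^sup>2 / 80)"
proof -
  interpret M: prob_space M by fact
  interpret N: product_prob_space "\<lambda>_. M" "{..<n}" by unfold_locales
  interpret N2: product_prob_space "\<lambda>_. M" "{..<2 * n}" by unfold_locales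
  interpret PS: product_sigma_finite "\<lambda>_. M" by unfold_locales
  have CM[measurable]: "C \<in> sets M" if "C \<in> \<C>" for C using \<C> that by auto
  let ?N = "PiM {..<n} (\<lambda>_. M)" and ?N' = "PiM {n..<2 * n} (\<lambda>_. M)" and ?N2 = "PiM {..<2 * n} (\<lambda>_. M)"
  interpret N': product_prob_space "\<lambda>_. M" "{n..<2 * n}" by unfold_locales
  have E1: "{z \<in> space ?N.
      t * sqrt (max (emp_mean n (\<lambda>i. (w (z i))\<^sup>2)) V)
      < \<bar>emp_mean n (\<lambda>i. w (z i) * indicator C (z i)) - (\<integral>z. w z * indicator C z \<partial>M)\<bar>} \<in> sets ?N"
    if [measurable]: "C \<in> sets M" for C
    unfolding emp_mean_def by measurable
  have "E = (\<Union>C\<in>\<C>. {z \<in> space ?N.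
      t * sqrt (max (emp_mean n (\<lambda>i. (w (z i))\<^sup>2)) V)
      < \<bar>emp_mean n (\<lambda>i. w (z i) * indicator C (z i)) - (\<integral>z. w z * indicator C z \<partial>M)\<bar>})"
    by (auto simp: E_def)
  then show Emeas: "E \<in> sets ?N" using E1 \<C> by (auto intro!: sets.countable_UN')
  show "measure ?N E \<le> 4 * real G * exp (- real n * t\<^sup>2 / 80)"
  \<comment> \<open>The ghost sample argument needs \<open>0 < V\<close>. If \<open>V = 0\<close>,
    the weight vanishes almost surely and the event is null.\<close>
  proof (cases "V = 0")
    case True
    have "AE z in M. (w z)\<^sup>2 = 0"
      using True sq unfolding V_def by (subst (asm) integral_nonneg_eq_0_iff_AE) auto
    then have w0: "AE z in M. w z = 0" by simp
    have "AE z in ?N. \<forall>i\<in>{..<n}. w (z i) = 0"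
    proof (subst AE_finite_all)
      show "\<forall>i\<in>{..<n}. AE z in ?N. w (z i) = 0"
      proof
        fix i assume i: "i \<in> {..<n}"
        show "AE z in ?N. w (z i) = 0"
          by (rule AE_PiM_component[OF _ i w0]) (rule M.prob_space_axioms)
      qed
    qed simp
    moreover have "(\<integral>z. w z * indicator C z \<partial>M) = 0" if "C \<in> \<C>" for C
    proof -
      have "(\<integral>z. w z * indicator C z \<partial>M) = (\<integral>z. 0 \<partial>M)"
        using w0 that by (intro integral_cong_AE) auto
      then show ?thesis by simp
    qed
    ultimately have "AE z in ?N. z \<notin> E"
      by (auto simp: E_def emp_mean_def True elim!: eventually_mono)
    then have "measure ?N E = 0"
      using Emeas by (simp add: N.prob_eq_0)
    then show ?thesis by simp
  next
    case False
    moreover have "0 \<le> V" unfolding V_def by simp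
    ultimately have V: "0 < V" by simp
    define f where "f C z = w z * indicator C z" for C z
    have [measurable]: "f C \<in> borel_measurable M" if "C \<in> sets M" for C
      unfolding f_def using that by measurable
    \<comment> \<open>The pooled sum of squares does not change when points are exchanged with their
      ghosts, so the threshold \<open>thr\<close> built from it is constant over all sign
      vectors.\<close>
    define Q where "Q z = (\<Sum>i<n. (w (z i))\<^sup>2 + (w (z (n + i)))\<^sup>2)" for z
    define D where "D C z = (\<Sum>i<n. f C (z i) - f C (z (n + i)))" for C z
    \<comment> \<open>The ghost mean may be off by \<open>t / 2 * sqrt V\<close>, hence the factor
      1/2. Its mean square is below \<open>4 * V\<close>, so the sum of both mean squares is at most
      five times \<open>max X1 V\<close>, hence the 5.\<close>
    define thr where "thr z = real n * t / 2 * sqrt (Q z / (5 * real n))" for z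
    define B where "B = {z \<in> space ?N2. \<exists>C\<in>\<C>. thr z < \<bar>D C z\<bar>}"
    have n: "0 < real n" using assms by simp
    have B1: "{z \<in> space ?N2. thr z < \<bar>D C z\<bar>} \<in> sets ?N2" if "C \<in> \<C>" for C
      using CM[OF that] unfolding thr_def D_def Q_def by measurable
    have "B = (\<Union>C\<in>\<C>. {z \<in> space ?N2. thr z < \<bar>D C z\<bar>})" by (auto simp: B_def)
    then have Bmeas[measurable]: "B \<in> sets ?N2" using B1 \<C> by (auto intro!: sets.countable_UN')
    have un: "{..<n} \<union> {n..<2 * n} = {..<2 * n}" and dj: "{..<n} \<inter> {n..<2 * n} = {}" by auto
    have emp: "emp_mean n h = (\<Sum>i<n. h i) / real n" for h by (simp add: emp_mean_def)
    \<comment> \<open>For each sample in \<open>E\<close>, at least half of the ghost samples put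
      the double sample into \<open>B\<close>; integrating over the sample gives the factor
      2.\<close>
    have half: "emeasure ?N E \<le> 2 * emeasure ?N2 B"
    proof -
      have "(1 / 2) * indicator E z \<le> (\<integral>\<^sup>+ y. indicator B (merge {..<n} {n..<2 * n} (z, y)) \<partial>?N')"
        if z: "z \<in> space ?N" for z
      proof (cases "z \<in> E")
        case True
        then obtain C where C: "C \<in> \<C>" and
          dev: "t * sqrt (max (emp_mean n (\<lambda>i. (w (z i))\<^sup>2)) V)
            < \<bar>emp_mean n (\<lambda>i. f C (z i)) - (\<integral>z. f C z \<partial>M)\<bar>"
          by (auto simp: E_def f_def)
        define A where "A = {y \<in> space ?N'.
           \<bar>(\<Sum>j\<in>{n..<2 * n}. w (y j) * indicator C (y j)) - real (card {n..<2 * n}) * (\<integral>z. w z * indicator C z \<partial>M)\<bar>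
             < real (card {n..<2 * n}) * (t / 2) * sqrt V \<and>
           (\<Sum>j\<in>{n..<2 * n}. (w (y j))\<^sup>2) < 4 * real (card {n..<2 * n}) * V}"
        have half: "1 / 2 \<le> measure ?N' A"
          unfolding A_def using assms V CM[OF C] n t
          by (intro ghost_sample_half[OF assms(1) _ _ _ sq]) (auto simp: V_def)
        have Ameas: "A \<in> sets ?N'" unfolding A_def using CM[OF C] by measurable
        have shift: "(\<Sum>j\<in>{n..<2 * n}. h j) = (\<Sum>i<n. h (n + i))" for h :: "nat \<Rightarrow> real"
          by (rule sum.reindex_bij_witness[of _ "\<lambda>i. n + i" "\<lambda>j. j - n"]) auto
        have sub: "merge {..<n} {n..<2 * n} (z, y) \<in> B" if y: "y \<in> A" for y
        proof -
          let ?m = "merge {..<n} {n..<2 * n} (z, y)"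
          have ysp: "y \<in> space ?N'" using y by (simp add: A_def)
          have m1: "?m i = z i" if "i < n" for i using that by (simp add: merge_def)
          have m2: "?m (n + i) = y (n + i)" if "i < n" for i using that by (simp add: merge_def)
          have msp: "?m \<in> space ?N2"
            using z ysp un by (auto simp: space_PiM PiE_def extensional_def merge_def Pi_iff)
          define X1 where "X1 = emp_mean n (\<lambda>i. (w (z i))\<^sup>2)"
          define X2 where "X2 = (\<Sum>i<n. (w (y (n + i)))\<^sup>2) / real n"
          define F1 where "F1 = (\<Sum>i<n. f C (z i))"
          define F2 where "F2 = (\<Sum>i<n. f C (y (n + i)))"
          define \<mu> where "\<mu> = (\<integral>z. f C z \<partial>M)"
          have "\<bar>(\<Sum>j\<in>{n..<2 * n}. f C (y j)) - real n * \<mu>\<bar> < real n * (t / 2) * sqrt V"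
              "(\<Sum>j\<in>{n..<2 * n}. (w (y j))\<^sup>2) < 4 * real n * V"
            using y by (simp_all add: A_def f_def \<mu>_def)
          then have y1: "\<bar>F2 - real n * \<mu>\<bar> < real n * (t / 2) * sqrt V" and "real n * X2 < real n * (4 * V)"
            unfolding shift using n by (simp_all add: F2_def X2_def)
          then have y2: "X2 < 4 * V" using n by simp
          have "F2 / real n - \<mu> = (F2 - real n * \<mu>) / real n" using n by (simp add: diff_divide_distrib)
          then have "\<bar>F2 / real n - \<mu>\<bar> = \<bar>F2 - real n * \<mu>\<bar> / real n" using n by simp
          also have "\<dots> < real n * (t / 2) * sqrt V / real n" using y1 n by (intro divide_strict_right_mono) auto
          finally have F2: "\<bar>F2 / real n - \<mu>\<bar> < t / 2 * sqrt V" using n by simp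
          have F1: "t * sqrt (max X1 V) < \<bar>F1 / real n - \<mu>\<bar>"
            using dev by (simp add: emp F1_def X1_def \<mu>_def)
          have "sqrt V \<le> sqrt (max X1 V)" by simp
          then have "t / 2 * sqrt V \<le> t / 2 * sqrt (max X1 V)" using t by (intro mult_left_mono) auto
          then have "t / 2 * sqrt (max X1 V) < \<bar>F1 / real n - F2 / real n\<bar>"
            using F1 F2 by linarith
          moreover have "sqrt (Q ?m / (5 * real n)) \<le> sqrt (max X1 V)"
          proof -
            have "Q ?m = (\<Sum>i<n. (w (z i))\<^sup>2 + (w (y (n + i)))\<^sup>2)"
              unfolding Q_def using m1 m2 by (intro sum.cong refl) simp
            also have "\<dots> = real n * (X1 + X2)"
              using n by (simp add: X1_def X2_def emp sum.distrib distrib_left)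
            finally have Q: "Q ?m = real n * (X1 + X2)" .
            then have "Q ?m / (5 * real n) = (X1 + X2) / 5" using n by simp
            also have "\<dots> \<le> max X1 V" using y2 by simp
            finally show ?thesis by simp
          qed
          then have "t / 2 * sqrt (Q ?m / (5 * real n)) \<le> t / 2 * sqrt (max X1 V)"
            using t by (intro mult_left_mono) auto
          ultimately have "t / 2 * sqrt (Q ?m / (5 * real n)) < \<bar>F1 - F2\<bar> / real n"
            using n by (simp add: diff_divide_distrib[symmetric])
          then have "thr ?m < \<bar>F1 - F2\<bar>" using n by (simp add: thr_def field_simps)
          moreover have "D C ?m = F1 - F2"
            unfolding D_def F1_def F2_def sum_subtractf[symmetric] using m1 m2 by (intro sum.cong refl) simp
          ultimately have "thr ?m < \<bar>D C ?m\<bar>" by simp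
          then show ?thesis using C msp unfolding B_def by blast
        qed
        have "(1 / 2) * indicator E z = (1 / 2 :: ennreal)" using True by simp
        also have "\<dots> = ennreal (1 / 2)" using divide_ennreal[of 1 2] by simp
        also have "\<dots> \<le> emeasure ?N' A" unfolding N'.emeasure_eq_measure by (rule ennreal_leI[OF half])
        also have "\<dots> = (\<integral>\<^sup>+ y. indicator A y \<partial>?N')" using Ameas by simp
        also have "\<dots> \<le> (\<integral>\<^sup>+ y. indicator B (merge {..<n} {n..<2 * n} (z, y)) \<partial>?N')"
          using sub by (intro nn_integral_mono) (auto simp: indicator_def)
        finally show ?thesis .
      qed simp
      then have "(\<integral>\<^sup>+ z. (1 / 2) * indicator E z \<partial>?N)
          \<le> (\<integral>\<^sup>+ z. (\<integral>\<^sup>+ y. indicator B (merge {..<n} {n..<2 * n} (z, y)) \<partial>?N') \<partial>?N)"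
        by (intro nn_integral_mono)
      also have "\<dots> = (\<integral>\<^sup>+ z. indicator B z \<partial>?N2)"
        using PS.product_nn_integral_fold[OF dj, of "indicator B"] by (simp add: un)
      also have "\<dots> = emeasure ?N2 B" by simp
      also have "(\<integral>\<^sup>+ z. (1 / 2) * indicator E z \<partial>?N) = (1 / 2) * emeasure ?N E"
        using Emeas by (simp add: nn_integral_cmult)
      finally have "2 * ((1 / 2) * emeasure ?N E) \<le> 2 * emeasure ?N2 B" by (intro mult_left_mono) auto
      moreover have "(2::ennreal) * (1 / 2) = 1"
        using ennreal_mult[of 2 "1 / 2"] divide_ennreal[of 1 2] by simp
      then have "2 * ((1 / 2) * emeasure ?N E) = emeasure ?N E"
        by (simp only: mult.assoc[symmetric] mult_1_left)
      ultimately show ?thesis by simp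
    qed
    \<comment> \<open>80 is what the Rademacher tail yields with variance proxy
      \<open>2 * Q z\<close> and squared threshold \<open>n * t\<^sup>2 * Q z / 20\<close>.\<close>
    define c where "c = real G * (2 * 2 ^ n * exp (- real n * t\<^sup>2 / 80))"
    have count: "real (card {S \<in> Pow {..<n}. (\<lambda>k\<in>{..<2 * n}. z (pair_swap n S k)) \<in> B}) \<le> c"
      if z: "z \<in> space ?N2" for z
    proof -
      let ?sw = "\<lambda>S. \<lambda>k\<in>{..<2 * n}. z (pair_swap n S k)"
      have sw1: "?sw S i = (if i \<in> S then z (n + i) else z i)" if "i < n" for S i
        using that by (simp add: pair_swap_def)
      have sw2: "?sw S (n + i) = (if i \<in> S then z i else z (n + i))" if "i < n" for S i
        using that by (simp add: pair_swap_def)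
      have Qsw: "Q (?sw S) = Q z" for S
        unfolding Q_def by (intro sum.cong refl) (simp add: sw1 sw2 del: restrict_apply)
      define T where "T = (\<lambda>C. {k\<in>{..<2 * n}. z k \<in> C}) ` \<C>"
      have T: "finite T" "card T \<le> G"
      proof -
        have "T \<subseteq> Pow {..<2 * n}" by (auto simp: T_def)
        then show "finite T" by (rule finite_subset) simp
        show "card T \<le> G" unfolding T_def using z by (intro G) (auto simp: space_PiM)
      qed
      \<comment> \<open>With the points fixed, a set of the class matters only through its trace
        \<open>Y\<close> on the \<open>2 * n\<close> points, so at most \<open>G\<close> Rademacher
        sums have to be controlled.\<close>
      define a where "a Y i = (if i \<in> Y then w (z i) else 0) - (if n + i \<in> Y then w (z (n + i)) else 0)" for Y i
      let ?A = "\<lambda>Y. {S \<in> Pow {..<n}. thr z < \<bar>signed_sum {..<n} (a Y) S\<bar>}"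
      have sub: "{S \<in> Pow {..<n}. ?sw S \<in> B} \<subseteq> (\<Union>Y\<in>T. ?A Y)"
      proof
        fix S assume "S \<in> {S \<in> Pow {..<n}. ?sw S \<in> B}"
        then obtain C where S: "S \<subseteq> {..<n}" and C: "C \<in> \<C>" and "thr (?sw S) < \<bar>D C (?sw S)\<bar>"
          by (auto simp: B_def)
        moreover have "thr (?sw S) = thr z" unfolding thr_def Qsw ..
        moreover have "D C (?sw S) = signed_sum {..<n} (a {k\<in>{..<2 * n}. z k \<in> C}) S"
          unfolding D_def signed_sum_def a_def
          by (intro sum.cong refl) (auto simp add: sw1 sw2 f_def indicator_def simp del: restrict_apply)
        ultimately show "S \<in> (\<Union>Y\<in>T. ?A Y)" by (auto simp: T_def)
      qed
      have each: "real (card (?A Y)) \<le> 2 * 2 ^ n * exp (- real n * t\<^sup>2 / 80)" if Y: "Y \<in> T" for Y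
      \<comment> \<open>The tail bound needs a positive variance proxy. If \<open>Q z = 0\<close>,
        all weights vanish and no signed sum exceeds the threshold 0 strictly.\<close>
      proof (cases "Q z = 0")
        case True
        then have w0: "(w (z i))\<^sup>2 + (w (z (n + i)))\<^sup>2 = 0" if "i < n" for i
          using that unfolding Q_def by (subst (asm) sum_nonneg_eq_0_iff) auto
        have "a Y i = 0" if "i < n" for i using w0[OF that] by (auto simp: a_def sum_power2_eq_zero_iff)
        then have "signed_sum {..<n} (a Y) S = 0" for S by (auto simp: signed_sum_def intro!: sum.neutral)
        then have empty: "?A Y = {}" using True by (auto simp: thr_def)
        show ?thesis unfolding empty by simp
      next
        case False
        have "0 \<le> Q z" unfolding Q_def by (intro sum_nonneg) auto
        then have Qz: "0 < Q z" using False by simp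
        have sum_le: "(\<Sum>i<n. (a Y i)\<^sup>2) \<le> 2 * Q z"
          unfolding Q_def sum_distrib_left
        proof (rule sum_mono)
          fix i
          have sq2: "(x - y)\<^sup>2 \<le> 2 * (x\<^sup>2 + y\<^sup>2)" for x y :: real
            using zero_le_power2[of "x + y"] by (simp add: power2_eq_square algebra_simps)
          have "(a Y i)\<^sup>2 \<le> 2 * ((if i \<in> Y then w (z i) else 0)\<^sup>2 + (if n + i \<in> Y then w (z (n + i)) else 0)\<^sup>2)"
            unfolding a_def by (rule sq2)
          also have "\<dots> \<le> 2 * ((w (z i))\<^sup>2 + (w (z (n + i)))\<^sup>2)"
            by (intro mult_left_mono add_mono) auto
          finally show "(a Y i)\<^sup>2 \<le> 2 * ((w (z i))\<^sup>2 + (w (z (n + i)))\<^sup>2)" .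
        qed
        have "real (card (?A Y)) \<le> 2 * 2 ^ card {..<n} * exp (- (thr z)\<^sup>2 / (2 * (2 * Q z)))"
          using Qz sum_le t n by (intro signed_sum_tail) (auto simp: thr_def)
        also have "- (thr z)\<^sup>2 / (2 * (2 * Q z)) = - real n * t\<^sup>2 / 80"
          using Qz n by (simp add: thr_def power_mult_distrib power_divide real_sqrt_pow2 power2_eq_square field_simps)
        finally show ?thesis by simp
      qed
      have "real (card {S \<in> Pow {..<n}. ?sw S \<in> B}) \<le> real (card (\<Union>Y\<in>T. ?A Y))"
        using T sub by (intro of_nat_mono card_mono) auto
      also have "\<dots> \<le> (\<Sum>Y\<in>T. real (card (?A Y)))"
        unfolding of_nat_sum[symmetric] by (intro of_nat_mono card_UN_le T(1))
      also have "\<dots> \<le> (\<Sum>Y\<in>T. 2 * 2 ^ n * exp (- real n * t\<^sup>2 / 80))"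
        by (intro sum_mono each)
      also have "\<dots> = real (card T) * (2 * 2 ^ n * exp (- real n * t\<^sup>2 / 80))" by simp
      also have "\<dots> \<le> c" unfolding c_def using T(2) by (intro mult_right_mono) auto
      finally show ?thesis .
    qed
    \<comment> \<open>By invariance every swap gives \<open>B\<close> the same measure, so
      \<open>2 ^ n\<close> copies of it are the integral of the number of swaps that lead into
      \<open>B\<close>, bounded pointwise by \<open>count\<close>.\<close>
    have "2 ^ n * emeasure ?N2 B \<le> ennreal c"
    proof -
      let ?sw = "\<lambda>S z. \<lambda>k\<in>{..<2 * n}. z (pair_swap n S k)"
      have sm[measurable]: "?sw S \<in> measurable ?N2 ?N2" if "S \<in> Pow {..<n}" for S
        using that by (intro measurable_restrict measurable_component_singleton) (auto simp: pair_swap_def)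
      have "2 ^ n * emeasure ?N2 B = (\<Sum>S\<in>Pow {..<n}. emeasure ?N2 B)"
        by (simp add: card_Pow)
      also have "\<dots> = (\<Sum>S\<in>Pow {..<n}. \<integral>\<^sup>+ z. indicator B (?sw S z) \<partial>?N2)"
      proof (rule sum.cong[OF refl])
        fix S assume S: "S \<in> Pow {..<n}"
        have "emeasure ?N2 B = (\<integral>\<^sup>+ z. indicator B z \<partial>distr ?N2 ?N2 (?sw S))"
          using distr_pair_swap[OF assms(1), of S n] S by simp
        also have "\<dots> = (\<integral>\<^sup>+ z. indicator B (?sw S z) \<partial>?N2)"
          using sm[OF S] by (intro nn_integral_distr) auto
        finally show "emeasure ?N2 B = (\<integral>\<^sup>+ z. indicator B (?sw S z) \<partial>?N2)" .
      qed
      also have "\<dots> = (\<integral>\<^sup>+ z. (\<Sum>S\<in>Pow {..<n}. indicator B (?sw S z)) \<partial>?N2)"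
        by (rule nn_integral_sum[symmetric]) (use sm in \<open>auto intro: measurable_compose[OF sm]\<close>)
      also have "\<dots> \<le> (\<integral>\<^sup>+ z. ennreal c \<partial>?N2)"
      proof (rule nn_integral_mono)
        fix z assume z: "z \<in> space ?N2"
        have "(\<Sum>S\<in>Pow {..<n}. indicator B (?sw S z) :: ennreal) = of_nat (card {S \<in> Pow {..<n}. ?sw S z \<in> B})"
          by (simp add: indicator_def sum.If_cases Int_def)
        also have "\<dots> \<le> ennreal c"
          unfolding ennreal_of_nat_eq_real_of_nat by (rule ennreal_leI[OF count[OF z]])
        finally show "(\<Sum>S\<in>Pow {..<n}. indicator B (?sw S z) :: ennreal) \<le> ennreal c" .
      qed
      also have "\<dots> = ennreal c" by (simp add: N2.emeasure_space_1)
      finally show ?thesis .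
    qed
    then have "ennreal (2 ^ n * measure ?N2 B) \<le> ennreal c"
      by (simp add: N2.emeasure_eq_measure ennreal_mult ennreal_power[symmetric] del: ennreal_power)
    then have "2 ^ n * measure ?N2 B \<le> c"
      by (rule ennreal_le_iff[THEN iffD1, rotated]) (simp add: c_def)
    then have "measure ?N2 B \<le> real G * (2 * exp (- real n * t\<^sup>2 / 80))"
      unfolding c_def by (simp add: mult_ac)
    moreover have "measure ?N E \<le> 2 * measure ?N2 B"
    proof -
      have "ennreal (measure ?N E) \<le> ennreal (2 * measure ?N2 B)"
        using half by (simp add: N.emeasure_eq_measure N2.emeasure_eq_measure ennreal_mult)
      then show ?thesis by (rule ennreal_le_iff[THEN iffD1, rotated]) simp
    qed
    ultimately show ?thesis by simp
  qed
qed

subsection \<open>A net of sparse directions\<close>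

text \<open>A net of mesh \<open>1 / g\<close> in the cube over \<open>R\<close>. Its cardinality
  depends on \<open>g\<close> and \<open>card R\<close> alone, and rounding a unit vector down
  coordinatewise leads into it.\<close>

definition grid :: "nat \<Rightarrow> nat set \<Rightarrow> (nat \<Rightarrow> real) set" where
  "grid g R = (\<lambda>k j. if j \<in> R then real_of_int (k j) / real g else 0) ` (R \<rightarrow>\<^sub>E {- int g..int g})"

lemma finite_grid: "finite R \<Longrightarrow> finite (grid g R)"
  unfolding grid_def by (intro finite_imageI finite_PiE) auto

lemma card_grid_le:
  assumes "finite R"
  shows "card (grid g R) \<le> (2 * g + 1) ^ card R"
proof -
  have "card (grid g R) \<le> card (R \<rightarrow>\<^sub>E {- int g..int g})"
    unfolding grid_def using assms by (intro card_image_le finite_PiE) auto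
  also have "\<dots> = (2 * g + 1) ^ card R"
    using assms by (simp add: card_PiE nat_add_distrib nat_mult_distrib)
  finally show ?thesis .
qed

lemma grid_support: "d \<in> grid g R \<Longrightarrow> j \<notin> R \<Longrightarrow> d j = 0"
  by (auto simp: grid_def)

lemma sum_mult_le_sqrt:
  fixes f h :: "'i \<Rightarrow> real"
  shows "\<bar>\<Sum>j\<in>R. f j * h j\<bar> \<le> sqrt (\<Sum>j\<in>R. (f j)\<^sup>2) * sqrt (\<Sum>j\<in>R. (h j)\<^sup>2)"
proof -
  have "\<bar>\<Sum>j\<in>R. f j * h j\<bar> \<le> (\<Sum>j\<in>R. \<bar>f j\<bar> * \<bar>h j\<bar>)"
    using sum_abs[of "\<lambda>j. f j * h j" R] by (simp add: abs_mult)
  also have "\<dots> \<le> L2_set f R * L2_set h R" by (rule L2_set_mult_ineq)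
  finally show ?thesis by (simp add: L2_set_def)
qed

text \<open>The norm \<open>L\<close> of the functional is its value at the unit vector
  \<open>l / L\<close>. Rounding this vector to the grid costs at most \<open>L / 2\<close>, which
  is absorbed on the left and gives \<open>L \<le> 2 * B\<close>.\<close>

lemma grid_norming:
  fixes l d :: "nat \<Rightarrow> real"
  assumes R: "finite R" and g: "2 * card R \<le> g" "0 < g"
    and B: "\<And>d. d \<in> grid g R \<Longrightarrow> (\<Sum>j\<in>R. (d j)\<^sup>2) \<le> 4 \<Longrightarrow> \<bar>\<Sum>j\<in>R. d j * l j\<bar> \<le> B"
  shows "\<bar>\<Sum>j\<in>R. d j * l j\<bar> \<le> 2 * B * sqrt (\<Sum>j\<in>R. (d j)\<^sup>2)"
proof -
  define L where "L = sqrt (\<Sum>j\<in>R. (l j)\<^sup>2)"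
  have L0: "0 \<le> L" by (simp add: L_def sum_nonneg)
  have L2: "L\<^sup>2 = (\<Sum>j\<in>R. (l j)\<^sup>2)" by (simp add: L_def sum_nonneg)
  have "L \<le> 2 * B"
  proof (cases "L = 0")
    case True
    have "(\<lambda>j. 0) \<in> grid g R"
      unfolding grid_def by (rule image_eqI[where x = "\<lambda>j\<in>R. 0"]) (auto simp: fun_eq_iff)
    from B[OF this] have "0 \<le> B" by simp
    then show ?thesis using True by simp
  next
    case False
    then have L: "0 < L" using L0 by simp
    define u where "u j = l j / L" for j
    define k where "k j = \<lfloor>real g * u j\<rfloor>" for j
    define e where "e j = (if j \<in> R then real_of_int (k j) / real g else 0)" for j
    have g0: "0 < real g" using g by simp
    have u2: "(\<Sum>j\<in>R. (u j)\<^sup>2) = 1"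
      using L by (simp add: u_def power_divide sum_divide_distrib[symmetric] L2[symmetric])
    have ub: "\<bar>u j\<bar> \<le> 1" if "j \<in> R" for j
    proof -
      have "(u j)\<^sup>2 \<le> (\<Sum>j\<in>R. (u j)\<^sup>2)" using that R by (intro member_le_sum) auto
      then show ?thesis by (simp add: u2 abs_square_le_1)
    qed
    have kb: "k j \<in> {- int g..int g}" if "j \<in> R" for j
    proof -
      have "- real g \<le> real g * u j" "real g * u j \<le> real g"
        using ub[OF that] g0 by (auto simp: abs_le_iff mult_le_cancel_left1 intro: order_trans[OF _ mult_left_mono[of "-1" "u j" "real g"]])
      then show ?thesis unfolding k_def by (simp add: le_floor_iff floor_le_iff)
    qed
    have e_grid: "e \<in> grid g R"
      unfolding grid_def e_def using kb by (intro image_eqI[where x = "\<lambda>j\<in>R. k j"]) (auto simp: fun_eq_iff)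
    have diff: "(u j - e j)\<^sup>2 \<le> (1 / real g)\<^sup>2" if "j \<in> R" for j
    proof -
      have "real g * (u j - e j) = real g * u j - real_of_int (k j)"
        using that g0 by (simp add: e_def right_diff_distrib)
      also have "\<bar>\<dots>\<bar> \<le> 1" unfolding k_def by linarith
      finally have "\<bar>real g * (u j - e j)\<bar> \<le> 1" by simp
      then have "\<bar>u j - e j\<bar> \<le> 1 / real g"
        using g0 unfolding abs_mult by (simp add: pos_le_divide_eq mult.commute)
      then show ?thesis by (rule abs_le_square_iff[THEN iffD1, OF order_trans]) simp
    qed
    have dsum: "(\<Sum>j\<in>R. (u j - e j)\<^sup>2) \<le> 1 / 4"
    proof -
      have "(\<Sum>j\<in>R. (u j - e j)\<^sup>2) \<le> real (card R) * (1 / real g)\<^sup>2"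
        using sum_mono[of R, OF diff] by simp
      also have "\<dots> \<le> 1 / 4"
      proof -
        have r: "2 * real (card R) \<le> real g" using g(1) by linarith
        have "4 * real (card R) \<le> (2 * real (card R))\<^sup>2"
          by (cases "card R") (auto simp: power2_eq_square algebra_simps)
        also have "\<dots> \<le> (real g)\<^sup>2" using r by (intro power_mono) auto
        finally show ?thesis using g0 by (simp add: field_simps)
      qed
      finally show ?thesis .
    qed
    \<comment> \<open>The rounded vector is within 1/2 of a unit vector, so its squared norm is
      below the 4 up to which the bound \<open>B\<close> is assumed.\<close>
    have "(\<Sum>j\<in>R. (e j)\<^sup>2) \<le> (\<Sum>j\<in>R. 2 * (u j)\<^sup>2 + 2 * (u j - e j)\<^sup>2)"
    proof (rule sum_mono)
      fix j
      show "(e j)\<^sup>2 \<le> 2 * (u j)\<^sup>2 + 2 * (u j - e j)\<^sup>2"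
        using zero_le_power2[of "2 * u j - e j"] by (simp add: power2_eq_square algebra_simps)
    qed
    also have "\<dots> \<le> 4" using u2 dsum by (simp add: sum.distrib sum_distrib_left[symmetric])
    finally have e4: "(\<Sum>j\<in>R. (e j)\<^sup>2) \<le> 4" .
    have "L = (\<Sum>j\<in>R. u j * l j)"
      using L by (simp add: u_def power2_eq_square[symmetric] sum_divide_distrib[symmetric] L2[symmetric])
        (simp add: power2_eq_square)
    also have "\<dots> = (\<Sum>j\<in>R. e j * l j) + (\<Sum>j\<in>R. (u j - e j) * l j)"
      by (simp add: sum.distrib[symmetric] algebra_simps)
    also have "\<dots> \<le> B + 1 / 2 * L"
    proof (rule add_mono)
      show "(\<Sum>j\<in>R. e j * l j) \<le> B" using B[OF e_grid e4] by simp
      have "(\<Sum>j\<in>R. (u j - e j) * l j) \<le> sqrt (\<Sum>j\<in>R. (u j - e j)\<^sup>2) * L"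
        unfolding L_def using sum_mult_le_sqrt[of "\<lambda>j. u j - e j" l R] by simp
      also have "\<dots> \<le> sqrt (1 / 4) * L" using dsum L0 by (intro mult_right_mono) auto
      also have "sqrt (1 / 4) = 1 / 2" by (simp add: real_sqrt_divide)
      finally show "(\<Sum>j\<in>R. (u j - e j) * l j) \<le> 1 / 2 * L" .
    qed
    finally show ?thesis by simp
  qed
  have "\<bar>\<Sum>j\<in>R. d j * l j\<bar> \<le> sqrt (\<Sum>j\<in>R. (d j)\<^sup>2) * L"
    unfolding L_def by (rule sum_mult_le_sqrt)
  also have "\<dots> \<le> sqrt (\<Sum>j\<in>R. (d j)\<^sup>2) * (2 * B)"
    using \<open>L \<le> 2 * B\<close> by (intro mult_left_mono) (auto intro: sum_nonneg)
  finally show ?thesis by (simp add: mult_ac)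
qed

section \<open>Arithmetic of the union bound\<close>

text \<open>The factors count the choices of \<open>T\<close>, of \<open>S\<close>, of grid points
  and of traces. With \<open>X = k * L + s * l\<close> and \<open>r * l \<le> X\<close>, their
  logarithms sum to at most \<open>8 * s * l + 2 * k * L + 6 * X \<le> 14 * X\<close>; \<kappa> is
  what remains for the sum over \<open>k\<close>.\<close>

lemma union_bound_exponent:
  fixes n p s k r N :: nat and \<kappa> L l :: real
  assumes n: "3 \<le> n" and N: "n \<le> N" "p \<le> N" and s: "1 \<le> s" and r: "r \<le> s + k"
    and Ll: "l = ln (real n)" "L = ln (real N)"
  shows "real ((n + 1) ^ s) * (real ((p + 1) ^ k) * (real ((2 * (4 * n) + 1) ^ r) *
      (4 * real ((2 * n + 1) ^ (r + 2)) * exp (- ((14 + \<kappa>) * (real k * L + real s * l))))))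
    \<le> exp (- \<kappa> * (real k * L + real s * l))"
proof -
  have np: "0 < real n" "0 < real N" using n N by auto
  have el: "exp l = real n" "exp L = real N" using np Ll by simp_all
  have lL: "l \<le> L" using np N Ll by simp
  have l0: "0 \<le> l" using n Ll by simp
  have n3: "3 \<le> real n" using n by simp
  have sq: "(real n)\<^sup>2 \<ge> 3 * real n" using n3 by (simp add: power2_eq_square)
  have e2: "exp (2 * l) = (real n)\<^sup>2" by (simp add: exp_double el)
  have e4: "exp (4 * l) = (real n)^4" using exp_double[of "2 * l"] by (simp add: e2)
  have E2: "exp (2 * L) = (real N)\<^sup>2" by (simp add: exp_double el)
  have a1: "real (n + 1) \<le> exp (2 * l)" "real (2 * n + 1) \<le> exp (2 * l)" "4 \<le> exp (2 * l)"
    using sq n3 by (auto simp: e2)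
  have a2: "real (p + 1) \<le> exp (2 * L)"
  proof -
    have "3 * real N \<le> (real N)\<^sup>2" using n N by (simp add: power2_eq_square)
    then show ?thesis unfolding E2 using N n by simp
  qed
  have a3: "real (2 * (4 * n) + 1) \<le> exp (4 * l)"
  proof -
    have "9 * 3 * real n \<le> (real n)\<^sup>2 * (real n)\<^sup>2"
    proof -
      have "(9::real) \<le> (real n)\<^sup>2" using power_mono[OF n3, of 2] by simp
      then have "9 * (3 * real n) \<le> (real n)\<^sup>2 * (real n)\<^sup>2" using sq by (intro mult_mono) auto
      then show ?thesis by simp
    qed
    then have "27 * real n \<le> (real n)^4" by (simp add: power2_eq_square power4_eq_xxxx)
    then show ?thesis unfolding e4 using n3 by simp
  qed
  have pw: "real (x ^ m) \<le> exp (real m * y)" if "real x \<le> exp y" for x m y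
    using power_mono[OF that, of m] by (simp add: exp_of_nat_mult)
  have rl: "real r * (c * l) \<le> c * (real k * L + real s * l)" if "0 \<le> c" for c
  proof -
    have "real r * l \<le> (real s + real k) * l" using r l0 by (intro mult_right_mono) auto
    also have "\<dots> \<le> real k * L + real s * l" using lL by (simp add: distrib_right mult_left_mono)
    finally have "c * (real r * l) \<le> c * (real k * L + real s * l)" using that by (rule mult_left_mono)
    then show ?thesis by (simp only: mult.left_commute)
  qed
  have b1: "real ((n + 1) ^ s) \<le> exp (real s * (2 * l))" by (rule pw[OF a1(1)])
  have b2: "real ((p + 1) ^ k) \<le> exp (real k * (2 * L))" by (rule pw[OF a2])
  have b3: "real ((2 * (4 * n) + 1) ^ r) \<le> exp (real r * (4 * l))" by (rule pw[OF a3])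
  have b4: "real ((2 * n + 1) ^ (r + 2)) \<le> exp (real (r + 2) * (2 * l))" by (rule pw[OF a1(2)])
  let ?X = "real k * L + real s * l"
  let ?e = "exp (- ((14 + \<kappa>) * ?X))"
  have "real ((n + 1) ^ s) * (real ((p + 1) ^ k) * (real ((2 * (4 * n) + 1) ^ r) *
      (4 * real ((2 * n + 1) ^ (r + 2)) * ?e)))
    \<le> exp (real s * (2 * l)) * (exp (real k * (2 * L)) * (exp (real r * (4 * l)) *
        (exp (2 * l) * exp (real (r + 2) * (2 * l)) * ?e)))"
    using b1 b2 b3 b4 a1(3)
    by (intro mult_mono order_refl mult_nonneg_nonneg) auto
  also have "\<dots> = exp (real s * (2 * l) + (real k * (2 * L) + (real r * (4 * l)
      + (2 * l + real (r + 2) * (2 * l) - (14 + \<kappa>) * ?X))))"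
    by (simp only: exp_add exp_diff exp_minus divide_inverse mult_ac)
  also have "\<dots> \<le> exp (- \<kappa> * ?X)"
  proof -
    have sl: "l \<le> real s * l" using s l0 mult_right_mono[of 1 "real s" l] by simp
    have kL: "0 \<le> real k * L" using l0 lL by simp
    have "real s * (2 * l) + (real k * (2 * L) + (real r * (4 * l) + (2 * l + real (r + 2) * (2 * l))))
      = 2 * (real s * l) + 2 * (real k * L) + real r * (4 * l) + real r * (2 * l) + 6 * l"
      by (simp add: algebra_simps)
    also have "\<dots> \<le> 2 * (real s * l) + 2 * (real k * L) + 4 * ?X + 2 * ?X + 6 * (real s * l)"
      using rl[of 4] rl[of 2] sl by linarith
    also have "\<dots> \<le> 14 * ?X" using kL by (simp add: algebra_simps)
    finally show ?thesis by (simp add: algebra_simps)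
  qed
  finally show ?thesis .
qed

text \<open>Each term is at most \<open>exp (- \<kappa> * l)\<close>, a power of \<open>n\<close>.
  The summand 2 in \<kappa> pays for the \<open>n + 1 \<le> n\<^sup>2\<close> terms; the logarithm
  leaves the factor \<epsilon> because \<open>1 \<le> l\<close>.\<close>

lemma union_bound_total:
  fixes n s :: nat and \<kappa> L l \<epsilon> :: real
  assumes n: "3 \<le> n" and s: "1 \<le> s" and l: "l = ln (real n)" "l \<le> L"
    and eps: "0 < \<epsilon>" and \<kappa>: "\<kappa> = 2 + max 0 (ln (1 / \<epsilon>))"
  shows "(\<Sum>k\<le>n. exp (- \<kappa> * (real k * L + real s * l))) \<le> \<epsilon>"
proof -
  have l1: "1 \<le> l"
  proof -
    have "exp 1 \<le> real n" using exp_le n by simp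
    then show ?thesis using n l by (subst l, subst ln_ge_iff) auto
  qed
  have \<kappa>2: "2 \<le> \<kappa>" using \<kappa> by simp
  have "(\<Sum>k\<le>n. exp (- \<kappa> * (real k * L + real s * l))) \<le> (\<Sum>k\<le>n. exp (- \<kappa> * l))"
  proof (rule sum_mono)
    fix k
    have "l \<le> real s * l" using s l1 mult_right_mono[of 1 "real s" l] by simp
    also have "\<dots> \<le> real k * L + real s * l" using l l1 by simp
    finally have "\<kappa> * l \<le> \<kappa> * (real k * L + real s * l)" using \<kappa>2 by (intro mult_left_mono) auto
    then show "exp (- \<kappa> * (real k * L + real s * l)) \<le> exp (- \<kappa> * l)" by simp
  qed
  also have "\<dots> = real (n + 1) * exp (- \<kappa> * l)" by simp
  also have "\<dots> \<le> exp (2 * l) * exp (- \<kappa> * l)"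
  proof (rule mult_right_mono)
    have "exp (2 * l) = (real n)\<^sup>2" using n l by (simp add: exp_double)
    moreover have "real (n + 1) \<le> (real n)\<^sup>2"
    proof -
      have "3 * real n \<le> (real n)\<^sup>2" using n by (simp add: power2_eq_square)
      then show ?thesis using n by simp
    qed
    ultimately show "real (n + 1) \<le> exp (2 * l)" by simp
  qed simp
  also have "\<dots> = exp (- (max 0 (ln (1 / \<epsilon>)) * l))"
    by (simp add: exp_add[symmetric] \<kappa> algebra_simps)
  also have "\<dots> \<le> exp (- max 0 (ln (1 / \<epsilon>)))"
    using l1 mult_left_mono[of 1 l "max 0 (ln (1 / \<epsilon>))"] by simp
  also have "\<dots> \<le> exp (ln \<epsilon>)"
    by (subst exp_le_cancel_iff) (use eps in \<open>simp add: ln_div\<close>)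
  also have "\<dots> = \<epsilon>" using eps by simp
  finally show ?thesis .
qed

section \<open>The check loss and Knight's identity\<close>

lemma check_loss_eq: "check_loss u t = u * t + max (- t) 0"
  by (auto simp: check_loss_def algebra_simps max_def)

lemma check_loss_diff_le: "0 < u \<Longrightarrow> u < 1 \<Longrightarrow> \<bar>check_loss u (e - v) - check_loss u e\<bar> \<le> \<bar>v\<bar>"
proof -
  assume u: "0 < u" "u < 1"
  define w where "w = u * v"
  have "check_loss u (e - v) - check_loss u e = - w + (max (v - e) 0 - max (- e) 0)"
    by (simp add: check_loss_eq w_def algebra_simps)
  moreover have "0 \<le> w" "w \<le> v" if "0 \<le> v"
    using u that mult_right_mono[of u 1 v] by (simp_all add: w_def)
  moreover have "w \<le> 0" "v \<le> w" if "v \<le> 0"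
    using u that mult_right_mono_neg[of u 1 v] by (simp_all add: w_def mult_nonneg_nonpos)
  ultimately show ?thesis by (cases "0 \<le> v") (auto simp: max_def abs_le_iff)
qed

text \<open>At the kink the subgradient is chosen to agree with the indicator
  \<open>e \<le> 0\<close> of the score, so no case of a zero residual has to be excluded.\<close>

lemma check_loss_subgradient: "- v * (u - of_bool (e \<le> 0)) \<le> check_loss u (e - v) - check_loss u e"
  by (auto simp: check_loss_eq algebra_simps max_def)

abbreviation unit_interval :: "real measure" where
  "unit_interval \<equiv> restrict_space lborel {0..1}"

lemma prob_space_unit_interval: "prob_space unit_interval"
  by (rule prob_space_restrict_space) auto

text \<open>Knight's identity: the integrand is the derivative of the loss along the segment from
  \<open>e\<close> to \<open>e - v\<close>, so the increment becomes linear in \<open>v\<close> for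
  a fixed indicator.\<close>

lemma check_loss_integral:
  assumes u: "0 < u" "u < 1"
  shows "(\<integral>\<tau>. v * (of_bool (e \<le> \<tau> * v) - u) \<partial>unit_interval) = check_loss u (e - v) - check_loss u e"
proof (cases "v = 0")
  case False
  let ?f = "\<lambda>\<tau>. v * (of_bool (e \<le> \<tau> * v) - u)"
  have hk: "(?f has_integral (check_loss u (e - 1 * v) - check_loss u (e - 0 * v))) {0..1}"
  \<comment> \<open>The kink of the loss is met at the single parameter \<open>e / v\<close>, the
    exceptional set of this form of the fundamental theorem.\<close>
  proof (rule fundamental_theorem_of_calculus_interior_strong[of "{e / v}" 0 1 "\<lambda>\<tau>. check_loss u (e - \<tau> * v)"])
    show "continuous_on {0..1} (\<lambda>\<tau>. check_loss u (e - \<tau> * v))"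
      unfolding check_loss_eq by (intro continuous_intros)
    fix \<tau> assume "\<tau> \<in> {0<..<1} - {e / v}"
    then have ne: "e - \<tau> * v \<noteq> 0" using False by (auto simp: field_simps)
    have "((\<lambda>\<tau>. check_loss u (e - \<tau> * v)) has_real_derivative ?f \<tau>) (at \<tau>)"
    proof (cases "e - \<tau> * v < 0")
      case True
      have "((\<lambda>\<tau>. (u - 1) * (e - \<tau> * v)) has_real_derivative ?f \<tau>) (at \<tau>)"
        using True by (auto intro!: derivative_eq_intros simp: algebra_simps)
      then show ?thesis
      proof (rule has_field_derivative_transform_within_open)
        show "open {\<tau>. e - \<tau> * v < 0}" by (intro open_Collect_less continuous_intros)
      qed (use True in \<open>auto simp: check_loss_def\<close>)
    next
      case False
      then have pos: "0 < e - \<tau> * v" using ne by simp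
      have "((\<lambda>\<tau>. u * (e - \<tau> * v)) has_real_derivative ?f \<tau>) (at \<tau>)"
        using pos by (auto intro!: derivative_eq_intros simp: algebra_simps)
      then show ?thesis
      proof (rule has_field_derivative_transform_within_open)
        show "open {\<tau>. 0 < e - \<tau> * v}" by (intro open_Collect_less continuous_intros)
      qed (use pos in \<open>auto simp: check_loss_def\<close>)
    qed
    then show "((\<lambda>\<tau>. check_loss u (e - \<tau> * v)) has_vector_derivative ?f \<tau>) (at \<tau>)"
      by (simp add: has_real_derivative_iff_has_vector_derivative)
  qed auto
  have bd: "\<bar>?f \<tau>\<bar> \<le> \<bar>v\<bar>" for \<tau>
    using u by (auto simp: abs_mult intro!: mult_left_le)
  have "set_integrable lborel {0..1} ?f"
    unfolding set_integrable_def
  proof (rule Bochner_Integration.integrable_bound[of lborel "\<lambda>\<tau>. indicator {0..1} \<tau> *\<^sub>R \<bar>v\<bar>"])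
    show "integrable lborel (\<lambda>\<tau>. indicator {0..1::real} \<tau> *\<^sub>R \<bar>v\<bar>)" by simp
    show "(\<lambda>\<tau>. indicator {0..1} \<tau> *\<^sub>R ?f \<tau>) \<in> borel_measurable lborel" by measurable
    show "AE \<tau> in lborel. norm (indicator {0..1} \<tau> *\<^sub>R ?f \<tau>) \<le> norm (indicator {0..1} \<tau> *\<^sub>R \<bar>v\<bar>)"
      using bd by (auto simp: indicator_def)
  qed
  then have "(LINT \<tau>:{0..1}|lborel. ?f \<tau>) = integral {0..1} ?f"
    by (rule set_borel_integral_eq_integral)
  also have "\<dots> = check_loss u (e - v) - check_loss u e"
    using integral_unique[OF hk] by simp
  finally show ?thesis
    by (simp add: set_lebesgue_integral_def integral_restrict_space)
qed (simp)

subsection \<open>The sample\<close>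

lemma emp_mean_cong: "(\<And>i. i < n \<Longrightarrow> f i = g i) \<Longrightarrow> emp_mean n f = emp_mean n g"
  by (simp add: emp_mean_def)

text \<open>The indicator of \<open>y \<le> a\<close> is continuous in \<open>a\<close> except at
  \<open>a = y\<close>, where it is only right continuous; hence the approach from above is demanded
  in that case alone.\<close>

lemma of_bool_le_tendsto:
  fixes a :: "nat \<Rightarrow> real"
  assumes "a \<longlonglongrightarrow> l" and "y = l \<Longrightarrow> (\<And>k. l \<le> a k)"
  shows "(\<lambda>k. of_bool (y \<le> a k) :: real) \<longlonglongrightarrow> of_bool (y \<le> l)"
proof (rule tendsto_eventually)
  consider "y < l" | "y = l" | "l < y" by linarith
  then show "\<forall>\<^sub>F k in sequentially. (of_bool (y \<le> a k) :: real) = of_bool (y \<le> l)"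
  proof cases
    case 1
    with order_tendstoD(1)[OF assms(1) 1] show ?thesis by (auto elim!: eventually_mono)
  next
    case 2
    with assms(2) show ?thesis by simp
  next
    case 3
    with order_tendstoD(2)[OF assms(1) 3] show ?thesis by (auto elim!: eventually_mono)
  qed
qed

locale qr_sample =
  fixes D :: "'a qr_model"
  assumes setting: "qr_setting D" and D1: "cond_D1 D" and D2: "cond_D2 D" and D3: "cond_D3 D"
begin

abbreviation "n \<equiv> nobs D"
abbreviation "p \<equiv> dimp D"
abbreviation "P \<equiv> Pr D"
abbreviation "U \<equiv> qset D"
abbreviation "XS \<equiv> cov_space D"

sublocale prob_space P
  using setting by (simp add: qr_setting_def)

lemma np3: "3 \<le> n" "3 \<le> p"
  using D1 by (simp_all add: cond_D1_def)

abbreviation "Obs \<equiv> borel \<Otimes>\<^sub>M cov_space D :: (real \<times> (nat \<Rightarrow> real)) measure"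

definition obs :: "nat \<Rightarrow> 'a \<Rightarrow> real \<times> (nat \<Rightarrow> real)" where
  "obs i \<omega> = (resp D i \<omega>, covar D i \<omega>)"

definition law :: "(real \<times> (nat \<Rightarrow> real)) measure" where
  "law = distr P Obs (obs 0)"

lemma obs_indep: "indep_vars (\<lambda>_. Obs) obs {..<n}"
  using D1 by (simp add: cond_D1_def obs_def[abs_def])

lemma obs_measurable[measurable]: "i < n \<Longrightarrow> obs i \<in> measurable P Obs"
  using obs_indep unfolding indep_vars_def by auto

lemma n_pos[simp]: "0 < n" and p_pos[simp]: "0 < p"
  using np3 by auto

lemma resp_measurable[measurable]: "i < n \<Longrightarrow> resp D i \<in> borel_measurable P"
  and covar_measurable[measurable]: "i < n \<Longrightarrow> covar D i \<in> measurable P XS"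
  using measurable_compose[OF obs_measurable measurable_fst] measurable_compose[OF obs_measurable measurable_snd]
  by (simp_all add: obs_def)

lemma XS_component[measurable]: "j < p \<Longrightarrow> (\<lambda>x. x j) \<in> borel_measurable XS"
  unfolding cov_space_def by measurable

lemma XS_dot[measurable]: "(\<lambda>x. dot p x d) \<in> borel_measurable XS"
  unfolding dot_def by (intro borel_measurable_sum borel_measurable_times XS_component) auto

lemma covar_component[measurable]:
  assumes "i < n" "j < p" shows "(\<lambda>\<omega>. covar D i \<omega> j) \<in> borel_measurable P"
  by (rule measurable_compose[OF covar_measurable[OF assms(1)] XS_component[OF assms(2)]])

lemma covar_dot[measurable]:
  assumes "i < n" shows "(\<lambda>\<omega>. dot p (covar D i \<omega>) d) \<in> borel_measurable P"
  by (rule measurable_compose[OF covar_measurable[OF assms] XS_dot])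

lemma law_prob: "prob_space law"
  unfolding law_def by (rule prob_space_distr) simp

lemma law_sets[measurable_cong]: "sets law = sets Obs"
  by (simp add: law_def)

lemma law_space: "space law = space Obs"
  by (simp add: law_def)

lemma distr_obs: "i < n \<Longrightarrow> distr P Obs (obs i) = law"
  using D1 unfolding cond_D1_def law_def obs_def[abs_def] by blast

definition sample :: "'a \<Rightarrow> nat \<Rightarrow> real \<times> (nat \<Rightarrow> real)" where
  "sample \<omega> = (\<lambda>i\<in>{..<n}. obs i \<omega>)"

lemma sample_measurable[measurable]: "sample \<in> measurable P (PiM {..<n} (\<lambda>_. Obs))"
  unfolding sample_def by (intro measurable_restrict) auto

text \<open>Carries bounds for product measures, where symmetrization takes place, back to the given
  probability space.\<close>

lemma distr_sample: "distr P (PiM {..<n} (\<lambda>_. Obs)) sample = PiM {..<n} (\<lambda>_. law)"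
proof -
  have "distr P (PiM {..<n} (\<lambda>_. Obs)) (\<lambda>\<omega>. \<lambda>i\<in>{..<n}. obs i \<omega>) = PiM {..<n} (\<lambda>i. distr P Obs (obs i))"
  proof (rule indep_vars_iff_distr_eq_PiM'[THEN iffD1, OF _ _ obs_indep])
    show "{..<n} \<noteq> {}" using n_pos by (intro notI) (auto simp del: n_pos)
  qed simp
  also have "\<dots> = PiM {..<n} (\<lambda>_. law)" by (intro PiM_cong refl) (simp add: distr_obs)
  finally show ?thesis by (simp add: sample_def[abs_def])
qed

text \<open>The Bochner integral of a non-integrable function is 0, so the value 1 in D.3 contains
  integrability.\<close>

lemma covar_sq_integrable: "j < p \<Longrightarrow> integrable P (\<lambda>\<omega>. (covar D 0 \<omega> j)\<^sup>2)"
  using D3 not_integrable_integral_eq[of P "\<lambda>\<omega>. (covar D 0 \<omega> j)\<^sup>2"] unfolding cond_D3_def by fastforce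

lemma covar_prod_integrable:
  assumes "j < p" "k < p" shows "integrable P (\<lambda>\<omega>. covar D 0 \<omega> j * covar D 0 \<omega> k)"
proof (rule Bochner_Integration.integrable_bound)
  show "integrable P (\<lambda>\<omega>. (covar D 0 \<omega> j)\<^sup>2 + (covar D 0 \<omega> k)\<^sup>2)"
    using assms covar_sq_integrable by (intro Bochner_Integration.integrable_add)
  show "AE \<omega> in P. norm (covar D 0 \<omega> j * covar D 0 \<omega> k) \<le> norm ((covar D 0 \<omega> j)\<^sup>2 + (covar D 0 \<omega> k)\<^sup>2)"
  proof (rule AE_I2)
    fix \<omega>
    have "\<bar>x * y\<bar> \<le> x\<^sup>2 + y\<^sup>2" for x y :: real
      using sum_squares_bound[of "\<bar>x\<bar>" "\<bar>y\<bar>"] mult_nonneg_nonneg[of "\<bar>x\<bar>" "\<bar>y\<bar>"]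
      unfolding abs_mult power2_abs by linarith
    then show "norm (covar D 0 \<omega> j * covar D 0 \<omega> k) \<le> norm ((covar D 0 \<omega> j)\<^sup>2 + (covar D 0 \<omega> k)\<^sup>2)"
      by simp
  qed
qed (use assms in measurable)

lemma dot_sq_expand: "(dot p x d)\<^sup>2 = (\<Sum>j<p. \<Sum>k<p. d j * d k * (x j * x k))"
  by (simp add: dot_def power2_eq_square sum_product mult_ac)

lemma dot_sq_integrable: "integrable P (\<lambda>\<omega>. (dot p (covar D 0 \<omega>) d)\<^sup>2)"
  unfolding dot_sq_expand
  by (intro Bochner_Integration.integrable_sum Bochner_Integration.integrable_mult_right covar_prod_integrable) auto

lemma dot_integrable: "integrable P (\<lambda>\<omega>. dot p (covar D 0 \<omega>) d)"
  by (rule square_integrable_imp_integrable[OF _ dot_sq_integrable]) (simp add: covar_dot)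

definition moment2 :: "(nat \<Rightarrow> real) \<Rightarrow> real" where
  "moment2 d = (\<integral>\<omega>. (dot p (covar D 0 \<omega>) d)\<^sup>2 \<partial>P)"

lemma moment2_nonneg: "0 \<le> moment2 d"
  by (simp add: moment2_def)

lemma gram_quad: "dot p d (matvec p (gram D) d) = moment2 d"
proof -
  have "moment2 d = (\<Sum>j<p. \<Sum>k<p. d j * d k * gram D j k)"
    unfolding moment2_def dot_sq_expand
    by (subst Bochner_Integration.integral_sum Bochner_Integration.integral_mult_right;
        (intro Bochner_Integration.integrable_sum Bochner_Integration.integrable_mult_right covar_prod_integrable sum.cong refl)?; (simp add: gram_def)?)+
  then show ?thesis
    by (simp add: dot_def matvec_def sum_distrib_left mult_ac)
qed

abbreviation "X_law \<equiv> distr P XS (covar D 0)"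

lemma X_law_prob: "prob_space X_law"
  by (rule prob_space_distr) simp

lemma cdens_nonneg: "0 \<le> cdens D x y"
  using D1 by (simp add: cond_D1_def)

lemma obs_distributed:
  "distributed P (X_law \<Otimes>\<^sub>M lborel) (\<lambda>\<omega>. (covar D 0 \<omega>, resp D 0 \<omega>)) (\<lambda>(x, y). ennreal (cdens D x y))"
  using D1 unfolding cond_D1_def by blast

lemma cdens_measurable[measurable]: "(\<lambda>(x, y). cdens D x y) \<in> borel_measurable (X_law \<Otimes>\<^sub>M lborel)"
proof -
  have "(\<lambda>z. enn2real (case z of (x, y) \<Rightarrow> ennreal (cdens D x y))) \<in> borel_measurable (X_law \<Otimes>\<^sub>M lborel)"
    using distributed_borel_measurable[OF obs_distributed] by measurable
  then show ?thesis by (simp add: case_prod_beta cdens_nonneg)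
qed

text \<open>For every covariate value the excluded response is one point, hence Lebesgue null, and
  the joint law has a density. This removes ties from all limits under the expectation.\<close>

lemma resp_ne_AE: "AE \<omega> in P. resp D 0 \<omega> \<noteq> dot p (covar D 0 \<omega>) b + c"
proof -
  interpret X: prob_space X_law by (rule X_law_prob)
  interpret XL: pair_sigma_finite X_law lborel ..
  have [measurable]: "(\<lambda>x. dot p x b) \<in> borel_measurable X_law" by simp
  have m: "Measurable.pred (X_law \<Otimes>\<^sub>M lborel) (\<lambda>z. snd z \<noteq> dot p (fst z) b + c)"
    by measurable
  have "AE z in X_law \<Otimes>\<^sub>M lborel. snd z \<noteq> dot p (fst z) b + c"
  proof (rule XL.AE_pair_measure)
    show "{z \<in> space (X_law \<Otimes>\<^sub>M lborel). snd z \<noteq> dot p (fst z) b + c} \<in> sets (X_law \<Otimes>\<^sub>M lborel)"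
      using m by (simp add: pred_def)
    show "AE x in X_law. AE y in lborel. snd (x, y) \<noteq> dot p (fst (x, y)) b + c"
      by (rule AE_I2, simp add: AE_lborel_singleton)
  qed
  then have "AE z in X_law \<Otimes>\<^sub>M lborel. 0 < (case z of (x, y) \<Rightarrow> ennreal (cdens D x y)) \<longrightarrow> snd z \<noteq> dot p (fst z) b + c"
    by (auto elim!: eventually_mono)
  then show ?thesis
    using distributed_AE2[OF obs_distributed m] by simp
qed

section \<open>Halfspaces with a sparse normal\<close>

definition halfspace :: "(nat \<Rightarrow> real) \<Rightarrow> real \<Rightarrow> (real \<times> (nat \<Rightarrow> real)) set" where
  "halfspace b c = {z \<in> space Obs. fst z \<le> dot p (snd z) b + c}"

lemma halfspace_sets[measurable]: "halfspace b c \<in> sets Obs"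
  unfolding halfspace_def by measurable

text \<open>Rational parameters keep the class countable and the exceptional event measurable; real
  ones are recovered as limits.\<close>

definition halfspaces :: "nat set \<Rightarrow> (real \<times> (nat \<Rightarrow> real)) set set" where
  "halfspaces R = (\<lambda>(b, c). halfspace (\<lambda>j. if j \<in> R then b j else 0) c) ` ((R \<rightarrow>\<^sub>E \<rat>) \<times> \<rat>)"

lemma halfspacesI:
  assumes "\<And>j. j \<in> R \<Longrightarrow> b j \<in> \<rat>" "\<And>j. j \<notin> R \<Longrightarrow> b j = 0" "c \<in> \<rat>"
  shows "halfspace b c \<in> halfspaces R"
  unfolding halfspaces_def
proof (rule image_eqI[where x = "(restrict b R, c)"])
  show "halfspace b c = (case (restrict b R, c) of (b, c) \<Rightarrow> halfspace (\<lambda>j. if j \<in> R then b j else 0) c)"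
    using assms(2) by (simp, intro arg_cong2[where f = halfspace]) (auto simp: fun_eq_iff)
qed (use assms in auto)

lemma halfspaces_countable: "finite R \<Longrightarrow> countable (halfspaces R)"
  unfolding halfspaces_def
  by (intro countable_image countable_SIGMA countable_PiE countable_rat) auto

text \<open>With the constant and the response as two more coordinates, placed at the free indices
  \<open>p\<close> and \<open>p + 1\<close>, membership is the sign of a linear form in
  \<open>card R + 2\<close> parameters.\<close>

lemma card_sparse_halfspace_traces:
  assumes R: "R \<subseteq> {..<p}" and z: "z \<in> {..<N} \<rightarrow> space Obs"
  shows "card ((\<lambda>C. {k\<in>{..<N}. z k \<in> C}) ` halfspaces R) \<le> (N + 1) ^ (card R + 2)"
proof -
  have finR: "finite R" using R finite_subset by blast
  let ?K = "insert p (insert (p + 1) R)"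
  define a where "a k j = (if j = p then 1 else if j = p + 1 then fst (z k) else snd (z k) j)" for k j
  have pR: "p \<notin> R" "p + 1 \<notin> R" using R by auto
  have "card ((\<lambda>C. {k\<in>{..<N}. z k \<in> C}) ` halfspaces R) \<le> (card {..<N} + 1) ^ card ?K"
  proof (rule card_halfspace_traces)
    show "finite ?K" using finR by simp
    show "finite {..<N}" by simp
    fix A assume "A \<in> (\<lambda>C. {k\<in>{..<N}. z k \<in> C}) ` halfspaces R"
    then obtain b c where A: "A = {k\<in>{..<N}. z k \<in> halfspace (\<lambda>j. if j \<in> R then b j else 0) c}"
      by (auto simp: halfspaces_def)
    define th where "th j = (if j = p then c else if j = p + 1 then - 1 else b j)" for j
    have "z k \<in> halfspace (\<lambda>j. if j \<in> R then b j else 0) c \<longleftrightarrow> 0 \<le> (\<Sum>j\<in>?K. a k j * th j)"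
      if k: "k < N" for k
    proof -
      have "(\<Sum>j\<in>R. a k j * th j) = (\<Sum>j\<in>R. snd (z k) j * b j)"
        using pR by (intro sum.cong refl) (auto simp: a_def th_def)
      also have "\<dots> = (\<Sum>j<p. snd (z k) j * (if j \<in> R then b j else 0))"
        using R by (intro sum.mono_neutral_cong_left) auto
      finally have "(\<Sum>j\<in>?K. a k j * th j) = c - fst (z k) + dot p (snd (z k)) (\<lambda>j. if j \<in> R then b j else 0)"
        using finR pR by (simp add: a_def th_def dot_def)
      then show ?thesis using z k by (auto simp: halfspace_def)
    qed
    then show "\<exists>th. A = {k\<in>{..<N}. 0 \<le> (\<Sum>j\<in>?K. a k j * th j)}"
      unfolding A by (intro exI[of _ th]) auto
  qed
  also have "card ?K = card R + 2" using finR pR by simp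
  finally show ?thesis by simp
qed

section \<open>Deviations in one direction, uniformly over halfspaces\<close>

text \<open>The offset \<open>c\<close> is 0 in the application. It lets rational halfspaces
  approach from outside, and \<open>c\<close> tending to infinity recovers
  \<open>dev_mean\<close>.\<close>

definition dev :: "'a \<Rightarrow> (nat \<Rightarrow> real) \<Rightarrow> real \<Rightarrow> (nat \<Rightarrow> real) \<Rightarrow> real" where
  "dev \<omega> b c d =
     emp_mean n (\<lambda>i. dot p (covar D i \<omega>) d * of_bool (resp D i \<omega> \<le> dot p (covar D i \<omega>) b + c))
     - (\<integral>\<omega>'. dot p (covar D 0 \<omega>') d * of_bool (resp D 0 \<omega>' \<le> dot p (covar D 0 \<omega>') b + c) \<partial>P)"

definition dev_mean :: "'a \<Rightarrow> (nat \<Rightarrow> real) \<Rightarrow> real" where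
  "dev_mean \<omega> d = emp_mean n (\<lambda>i. dot p (covar D i \<omega>) d) - (\<integral>\<omega>'. dot p (covar D 0 \<omega>') d \<partial>P)"

definition dev_scale :: "'a \<Rightarrow> (nat \<Rightarrow> real) \<Rightarrow> real" where
  "dev_scale \<omega> d = max (emp_mean n (\<lambda>i. (dot p (covar D i \<omega>) d)\<^sup>2)) (moment2 d)"

text \<open>Sample points may lie on the limiting hyperplane, so the empirical part needs
  convergence from above; in the population part ties are null.\<close>

lemma dev_tendsto:
  assumes lim: "\<And>x. (\<lambda>k. dot p x (b' k) + c' k) \<longlonglongrightarrow> dot p x b + c"
    and above: "\<And>i k. i < n \<Longrightarrow> dot p (covar D i \<omega>) b + c \<le> dot p (covar D i \<omega>) (b' k) + c' k"
  shows "(\<lambda>k. dev \<omega> (b' k) (c' k) d) \<longlonglongrightarrow> dev \<omega> b c d"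
  unfolding dev_def
proof (rule tendsto_diff)
  show "(\<lambda>k. emp_mean n (\<lambda>i. dot p (covar D i \<omega>) d * of_bool (resp D i \<omega> \<le> dot p (covar D i \<omega>) (b' k) + c' k)))
     \<longlonglongrightarrow> emp_mean n (\<lambda>i. dot p (covar D i \<omega>) d * of_bool (resp D i \<omega> \<le> dot p (covar D i \<omega>) b + c))"
    unfolding emp_mean_def
    by (intro tendsto_mult tendsto_const tendsto_sum of_bool_le_tendsto lim above) auto
  show "(\<lambda>k. \<integral>\<omega>'. dot p (covar D 0 \<omega>') d * of_bool (resp D 0 \<omega>' \<le> dot p (covar D 0 \<omega>') (b' k) + c' k) \<partial>P)
    \<longlonglongrightarrow> (\<integral>\<omega>'. dot p (covar D 0 \<omega>') d * of_bool (resp D 0 \<omega>' \<le> dot p (covar D 0 \<omega>') b + c) \<partial>P)"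
  proof (rule integral_dominated_convergence[where w = "\<lambda>\<omega>. \<bar>dot p (covar D 0 \<omega>) d\<bar>"])
    show "integrable P (\<lambda>\<omega>. \<bar>dot p (covar D 0 \<omega>) d\<bar>)" using dot_integrable by (rule integrable_abs)
    show "AE \<omega> in P. (\<lambda>k. dot p (covar D 0 \<omega>) d * of_bool (resp D 0 \<omega> \<le> dot p (covar D 0 \<omega>) (b' k) + c' k))
        \<longlonglongrightarrow> dot p (covar D 0 \<omega>) d * of_bool (resp D 0 \<omega> \<le> dot p (covar D 0 \<omega>) b + c)"
      using resp_ne_AE[of b c]
      by eventually_elim (intro tendsto_mult tendsto_const of_bool_le_tendsto lim, simp)
  qed (auto intro!: AE_I2 simp: abs_mult)
qed

text \<open>Rational normals converging to \<open>b\<close> may cut off sample points, since the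
  covariates have arbitrary signs; a slightly too large offset compensates for this.\<close>

lemma dev_rational_approx:
  assumes R: "R \<subseteq> {..<p}"
    and B: "\<And>b c. (\<And>j. j \<in> R \<Longrightarrow> b j \<in> \<rat>) \<Longrightarrow> (\<And>j. j \<notin> R \<Longrightarrow> b j = 0) \<Longrightarrow> c \<in> \<rat> \<Longrightarrow> \<bar>dev \<omega> b c d\<bar> \<le> B"
    and b: "\<And>j. j < p \<Longrightarrow> j \<notin> R \<Longrightarrow> b j = 0"
  shows "\<bar>dev \<omega> b c d\<bar> \<le> B"
proof -
  have "\<forall>k j. \<exists>q. q \<in> \<rat> \<and> b j < q \<and> q < b j + 1 / (real k + 1)"
    using Rats_dense_in_real by (metis add.commute add_pos_nonneg less_add_same_cancel1 of_nat_0_le_iff zero_less_divide_1_iff zero_less_one)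
  then obtain q where q: "\<And>k j. q k j \<in> \<rat>" "\<And>k j. b j < q k j" "\<And>k j. q k j < b j + 1 / (real k + 1)"
    by metis
  define b' where "b' k j = (if j \<in> R then q k j else 0)" for k j
  \<comment> \<open>Bounds the l1-norm of every sampled covariate. An error of
    \<open>1 / (k + 1)\<close> per coordinate moves the hyperplane at the sample points by at most
    \<open>B0 / (k + 1)\<close>, which the offset \<open>c'\<close> adds.\<close>
  define B0 where "B0 = (\<Sum>i<n. \<Sum>j<p. \<bar>covar D i \<omega> j\<bar>)"
  have "\<forall>k. \<exists>r. r \<in> \<rat> \<and> c + B0 / (real k + 1) < r \<and> r < c + B0 / (real k + 1) + 1 / (real k + 1)"
    using Rats_dense_in_real by (metis add.commute add_pos_nonneg less_add_same_cancel1 of_nat_0_le_iff zero_less_divide_1_iff zero_less_one)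
  then obtain c' where c': "\<And>k. c' k \<in> \<rat>" "\<And>k. c + B0 / (real k + 1) < c' k"
      "\<And>k. c' k < c + B0 / (real k + 1) + 1 / (real k + 1)"
    by metis
  have inv: "(\<lambda>k. 1 / (real k + 1)) \<longlonglongrightarrow> 0"
    using LIMSEQ_inverse_real_of_nat by (simp add: inverse_eq_divide add.commute)
  then have invB: "(\<lambda>k. B0 / (real k + 1)) \<longlonglongrightarrow> 0"
    using tendsto_mult_right[of "\<lambda>k. 1 / (real k + 1)" 0 sequentially B0] by simp
  have ql: "(\<lambda>k. q k j) \<longlonglongrightarrow> b j" for j
  proof (rule tendsto_sandwich[where f = "\<lambda>_. b j" and h = "\<lambda>k. b j + 1 / (real k + 1)"])
    show "(\<lambda>k. b j + 1 / (real k + 1)) \<longlonglongrightarrow> b j"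
      using tendsto_add[OF tendsto_const[of "b j"] inv] by simp
  qed (use q in \<open>auto intro!: always_eventually less_imp_le\<close>)
  have bl: "(\<lambda>k. b' k j) \<longlonglongrightarrow> b j" if "j < p" for j
    using ql[of j] b[OF that] by (cases "j \<in> R") (auto simp: b'_def)
  have cl: "c' \<longlonglongrightarrow> c"
  proof (rule tendsto_sandwich[where f = "\<lambda>k. c + B0 / (real k + 1)" and h = "\<lambda>k. c + B0 / (real k + 1) + 1 / (real k + 1)"])
    show "(\<lambda>k. c + B0 / (real k + 1)) \<longlonglongrightarrow> c"
      using tendsto_add[OF tendsto_const[of c] invB] by simp
    show "(\<lambda>k. c + B0 / (real k + 1) + 1 / (real k + 1)) \<longlonglongrightarrow> c"
      using tendsto_add[OF tendsto_add[OF tendsto_const[of c] invB] inv] by simp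
  qed (use c' in \<open>auto intro!: always_eventually less_imp_le\<close>)
  have lim: "(\<lambda>k. dot p x (b' k) + c' k) \<longlonglongrightarrow> dot p x b + c" for x
    unfolding dot_def by (intro tendsto_add cl tendsto_sum tendsto_mult tendsto_const bl) auto
  have above: "dot p (covar D i \<omega>) b + c \<le> dot p (covar D i \<omega>) (b' k) + c' k" if i: "i < n" for i k
  proof -
    have "dot p (covar D i \<omega>) b - dot p (covar D i \<omega>) (b' k) = (\<Sum>j<p. covar D i \<omega> j * (b j - b' k j))"
      by (simp add: dot_def sum_subtractf[symmetric] right_diff_distrib)
    also have "\<dots> \<le> (\<Sum>j<p. \<bar>covar D i \<omega> j\<bar> * (1 / (real k + 1)))"
    proof (rule sum_mono)
      fix j assume "j \<in> {..<p}"
      then have "\<bar>b j - b' k j\<bar> \<le> 1 / (real k + 1)"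
        using b[of j] q(2)[of j k] q(3)[of k j] by (cases "j \<in> R") (auto simp: b'_def)
      then have "\<bar>covar D i \<omega> j * (b j - b' k j)\<bar> \<le> \<bar>covar D i \<omega> j\<bar> * (1 / (real k + 1))"
        unfolding abs_mult by (intro mult_left_mono) auto
      then show "covar D i \<omega> j * (b j - b' k j) \<le> \<bar>covar D i \<omega> j\<bar> * (1 / (real k + 1))" by linarith
    qed
    also have "\<dots> = (\<Sum>j<p. \<bar>covar D i \<omega> j\<bar>) * (1 / (real k + 1))" by (rule sum_distrib_right[symmetric])
    also have "\<dots> \<le> B0 * (1 / (real k + 1))"
      unfolding B0_def using i by (intro mult_right_mono member_le_sum) (auto intro: sum_nonneg)
    finally show ?thesis using c'(2)[of k] by simp
  qed
  have "\<bar>dev \<omega> (b' k) (c' k) d\<bar> \<le> B" for k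
    by (rule B) (auto simp: b'_def q c')
  moreover have "(\<lambda>k. \<bar>dev \<omega> (b' k) (c' k) d\<bar>) \<longlonglongrightarrow> \<bar>dev \<omega> b c d\<bar>"
    by (intro tendsto_rabs dev_tendsto lim above)
  ultimately show ?thesis by (intro LIMSEQ_le_const2) auto
qed

text \<open>The halfspaces with normal 0 and growing offset exhaust the space.\<close>

lemma dev_mean_le:
  assumes B: "\<And>k::nat. \<bar>dev \<omega> (\<lambda>_. 0) (real k) d\<bar> \<le> B"
  shows "\<bar>dev_mean \<omega> d\<bar> \<le> B"
proof -
  have ev: "(\<lambda>k. of_bool (y \<le> dot p x (\<lambda>_. 0) + real k) :: real) \<longlonglongrightarrow> 1" for x y
  proof (rule tendsto_eventually)
    show "\<forall>\<^sub>F k in sequentially. (of_bool (y \<le> dot p x (\<lambda>_. 0) + real k) :: real) = 1"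
      using eventually_ge_at_top[of "nat \<lceil>y\<rceil>"]
      by eventually_elim (simp add: dot_def nat_le_iff ceiling_le_iff)
  qed
  have "(\<lambda>k. dev \<omega> (\<lambda>_. 0) (real k) d) \<longlonglongrightarrow> dev_mean \<omega> d"
    unfolding dev_def dev_mean_def
  proof (rule tendsto_diff)
    show "(\<lambda>k. emp_mean n (\<lambda>i. dot p (covar D i \<omega>) d * of_bool (resp D i \<omega> \<le> dot p (covar D i \<omega>) (\<lambda>_. 0) + real k)))
       \<longlonglongrightarrow> emp_mean n (\<lambda>i. dot p (covar D i \<omega>) d)"
      unfolding emp_mean_def
      by (intro tendsto_mult tendsto_const tendsto_sum) (rule tendsto_eq_rhs[OF tendsto_mult[OF tendsto_const ev]], simp)
    show "(\<lambda>k. \<integral>\<omega>'. dot p (covar D 0 \<omega>') d * of_bool (resp D 0 \<omega>' \<le> dot p (covar D 0 \<omega>') (\<lambda>_. 0) + real k) \<partial>P)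
      \<longlonglongrightarrow> (\<integral>\<omega>'. dot p (covar D 0 \<omega>') d \<partial>P)"
    proof (rule integral_dominated_convergence[where w = "\<lambda>\<omega>. \<bar>dot p (covar D 0 \<omega>) d\<bar>"])
      show "integrable P (\<lambda>\<omega>. \<bar>dot p (covar D 0 \<omega>) d\<bar>)" using dot_integrable by (rule integrable_abs)
      show "AE \<omega> in P. (\<lambda>k. dot p (covar D 0 \<omega>) d * of_bool (resp D 0 \<omega> \<le> dot p (covar D 0 \<omega>) (\<lambda>_. 0) + real k))
          \<longlonglongrightarrow> dot p (covar D 0 \<omega>) d"
        by (rule AE_I2) (rule tendsto_eq_rhs[OF tendsto_mult[OF tendsto_const ev]], simp)
    qed (auto intro!: AE_I2 simp: abs_mult)
  qed
  then have "(\<lambda>k. \<bar>dev \<omega> (\<lambda>_. 0) (real k) d\<bar>) \<longlonglongrightarrow> \<bar>dev_mean \<omega> d\<bar>" by (rule tendsto_rabs)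
  then show ?thesis using B by (intro LIMSEQ_le_const2) auto
qed

text \<open>For one direction, a single event covers all halfspaces with normal supported in
  \<open>R\<close>: the rational ones by \<open>relative_deviation\<close>, the others by
  approximation.\<close>

lemma dev_event:
  assumes R: "R \<subseteq> {..<p}" and t: "0 < t" "16 \<le> real n * t\<^sup>2"
  obtains E where "E \<in> sets P"
    "measure P E \<le> 4 * real ((2 * n + 1) ^ (card R + 2)) * exp (- real n * t\<^sup>2 / 80)"
    "\<And>\<omega> (b :: nat \<Rightarrow> real) c. \<omega> \<in> space P - E \<Longrightarrow> (\<And>j. j < p \<Longrightarrow> j \<notin> R \<Longrightarrow> b j = 0) \<Longrightarrow>
       \<bar>dev \<omega> b c d\<bar> \<le> t * sqrt (dev_scale \<omega> d) \<and> \<bar>dev_mean \<omega> d\<bar> \<le> t * sqrt (dev_scale \<omega> d)"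
proof -
  have finR: "finite R" using R finite_subset by blast
  define w where "w z = dot p (snd z) d" for z :: "real \<times> (nat \<Rightarrow> real)"
  have wO[measurable]: "w \<in> borel_measurable Obs" unfolding w_def by measurable
  have w_obs: "w (obs i \<omega>) = dot p (covar D i \<omega>) d" for i \<omega> by (simp add: w_def obs_def)
  have sq: "integrable law (\<lambda>z. (w z)\<^sup>2)"
    unfolding law_def by (subst integrable_distr_eq) (auto simp: w_obs dot_sq_integrable)
  have V: "(\<integral>z. (w z)\<^sup>2 \<partial>law) = moment2 d"
    unfolding law_def by (subst integral_distr) (auto simp: w_obs moment2_def)
  have Cint: "(\<integral>z. w z * indicator (halfspace b c) z \<partial>law)
      = (\<integral>\<omega>'. dot p (covar D 0 \<omega>') d * of_bool (resp D 0 \<omega>' \<le> dot p (covar D 0 \<omega>') b + c) \<partial>P)" for b c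
  proof -
    have "(\<integral>z. w z * indicator (halfspace b c) z \<partial>law) = (\<integral>\<omega>. w (obs 0 \<omega>) * indicator (halfspace b c) (obs 0 \<omega>) \<partial>P)"
      unfolding law_def by (subst integral_distr) auto
    also have "\<dots> = (\<integral>\<omega>'. dot p (covar D 0 \<omega>') d * of_bool (resp D 0 \<omega>' \<le> dot p (covar D 0 \<omega>') b + c) \<partial>P)"
    proof (intro Bochner_Integration.integral_cong refl)
      fix \<omega> assume "\<omega> \<in> space P"
      then have "obs 0 \<omega> \<in> space Obs" using measurable_space[OF obs_measurable[of 0]] by simp
      then show "w (obs 0 \<omega>) * indicator (halfspace b c) (obs 0 \<omega>)
          = dot p (covar D 0 \<omega>) d * of_bool (resp D 0 \<omega> \<le> dot p (covar D 0 \<omega>) b + c)"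
        unfolding w_obs by (auto simp: halfspace_def indicator_def obs_def)
    qed
    finally show ?thesis .
  qed
  define E where "E = {z \<in> space (PiM {..<n} (\<lambda>_. law)). \<exists>C\<in>halfspaces R.
      t * sqrt (max (emp_mean n (\<lambda>i. (w (z i))\<^sup>2)) (\<integral>z. (w z)\<^sup>2 \<partial>law))
      < \<bar>emp_mean n (\<lambda>i. w (z i) * indicator C (z i)) - (\<integral>z. w z * indicator C z \<partial>law)\<bar>}"
  have hs: "halfspaces R \<subseteq> sets law"
    by (auto simp: halfspaces_def law_sets)
  have G: "card ((\<lambda>C. {k\<in>{..<2 * n}. z k \<in> C}) ` halfspaces R) \<le> (2 * n + 1) ^ (card R + 2)"
    if "z \<in> {..<2 * n} \<rightarrow> space law" for z
    using card_sparse_halfspace_traces[OF R] that by (simp add: law_space)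
  have wl: "w \<in> borel_measurable law" by measurable
  note rd = relative_deviation[OF law_prob n_pos wl sq halfspaces_countable[OF finR] hs G t, folded E_def]
  have setsN: "sets (PiM {..<n} (\<lambda>_. law)) = sets (PiM {..<n} (\<lambda>_. Obs))"
    by (intro sets_PiM_cong refl) (simp add: law_sets)
  have Em: "E \<in> sets (PiM {..<n} (\<lambda>_. Obs))" using rd(1) setsN by simp
  let ?E = "sample -` E \<inter> space P"
  show thesis
  proof (rule that[of ?E])
    show "?E \<in> sets P" using Em by measurable
    have "measure P ?E = measure (distr P (PiM {..<n} (\<lambda>_. Obs)) sample) E"
      using Em by (subst measure_distr) auto
    also have "\<dots> \<le> 4 * real ((2 * n + 1) ^ (card R + 2)) * exp (- real n * t\<^sup>2 / 80)"
      unfolding distr_sample by (rule rd(2))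
    finally show "measure P ?E \<le> 4 * real ((2 * n + 1) ^ (card R + 2)) * exp (- real n * t\<^sup>2 / 80)" .
    fix \<omega> c and b :: "nat \<Rightarrow> real" assume \<omega>: "\<omega> \<in> space P - ?E" and b: "\<And>j. j < p \<Longrightarrow> j \<notin> R \<Longrightarrow> b j = 0"
    have smp: "sample \<omega> \<in> space (PiM {..<n} (\<lambda>_. law))"
      using measurable_space[OF sample_measurable, of \<omega>] \<omega> sets_eq_imp_space_eq[OF setsN] by simp
    have rat: "\<bar>dev \<omega> b c d\<bar> \<le> t * sqrt (dev_scale \<omega> d)"
      if "\<And>j. j \<in> R \<Longrightarrow> b j \<in> \<rat>" "\<And>j. j \<notin> R \<Longrightarrow> b j = 0" "c \<in> \<rat>" for b c
    proof -
      have C: "halfspace b c \<in> halfspaces R" using that by (rule halfspacesI)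
      have e1: "emp_mean n (\<lambda>i. (w (sample \<omega> i))\<^sup>2) = emp_mean n (\<lambda>i. (dot p (covar D i \<omega>) d)\<^sup>2)"
        by (rule emp_mean_cong) (simp add: sample_def w_obs)
      have e2: "emp_mean n (\<lambda>i. w (sample \<omega> i) * indicator (halfspace b c) (sample \<omega> i))
          = emp_mean n (\<lambda>i. dot p (covar D i \<omega>) d * of_bool (resp D i \<omega> \<le> dot p (covar D i \<omega>) b + c))"
      proof (rule emp_mean_cong)
        fix i assume i: "i < n"
        then have "obs i \<omega> \<in> space Obs" using measurable_space[OF obs_measurable[of i]] \<omega> by simp
        then show "w (sample \<omega> i) * indicator (halfspace b c) (sample \<omega> i)
            = dot p (covar D i \<omega>) d * of_bool (resp D i \<omega> \<le> dot p (covar D i \<omega>) b + c)"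
          using i by (auto simp: sample_def w_obs halfspace_def indicator_def) (simp_all add: obs_def)
      qed
      have "sample \<omega> \<notin> E" using \<omega> by blast
      then have "\<not> t * sqrt (max (emp_mean n (\<lambda>i. (w (sample \<omega> i))\<^sup>2)) (\<integral>z. (w z)\<^sup>2 \<partial>law))
        < \<bar>emp_mean n (\<lambda>i. w (sample \<omega> i) * indicator (halfspace b c) (sample \<omega> i)) - (\<integral>z. w z * indicator (halfspace b c) z \<partial>law)\<bar>"
        using C smp unfolding E_def by blast
      then show ?thesis unfolding e1 e2 Cint V by (simp add: dev_def dev_scale_def)
    qed
    have "\<bar>dev \<omega> b c d\<bar> \<le> t * sqrt (dev_scale \<omega> d)"
      by (rule dev_rational_approx[OF R rat b])
    moreover have "\<bar>dev_mean \<omega> d\<bar> \<le> t * sqrt (dev_scale \<omega> d)"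
      by (rule dev_mean_le, rule rat) auto
    ultimately show "\<bar>dev \<omega> b c d\<bar> \<le> t * sqrt (dev_scale \<omega> d) \<and> \<bar>dev_mean \<omega> d\<bar> \<le> t * sqrt (dev_scale \<omega> d)" ..
  qed
qed

end

subsection \<open>Uniform deviation over sparse directions\<close>

lemma (in finite_measure) measure_UN_le_card:
  assumes "finite I" "\<And>i. i \<in> I \<Longrightarrow> A i \<in> sets M" "\<And>i. i \<in> I \<Longrightarrow> measure M (A i) \<le> c"
  shows "measure M (\<Union>i\<in>I. A i) \<le> real (card I) * c"
proof -
  have "measure M (\<Union>i\<in>I. A i) \<le> (\<Sum>i\<in>I. measure M (A i))"
    using assms by (intro finite_measure_subadditive_finite) auto
  also have "\<dots> \<le> (\<Sum>i\<in>I. c)" by (intro sum_mono assms)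
  finally show ?thesis by simp
qed

lemma dot_self_eq: "dot p d d = (\<Sum>j<p. (d j)\<^sup>2)"
  by (simp add: dot_def power2_eq_square)

lemma l2norm_eq: "l2norm p d = sqrt (dot p d d)"
  by (simp add: l2norm_def L2_set_def dot_self_eq)

lemma dot_cauchy_schwarz: "(dot p v w)\<^sup>2 \<le> dot p v v * dot p w w"
proof -
  have "\<bar>dot p v w\<bar> \<le> sqrt (dot p v v) * sqrt (dot p w w)"
    unfolding dot_self_eq unfolding dot_def by (rule sum_mult_le_sqrt)
  then have "\<bar>dot p v w\<bar> \<le> sqrt (dot p v v * dot p w w)" by (simp add: real_sqrt_mult)
  then have "(\<bar>dot p v w\<bar>)\<^sup>2 \<le> (sqrt (dot p v v * dot p w w))\<^sup>2" by (rule power_mono) simp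
  then show ?thesis by (simp add: dot_self_nonneg)
qed

lemma dot_self_pos: "nonzero p d \<Longrightarrow> 0 < dot p d d"
  unfolding nonzero_def dot_self_eq by (auto intro!: sum_pos2)

lemma dot_not_nonzero: "\<not> nonzero p d \<Longrightarrow> dot p x d = 0"
  by (simp add: nonzero_def dot_def)

lemma emp_mean_mono: "(\<And>i. i < n \<Longrightarrow> f i \<le> g i) \<Longrightarrow> emp_mean n f \<le> emp_mean n g"
  unfolding emp_mean_def by (intro mult_left_mono sum_mono) auto

lemma emp_mean_nonneg: "(\<And>i. i < n \<Longrightarrow> 0 \<le> f i) \<Longrightarrow> 0 \<le> emp_mean n f"
  unfolding emp_mean_def by (intro mult_nonneg_nonneg sum_nonneg) auto

lemma emp_mean_sum: "emp_mean n (\<lambda>i. \<Sum>j\<in>R. d j * f j i) = (\<Sum>j\<in>R. d j * emp_mean n (f j))"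
proof -
  have "(\<Sum>i<n. \<Sum>j\<in>R. d j * f j i) = (\<Sum>j\<in>R. d j * (\<Sum>i<n. f j i))"
    by (subst sum.swap) (simp add: sum_distrib_left)
  then show ?thesis by (simp add: emp_mean_def sum_distrib_left mult_ac)
qed

lemma unit_interval_ident: "(\<lambda>\<tau>. \<tau>) \<in> borel_measurable unit_interval"
  by (rule measurable_restrict_space1) simp

context qr_sample
begin

text \<open>The supremum in \<open>phi\<close> is a real one and dominates its members only if it is
  bounded; by Cauchy-Schwarz both quotients are at most the corresponding mean of
  \<open>dot p x x\<close>.\<close>

lemma dev_scale_le:
  assumes "l0norm p d \<le> k"
  shows "dev_scale \<omega> d \<le> phi D \<omega> k * dot p d d"
proof (cases "nonzero p d")
  case False
  then show ?thesis by (simp add: dev_scale_def moment2_def dot_not_nonzero emp_mean_def)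
next
  case True
  let ?f = "\<lambda>\<delta>. max (emp_mean n (\<lambda>i. (dot p (covar D i \<omega>) \<delta>)\<^sup>2) / dot p \<delta> \<delta>)
            ((\<integral>\<omega>'. (dot p (covar D 0 \<omega>') \<delta>)\<^sup>2 \<partial>P) / dot p \<delta> \<delta>)"
  let ?A = "{\<delta>. nonzero p \<delta> \<and> l0norm p \<delta> \<le> k}"
  have int: "integrable P (\<lambda>\<omega>'. dot p (covar D 0 \<omega>') (covar D 0 \<omega>'))"
    unfolding dot_def by (intro Bochner_Integration.integrable_sum covar_prod_integrable) auto
  have "bdd_above (?f ` ?A)"
  proof (rule bdd_aboveI2)
    fix \<delta> assume "\<delta> \<in> ?A"
    then have pos: "0 < dot p \<delta> \<delta>" by (simp add: dot_self_pos)
    have "emp_mean n (\<lambda>i. (dot p (covar D i \<omega>) \<delta>)\<^sup>2)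
        \<le> emp_mean n (\<lambda>i. dot p (covar D i \<omega>) (covar D i \<omega>) * dot p \<delta> \<delta>)"
      by (intro emp_mean_mono dot_cauchy_schwarz)
    also have "\<dots> = emp_mean n (\<lambda>i. dot p (covar D i \<omega>) (covar D i \<omega>)) * dot p \<delta> \<delta>"
      by (simp add: emp_mean_def sum_distrib_right)
    finally have 1: "emp_mean n (\<lambda>i. (dot p (covar D i \<omega>) \<delta>)\<^sup>2) / dot p \<delta> \<delta>
        \<le> emp_mean n (\<lambda>i. dot p (covar D i \<omega>) (covar D i \<omega>))" using pos by (simp add: pos_divide_le_eq)
    have "(\<integral>\<omega>'. (dot p (covar D 0 \<omega>') \<delta>)\<^sup>2 \<partial>P) \<le> (\<integral>\<omega>'. dot p (covar D 0 \<omega>') (covar D 0 \<omega>') * dot p \<delta> \<delta> \<partial>P)"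
      by (rule integral_mono[OF dot_sq_integrable]) (rule integrable_mult_left[OF int], rule dot_cauchy_schwarz)
    also have "\<dots> = (\<integral>\<omega>'. dot p (covar D 0 \<omega>') (covar D 0 \<omega>') \<partial>P) * dot p \<delta> \<delta>" by simp
    finally have 2: "(\<integral>\<omega>'. (dot p (covar D 0 \<omega>') \<delta>)\<^sup>2 \<partial>P) / dot p \<delta> \<delta>
        \<le> (\<integral>\<omega>'. dot p (covar D 0 \<omega>') (covar D 0 \<omega>') \<partial>P)" using pos by (simp add: pos_divide_le_eq)
    show "?f \<delta> \<le> max (emp_mean n (\<lambda>i. dot p (covar D i \<omega>) (covar D i \<omega>)))
        (\<integral>\<omega>'. dot p (covar D 0 \<omega>') (covar D 0 \<omega>') \<partial>P)"
      using 1 2 by (intro max.mono)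
  qed
  then have "?f d \<le> phi D \<omega> k"
    unfolding phi_def using True assms by (intro cSUP_upper) auto
  then have "?f d * dot p d d \<le> phi D \<omega> k * dot p d d"
    by (intro mult_right_mono dot_self_nonneg)
  moreover have "?f d * dot p d d = dev_scale \<omega> d"
    using dot_self_pos[OF True] by (auto simp: dev_scale_def moment2_def max_def divide_right_mono field_simps)
  ultimately show ?thesis by simp
qed

lemma phi_nonneg: "1 \<le> k \<Longrightarrow> 0 \<le> phi D \<omega> k"
proof -
  assume k: "1 \<le> k"
  have "supp p (unit_vec 0) \<subseteq> {0}" by (auto simp: supp_def unit_vec_def)
  then have "card (supp p (unit_vec 0)) \<le> card {0::nat}" by (intro card_mono) auto
  then have "l0norm p (unit_vec 0) \<le> k" using k by (simp add: l0norm_def)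
  then have "dev_scale \<omega> (unit_vec 0) \<le> phi D \<omega> k * dot p (unit_vec 0) (unit_vec 0)" by (rule dev_scale_le)
  moreover have "dot p (unit_vec 0) (unit_vec 0) = 1" by (simp add: dot_unit) (simp add: unit_vec_def)
  moreover have "0 \<le> dev_scale \<omega> (unit_vec 0)" by (simp add: dev_scale_def moment2_nonneg le_max_iff_disj)
  ultimately show ?thesis by simp
qed

lemma dot_unit_sum: "dot p x d = (\<Sum>j<p. d j * dot p x (unit_vec j))"
  by (simp add: dot_unit dot_def[of p x d] mult.commute)

text \<open>With the halfspace fixed the deviation is linear in the direction. Hence only directions
  need a net, not the halfspaces.\<close>

lemma dev_linear: "dev \<omega> b c d = (\<Sum>j<p. d j * dev \<omega> b c (unit_vec j))"
proof -
  have e: "emp_mean n (\<lambda>i. dot p (covar D i \<omega>) d * of_bool (resp D i \<omega> \<le> dot p (covar D i \<omega>) b + c))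
      = (\<Sum>j<p. d j * emp_mean n (\<lambda>i. dot p (covar D i \<omega>) (unit_vec j) * of_bool (resp D i \<omega> \<le> dot p (covar D i \<omega>) b + c)))"
    unfolding emp_mean_sum[symmetric] dot_unit_sum[of _ d] sum_distrib_right by (simp add: mult.assoc)
  have int: "integrable P (\<lambda>\<omega>'. dot p (covar D 0 \<omega>') v * of_bool (resp D 0 \<omega>' \<le> dot p (covar D 0 \<omega>') b + c))" for v
    by (rule Bochner_Integration.integrable_bound[OF dot_integrable[of v]]) (auto intro!: AE_I2)
  have "(\<integral>\<omega>'. dot p (covar D 0 \<omega>') d * of_bool (resp D 0 \<omega>' \<le> dot p (covar D 0 \<omega>') b + c) \<partial>P)
      = (\<integral>\<omega>'. (\<Sum>j<p. d j * (dot p (covar D 0 \<omega>') (unit_vec j) * of_bool (resp D 0 \<omega>' \<le> dot p (covar D 0 \<omega>') b + c))) \<partial>P)"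
    unfolding dot_unit_sum[of _ d] sum_distrib_right by (simp only: mult.assoc)
  also have "\<dots> = (\<Sum>j<p. d j * (\<integral>\<omega>'. dot p (covar D 0 \<omega>') (unit_vec j) * of_bool (resp D 0 \<omega>' \<le> dot p (covar D 0 \<omega>') b + c) \<partial>P))"
    using int by (subst Bochner_Integration.integral_sum) simp_all
  finally show ?thesis using e by (simp add: dev_def right_diff_distrib sum_subtractf)
qed

lemma dev_mean_linear: "dev_mean \<omega> d = (\<Sum>j<p. d j * dev_mean \<omega> (unit_vec j))"
proof -
  have e: "emp_mean n (\<lambda>i. dot p (covar D i \<omega>) d) = (\<Sum>j<p. d j * emp_mean n (\<lambda>i. dot p (covar D i \<omega>) (unit_vec j)))"
    unfolding emp_mean_sum[symmetric] dot_unit_sum[of _ d] ..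
  have "(\<integral>\<omega>'. dot p (covar D 0 \<omega>') d \<partial>P) = (\<integral>\<omega>'. (\<Sum>j<p. d j * dot p (covar D 0 \<omega>') (unit_vec j)) \<partial>P)"
    unfolding dot_unit_sum[of _ d] ..
  also have "\<dots> = (\<Sum>j<p. d j * (\<integral>\<omega>'. dot p (covar D 0 \<omega>') (unit_vec j) \<partial>P))"
    using dot_integrable by (subst Bochner_Integration.integral_sum) simp_all
  finally show ?thesis using e by (simp add: dev_mean_def right_diff_distrib sum_subtractf)
qed

text \<open>The 4 is a factor 2 from grid vectors of norm up to 2 and another 2 from
  \<open>grid_norming\<close>.\<close>

lemma grid_bound_extends:
  assumes R: "R \<subseteq> {..<p}" "card R \<le> k" "2 * k \<le> g" "1 \<le> k" and t: "0 \<le> t"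
    and B: "\<And>d. d \<in> grid g R \<Longrightarrow> \<bar>\<Sum>j<p. d j * l j\<bar> \<le> t * sqrt (dev_scale \<omega> d)"
    and d: "\<And>j. j < p \<Longrightarrow> j \<notin> R \<Longrightarrow> d j = 0"
  shows "\<bar>\<Sum>j<p. d j * l j\<bar> \<le> 4 * t * sqrt (phi D \<omega> k) * l2norm p d"
proof -
  have finR: "finite R" using R finite_subset by blast
  have restrict: "(\<Sum>j<p. v j * h j) = (\<Sum>j\<in>R. v j * h j)" if "\<And>j. j < p \<Longrightarrow> j \<notin> R \<Longrightarrow> v j = 0" for v h :: "nat \<Rightarrow> real"
    using R that by (intro sum.mono_neutral_right) auto
  have dotR: "dot p v v = (\<Sum>j\<in>R. (v j)\<^sup>2)" if "\<And>j. j < p \<Longrightarrow> j \<notin> R \<Longrightarrow> v j = 0" for v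
    using restrict[of v v] that by (simp add: dot_def power2_eq_square)
  have "\<bar>\<Sum>j\<in>R. d j * l j\<bar> \<le> 2 * (2 * t * sqrt (phi D \<omega> k)) * sqrt (\<Sum>j\<in>R. (d j)\<^sup>2)"
  proof (rule grid_norming[OF finR, of g])
    show "2 * card R \<le> g" "0 < g" using R by auto
    fix e assume e: "e \<in> grid g R" and e4: "(\<Sum>j\<in>R. (e j)\<^sup>2) \<le> 4"
    have e0: "e j = 0" if "j \<notin> R" for j using grid_support[OF e that] .
    have "supp p e \<subseteq> R" using e0 by (auto simp: supp_def)
    from card_mono[OF finR this] R(2) have "l0norm p e \<le> k" by (simp add: l0norm_def)
    then have "dev_scale \<omega> e \<le> phi D \<omega> k * dot p e e" by (rule dev_scale_le)
    also have "\<dots> \<le> phi D \<omega> k * 4" using e4 dotR[of e] e0 R phi_nonneg by (intro mult_left_mono) auto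
    finally have "sqrt (dev_scale \<omega> e) \<le> sqrt (phi D \<omega> k * 4)" by simp
    also have "\<dots> = 2 * sqrt (phi D \<omega> k)" by (simp add: real_sqrt_mult)
    finally have "t * sqrt (dev_scale \<omega> e) \<le> t * (2 * sqrt (phi D \<omega> k))" using t by (rule mult_left_mono)
    then show "\<bar>\<Sum>j\<in>R. e j * l j\<bar> \<le> 2 * t * sqrt (phi D \<omega> k)"
      using B[OF e] restrict[of e l] e0 by simp
  qed
  then show ?thesis using restrict[of d l] d dotR[of d] by (simp add: l2norm_eq)
qed

lemma spars_pos: "1 \<le> spars D"
  using D2 by (simp add: cond_D2_def)

lemma ln_n_ge_1: "1 \<le> ln (real n)"
proof -
  have "exp 1 \<le> real n" using exp_le np3 by simp
  then show ?thesis by (subst ln_ge_iff) auto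
qed

lemma ln_n_le_log_np: "ln (real n) \<le> log_np D"
  unfolding log_np_def using n_pos by (intro ln_mono) auto

lemma spars_le_n: "spars D \<le> n"
proof -
  have L: "1 \<le> log_np D" using ln_n_ge_1 ln_n_le_log_np by simp
  have "real (spars D) * log_np D \<le> real n"
    using setting L by (simp add: qr_setting_def pos_le_divide_eq)
  moreover have "real (spars D) * 1 \<le> real (spars D) * log_np D" using L by (intro mult_left_mono) auto
  ultimately show ?thesis by linarith
qed

text \<open>The numerator of the squared rate in the theorem, and at the same time the exponent that
  pays for the union bound at size \<open>k\<close>.\<close>

definition rate :: "nat \<Rightarrow> real" where
  "rate k = real k * log_np D + real (spars D) * ln (real n)"

lemma rate_ge_1: "1 \<le> rate k"
proof -
  have "1 * 1 \<le> real (spars D) * ln (real n)"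
    using spars_pos ln_n_ge_1 by (intro mult_mono) auto
  moreover have "0 \<le> real k * log_np D" using ln_n_ge_1 ln_n_le_log_np by simp
  ultimately show ?thesis by (simp add: rate_def)
qed

text \<open>Union bound over the size \<open>k\<close>, the part \<open>T\<close> of the support
  inside \<open>V\<close>, the remaining part \<open>S\<close>, and the grid directions on
  \<open>T \<union> S\<close>. As \<open>card V \<le> n\<close>, the sets \<open>T\<close> number at
  most \<open>(n + 1) ^ s\<close>, without reference to \<open>p\<close>.\<close>

lemma sparse_dev_event:
  fixes \<epsilon> :: real
  assumes eps: "0 < \<epsilon>" and V: "V \<subseteq> {..<p}" "card V \<le> n"
  defines "K \<equiv> 80 * (16 + max 0 (ln (1 / \<epsilon>)))"
  obtains E where "E \<in> sets P" "measure P E \<le> \<epsilon>"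
    "\<And>\<omega> k T S (b :: nat \<Rightarrow> real) c (d :: nat \<Rightarrow> real). \<lbrakk>\<omega> \<in> space P - E; k \<le> n; T \<subseteq> V; card T \<le> spars D; S \<subseteq> {..<p}; card S \<le> k;
       \<And>j. j < p \<Longrightarrow> j \<notin> T \<union> S \<Longrightarrow> b j = 0; \<And>j. j < p \<Longrightarrow> j \<notin> T \<union> S \<Longrightarrow> d j = 0\<rbrakk> \<Longrightarrow>
       \<bar>dev \<omega> b c d\<bar> \<le> 4 * sqrt (K * rate k / real n) * sqrt (phi D \<omega> (k + spars D)) * l2norm p d \<and>
       \<bar>dev_mean \<omega> d\<bar> \<le> 4 * sqrt (K * rate k / real n) * sqrt (phi D \<omega> (k + spars D)) * l2norm p d"
proof -
  define \<kappa> where "\<kappa> = 2 + max 0 (ln (1 / \<epsilon>))"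
  have K: "K = 80 * (14 + \<kappa>)" by (simp add: K_def \<kappa>_def)
  have \<kappa>2: "2 \<le> \<kappa>" by (simp add: \<kappa>_def)
  define t where "t k = sqrt (K * rate k / real n)" for k
  \<comment> \<open>This is the condition \<open>16 \<le> n * t\<^sup>2\<close> of the ghost sample
    argument.\<close>
  have Kr: "16 \<le> K * rate k" for k
  proof -
    have "16 * 1 \<le> K * rate k" using rate_ge_1[of k] \<kappa>2 K by (intro mult_mono) auto
    then show ?thesis by simp
  qed
  have t0: "0 < t k" for k using Kr[of k] n_pos by (simp add: t_def)
  have nt: "real n * (t k)\<^sup>2 = K * rate k" for k using Kr[of k] n_pos by (simp add: t_def)
  let ?TT = "{T. T \<subseteq> V \<and> card T \<le> spars D}"
  let ?SS = "\<lambda>k. {S. S \<subseteq> {..<p} \<and> card S \<le> k}"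
  let ?Q = "\<lambda>k T S d E. E \<in> sets P \<and>
    measure P E \<le> 4 * real ((2 * n + 1) ^ (card (T \<union> S) + 2)) * exp (- real n * (t k)\<^sup>2 / 80) \<and>
    (\<forall>\<omega>\<in>space P - E. \<forall>(b :: nat \<Rightarrow> real) c. (\<forall>j. j < p \<longrightarrow> j \<notin> T \<union> S \<longrightarrow> b j = 0) \<longrightarrow>
       \<bar>dev \<omega> b c d\<bar> \<le> t k * sqrt (dev_scale \<omega> d) \<and> \<bar>dev_mean \<omega> d\<bar> \<le> t k * sqrt (dev_scale \<omega> d))"
  define bad where "bad k T S d = (SOME E. ?Q k T S d E)" for k T S d
  have finV: "finite V" using V finite_subset by blast
  have finT: "finite ?TT" using finV by simp
  have finS: "finite (?SS k)" for k by simp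
  have bad: "?Q k T S d (bad k T S d)" if "T \<in> ?TT" "S \<in> ?SS k" for k T S d
    unfolding bad_def
  proof (rule someI_ex)
    have "T \<union> S \<subseteq> {..<p}" using that V by auto
    then show "\<exists>E. ?Q k T S d E"
      using t0[of k] Kr[of k] nt[of k] by (rule_tac dev_event[of "T \<union> S" "t k" d]) (auto 0 4)
  qed
  have finR: "finite (T \<union> S)" if "T \<in> ?TT" "S \<in> ?SS k" for T S k
    using that finV by (auto intro: finite_subset)
  have cardR: "card (T \<union> S) \<le> spars D + k" if "T \<in> ?TT" "S \<in> ?SS k" for T S k
    using that card_Un_le[of T S] by auto
  define E3 where "E3 k T S = (\<Union>d\<in>grid (4 * n) (T \<union> S). bad k T S d)" for k T S
  define E2 where "E2 k T = (\<Union>S\<in>?SS k. E3 k T S)" for k T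
  define E1 where "E1 k = (\<Union>T\<in>?TT. E2 k T)" for k
  define E0 where "E0 = (\<Union>k\<in>{..n}. E1 k)"
  \<comment> \<open>\<alpha> and \<beta> bound the numbers of sets \<open>T\<close> and
    \<open>S\<close>. The bound for \<open>E3\<close> has both divided out, and each of the next two
    unions multiplies one of them back.\<close>
  define \<alpha> where "\<alpha> = real ((n + 1) ^ spars D)"
  define \<beta> where "\<beta> k = real ((p + 1) ^ k)" for k
  define \<gamma> where "\<gamma> k = exp (- \<kappa> * rate k)" for k
  have pos: "0 < \<alpha>" "0 < \<beta> k" for k by (simp_all add: \<alpha>_def \<beta>_def)
  have s3: "E3 k T S \<in> sets P" if "T \<in> ?TT" "S \<in> ?SS k" for k T S
    unfolding E3_def using bad[OF that] finR[OF that] finite_grid by (intro sets.finite_UN) auto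
  have m3: "measure P (E3 k T S) \<le> \<gamma> k / (\<alpha> * \<beta> k)" if TS: "T \<in> ?TT" "S \<in> ?SS k" for k T S
  proof -
    let ?r = "card (T \<union> S)"
    let ?b = "4 * real ((2 * n + 1) ^ (?r + 2)) * exp (- real n * (t k)\<^sup>2 / 80)"
    have "measure P (E3 k T S) \<le> real (card (grid (4 * n) (T \<union> S))) * ?b"
      unfolding E3_def using bad[OF TS] finR[OF TS] finite_grid by (intro measure_UN_le_card) auto
    also have "\<dots> \<le> real ((2 * (4 * n) + 1) ^ ?r) * ?b"
      using card_grid_le[OF finR[OF TS], of "4 * n"] by (intro mult_right_mono of_nat_mono) auto
    finally have m: "measure P (E3 k T S) \<le> real ((2 * (4 * n) + 1) ^ ?r) * ?b" .
    have e: "- real n * (t k)\<^sup>2 / 80 = - ((14 + \<kappa>) * (real k * log_np D + real (spars D) * ln (real n)))"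
      using nt[of k] by (simp add: K rate_def)
    have "\<alpha> * (\<beta> k * measure P (E3 k T S)) \<le> \<alpha> * (\<beta> k * (real ((2 * (4 * n) + 1) ^ ?r) * ?b))"
      using pos(1) pos(2)[of k] m by (intro mult_left_mono) auto
    also have "\<dots> \<le> \<gamma> k"
      unfolding e \<alpha>_def \<beta>_def \<gamma>_def rate_def
      using np3 spars_pos cardR[OF TS]
      by (intro union_bound_exponent[where N = "max n p"]) (auto simp: log_np_def)
    finally show ?thesis using pos(1) pos(2)[of k] by (simp add: field_simps)
  qed
  have s2: "E2 k T \<in> sets P" if "T \<in> ?TT" for k T
    unfolding E2_def by (rule sets.finite_UN[OF finS s3[OF that]])
  have m2: "measure P (E2 k T) \<le> \<gamma> k / \<alpha>" if T: "T \<in> ?TT" for k T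
  proof -
    have "measure P (E2 k T) \<le> real (card (?SS k)) * (\<gamma> k / (\<alpha> * \<beta> k))"
      unfolding E2_def by (rule measure_UN_le_card[OF finS s3[OF T] m3[OF T]])
    also have "\<dots> \<le> \<beta> k * (\<gamma> k / (\<alpha> * \<beta> k))"
    proof (rule mult_right_mono)
      show "real (card (?SS k)) \<le> \<beta> k"
        unfolding \<beta>_def using card_subsets_bounded[of "{..<p}" k] by (intro of_nat_mono) simp
      show "0 \<le> \<gamma> k / (\<alpha> * \<beta> k)" using pos(1) pos(2)[of k] by (simp add: \<gamma>_def)
    qed
    finally show ?thesis using pos(1) pos(2)[of k] by simp
  qed
  have s1: "E1 k \<in> sets P" for k
    unfolding E1_def by (rule sets.finite_UN[OF finT s2])
  have m1: "measure P (E1 k) \<le> \<gamma> k" for k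
  proof -
    have "measure P (E1 k) \<le> real (card ?TT) * (\<gamma> k / \<alpha>)"
      unfolding E1_def by (rule measure_UN_le_card[OF finT s2 m2])
    also have "\<dots> \<le> \<alpha> * (\<gamma> k / \<alpha>)"
    proof (rule mult_right_mono)
      have "card ?TT \<le> (card V + 1) ^ spars D" by (rule card_subsets_bounded[OF finV])
      also have "\<dots> \<le> (n + 1) ^ spars D" using V by (intro power_mono) auto
      finally show "real (card ?TT) \<le> \<alpha>" unfolding \<alpha>_def by (rule of_nat_mono)
      show "0 \<le> \<gamma> k / \<alpha>" using pos(1) pos(2)[of k] by (simp add: \<gamma>_def)
    qed
    finally show ?thesis using pos(1) pos(2)[of k] by simp
  qed
  have s0: "E0 \<in> sets P" unfolding E0_def by (rule sets.finite_UN[OF finite_atMost s1])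
  show thesis
  proof (rule that[OF s0])
    have "measure P E0 \<le> (\<Sum>k\<le>n. measure P (E1 k))"
      unfolding E0_def using s1 by (intro finite_measure_subadditive_finite) auto
    also have "\<dots> \<le> (\<Sum>k\<le>n. \<gamma> k)" by (intro sum_mono m1)
    also have "\<dots> \<le> \<epsilon>"
      unfolding \<gamma>_def rate_def
      by (rule union_bound_total[OF np3(1) spars_pos refl ln_n_le_log_np eps \<kappa>_def])
    finally show "measure P E0 \<le> \<epsilon>" .
    fix \<omega> k T S c and b d :: "nat \<Rightarrow> real"
    assume \<omega>: "\<omega> \<in> space P - E0" and k: "k \<le> n" and TS: "T \<subseteq> V" "card T \<le> spars D" "S \<subseteq> {..<p}" "card S \<le> k"
      and b: "\<And>j. j < p \<Longrightarrow> j \<notin> T \<union> S \<Longrightarrow> b j = 0" and d: "\<And>j. j < p \<Longrightarrow> j \<notin> T \<union> S \<Longrightarrow> d j = 0"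
    have TS': "T \<in> ?TT" "S \<in> ?SS k" using TS by auto
    have bnd: "\<bar>dev \<omega> b c e\<bar> \<le> t k * sqrt (dev_scale \<omega> e)" "\<bar>dev_mean \<omega> e\<bar> \<le> t k * sqrt (dev_scale \<omega> e)"
      if e: "e \<in> grid (4 * n) (T \<union> S)" for e
    proof -
      have "\<omega> \<in> space P - bad k T S e"
        using \<omega> k TS' e unfolding E0_def E1_def E2_def E3_def by blast
      then show "\<bar>dev \<omega> b c e\<bar> \<le> t k * sqrt (dev_scale \<omega> e)" "\<bar>dev_mean \<omega> e\<bar> \<le> t k * sqrt (dev_scale \<omega> e)"
        using bad[OF TS', of e] b by blast+
    qed
    have g: "\<bar>\<Sum>j<p. e j * dev \<omega> b c (unit_vec j)\<bar> \<le> t k * sqrt (dev_scale \<omega> e)"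
      "\<bar>\<Sum>j<p. e j * dev_mean \<omega> (unit_vec j)\<bar> \<le> t k * sqrt (dev_scale \<omega> e)"
      if "e \<in> grid (4 * n) (T \<union> S)" for e
      using bnd[OF that] unfolding dev_linear[of \<omega> b c e] dev_mean_linear[of \<omega> e] by simp_all
    \<comment> \<open>The mesh \<open>4 * n\<close> works for all sizes because \<open>k\<close> and
      \<open>s\<close> are both at most \<open>n\<close>.\<close>
    have R: "T \<union> S \<subseteq> {..<p}" "card (T \<union> S) \<le> k + spars D" "2 * (k + spars D) \<le> 4 * n" "1 \<le> k + spars D"
      using TS V cardR[OF TS'] k spars_le_n spars_pos by auto
    show "\<bar>dev \<omega> b c d\<bar> \<le> 4 * sqrt (K * rate k / real n) * sqrt (phi D \<omega> (k + spars D)) * l2norm p d \<and>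
       \<bar>dev_mean \<omega> d\<bar> \<le> 4 * sqrt (K * rate k / real n) * sqrt (phi D \<omega> (k + spars D)) * l2norm p d"
      unfolding dev_linear[of \<omega> b c d] dev_mean_linear[of \<omega> d] t_def[symmetric]
      by (intro conjI grid_bound_extends[OF R less_imp_le[OF t0]] g d)
  qed
qed

section \<open>From halfspaces to increments of the loss\<close>

text \<open>Knight's identity is applied under the empirical and the population mean and the
  integrals are exchanged. What remains is the average over \<tau> of \<open>dev\<close> along the
  segment minus \<open>u\<close> times \<open>dev_mean\<close>, each bounded by
  \<open>B\<close>.\<close>

lemma increment_deviation_le:
  assumes u: "0 < u" "u < 1"
    and B: "\<And>\<tau>. \<bar>dev \<omega> (\<lambda>j. coef D u j + \<tau> * \<delta> j) 0 \<delta>\<bar> \<le> B" "\<bar>dev_mean \<omega> \<delta>\<bar> \<le> B"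
  shows "\<bar>emp_loss_increment D \<omega> u \<delta> - loss_increment D u \<delta>\<bar> \<le> 2 * B"
proof -
  interpret I: prob_space unit_interval by (rule prob_space_unit_interval)
  interpret PI: pair_sigma_finite P unit_interval ..
  note [measurable] = unit_interval_ident
  have I1: "I.prob {0..1} = 1" using I.prob_space by (simp add: space_restrict_space)
  let ?b = "\<lambda>\<tau> j. coef D u j + \<tau> * \<delta> j"
  \<comment> \<open>The summand \<open>+ 0\<close> makes the indicator literally the one in
    \<open>dev\<close> with offset 0.\<close>
  define f where "f i \<omega> \<tau> = dot p (covar D i \<omega>) \<delta> * (of_bool (resp D i \<omega> \<le> dot p (covar D i \<omega>) (?b \<tau>) + 0) - u)" for i \<omega> \<tau>
  have dotb: "dot p x (?b \<tau>) = dot p x (coef D u) + \<tau> * dot p x \<delta>" for x \<tau>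
    by (simp add: dot_def algebra_simps sum.distrib sum_distrib_left)
  have fm: "(\<lambda>\<tau>. f i \<omega> \<tau>) \<in> borel_measurable unit_interval" for i \<omega>
    unfolding f_def dotb by measurable
  have fb: "\<bar>f i \<omega> \<tau>\<bar> \<le> \<bar>dot p (covar D i \<omega>) \<delta>\<bar>" for i \<omega> \<tau>
    unfolding f_def abs_mult using u by (intro mult_left_le) auto
  have fi: "integrable unit_interval (\<lambda>\<tau>. f i \<omega> \<tau>)" for i \<omega>
    by (rule I.integrable_const_bound[OF _ fm]) (use fb in auto)
  have incr: "check_loss u (resp D i \<omega> - dot p (covar D i \<omega>) (\<lambda>j. coef D u j + \<delta> j))
      - check_loss u (resp D i \<omega> - dot p (covar D i \<omega>) (coef D u)) = (\<integral>\<tau>. f i \<omega> \<tau> \<partial>unit_interval)" for i \<omega>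
  proof -
    have "(\<integral>\<tau>. f i \<omega> \<tau> \<partial>unit_interval) = (\<integral>\<tau>. dot p (covar D i \<omega>) \<delta> * (of_bool (resp D i \<omega> - dot p (covar D i \<omega>) (coef D u) \<le> \<tau> * dot p (covar D i \<omega>) \<delta>) - u) \<partial>unit_interval)"
      unfolding f_def dotb by (simp add: algebra_simps)
    then show ?thesis
      unfolding check_loss_integral[OF u] by (simp add: dot_add_right algebra_simps)
  qed
  have emp: "emp_loss_increment D \<omega> u \<delta> = (\<integral>\<tau>. emp_mean n (\<lambda>i. f i \<omega> \<tau>) \<partial>unit_interval)"
  proof -
    have "emp_loss_increment D \<omega> u \<delta> = emp_mean n (\<lambda>i. \<integral>\<tau>. f i \<omega> \<tau> \<partial>unit_interval)"
      unfolding incr[symmetric]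
      by (simp add: emp_loss_increment_def emp_loss_def emp_mean_def responses_def design_def sum_subtractf right_diff_distrib)
    also have "\<dots> = (\<integral>\<tau>. emp_mean n (\<lambda>i. f i \<omega> \<tau>) \<partial>unit_interval)"
      unfolding emp_mean_def using fi
      by (subst integral_mult_right_zero) (subst Bochner_Integration.integral_sum, simp_all)
    finally show ?thesis .
  qed
  have ei: "integrable unit_interval (\<lambda>\<tau>. emp_mean n (\<lambda>i. f i \<omega> \<tau>))"
    unfolding emp_mean_def using fi by (intro integrable_mult_right Bochner_Integration.integrable_sum)
  have jm: "(\<lambda>(\<omega>, \<tau>). f 0 \<omega> \<tau>) \<in> borel_measurable (P \<Otimes>\<^sub>M unit_interval)"
  proof -
    have [measurable]: "(\<lambda>\<omega>. dot p (covar D 0 \<omega>) v) \<in> borel_measurable P" for v by simp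
    have [measurable]: "resp D 0 \<in> borel_measurable P" by simp
    show ?thesis unfolding f_def dotb by measurable
  qed
  \<comment> \<open>The integrand is dominated by the absolute value of \<open>x'\<delta>\<close>,
    which does not depend on \<tau> and is integrable.\<close>
  have joint: "integrable (P \<Otimes>\<^sub>M unit_interval) (\<lambda>(\<omega>, \<tau>). f 0 \<omega> \<tau>)"
  proof (rule PI.Fubini_integrable[OF jm])
    show "integrable P (\<lambda>x. \<integral>y. norm (case (x, y) of (\<omega>, \<tau>) \<Rightarrow> f 0 \<omega> \<tau>) \<partial>unit_interval)"
    proof (rule Bochner_Integration.integrable_bound[OF integrable_abs[OF dot_integrable[of \<delta>]]])
      have "(\<lambda>(\<omega>, \<tau>). norm (f 0 \<omega> \<tau>)) \<in> borel_measurable (P \<Otimes>\<^sub>M unit_interval)"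
        using measurable_compose[OF jm borel_measurable_norm] by (simp add: case_prod_beta)
      then show "(\<lambda>x. \<integral>y. norm (case (x, y) of (\<omega>, \<tau>) \<Rightarrow> f 0 \<omega> \<tau>) \<partial>unit_interval) \<in> borel_measurable P"
        by (simp add: I.borel_measurable_lebesgue_integral)
      show "AE x in P. norm (\<integral>y. norm (case (x, y) of (\<omega>, \<tau>) \<Rightarrow> f 0 \<omega> \<tau>) \<partial>unit_interval) \<le> norm \<bar>dot p (covar D 0 x) \<delta>\<bar>"
      proof (rule AE_I2)
        fix x
        have "(\<integral>y. norm (f 0 x y) \<partial>unit_interval) \<le> (\<integral>y. \<bar>dot p (covar D 0 x) \<delta>\<bar> \<partial>unit_interval)"
          using fi fb by (intro integral_mono integrable_norm) auto
        then show "norm (\<integral>y. norm (case (x, y) of (\<omega>, \<tau>) \<Rightarrow> f 0 \<omega> \<tau>) \<partial>unit_interval) \<le> norm \<bar>dot p (covar D 0 x) \<delta>\<bar>"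
          by (simp add: I1)
      qed
    qed
    show "AE x in P. integrable unit_interval (\<lambda>y. case (x, y) of (\<omega>, \<tau>) \<Rightarrow> f 0 \<omega> \<tau>)"
      using fi by simp
  qed
  have pop: "loss_increment D u \<delta> = (\<integral>\<tau>. (\<integral>\<omega>. f 0 \<omega> \<tau> \<partial>P) \<partial>unit_interval)"
    unfolding loss_increment_def incr using PI.Fubini_integral[OF joint] by simp
  have pi: "integrable unit_interval (\<lambda>\<tau>. \<integral>\<omega>. f 0 \<omega> \<tau> \<partial>P)"
    using PI.integrable_snd[OF joint] by simp
  have h: "emp_mean n (\<lambda>i. f i \<omega> \<tau>) - (\<integral>\<omega>. f 0 \<omega> \<tau> \<partial>P) = dev \<omega> (?b \<tau>) 0 \<delta> - u * dev_mean \<omega> \<delta>" for \<tau>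
  proof -
    have int: "integrable P (\<lambda>\<omega>'. dot p (covar D 0 \<omega>') \<delta> * of_bool (resp D 0 \<omega>' \<le> dot p (covar D 0 \<omega>') (?b \<tau>) + 0))"
      by (rule Bochner_Integration.integrable_bound[OF dot_integrable[of \<delta>]]) (auto intro!: AE_I2)
    have "(\<integral>\<omega>. f 0 \<omega> \<tau> \<partial>P) = (\<integral>\<omega>'. dot p (covar D 0 \<omega>') \<delta> * of_bool (resp D 0 \<omega>' \<le> dot p (covar D 0 \<omega>') (?b \<tau>) + 0)
        - dot p (covar D 0 \<omega>') \<delta> * u \<partial>P)"
      unfolding f_def by (simp only: right_diff_distrib)
    also have "\<dots> = (\<integral>\<omega>'. dot p (covar D 0 \<omega>') \<delta> * of_bool (resp D 0 \<omega>' \<le> dot p (covar D 0 \<omega>') (?b \<tau>) + 0) \<partial>P)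
        - (\<integral>\<omega>'. dot p (covar D 0 \<omega>') \<delta> \<partial>P) * u"
      using int dot_integrable by (subst Bochner_Integration.integral_diff) auto
    finally show ?thesis
      unfolding dev_def dev_mean_def f_def emp_mean_def
      by (simp add: right_diff_distrib sum_subtractf sum_distrib_left mult_ac)
  qed
  have hb: "\<bar>dev \<omega> (?b \<tau>) 0 \<delta> - u * dev_mean \<omega> \<delta>\<bar> \<le> 2 * B" for \<tau>
  proof -
    have "\<bar>u * dev_mean \<omega> \<delta>\<bar> \<le> 1 * B" unfolding abs_mult using u B by (intro mult_mono) auto
    then show ?thesis using B(1)[of \<tau>] by linarith
  qed
  have "emp_loss_increment D \<omega> u \<delta> - loss_increment D u \<delta>
      = (\<integral>\<tau>. dev \<omega> (?b \<tau>) 0 \<delta> - u * dev_mean \<omega> \<delta> \<partial>unit_interval)"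
    unfolding emp pop h[symmetric] by (rule Bochner_Integration.integral_diff[OF ei pi, symmetric])
  also have "\<bar>\<dots>\<bar> \<le> (\<integral>\<tau>. \<bar>dev \<omega> (?b \<tau>) 0 \<delta> - u * dev_mean \<omega> \<delta>\<bar> \<partial>unit_interval)"
    by (rule integral_abs_bound)
  also have "\<dots> \<le> (\<integral>\<tau>. 2 * B \<partial>unit_interval)"
  proof (rule integral_mono)
    show "integrable unit_interval (\<lambda>\<tau>. \<bar>dev \<omega> (?b \<tau>) 0 \<delta> - u * dev_mean \<omega> \<delta>\<bar>)"
      unfolding h[symmetric] by (intro integrable_abs Bochner_Integration.integrable_diff ei pi)
  qed (use hb in auto)
  also have "\<dots> = 2 * B" by (simp add: I1)
  finally show ?thesis .
qed

lemma sparse_increment_event: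
  fixes \<epsilon> :: real
  assumes eps: "0 < \<epsilon>" and V: "card (\<Union>u\<in>U. Tset D u) \<le> n"
  defines "K \<equiv> 80 * (16 + max 0 (ln (1 / \<epsilon>)))"
  obtains E where "E \<in> sets P" "measure P E \<le> \<epsilon>"
    "\<And>\<omega> u k \<delta>. \<lbrakk>\<omega> \<in> space P - E; u \<in> U; k \<le> n; card (supp p \<delta> - Tset D u) \<le> k\<rbrakk> \<Longrightarrow>
       \<bar>emp_loss_increment D \<omega> u \<delta> - loss_increment D u \<delta>\<bar>
       \<le> 8 * sqrt (K * rate k / real n) * sqrt (phi D \<omega> (k + spars D)) * l2norm p \<delta>"
proof -
  let ?V = "\<Union>u\<in>U. Tset D u"
  have Vp: "?V \<subseteq> {..<p}" by (auto simp: Tset_def supp_def)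
  obtain E where E: "E \<in> sets P" "measure P E \<le> \<epsilon>" and dev: "\<And>\<omega> k T S (b :: nat \<Rightarrow> real) c (d :: nat \<Rightarrow> real). \<lbrakk>\<omega> \<in> space P - E; k \<le> n; T \<subseteq> ?V; card T \<le> spars D; S \<subseteq> {..<p}; card S \<le> k;
       \<And>j. j < p \<Longrightarrow> j \<notin> T \<union> S \<Longrightarrow> b j = 0; \<And>j. j < p \<Longrightarrow> j \<notin> T \<union> S \<Longrightarrow> d j = 0\<rbrakk> \<Longrightarrow>
       \<bar>dev \<omega> b c d\<bar> \<le> 4 * sqrt (K * rate k / real n) * sqrt (phi D \<omega> (k + spars D)) * l2norm p d \<and>
       \<bar>dev_mean \<omega> d\<bar> \<le> 4 * sqrt (K * rate k / real n) * sqrt (phi D \<omega> (k + spars D)) * l2norm p d"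
    using sparse_dev_event[OF eps Vp V] unfolding K_def by blast
  show thesis
  proof (rule that[OF E])
    fix \<omega> u k \<delta> assume \<omega>: "\<omega> \<in> space P - E" and u: "u \<in> U" and k: "k \<le> n" and S: "card (supp p \<delta> - Tset D u) \<le> k"
    have u01: "0 < u" "u < 1" using setting u by (auto simp: qr_setting_def quantile_indices_def)
    have T: "Tset D u \<subseteq> ?V" "card (Tset D u) \<le> spars D" using setting u by (auto simp: qr_setting_def)
    have Sp: "supp p \<delta> - Tset D u \<subseteq> {..<p}" by (auto simp: supp_def)
    \<comment> \<open>All points of the segment share the support \<open>T \<union> S\<close> with
      \<open>S = supp p \<delta> - T\<close>, so one application of the event covers every
      \<tau>.\<close>
    have z: "coef D u j + \<tau> * \<delta> j = 0" "\<delta> j = 0" if "j < p" "j \<notin> Tset D u \<union> (supp p \<delta> - Tset D u)" for j \<tau>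
      using that by (auto simp: Tset_def supp_def)
    have "\<bar>emp_loss_increment D \<omega> u \<delta> - loss_increment D u \<delta>\<bar>
       \<le> 2 * (4 * sqrt (K * rate k / real n) * sqrt (phi D \<omega> (k + spars D)) * l2norm p \<delta>)"
    proof (intro increment_deviation_le u01)
      have b: "\<bar>dev \<omega> (\<lambda>j. coef D u j + \<tau> * \<delta> j) 0 \<delta>\<bar> \<le> 4 * sqrt (K * rate k / real n) * sqrt (phi D \<omega> (k + spars D)) * l2norm p \<delta> \<and>
          \<bar>dev_mean \<omega> \<delta>\<bar> \<le> 4 * sqrt (K * rate k / real n) * sqrt (phi D \<omega> (k + spars D)) * l2norm p \<delta>" for \<tau>
        by (rule dev[OF \<omega> k T Sp S]) (fact z)+
      show "\<bar>dev \<omega> (\<lambda>j. coef D u j + \<tau> * \<delta> j) 0 \<delta>\<bar> \<le> 4 * sqrt (K * rate k / real n) * sqrt (phi D \<omega> (k + spars D)) * l2norm p \<delta>" for \<tau>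
        using b by blast
      show "\<bar>dev_mean \<omega> \<delta>\<bar> \<le> 4 * sqrt (K * rate k / real n) * sqrt (phi D \<omega> (k + spars D)) * l2norm p \<delta>"
        using b by blast
    qed
    then show "\<bar>emp_loss_increment D \<omega> u \<delta> - loss_increment D u \<delta>\<bar>
       \<le> 8 * sqrt (K * rate k / real n) * sqrt (phi D \<omega> (k + spars D)) * l2norm p \<delta>" by simp
  qed
qed

end

subsection \<open>Conditional distributions with a density\<close>

text \<open>Right continuity of the distribution function puts the infimum into the set;
  \<open>0 < r < 1\<close> makes the set nonempty and bounded below. It serves the conditional
  quantiles of the response as well as the quantile in the penalty.\<close>

lemma (in prob_space) quantile_le_iff:
  fixes L :: "'a \<Rightarrow> real"
  assumes [measurable]: "L \<in> borel_measurable M" and r: "0 < r" "r < 1"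
  defines "q \<equiv> Inf {t. r \<le> prob {v \<in> space M. L v \<le> t}}"
  shows "q \<le> t \<longleftrightarrow> r \<le> prob {v \<in> space M. L v \<le> t}"
proof -
  interpret D: real_distribution "distr M borel L" by (rule real_distribution_distr) measurable
  define F where "F = cdf (distr M borel L)"
  have F: "prob {v \<in> space M. L v \<le> t} = F t" for t
    unfolding F_def cdf_def
    by (subst measure_distr) (auto intro!: arg_cong[where f = prob])
  let ?S = "{t. r \<le> F t}"
  have q: "q = Inf ?S" by (simp add: q_def F)
  have mono: "F s \<le> F t" if "s \<le> t" for s t using D.cdf_nondecreasing[OF that] by (simp add: F_def)
  have "\<forall>\<^sub>F t in at_top. r < F t"
    using order_tendstoD(1)[OF D.cdf_lim_at_top_prob r(2)] by (simp add: F_def)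
  then obtain t1 where t1: "r < F t1" by (auto dest: eventually_happens)
  then have ne: "?S \<noteq> {}" by (auto intro: less_imp_le)
  have "\<forall>\<^sub>F t in at_bot. F t < r"
    using order_tendstoD(2)[OF D.cdf_lim_at_bot r(1)] by (simp add: F_def)
  then obtain t0 where t0: "F t0 < r" by (auto dest: eventually_happens)
  have bdd: "bdd_below ?S"
  proof (rule bdd_belowI)
    fix t assume "t \<in> ?S"
    then show "t0 \<le> t" using t0 mono[of t t0] by (cases "t \<le> t0") auto
  qed
  have attained: "r \<le> F q"
  proof (rule ccontr)
    assume "\<not> r \<le> F q"
    then have less: "F q < r" by simp
    have "(F \<longlongrightarrow> F q) (at_right q)"
      using D.cdf_is_right_cont[of q] by (simp add: F_def continuous_within)
    then have "\<forall>\<^sub>F t in at_right q. F t < r" by (rule order_tendstoD(2)[OF _ less])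
    then obtain b where b: "q < b" "\<And>t. q < t \<Longrightarrow> t < b \<Longrightarrow> F t < r"
      by (auto simp: eventually_at_right_field)
    obtain s where s: "s \<in> ?S" "s < b" using cInf_lessD[OF ne, of b] b(1) q by auto
    have "q \<le> s" using cInf_lower[OF s(1) bdd] q by simp
    moreover have "F s < r"
      using less b(2)[of s] s(2) \<open>q \<le> s\<close> by (cases "s = q") auto
    ultimately show False using s by simp
  qed
  show ?thesis
    unfolding F
  proof
    assume "q \<le> t"
    then show "r \<le> F t" using attained mono[of q t] by simp
  next
    assume "r \<le> F t"
    then show "q \<le> t" unfolding q using bdd by (intro cInf_lower) auto
  qed
qed

text \<open>Both sides agree on boxes: a section of a box is a box again, so the iterated integral
  factors. This will separate the design from the uniform variables.\<close>

lemma distr_zip_PiM: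
  assumes M1: "prob_space M1" and M2: "prob_space M2" and I: "finite I"
  shows "distr (PiM I (\<lambda>_. M1) \<Otimes>\<^sub>M PiM I (\<lambda>_. M2)) (PiM I (\<lambda>_. M1 \<Otimes>\<^sub>M M2))
           (\<lambda>z. \<lambda>i\<in>I. (fst z i, snd z i)) = PiM I (\<lambda>_. M1 \<Otimes>\<^sub>M M2)"
proof -
  interpret M1: prob_space M1 by fact
  interpret M2: prob_space M2 by fact
  interpret M12: pair_prob_space M1 M2 ..
  interpret P1: product_prob_space "\<lambda>_. M1" I by unfold_locales
  interpret P2: product_prob_space "\<lambda>_. M2" I by unfold_locales
  interpret P12: pair_prob_space "PiM I (\<lambda>_. M1)" "PiM I (\<lambda>_. M2)" ..
  interpret PP: product_sigma_finite "\<lambda>_. M1 \<Otimes>\<^sub>M M2" by unfold_locales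
  let ?zip = "\<lambda>z. \<lambda>i\<in>I. (fst z i, snd z i)"
  have zm: "?zip \<in> measurable (PiM I (\<lambda>_. M1) \<Otimes>\<^sub>M PiM I (\<lambda>_. M2)) (PiM I (\<lambda>_. M1 \<Otimes>\<^sub>M M2))"
    by (intro measurable_restrict measurable_Pair measurable_compose[OF measurable_fst]
        measurable_compose[OF measurable_snd] measurable_component_singleton)
  show ?thesis
  proof (rule PP.PiM_eqI[OF I])
    fix A assume A: "\<And>i. i \<in> I \<Longrightarrow> A i \<in> sets (M1 \<Otimes>\<^sub>M M2)"
    have box: "Pi\<^sub>E I A \<in> sets (PiM I (\<lambda>_. M1 \<Otimes>\<^sub>M M2))" using A I by (intro sets_PiM_I_finite) auto
    let ?B = "?zip -` Pi\<^sub>E I A \<inter> space (PiM I (\<lambda>_. M1) \<Otimes>\<^sub>M PiM I (\<lambda>_. M2))"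
    have Bm: "?B \<in> sets (PiM I (\<lambda>_. M1) \<Otimes>\<^sub>M PiM I (\<lambda>_. M2))" by (rule measurable_sets[OF zm box])
    have sec: "Pair x -` ?B = Pi\<^sub>E I (\<lambda>i. Pair (x i) -` A i)" if x: "x \<in> space (PiM I (\<lambda>_. M1))" for x
    proof (intro equalityI subsetI)
      fix v assume v: "v \<in> Pair x -` ?B"
      then have "v \<in> space (PiM I (\<lambda>_. M2))" by (auto simp: space_pair_measure split: if_splits)
      moreover have "\<forall>i\<in>I. (x i, v i) \<in> A i" using v by (auto simp: PiE_iff)
      ultimately show "v \<in> Pi\<^sub>E I (\<lambda>i. Pair (x i) -` A i)" by (simp add: PiE_iff space_PiM)
    next
      fix v assume v: "v \<in> Pi\<^sub>E I (\<lambda>i. Pair (x i) -` A i)"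
      have "v i \<in> space M2" if "i \<in> I" for i
      proof -
        have "(x i, v i) \<in> A i" using v that by auto
        then show ?thesis using sets.sets_into_space[OF A[OF that]] by (auto simp: space_pair_measure)
      qed
      then show "v \<in> Pair x -` ?B"
        using v x by (auto simp: space_pair_measure space_PiM PiE_iff)
    qed
    have "emeasure (distr (PiM I (\<lambda>_. M1) \<Otimes>\<^sub>M PiM I (\<lambda>_. M2)) (PiM I (\<lambda>_. M1 \<Otimes>\<^sub>M M2)) ?zip) (Pi\<^sub>E I A)
        = emeasure (PiM I (\<lambda>_. M1) \<Otimes>\<^sub>M PiM I (\<lambda>_. M2)) ?B"
      by (rule emeasure_distr[OF zm box])
    also have "\<dots> = (\<integral>\<^sup>+ x. emeasure (PiM I (\<lambda>_. M2)) (Pair x -` ?B) \<partial>PiM I (\<lambda>_. M1))"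
      by (rule P2.P.emeasure_pair_measure_alt[OF Bm])
    also have "\<dots> = (\<integral>\<^sup>+ x. (\<Prod>i\<in>I. emeasure M2 (Pair (x i) -` A i)) \<partial>PiM I (\<lambda>_. M1))"
    proof (rule nn_integral_cong)
      fix x assume x: "x \<in> space (PiM I (\<lambda>_. M1))"
      show "emeasure (PiM I (\<lambda>_. M2)) (Pair x -` ?B) = (\<Prod>i\<in>I. emeasure M2 (Pair (x i) -` A i))"
        unfolding sec[OF x] using A I by (intro P2.emeasure_PiM sets_Pair1) auto
    qed
    also have "\<dots> = (\<Prod>i\<in>I. \<integral>\<^sup>+ x. emeasure M2 (Pair x -` A i) \<partial>M1)"
      using A I by (intro P1.product_nn_integral_prod M2.measurable_emeasure_Pair) auto
    also have "\<dots> = (\<Prod>i\<in>I. emeasure (M1 \<Otimes>\<^sub>M M2) (A i))"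
      using A by (intro prod.cong refl M2.emeasure_pair_measure_alt[symmetric]) auto
    finally show "emeasure (distr (PiM I (\<lambda>_. M1) \<Otimes>\<^sub>M PiM I (\<lambda>_. M2)) (PiM I (\<lambda>_. M1 \<Otimes>\<^sub>M M2)) ?zip) (Pi\<^sub>E I A)
        = (\<Prod>i\<in>I. emeasure (M1 \<Otimes>\<^sub>M M2) (A i))" .
  qed simp
qed

abbreviation uniform01 :: "real measure" where
  "uniform01 \<equiv> uniform_measure lborel {0<..<1}"

lemma prob_space_uniform01: "prob_space uniform01"
  by (rule prob_space_uniform_measure) auto

lemma uniform01_atMost: "0 < a \<Longrightarrow> a < 1 \<Longrightarrow> measure uniform01 {..a} = a"
proof -
  assume a: "0 < a" "a < 1"
  have "{0<..<1} \<inter> {..a} = {0<..a}" using a by auto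
  then show ?thesis using a by (subst measure_uniform_measure) auto
qed

section \<open>The conditional law of the response at one covariate value\<close>

locale cont_density =
  fixes f :: "real \<Rightarrow> real"
  assumes cont: "\<And>y. isCont f y" and nonneg: "\<And>y. 0 \<le> f y"
    and mass: "(\<integral>\<^sup>+ y. ennreal (f y) \<partial>lborel) = 1"
begin

definition F :: "real \<Rightarrow> real" where
  "F t = (LINT v:{..t}|lborel. f v)"

lemma f_measurable[measurable]: "f \<in> borel_measurable borel"
  using cont by (intro borel_measurable_continuous_onI continuous_at_imp_continuous_on) auto

lemma f_integrable: "integrable lborel f"
  using mass nonneg by (intro integrableI_nonneg) auto

abbreviation "law_y \<equiv> density lborel (\<lambda>y. ennreal (f y))"

sublocale Y: prob_space law_y
  by (rule prob_spaceI) (simp add: emeasure_density mass)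

sublocale Y: real_distribution law_y
  by unfold_locales simp_all

lemma F_cdf: "F = cdf law_y"
proof
  fix t
  have "emeasure law_y {..t} = (\<integral>\<^sup>+ v. ennreal (indicator {..t} v *\<^sub>R f v) \<partial>lborel)"
    by (subst emeasure_density) (auto intro!: nn_integral_cong simp: indicator_def nonneg)
  also have "\<dots> = ennreal (F t)"
    unfolding F_def set_lebesgue_integral_def
    using f_integrable nonneg
    by (intro nn_integral_eq_integral integrable_mult_indicator) auto
  finally show "F t = cdf law_y t"
    unfolding cdf_def measure_def
    by (simp add: F_def set_lebesgue_integral_def integral_nonneg_AE nonneg)
qed

lemma F_mono: "s \<le> t \<Longrightarrow> F s \<le> F t"
  unfolding F_cdf by (rule Y.cdf_nondecreasing)

lemma F_bounds: "0 \<le> F t" "F t \<le> 1"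
  unfolding F_cdf using Y.cdf_nonneg Y.cdf_bounded_prob by auto

lemma F_isCont: "isCont F t"
proof -
  have "emeasure law_y {t} = 0"
    by (subst emeasure_density) (auto intro!: nn_integral_0_iff_AE[THEN iffD2] AE_mp[OF AE_lborel_singleton[of t]])
  then show ?thesis unfolding F_cdf by (subst Y.isCont_cdf) (simp add: measure_def)
qed

lemma F_diff:
  assumes "a \<le> b"
  shows "(f has_integral (F b - F a)) {a..b}"
proof -
  have int: "f integrable_on {a..b}"
    using cont by (intro integrable_continuous_real continuous_at_imp_continuous_on) auto
  have si: "set_integrable lborel A f" if "A \<in> sets borel" for A
    unfolding set_integrable_def using that f_integrable by (intro integrable_mult_indicator) auto
  have "{..b} = {..a} \<union> {a<..b}" using assms by auto
  then have "F b = F a + (LINT v:{a<..b}|lborel. f v)"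
    unfolding F_def by (simp, subst set_integral_Un) (auto intro!: si)
  also have "(LINT v:{a<..b}|lborel. f v) = (LINT v:{a..b}|lborel. f v)"
    unfolding set_lebesgue_integral_def
  proof (rule integral_cong_AE)
    show "AE v in lborel. indicator {a<..b} v *\<^sub>R f v = indicator {a..b} v *\<^sub>R f v"
      using AE_lborel_singleton[of a] by eventually_elim (auto simp: indicator_def)
  qed measurable
  also have "\<dots> = integral {a..b} f"
    by (rule set_borel_integral_eq_integral(2)[OF si]) simp
  finally show ?thesis using int by (simp add: has_integral_integral)
qed

text \<open>Continuity keeps the density above half its value near \<open>a\<close>, so
  \<open>F\<close> rises at once to the right of \<open>a\<close>.\<close>

lemma F_strict:
  assumes "F a = u" "0 < f a" "a < y" shows "u < F y"
proof -
  have "\<forall>\<^sub>F v in at a. f a / 2 < f v"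
    using order_tendstoD(1)[OF cont[of a, unfolded isCont_def], of "f a / 2"] assms(2) by simp
  then obtain e where e: "0 < e" "\<And>v. v \<noteq> a \<Longrightarrow> dist v a < e \<Longrightarrow> f a / 2 < f v"
    unfolding eventually_at by blast
  define b where "b = min y (a + e / 2)"
  have b: "a < b" "b \<le> y" using e assms by (auto simp: b_def)
  have "((\<lambda>_. f a / 2) has_integral (f a / 2 * (b - a))) {a..b}"
    using has_integral_const_real[of "f a / 2" a b] b by (simp add: mult.commute)
  moreover have "(f has_integral (F b - F a)) {a..b}" using b by (intro F_diff) simp
  ultimately have "f a / 2 * (b - a) \<le> F b - F a"
  proof (rule has_integral_le)
    fix v assume "v \<in> {a..b}"
    then have v: "a \<le> v" "v \<le> a + e / 2" by (auto simp: b_def)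
    then show "f a / 2 \<le> f v"
      using e(2)[of v] e(1) assms(2) by (cases "v = a") (auto simp: dist_real_def)
  qed
  moreover have "0 < f a / 2 * (b - a)" using assms b by simp
  ultimately show ?thesis using F_mono[OF b(2)] assms(1) by linarith
qed

text \<open>The infimum belongs to the set, and everything to its left has distribution function
  below \<open>u\<close>; as there are no atoms, the left limit forces equality.\<close>

lemma F_quantile:
  assumes u: "0 < u" "u < 1"
  shows "F (Inf {t. u \<le> F t}) = u"
proof -
  let ?q = "Inf {t. u \<le> F t}"
  have iff: "?q \<le> t \<longleftrightarrow> u \<le> F t" for t
  proof -
    have "(\<lambda>y. y) \<in> borel_measurable law_y" by simp
    from Y.quantile_le_iff[OF this u, of t]
    show ?thesis unfolding F_cdf cdf_def atMost_def by simp
  qed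
  have "u \<le> F ?q" using iff[of ?q] by simp
  moreover have "F ?q \<le> u"
  proof (rule tendsto_upperbound)
    show "(F \<longlongrightarrow> F ?q) (at_left ?q)"
      using F_isCont[of ?q] by (auto simp: isCont_def intro: tendsto_mono[OF at_le])
    have "F t \<le> u" if "t < ?q" for t using iff[of t] that by simp
    then show "\<forall>\<^sub>F t in at_left ?q. F t \<le> u"
      by (auto simp: eventually_at_filter)
  qed simp
  ultimately show ?thesis by simp
qed

text \<open>The probability integral transform, without assuming that \<open>F\<close> is strictly
  increasing.\<close>

lemma distr_F: "distr law_y borel F = uniform01"
proof (rule cdf_unique)
  interpret Un: prob_space uniform01 by (rule prob_space_uniform01)
  have Fm[measurable]: "F \<in> borel_measurable borel"
    using F_isCont by (intro borel_measurable_continuous_onI continuous_at_imp_continuous_on) auto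
  show "real_distribution (distr law_y borel F)"
    by (rule Y.real_distribution_distr) simp
  show "real_distribution uniform01"
    by unfold_locales simp_all
  interpret DF: prob_space "distr law_y borel F" by (rule Y.prob_space_distr) simp
  have m: "measure (distr law_y borel F) {..a} = measure law_y {y. F y \<le> a}" for a
    by (subst measure_distr) (auto intro!: arg_cong[where f = "measure law_y"])
  have in01: "measure (distr law_y borel F) {..a} = a" if a: "0 < a" "a < 1" for a
  proof -
    have "{y. F y \<le> a} \<noteq> {}" "bdd_above {y. F y \<le> a}"
    proof -
      have "\<forall>\<^sub>F t in at_bot. F t < a"
        using order_tendstoD(2)[OF Y.cdf_lim_at_bot a(1)] by (simp add: F_cdf)
      then show "{y. F y \<le> a} \<noteq> {}" by (auto dest!: eventually_happens intro: less_imp_le)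
      have "\<forall>\<^sub>F t in at_top. a < F t"
        using order_tendstoD(1)[OF Y.cdf_lim_at_top_prob a(2)] by (simp add: F_cdf)
      then obtain t where "a < F t" by (auto dest!: eventually_happens)
      then show "bdd_above {y. F y \<le> a}"
        using F_mono by (intro bdd_aboveI[of _ t]) (metis linorder_le_cases mem_Collect_eq not_le order_trans)
    qed
    note S = this
    \<comment> \<open>The sublevel set is closed and downward closed, hence \<open>{..c}\<close>;
      continuity from the right gives \<open>F c = a\<close> even if \<open>F\<close> is flat to the
      left of \<open>c\<close>.\<close>
    define c where "c = Sup {y. F y \<le> a}"
    have cl: "closed {y. F y \<le> a}"
      using F_isCont by (intro closed_Collect_le continuous_at_imp_continuous_on continuous_on_const) auto
    have "c \<in> {y. F y \<le> a}" unfolding c_def by (rule closed_contains_Sup[OF S cl])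
    then have Fc: "F c \<le> a" by simp
    have eq: "{y. F y \<le> a} = {..c}"
      using cSup_upper[OF _ S(2)] F_mono Fc by (auto simp: c_def[symmetric] intro: order_trans)
    have "a \<le> F c"
    proof (rule tendsto_lowerbound)
      show "(F \<longlongrightarrow> F c) (at_right c)"
        using F_isCont[of c] by (auto simp: isCont_def intro: tendsto_mono[OF at_le])
      have "a \<le> F t" if "c < t" for t
      proof -
        have "t \<notin> {y. F y \<le> a}" unfolding eq using that by simp
        then show ?thesis by simp
      qed
      then show "\<forall>\<^sub>F t in at_right c. a \<le> F t"
        unfolding eventually_at_right_field by (intro exI[of _ "c + 1"]) auto
    qed simp
    then have "F c = a" using Fc by simp
    then show ?thesis unfolding m eq by (simp add: F_cdf cdf_def)
  qed
  show "cdf (distr law_y borel F) = cdf uniform01"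
  proof
    fix a :: real
    consider "a < 0" | "a = 0" | "0 < a" "a < 1" | "1 \<le> a" by linarith
    then show "cdf (distr law_y borel F) a = cdf uniform01 a"
    proof cases
      case 1
      have "\<not> F y \<le> a" for y using F_bounds(1)[of y] 1 by linarith
      then have e: "{y. F y \<le> a} = {}" by simp
      have "{0<..<1} \<inter> {..a} = {}" using 1 by auto
      then show ?thesis unfolding cdf_def m e by (subst measure_uniform_measure) auto
    next
      case 2
      \<comment> \<open>At \<open>a = 0\<close> the sublevel set may be empty or have no finite
        supremum, so the value is squeezed by those at positive arguments.\<close>
      have "measure (distr law_y borel F) {..0} \<le> 0"
      proof (rule field_le_epsilon)
        fix e :: real assume e: "0 < e"
        have "measure (distr law_y borel F) {..0} \<le> measure (distr law_y borel F) {..min e (1/2)}"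
          using e by (intro DF.finite_measure_mono) auto
        also have "\<dots> = min e (1/2)" using e by (intro in01) auto
        finally show "measure (distr law_y borel F) {..0} \<le> 0 + e" by simp
      qed
      then have "measure (distr law_y borel F) {..0} = 0" by (simp add: measure_le_0_iff)
      moreover have "{0<..<1} \<inter> {..0::real} = {}" by auto
      then have "measure uniform01 {..0} = 0" by (subst measure_uniform_measure) auto
      ultimately show ?thesis unfolding cdf_def 2 by simp
    next
      case 3
      then show ?thesis unfolding cdf_def using in01 uniform01_atMost by simp
    next
      case 4
      have e: "{y. F y \<le> a} = UNIV" using F_bounds(2) 4 by (auto intro: order_trans)
      have "{0<..<1} \<inter> {..a} = {0<..<1}" using 4 by auto
      then have "measure uniform01 {..a} = 1" by (subst measure_uniform_measure) auto
      moreover have "measure law_y UNIV = 1" using Y.prob_space by simp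
      ultimately show ?thesis unfolding cdf_def m e by simp
    qed
  qed
qed

text \<open>By Knight's identity and Fubini the expected increment is the average over \<tau> of
  \<open>v * (F (a + \<tau> * v) - F a)\<close>. The constants 1/2 and 1/6 are the integrals of
  \<tau> and of \<open>\<tau>\<^sup>2 / 2\<close>.\<close>

lemma loss_expansion:
  assumes u: "0 < u" "u < 1" and Fa: "F a = u"
    and lip: "\<And>s. \<bar>f (a + s) - f a\<bar> \<le> B * \<bar>s\<bar>" and B: "0 \<le> B"
  shows "v\<^sup>2 * f a / 2 - B * \<bar>v\<bar> ^ 3 / 6
    \<le> (\<integral>y. check_loss u (y - a - v) - check_loss u (y - a) \<partial>law_y)"
proof -
  interpret I: prob_space unit_interval by (rule prob_space_unit_interval)
  interpret YI: pair_sigma_finite law_y unit_interval ..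
  have I1: "I.prob {0..1} = 1" using I.prob_space by (simp add: space_restrict_space)
  let ?g = "\<lambda>y \<tau>. v * (of_bool (y - a \<le> \<tau> * v) - u)"
  have gb: "\<bar>?g y \<tau>\<bar> \<le> \<bar>v\<bar>" for y \<tau>
    unfolding abs_mult using u by (intro mult_left_le) auto
  interpret YIp: pair_prob_space law_y unit_interval ..
  have joint: "integrable (law_y \<Otimes>\<^sub>M unit_interval) (\<lambda>(y, \<tau>). ?g y \<tau>)"
  proof (rule YIp.P.integrable_const_bound[where B = "\<bar>v\<bar>"])
    show "AE x in law_y \<Otimes>\<^sub>M unit_interval. norm (case x of (y, \<tau>) \<Rightarrow> ?g y \<tau>) \<le> \<bar>v\<bar>"
      using gb by (auto intro!: AE_I2)
    have [measurable]: "fst \<in> borel_measurable (law_y \<Otimes>\<^sub>M unit_interval)"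
      by (rule measurable_compose[OF measurable_fst, of "\<lambda>y. y", simplified]) simp
    have [measurable]: "snd \<in> borel_measurable (law_y \<Otimes>\<^sub>M unit_interval)"
      by (rule measurable_compose[OF measurable_snd unit_interval_ident])
    show "(\<lambda>(y, \<tau>). ?g y \<tau>) \<in> borel_measurable (law_y \<Otimes>\<^sub>M unit_interval)"
      unfolding case_prod_beta by measurable
  qed
  have "(\<integral>y. check_loss u (y - a - v) - check_loss u (y - a) \<partial>law_y)
      = (\<integral>y. (\<integral>\<tau>. ?g y \<tau> \<partial>unit_interval) \<partial>law_y)"
    by (simp only: check_loss_integral[OF u])
  also have "\<dots> = (\<integral>\<tau>. (\<integral>y. ?g y \<tau> \<partial>law_y) \<partial>unit_interval)"
    using YI.Fubini_integral[OF joint, unfolded prod.case] by (rule sym)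
  finally have eq: "(\<integral>y. check_loss u (y - a - v) - check_loss u (y - a) \<partial>law_y)
      = (\<integral>\<tau>. (\<integral>y. ?g y \<tau> \<partial>law_y) \<partial>unit_interval)" .
  have inner: "(\<integral>y. ?g y \<tau> \<partial>law_y) = v * (F (a + \<tau> * v) - F a)" for \<tau>
  proof -
    have "(\<integral>y. ?g y \<tau> \<partial>law_y) = (\<integral>y. v * (indicator {..a + \<tau> * v} y - u) \<partial>law_y)"
      by (intro Bochner_Integration.integral_cong refl) (auto simp: indicator_def)
    also have "\<dots> = v * (measure law_y {..a + \<tau> * v} - u)"
      using Y.prob_space by (simp add: Y.emeasure_eq_measure)
    finally show ?thesis by (simp add: Fa F_cdf cdf_def flip: Fa)
  qed
  have lower: "\<tau> * (v\<^sup>2 * f a) - \<tau>\<^sup>2 * (B * \<bar>v\<bar> ^ 3 / 2) \<le> v * (F (a + \<tau> * v) - F a)" if \<tau>: "0 \<le> \<tau>" for \<tau>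
  proof -
    define z where "z = \<tau> * v"
    have key: "\<bar>F (a + z) - F a - z * f a\<bar> \<le> B * z\<^sup>2 / 2"
    proof -
      \<comment> \<open>Ordering the endpoints lets one estimate cover both signs of
        \<open>z\<close>.\<close>
      define lo where "lo = min a (a + z)"
      define hi where "hi = max a (a + z)"
      have lohi: "lo \<le> hi" by (simp add: lo_def hi_def)
      have hw: "hi - lo = \<bar>z\<bar>" by (simp add: lo_def hi_def max_def min_def)
      have hF: "(f has_integral (F hi - F lo)) {lo..hi}" by (rule F_diff[OF lohi])
      have hc: "((\<lambda>_. f a) has_integral (f a * \<bar>z\<bar>)) {lo..hi}"
        using has_integral_const_real[of "f a" lo hi] lohi hw by (simp add: mult.commute)
      have diff: "((\<lambda>y. f y - f a) has_integral (F hi - F lo - f a * \<bar>z\<bar>)) {lo..hi}"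
        by (rule has_integral_diff[OF hF hc])
      have hl: "((\<lambda>y. B * \<bar>y - a\<bar>) has_integral (B * z\<^sup>2 / 2)) {lo..hi}"
      proof (cases "0 \<le> z")
        case True
        have "((\<lambda>y. B * (y - a)) has_integral (B * (a + z - a)\<^sup>2 / 2 - B * (a - a)\<^sup>2 / 2)) {a..a + z}"
          using True by (intro fundamental_theorem_of_calculus)
            (auto intro!: derivative_eq_intros simp: has_real_derivative_iff_has_vector_derivative[symmetric])
        then have "((\<lambda>y. B * (y - a)) has_integral (B * z\<^sup>2 / 2)) {lo..hi}"
          using True by (simp add: lo_def hi_def)
        then show ?thesis
          by (rule has_integral_eq[rotated]) (use True in \<open>auto simp: lo_def hi_def\<close>)
      next
        case False
        have "((\<lambda>y. B * (a - y)) has_integral (- B * (a - a)\<^sup>2 / 2 - - B * (a - (a + z))\<^sup>2 / 2)) {a + z..a}"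
          using False by (intro fundamental_theorem_of_calculus)
            (auto intro!: derivative_eq_intros simp: has_real_derivative_iff_has_vector_derivative[symmetric] field_simps)
        then have "((\<lambda>y. B * (a - y)) has_integral (B * z\<^sup>2 / 2)) {lo..hi}"
          using False by (simp add: lo_def hi_def)
        then show ?thesis
          by (rule has_integral_eq[rotated]) (use False in \<open>auto simp: lo_def hi_def\<close>)
      qed
      have "norm (F hi - F lo - f a * \<bar>z\<bar>) \<le> B * z\<^sup>2 / 2"
      proof -
        have "norm (integral {lo..hi} (\<lambda>y. f y - f a)) \<le> integral {lo..hi} (\<lambda>y. B * \<bar>y - a\<bar>)"
        proof (rule integral_norm_bound_integral)
          show "(\<lambda>y. f y - f a) integrable_on {lo..hi}" using diff by (rule has_integral_integrable)
          show "(\<lambda>y. B * \<bar>y - a\<bar>) integrable_on {lo..hi}" using hl by (rule has_integral_integrable)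
          show "norm (f y - f a) \<le> B * \<bar>y - a\<bar>" for y using lip[of "y - a"] by simp
        qed
        then show ?thesis unfolding integral_unique[OF diff] integral_unique[OF hl] .
      qed
      then have "\<bar>F hi - F lo - f a * \<bar>z\<bar>\<bar> \<le> B * z\<^sup>2 / 2" by simp
      then show ?thesis
        by (cases "0 \<le> z") (auto simp: lo_def hi_def max_def min_def abs_if mult.commute split: if_splits)
    qed
    have "\<bar>v * (F (a + z) - F a - z * f a)\<bar> \<le> \<bar>v\<bar> * (B * z\<^sup>2 / 2)"
      unfolding abs_mult using key by (rule mult_left_mono) simp
    also have "\<dots> = \<tau>\<^sup>2 * (B * \<bar>v\<bar> ^ 3 / 2)"
      by (simp add: z_def power_mult_distrib power3_eq_cube power2_eq_square abs_mult_self_eq mult_ac)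
    finally have "- (\<tau>\<^sup>2 * (B * \<bar>v\<bar> ^ 3 / 2)) \<le> v * (F (a + z) - F a - z * f a)" by linarith
    then show ?thesis by (simp add: z_def algebra_simps power2_eq_square)
  qed
  have poly: "((\<lambda>\<tau>. \<tau> * c - \<tau>\<^sup>2 * d) has_integral (c / 2 - d / 3)) {0..1}" for c d :: real
  proof -
    have "((\<lambda>\<tau>. \<tau> * c - \<tau>\<^sup>2 * d) has_integral ((1\<^sup>2 * c / 2 - 1 ^ 3 * d / 3) - (0\<^sup>2 * c / 2 - 0 ^ 3 * d / 3))) {0..1}"
      by (intro fundamental_theorem_of_calculus)
        (auto intro!: derivative_eq_intros simp: has_real_derivative_iff_has_vector_derivative[symmetric] power2_eq_square)
    then show ?thesis by simp
  qed
  have polyI: "(\<integral>\<tau>. \<tau> * c - \<tau>\<^sup>2 * d \<partial>unit_interval) = c / 2 - d / 3"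
    "integrable unit_interval (\<lambda>\<tau>. \<tau> * c - \<tau>\<^sup>2 * d)" for c d :: real
  proof -
    have si: "set_integrable lborel {0..1} (\<lambda>\<tau>. \<tau> * c - \<tau>\<^sup>2 * d)"
      by (intro borel_integrable_atLeastAtMost' continuous_intros)
    show "integrable unit_interval (\<lambda>\<tau>. \<tau> * c - \<tau>\<^sup>2 * d)"
      using si by (simp add: set_integrable_def integrable_restrict_space)
    have "(LINT \<tau>:{0..1}|lborel. \<tau> * c - \<tau>\<^sup>2 * d) = integral {0..1} (\<lambda>\<tau>. \<tau> * c - \<tau>\<^sup>2 * d)"
      by (rule set_borel_integral_eq_integral(2)[OF si])
    also have "\<dots> = c / 2 - d / 3" by (rule integral_unique[OF poly])
    finally show "(\<integral>\<tau>. \<tau> * c - \<tau>\<^sup>2 * d \<partial>unit_interval) = c / 2 - d / 3"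
      by (simp add: set_lebesgue_integral_def integral_restrict_space)
  qed
  have "(\<integral>\<tau>. \<tau> * (v\<^sup>2 * f a) - \<tau>\<^sup>2 * (B * \<bar>v\<bar> ^ 3 / 2) \<partial>unit_interval)
      \<le> (\<integral>\<tau>. (\<integral>y. ?g y \<tau> \<partial>law_y) \<partial>unit_interval)"
  proof (rule integral_mono[OF polyI(2)])
    show "integrable unit_interval (\<lambda>\<tau>. \<integral>y. ?g y \<tau> \<partial>law_y)" using YI.integrable_snd[OF joint] by simp
    fix \<tau> assume "\<tau> \<in> space unit_interval"
    then have "0 \<le> \<tau>" by (simp add: space_restrict_space)
    then show "\<tau> * (v\<^sup>2 * f a) - \<tau>\<^sup>2 * (B * \<bar>v\<bar> ^ 3 / 2) \<le> (\<integral>y. ?g y \<tau> \<partial>law_y)"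
      unfolding inner by (rule lower)
  qed
  then show ?thesis unfolding eq polyI(1) by simp
qed

end

subsection \<open>Almost sure properties of the covariates\<close>

text \<open>Right limits through \<open>Q\<close> reach every point of \<open>U\<close>, so suprema over \<open>U\<close> of right-continuous
  functions are suprema over the countable set \<open>Q\<close>.\<close>

lemma countable_right_dense_subset:
  fixes U :: "real set"
  assumes "compact U"
  obtains Q where "countable Q" "Q \<subseteq> U" "\<And>u e. u \<in> U \<Longrightarrow> 0 < e \<Longrightarrow> \<exists>v\<in>Q. u \<le> v \<and> v < u + e"
proof
  let ?Q = "(\<lambda>b. Sup (U \<inter> {..b})) ` {b \<in> \<rat>. U \<inter> {..b} \<noteq> {}}"
  show "countable ?Q" by (intro countable_image countable_Collect countable_rat) 
  have cl: "closed U" and bd: "bdd_above U"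
    using compact_imp_closed[OF assms] bounded_imp_bdd_above[OF compact_imp_bounded[OF assms]] by simp_all
  have bdd: "bdd_above (U \<inter> {..b})" for b by simp
  have inU: "Sup (U \<inter> {..b}) \<in> U \<inter> {..b}" if "U \<inter> {..b} \<noteq> {}" for b
    using that cl bdd by (intro closed_contains_Sup) auto
  show "?Q \<subseteq> U" using inU by blast
  fix u e :: real assume u: "u \<in> U" and e: "0 < e"
  obtain b where b: "b \<in> \<rat>" "u < b" "b < u + e" using Rats_dense_in_real[of u "u + e"] e by auto
  have uin: "u \<in> U \<inter> {..b}" using u b by simp
  then have ne: "U \<inter> {..b} \<noteq> {}" by blast
  have "u \<le> Sup (U \<inter> {..b})" by (rule cSup_upper[OF uin bdd])
  moreover have "Sup (U \<inter> {..b}) < u + e" using inU[OF ne] b by auto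
  ultimately show "\<exists>v\<in>?Q. u \<le> v \<and> v < u + e" using b ne by blast
qed

context qr_sample
begin

lemma U_props: "compact U" "U \<noteq> {}" "\<And>u. u \<in> U \<Longrightarrow> 0 < u \<and> u < 1"
  using setting by (auto simp: qr_setting_def quantile_indices_def)

definition U0 :: "real set" where
  "U0 = (SOME Q. countable Q \<and> Q \<subseteq> U \<and> (\<forall>u e. u \<in> U \<longrightarrow> 0 < e \<longrightarrow> (\<exists>v\<in>Q. u \<le> v \<and> v < u + e)))"

lemma U0: "countable U0" "U0 \<subseteq> U" "\<And>u e. u \<in> U \<Longrightarrow> 0 < e \<Longrightarrow> \<exists>v\<in>U0. u \<le> v \<and> v < u + e"
proof -
  have "\<exists>Q. countable Q \<and> Q \<subseteq> U \<and> (\<forall>u e. u \<in> U \<longrightarrow> 0 < e \<longrightarrow> (\<exists>v\<in>Q. u \<le> v \<and> v < u + e))"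
    using countable_right_dense_subset[OF U_props(1)] by metis
  from someI_ex[OF this, folded U0_def]
  show "countable U0" "U0 \<subseteq> U" "\<And>u e. u \<in> U \<Longrightarrow> 0 < e \<Longrightarrow> \<exists>v\<in>U0. u \<le> v \<and> v < u + e" by blast+
qed

lemma U0_nonempty: "U0 \<noteq> {}"
  using U_props(2) U0(3)[of _ 1] by fastforce

lemma U0_sequence:
  assumes "u \<in> U"
  obtains w where "\<And>k. w k \<in> U0" "\<And>k. u \<le> w k" "w \<longlonglongrightarrow> u"
proof -
  have "\<forall>k. \<exists>v. v \<in> U0 \<and> u \<le> v \<and> v < u + 1 / real (Suc k)"
    using U0(3)[OF assms] by (meson divide_pos_pos of_nat_0_less_iff zero_less_Suc zero_less_one)
  then obtain w where w: "\<And>k. w k \<in> U0" "\<And>k. u \<le> w k" "\<And>k. w k < u + 1 / real (Suc k)"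
    by metis
  have "w \<longlonglongrightarrow> u"
  proof (rule tendsto_sandwich[where f = "\<lambda>_. u" and h = "\<lambda>k. u + 1 / real (Suc k)"])
    show "(\<lambda>k. u + 1 / real (Suc k)) \<longlonglongrightarrow> u"
      using tendsto_add[OF tendsto_const[of u] LIMSEQ_inverse_real_of_nat] by (simp add: inverse_eq_divide)
  qed (use w in \<open>auto intro!: always_eventually less_imp_le\<close>)
  then show thesis using w that by blast
qed

text \<open>The complement of the support is covered by null boxes with rational center and radius,
  of which there are countably many.\<close>

lemma support_AE: "AE x in X_law. x \<in> cov_support D"
proof -
  define box where "box q r = {x \<in> space XS. \<forall>j<p. \<bar>x j - q j\<bar> < r}" for q :: "nat \<Rightarrow> real" and r
  define N where "N = {(q, r). q \<in> {..<p} \<rightarrow>\<^sub>E \<rat> \<and> r \<in> \<rat> \<and> measure X_law (box q r) = 0}"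
  interpret X: prob_space X_law by (rule X_law_prob)
  have box_sets[measurable]: "box q r \<in> sets XS" for q r
  proof -
    have "{x \<in> space XS. \<forall>j\<in>{..<p}. \<bar>x j - q j\<bar> < r} \<in> sets XS"
    proof (rule sets.sets_Collect_finite_All)
      fix j assume "j \<in> {..<p}"
      then have [measurable]: "(\<lambda>x. x j) \<in> borel_measurable XS" by (simp add: XS_component)
      show "{x \<in> space XS. \<bar>x j - q j\<bar> < r} \<in> sets XS" by measurable
    qed simp
    then show ?thesis by (simp add: box_def Ball_def)
  qed
  have "N \<subseteq> ({..<p} \<rightarrow>\<^sub>E \<rat>) \<times> \<rat>" by (auto simp: N_def)
  then have cN: "countable N"
    by (rule countable_subset) (intro countable_SIGMA countable_PiE countable_rat; simp)
  have AE: "AE x in X_law. \<forall>z\<in>N. x \<notin> box (fst z) (snd z)"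
  proof (rule AE_ball_countable[THEN iffD2, OF cN], rule ballI)
    fix z assume "z \<in> N"
    then have "measure X_law (box (fst z) (snd z)) = 0" by (simp add: N_def case_prod_beta)
    then show "AE x in X_law. x \<notin> box (fst z) (snd z)"
      by (rule X.prob_eq_0[THEN iffD1, rotated]) simp
  qed
  have law_box: "measure X_law (box q r) = measure P {\<omega> \<in> space P. \<forall>j<p. \<bar>covar D 0 \<omega> j - q j\<bar> < r}" for q r
  proof -
    have "covar D 0 -` box q r \<inter> space P = {\<omega> \<in> space P. \<forall>j<p. \<bar>covar D 0 \<omega> j - q j\<bar> < r}"
      using measurable_space[OF covar_measurable[OF n_pos]] by (auto simp: box_def)
    then show ?thesis by (subst measure_distr) auto
  qed
  have "AE x in X_law. x \<in> space XS" using AE_space[of X_law] by simp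
  with AE show ?thesis
  proof eventually_elim
    case (elim x)
    show ?case
    proof (rule ccontr)
      assume "x \<notin> cov_support D"
      then obtain e where e: "0 < e" "\<not> 0 < measure P {\<omega> \<in> space P. \<forall>j<p. \<bar>covar D 0 \<omega> j - x j\<bar> < e}"
        using elim(2) by (auto simp: cov_support_def)
      then have null: "measure X_law (box x e) = 0"
        unfolding law_box using measure_nonneg[of P "{\<omega> \<in> space P. \<forall>j<p. \<bar>covar D 0 \<omega> j - x j\<bar> < e}"] by linarith
      \<comment> \<open>A box of radius below \<open>e / 2\<close> whose center is that close to
        \<open>x\<close> stays inside the null box of radius \<open>e\<close>.\<close>
      obtain r where r: "r \<in> \<rat>" "0 < r" "r < e / 2" using Rats_dense_in_real[of 0 "e / 2"] e by auto
      have "\<forall>j. \<exists>t. t \<in> \<rat> \<and> x j < t \<and> t < x j + r"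
        using Rats_dense_in_real r(2) by (meson less_add_same_cancel1)
      then obtain t where t: "\<And>j. t j \<in> \<rat>" "\<And>j. x j < t j" "\<And>j. t j < x j + r" by metis
      define q where "q = restrict t {..<p}"
      have near: "\<bar>x j - q j\<bar> < r" if "j < p" for j
        using t(2,3)[of j] that by (simp add: q_def)
      have "box q r \<subseteq> box x e"
      proof
        fix y assume y: "y \<in> box q r"
        have "\<bar>y j - x j\<bar> < e" if "j < p" for j
          using near[OF that] y that r(3) by (fastforce simp: box_def)
        then show "y \<in> box x e" using y by (simp add: box_def)
      qed
      then have "measure X_law (box q r) \<le> measure X_law (box x e)" by (intro X.finite_measure_mono) auto
      then have "measure X_law (box q r) = 0" using null measure_nonneg[of X_law "box q r"] by linarith
      then have "(q, r) \<in> N" using t(1) r(1) by (auto simp: N_def q_def)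
      moreover have "x \<in> box q r" using near elim(2) by (simp add: box_def)
      ultimately show False using elim(1) by force
    qed
  qed
qed

lemma cdens_section[measurable]: "x \<in> space XS \<Longrightarrow> cdens D x \<in> borel_measurable borel"
  using measurable_compose[OF measurable_Pair1'[of x X_law lborel] cdens_measurable] by simp

text \<open>D.1 only provides a joint density. Integrating it over \<open>A\<close> times the line
  returns the law of the covariates, so its marginal is 1 almost everywhere.\<close>

lemma mass_AE: "AE x in X_law. (\<integral>\<^sup>+ y. ennreal (cdens D x y) \<partial>lborel) = 1"
proof -
  interpret X: prob_space X_law by (rule X_law_prob)
  let ?m = "\<lambda>x. \<integral>\<^sup>+ y. ennreal (cdens D x y) \<partial>lborel"
  have m[measurable]: "?m \<in> borel_measurable X_law"
    using lborel.borel_measurable_nn_integral_fst[of "\<lambda>z. ennreal (case z of (x, y) \<Rightarrow> cdens D x y)" X_law] by simp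
  have "density X_law ?m = density X_law (\<lambda>_. 1)"
  proof (rule measure_eqI)
    fix A assume "A \<in> sets (density X_law ?m)"
    then have A[measurable]: "A \<in> sets XS" by simp
    have AX: "A \<in> sets X_law" by simp
    have "emeasure (density X_law ?m) A = (\<integral>\<^sup>+ x. ?m x * indicator A x \<partial>X_law)"
      using AX by (intro emeasure_density) auto
    also have "\<dots> = (\<integral>\<^sup>+ x. (\<integral>\<^sup>+ y. ennreal (cdens D x y) * indicator A x \<partial>lborel) \<partial>X_law)"
      by (intro nn_integral_cong nn_integral_multc[symmetric]) (simp)
    also have "\<dots> = (\<integral>\<^sup>+ z. (case z of (x, y) \<Rightarrow> ennreal (cdens D x y)) * indicator A (fst z) \<partial>(X_law \<Otimes>\<^sub>M lborel))"
      by (subst lborel.nn_integral_fst[symmetric]) auto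
    also have "\<dots> = (\<integral>\<^sup>+ \<omega>. indicator A (fst (covar D 0 \<omega>, resp D 0 \<omega>)) \<partial>P)"
      by (rule distributed_nn_integral[OF obs_distributed]) measurable
    also have "\<dots> = (\<integral>\<^sup>+ x. indicator A x \<partial>X_law)"
      by (subst nn_integral_distr) auto
    finally show "emeasure (density X_law ?m) A = emeasure (density X_law (\<lambda>_. 1)) A"
      using AX by (simp add: emeasure_density)
  qed simp
  then show ?thesis using X.density_unique[OF m] by simp
qed

lemma cdens_C1:
  assumes "x \<in> cov_support D"
  shows "(cdens D x has_real_derivative deriv (cdens D x) y) (at y)"
    "\<bar>cdens D x y\<bar> \<le> f_up D" "\<bar>deriv (cdens D x) y\<bar> \<le> f_up' D"
    "u \<in> U \<Longrightarrow> f_lo D < cdens D x (dot p x (coef D u))"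
proof -
  have a: "(cdens D x) C1_differentiable_on UNIV"
    "\<bar>cdens D x y\<bar> \<le> f_up D" "\<bar>deriv (cdens D x) y\<bar> \<le> f_up' D"
    "u \<in> U \<Longrightarrow> f_lo D < cdens D x (dot p x (coef D u))"
    using D1 assms unfolding cond_D1_def by blast+
  then obtain g where "\<And>y. (cdens D x has_vector_derivative g y) (at y)"
    unfolding C1_differentiable_on_def by auto
  then have g: "\<And>y. (cdens D x has_real_derivative g y) (at y)"
    by (simp add: has_real_derivative_iff_has_vector_derivative)
  then have "deriv (cdens D x) y = g y" by (intro DERIV_imp_deriv)
  then show "(cdens D x has_real_derivative deriv (cdens D x) y) (at y)" using g by simp
  show "\<bar>cdens D x y\<bar> \<le> f_up D" "\<bar>deriv (cdens D x) y\<bar> \<le> f_up' D"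
    "u \<in> U \<Longrightarrow> f_lo D < cdens D x (dot p x (coef D u))" by fact+
qed

lemma cdens_lipschitz:
  assumes "x \<in> cov_support D"
  shows "\<bar>cdens D x (a + s) - cdens D x a\<bar> \<le> f_up' D * \<bar>s\<bar>"
proof -
  have "norm (cdens D x (a + s) - cdens D x a) \<le> f_up' D * norm ((a + s) - a)"
    by (rule field_differentiable_bound[where S = UNIV and f' = "deriv (cdens D x)"])
      (use cdens_C1[OF assms] in auto)
  then show ?thesis by simp
qed

lemma f_up'_nonneg: "0 \<le> f_up' D"
proof -
  interpret X: prob_space X_law by (rule X_law_prob)
  have "\<not> (AE x in X_law. False)" by simp
  then obtain x where "x \<in> cov_support D" using support_AE by (metis (mono_tags, lifting) AE_cong eventually_mono)
  from cdens_C1(3)[OF this, of 0] show ?thesis by linarith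
qed

lemma cont_density_cdens:
  assumes "x \<in> cov_support D" "(\<integral>\<^sup>+ y. ennreal (cdens D x y) \<partial>lborel) = 1"
  shows "cont_density (cdens D x)"
  using assms cdens_C1(1)[OF assms(1)] cdens_nonneg
  by unfold_locales (auto intro: DERIV_isCont)

lemma cdf_eq: "cont_density (cdens D x) \<Longrightarrow> cont_density.F (cdens D x) t = cond_cdf D x t"
  by (simp add: cont_density.F_def cond_cdf_def)

lemma cond_cdf_measurable: "(\<lambda>z. cond_cdf D (fst z) (snd z)) \<in> borel_measurable (XS \<Otimes>\<^sub>M borel)"
proof -
  let ?N = "XS \<Otimes>\<^sub>M (borel :: real measure)"
  have "(\<lambda>w. (fst (fst w), snd w)) \<in> measurable (?N \<Otimes>\<^sub>M lborel) (X_law \<Otimes>\<^sub>M lborel)"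
    by measurable
  from measurable_compose[OF this cdens_measurable]
  have [measurable]: "(\<lambda>w. cdens D (fst (fst w)) (snd w)) \<in> borel_measurable (?N \<Otimes>\<^sub>M lborel)" by simp
  have ind: "(\<lambda>w. indicator {..snd (fst w)} (snd w) :: real) \<in> borel_measurable (?N \<Otimes>\<^sub>M lborel)"
  proof -
    have "(\<lambda>w. indicator {..snd (fst w)} (snd w) :: real) = (\<lambda>w. of_bool (snd w \<le> snd (fst w)))"
      by (auto simp: fun_eq_iff indicator_def)
    also have "\<dots> \<in> borel_measurable (?N \<Otimes>\<^sub>M lborel)" by measurable
    finally show ?thesis .
  qed
  have "(\<lambda>(z, v). indicator {..snd z} v *\<^sub>R cdens D (fst z) v) \<in> borel_measurable (?N \<Otimes>\<^sub>M lborel)"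
    unfolding case_prod_beta using ind by measurable
  from lborel.borel_measurable_lebesgue_integral[OF this]
  show ?thesis by (simp add: cond_cdf_def set_lebesgue_integral_def)
qed

lemma cond_cdf_compose[measurable]:
  assumes [measurable]: "f \<in> measurable N XS" "g \<in> borel_measurable N"
  shows "(\<lambda>z. cond_cdf D (f z) (g z)) \<in> borel_measurable N"
proof -
  have "(\<lambda>z. (f z, g z)) \<in> measurable N (XS \<Otimes>\<^sub>M borel)" by measurable
  from measurable_compose[OF this cond_cdf_measurable] show ?thesis by simp
qed

lemma quantile_AE:
  assumes u: "u \<in> U"
  shows "AE x in X_law. cond_cdf D x (dot p x (coef D u)) = u"
proof -
  have q: "AE \<omega> in P. cond_quantile D u (covar D 0 \<omega>) = dot p (covar D 0 \<omega>) (coef D u)"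
    using D1 u by (simp add: cond_D1_def)
  have m: "covar D 0 \<in> measurable P XS" by simp
  have "AE \<omega> in P. covar D 0 \<omega> \<in> cov_support D" by (rule AE_distrD[OF m support_AE])
  moreover have "AE \<omega> in P. (\<integral>\<^sup>+ y. ennreal (cdens D (covar D 0 \<omega>) y) \<partial>lborel) = 1" by (rule AE_distrD[OF m mass_AE])
  ultimately have "AE \<omega> in P. cond_cdf D (covar D 0 \<omega>) (dot p (covar D 0 \<omega>) (coef D u)) = u"
    using q
  proof eventually_elim
    case (elim \<omega>)
    have cd: "cont_density (cdens D (covar D 0 \<omega>))" using elim by (intro cont_density_cdens)
    from cont_density.F_quantile[OF this, of u] U_props(3)[OF u]
    show ?case using elim(3) by (simp add: cdf_eq[OF cd] cond_quantile_def)
  qed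
  then show ?thesis
  proof (subst AE_distr_iff[OF m])
    show "{x \<in> space XS. cond_cdf D x (dot p x (coef D u)) = u} \<in> sets XS" by measurable
  qed
qed

text \<open>Everything almost sure that is needed of a covariate value, with one null set for all
  quantile indices.\<close>

definition regular :: "(nat \<Rightarrow> real) \<Rightarrow> bool" where
  "regular x \<longleftrightarrow> x \<in> cov_support D \<and> cont_density (cdens D x) \<and>
     (\<forall>u\<in>U. cond_cdf D x (dot p x (coef D u)) = u)"

lemma coef_component_tendsto:
  assumes u: "u \<in> U" and w: "\<And>k. w k \<in> U" "w \<longlonglongrightarrow> u" and j: "j < p"
  shows "(\<lambda>k. coef D (w k) j) \<longlonglongrightarrow> coef D u j"
proof -
  have bound: "\<bar>coef D (w k) j - coef D u j\<bar> \<le> Lip D * \<bar>w k - u\<bar>" for k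
  proof -
    have "\<bar>coef D (w k) j - coef D u j\<bar> \<le> l2norm p (\<lambda>j. coef D (w k) j - coef D u j)"
      unfolding l2norm_eq dot_self_eq real_sqrt_abs[symmetric]
      using j by (intro real_sqrt_le_mono member_le_sum) auto
    also have "\<dots> \<le> Lip D * \<bar>w k - u\<bar>" using D2 u w(1) by (simp add: cond_D2_def)
    finally show ?thesis .
  qed
  have lim: "(\<lambda>k. Lip D * \<bar>w k - u\<bar>) \<longlonglongrightarrow> 0"
    using tendsto_mult[OF tendsto_const[of "Lip D"] tendsto_rabs[OF tendsto_diff[OF w(2) tendsto_const[of u]]]] by simp
  have "\<forall>\<^sub>F k in sequentially. norm (coef D (w k) j - coef D u j) \<le> Lip D * \<bar>w k - u\<bar>"
    using bound by (intro always_eventually) simp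
  then have "(\<lambda>k. coef D (w k) j - coef D u j) \<longlonglongrightarrow> 0" using lim by (rule Lim_null_comparison)
  then show ?thesis by (rule LIM_zero_cancel)
qed

text \<open>The quantile equations hold off a null set that may depend on \<open>u\<close>. They are
  imposed on the countable set \<open>U0\<close> and extended to all of \<open>U\<close> by
  continuity of \<open>F\<close> and of the coefficients, which are Lipschitz by D.2.\<close>

lemma regular_AE: "AE x in X_law. regular x"
proof -
  have "AE x in X_law. \<forall>u\<in>U0. cond_cdf D x (dot p x (coef D u)) = u"
    using quantile_AE U0 by (subst AE_ball_countable) auto
  with support_AE mass_AE show ?thesis
  proof eventually_elim
    case (elim x)
    have cd: "cont_density (cdens D x)" using elim by (intro cont_density_cdens)
    have "cond_cdf D x (dot p x (coef D u)) = u" if u: "u \<in> U" for u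
    proof -
      obtain w where w: "\<And>k. w k \<in> U0" "w \<longlonglongrightarrow> u" using U0_sequence[OF u] by metis
      have "(\<lambda>k. dot p x (coef D (w k))) \<longlonglongrightarrow> dot p x (coef D u)"
        unfolding dot_def using w U0(2)
        by (intro tendsto_sum tendsto_mult tendsto_const coef_component_tendsto u) auto
      then have "(\<lambda>k. cond_cdf D x (dot p x (coef D (w k)))) \<longlonglongrightarrow> cond_cdf D x (dot p x (coef D u))"
        using isCont_tendsto_compose[OF cont_density.F_isCont[OF cd]] by (simp add: cdf_eq[OF cd])
      moreover have "cond_cdf D x (dot p x (coef D (w k))) = w k" for k using elim(3) w by blast
      ultimately show ?thesis using w(2) LIMSEQ_unique by simp
    qed
    then show ?case using elim cd by (simp add: regular_def)
  qed
qed

text \<open>The density and quantile conditions are stated for observation 0; equality of the laws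
  carries them to the others.\<close>

lemma regular_AE_covar: "i < n \<Longrightarrow> AE \<omega> in P. regular (covar D i \<omega>)"
proof -
  assume i: "i < n"
  have "distr P XS (covar D i) = distr (distr P Obs (obs i)) XS snd" if "i < n" for i
    using that by (subst distr_distr) (auto simp: comp_def obs_def)
  then have d: "distr P XS (covar D i) = X_law"
    using distr_obs[OF i] distr_obs[OF n_pos] i n_pos by simp
  have "AE x in distr P XS (covar D i). regular x" unfolding d by (rule regular_AE)
  then show ?thesis by (rule AE_distrD[OF covar_measurable[OF i]])
qed

end

subsection \<open>The pivotal penalty level\<close>

lemma abs_emp_mean_le: "\<bar>emp_mean n f\<bar> \<le> emp_mean n (\<lambda>i. \<bar>f i\<bar>)"
  unfolding emp_mean_def abs_mult by (intro mult_mono sum_abs) auto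

lemma W_of_upper:
  assumes "quantile_indices U" "u \<in> U"
  shows "1 / sqrt (u * (1 - u)) \<le> W_of U"
proof -
  have U: "compact U" "\<And>u. u \<in> U \<Longrightarrow> 0 < u \<and> u < 1" using assms(1) by (auto simp: quantile_indices_def)
  have "continuous_on U (\<lambda>u. 1 / sqrt (u * (1 - u)))"
    by (intro continuous_intros) (use U(2) in force)
  then have "compact ((\<lambda>u. 1 / sqrt (u * (1 - u))) ` U)" using U(1) by (rule compact_continuous_image)
  then have "bdd_above ((\<lambda>u. 1 / sqrt (u * (1 - u))) ` U)"
    by (intro bounded_imp_bdd_above compact_imp_bounded)
  then show ?thesis unfolding W_of_def using assms(2) by (intro cSUP_upper)
qed

lemma W_of_pos:
  assumes "quantile_indices U" shows "0 < W_of U"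
proof -
  have "U \<noteq> {}" "U \<subseteq> {0<..<1}" using assms by (simp_all add: quantile_indices_def)
  then obtain u where u: "u \<in> U" "0 < u" "u < 1" by fastforce
  then have "0 < 1 / sqrt (u * (1 - u))" by simp
  then show ?thesis using W_of_upper[OF assms u(1)] by linarith
qed

context qr_sample
begin

lemma quantile_indices_U: "quantile_indices U"
  using setting by (simp add: qr_setting_def)

abbreviation score :: "(nat \<Rightarrow> nat \<Rightarrow> real) \<Rightarrow> (nat \<Rightarrow> real) \<Rightarrow> nat \<Rightarrow> real \<Rightarrow> real" where
  "score X v j u \<equiv>
     \<bar>emp_mean n (\<lambda>i. X i j * (u - of_bool (v i \<le> u)) / (sigma_hat n X j * sqrt (u * (1 - u))))\<bar>"

text \<open>A bound without \<open>u\<close>, so that the real supremum over \<open>U\<close> is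
  genuine. Designs with \<open>sigma_hat n X j = 0\<close> are covered, both sides being 0.\<close>

lemma score_le:
  assumes u: "u \<in> U"
  shows "score X v j u \<le> emp_mean n (\<lambda>i. \<bar>X i j / sigma_hat n X j\<bar>) * W_of U"
proof -
  have u01: "0 < u" "u < 1" using U_props(3)[OF u] by auto
  have "score X v j u \<le> emp_mean n (\<lambda>i. \<bar>X i j * (u - of_bool (v i \<le> u)) / (sigma_hat n X j * sqrt (u * (1 - u)))\<bar>)"
    by (rule abs_emp_mean_le)
  also have "\<dots> \<le> emp_mean n (\<lambda>i. \<bar>X i j / sigma_hat n X j\<bar> * W_of U)"
  proof (rule emp_mean_mono)
    fix i
    have "\<bar>X i j * (u - of_bool (v i \<le> u)) / (sigma_hat n X j * sqrt (u * (1 - u)))\<bar>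
        = \<bar>X i j / sigma_hat n X j\<bar> * (\<bar>u - of_bool (v i \<le> u)\<bar> * (1 / sqrt (u * (1 - u))))"
      using u01 by (simp add: abs_mult)
    also have "\<dots> \<le> \<bar>X i j / sigma_hat n X j\<bar> * (1 * W_of U)"
      using u01 W_of_upper[OF quantile_indices_U u]
      by (intro mult_left_mono mult_mono) auto
    finally show "\<bar>X i j * (u - of_bool (v i \<le> u)) / (sigma_hat n X j * sqrt (u * (1 - u)))\<bar>
        \<le> \<bar>X i j / sigma_hat n X j\<bar> * W_of U" by simp
  qed
  also have "\<dots> = emp_mean n (\<lambda>i. \<bar>X i j / sigma_hat n X j\<bar>) * W_of U"
    by (simp add: emp_mean_def sum_distrib_right)
  finally show ?thesis .
qed

lemma lessThan_p: "finite {..<p}" "{..<p} \<noteq> {}"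
  using p_pos by (auto simp del: p_pos)

lemma max_score_bdd: "bdd_above ((\<lambda>u. MAX j\<in>{..<p}. score X v j u) ` U)"
proof (rule bdd_aboveI2)
  fix u assume u: "u \<in> U"
  show "(MAX j\<in>{..<p}. score X v j u) \<le> (MAX j\<in>{..<p}. emp_mean n (\<lambda>i. \<bar>X i j / sigma_hat n X j\<bar>) * W_of U)"
  proof (rule Max.boundedI)
    fix a assume "a \<in> (\<lambda>j. score X v j u) ` {..<p}"
    then obtain j where j: "j \<in> {..<p}" "a = score X v j u" by auto
    have "a \<le> emp_mean n (\<lambda>i. \<bar>X i j / sigma_hat n X j\<bar>) * W_of U" unfolding j(2) by (rule score_le[OF u])
    also have "\<dots> \<le> (MAX j\<in>{..<p}. emp_mean n (\<lambda>i. \<bar>X i j / sigma_hat n X j\<bar>) * W_of U)"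
      using j(1) by (intro Max_ge) auto
    finally show "a \<le> (MAX j\<in>{..<p}. emp_mean n (\<lambda>i. \<bar>X i j / sigma_hat n X j\<bar>) * W_of U)" .
  qed (use lessThan_p in auto)
qed

lemma score_le_Lambda:
  assumes "u \<in> U" "j < p"
  shows "real n * score X v j u \<le> Lambda_stat U n p X v"
proof -
  have "score X v j u \<le> (MAX j\<in>{..<p}. score X v j u)" using assms by (intro Max_ge) auto
  also have "\<dots> \<le> (SUP u\<in>U. MAX j\<in>{..<p}. score X v j u)"
    using assms(1) max_score_bdd by (rule cSUP_upper)
  finally show ?thesis unfolding Lambda_stat_def by (intro mult_left_mono) auto
qed

lemma Lambda_nonneg: "0 \<le> Lambda_stat U n p X v"
proof -
  obtain u where "u \<in> U" using U_props(2) by auto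
  from score_le_Lambda[OF this p_pos, of X v] show ?thesis
    by (rule order_trans[rotated]) simp
qed

text \<open>The score is right continuous in \<open>u\<close> because
  \<open>of_bool (v i \<le> u)\<close> is, so \<open>U0\<close> suffices. A supremum over a
  countable set is measurable.\<close>

lemma Lambda_countable:
  "Lambda_stat U n p X v = real n * (SUP u\<in>U0. MAX j\<in>{..<p}. score X v j u)"
proof -
  let ?h = "\<lambda>u. MAX j\<in>{..<p}. score X v j u"
  have bdd0: "bdd_above (?h ` U0)"
    using max_score_bdd by (rule bdd_above_mono) (use U0(2) in auto)
  have "(SUP u\<in>U. ?h u) \<le> (SUP u\<in>U0. ?h u)"
  proof (rule cSUP_least[OF U_props(2)])
    fix u assume u: "u \<in> U"
    have "?h u \<in> (\<lambda>j. score X v j u) ` {..<p}" using lessThan_p by (intro Max_in) auto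
    then obtain j where j: "j \<in> {..<p}" "?h u = score X v j u" by auto
    obtain w where w: "\<And>k. w k \<in> U0" "\<And>k. u \<le> w k" "w \<longlonglongrightarrow> u" using U0_sequence[OF u] by metis
    have pos: "sqrt (u * (1 - u)) \<noteq> 0" using U_props(3)[OF u] by simp
    have lim: "(\<lambda>k. (w k - of_bool (v i \<le> w k)) / sqrt (w k * (1 - w k)))
        \<longlonglongrightarrow> (u - of_bool (v i \<le> u)) / sqrt (u * (1 - u))" for i
      by (intro tendsto_divide tendsto_diff tendsto_real_sqrt tendsto_mult tendsto_const
          of_bool_le_tendsto w(3) pos w(2))
    have "(\<lambda>k. score X v j (w k)) \<longlonglongrightarrow> score X v j u"
      unfolding emp_mean_def times_divide_times_eq[symmetric]
      by (intro tendsto_rabs tendsto_mult tendsto_sum tendsto_const lim)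
    moreover have "score X v j (w k) \<le> (SUP u\<in>U0. ?h u)" for k
    proof -
      have "score X v j (w k) \<le> ?h (w k)" using j by (intro Max_ge) auto
      also have "\<dots> \<le> (SUP u\<in>U0. ?h u)" using w(1) bdd0 by (rule cSUP_upper)
      finally show ?thesis .
    qed
    ultimately show "?h u \<le> (SUP u\<in>U0. ?h u)" unfolding j(2) by (intro LIMSEQ_le_const2) auto
  qed
  moreover have "(SUP u\<in>U0. ?h u) \<le> (SUP u\<in>U. ?h u)"
    by (rule cSUP_subset_mono[OF U0_nonempty max_score_bdd U0(2)]) simp
  ultimately show ?thesis unfolding Lambda_stat_def by simp
qed

abbreviation "PX \<equiv> PiM {..<n} (\<lambda>_. X_law)"
abbreviation "PU \<equiv> PiM {..<n} (\<lambda>_. uniform01)"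

lemma PX_prob: "prob_space PX" and PU_prob: "prob_space PU"
  using X_law_prob prob_space_uniform01 by (auto intro!: prob_space_PiM)

lemma Lambda_measurable:
  "(\<lambda>z. Lambda_stat U n p (fst z) (snd z)) \<in> borel_measurable (PX \<Otimes>\<^sub>M PU)"
proof -
  have X[measurable]: "(\<lambda>z. fst z i j) \<in> borel_measurable (PX \<Otimes>\<^sub>M PU)" if "i < n" "j < p" for i j
  proof -
    have "(\<lambda>z. fst z i) \<in> measurable (PX \<Otimes>\<^sub>M PU) X_law"
      using that by (intro measurable_compose[OF measurable_fst] measurable_component_singleton) auto
    then have "(\<lambda>z. fst z i) \<in> measurable (PX \<Otimes>\<^sub>M PU) XS" by simp
    from measurable_compose[OF this XS_component[OF that(2)]] show ?thesis .
  qed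
  have v[measurable]: "(\<lambda>z. snd z i) \<in> borel_measurable (PX \<Otimes>\<^sub>M PU)" if "i < n" for i
  proof -
    have "(\<lambda>z. snd z i) \<in> measurable (PX \<Otimes>\<^sub>M PU) uniform01"
      using that by (intro measurable_compose[OF measurable_snd] measurable_component_singleton) auto
    moreover have "sets uniform01 = sets (borel :: real measure)" by simp
    ultimately show ?thesis using measurable_cong_sets[OF refl] by blast
  qed
  have s: "(\<lambda>z. score (fst z) (snd z) j u) \<in> borel_measurable (PX \<Otimes>\<^sub>M PU)" if [simp]: "j < p" for j u
    unfolding emp_mean_def sigma_hat_def
    by (intro borel_measurable_abs borel_measurable_times borel_measurable_const borel_measurable_sum
        borel_measurable_divide borel_measurable_power borel_measurable_diff
        measurable_compose[OF _ borel_measurable_sqrt] X) 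
      (use v in \<open>auto intro!: measurable_If simp: of_bool_def\<close>)
  show ?thesis
    unfolding Lambda_countable
  proof (intro borel_measurable_times borel_measurable_const borel_measurable_cSUP U0(1))
    fix u assume "u \<in> U0"
    show "(\<lambda>z. MAX j\<in>{..<p}. score (fst z) (snd z) j u) \<in> borel_measurable (PX \<Otimes>\<^sub>M PU)"
      by (intro borel_measurable_Max s) auto
  next
    fix z
    show "bdd_above ((\<lambda>u. MAX j\<in>{..<p}. score (fst z) (snd z) j u) ` U0)"
      using max_score_bdd by (rule bdd_above_mono) (use U0(2) in auto)
  qed
qed

section \<open>The pivotal property\<close>

text \<open>The conditional probability integral transform of an observation; it takes the place of
  the uniform variable in the definition of the penalty.\<close>

definition V :: "nat \<Rightarrow> 'a \<Rightarrow> real" where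
  "V i \<omega> = cond_cdf D (covar D i \<omega>) (resp D i \<omega>)"

definition pit :: "real \<times> (nat \<Rightarrow> real) \<Rightarrow> (nat \<Rightarrow> real) \<times> real" where
  "pit z = (snd z, cond_cdf D (snd z) (fst z))"

lemma pit_measurable[measurable]: "pit \<in> measurable Obs (XS \<Otimes>\<^sub>M borel)"
  unfolding pit_def[abs_def] by measurable

lemma pit_obs: "pit (obs i \<omega>) = (covar D i \<omega>, V i \<omega>)"
  by (simp add: pit_def obs_def V_def)

text \<open>Given the covariates the transform is uniform whatever their value. The joint law is
  therefore a product, which contains the independence from the design.\<close>

lemma distr_pit: "distr law (XS \<Otimes>\<^sub>M borel) pit = X_law \<Otimes>\<^sub>M uniform01"
proof (rule measure_eqI)
  interpret X: prob_space X_law by (rule X_law_prob)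
  interpret Un: prob_space uniform01 by (rule prob_space_uniform01)
  show sets: "sets (distr law (XS \<Otimes>\<^sub>M borel) pit) = sets (X_law \<Otimes>\<^sub>M uniform01)"
    unfolding sets_distr by (intro sets_pair_measure_cong) auto
  fix A assume "A \<in> sets (distr law (XS \<Otimes>\<^sub>M borel) pit)"
  then have A[measurable]: "A \<in> sets (XS \<Otimes>\<^sub>M borel)" by simp
  have AU: "A \<in> sets (X_law \<Otimes>\<^sub>M uniform01)" using A sets by simp
  have A2: "A \<in> sets (X_law \<Otimes>\<^sub>M lborel)"
    using A by (subst sets_pair_measure_cong[of X_law XS lborel borel]) auto
  have pm: "pit \<in> measurable law (XS \<Otimes>\<^sub>M borel)" by measurable
  define g where "g z = (indicator A (fst z, cond_cdf D (fst z) (snd z)) :: ennreal)" for z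
  have gm: "g \<in> borel_measurable (X_law \<Otimes>\<^sub>M lborel)"
  proof -
    have "(\<lambda>z. (fst z, cond_cdf D (fst z) (snd z))) \<in> measurable (X_law \<Otimes>\<^sub>M lborel) (XS \<Otimes>\<^sub>M borel)"
      by measurable
    from measurable_compose[OF this borel_measurable_indicator[OF A]] show ?thesis by (simp add: g_def[abs_def])
  qed
  have "emeasure (distr law (XS \<Otimes>\<^sub>M borel) pit) A = (\<integral>\<^sup>+ z. indicator A z \<partial>distr law (XS \<Otimes>\<^sub>M borel) pit)"
    by simp
  also have "\<dots> = (\<integral>\<^sup>+ z. indicator A (pit z) \<partial>law)"
    by (rule nn_integral_distr[OF pm]) simp
  also have "\<dots> = (\<integral>\<^sup>+ \<omega>. indicator A (pit (obs 0 \<omega>)) \<partial>P)"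
    unfolding law_def by (rule nn_integral_distr) (auto intro!: measurable_compose[OF pit_measurable])
  also have "\<dots> = (\<integral>\<^sup>+ \<omega>. g (covar D 0 \<omega>, resp D 0 \<omega>) \<partial>P)"
    by (simp add: pit_obs V_def g_def)
  also have "\<dots> = (\<integral>\<^sup>+ z. (case z of (x, y) \<Rightarrow> ennreal (cdens D x y)) * g z \<partial>(X_law \<Otimes>\<^sub>M lborel))"
    by (rule distributed_nn_integral[OF obs_distributed gm, symmetric])
  also have "\<dots> = (\<integral>\<^sup>+ x. (\<integral>\<^sup>+ y. ennreal (cdens D x y) * g (x, y) \<partial>lborel) \<partial>X_law)"
    using gm by (subst lborel.nn_integral_fst[symmetric]) auto
  also have "\<dots> = (\<integral>\<^sup>+ x. (\<integral>\<^sup>+ v. indicator A (x, v) \<partial>uniform01) \<partial>X_law)"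
  proof (rule nn_integral_cong_AE)
    have "AE x in X_law. x \<in> space XS" using AE_space[of X_law] by simp
    with regular_AE
    show "AE x in X_law. (\<integral>\<^sup>+ y. ennreal (cdens D x y) * g (x, y) \<partial>lborel) = (\<integral>\<^sup>+ v. indicator A (x, v) \<partial>uniform01)"
    proof eventually_elim
      case (elim x)
      interpret cd: cont_density "cdens D x" using elim(1) by (simp add: regular_def)
      have F: "cd.F = cond_cdf D x" using cdf_eq[OF cd.cont_density_axioms] by auto
      have sec: "(\<lambda>v. indicator A (x, v) :: ennreal) \<in> borel_measurable borel"
        using elim(2) by (intro measurable_compose[OF measurable_Pair1' borel_measurable_indicator[OF A]]) simp
      have Fm: "cd.F \<in> measurable cd.law_y borel"
        using cd.F_isCont by (simp, intro borel_measurable_continuous_onI continuous_at_imp_continuous_on) auto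
      have gx: "(\<lambda>y. g (x, y)) \<in> borel_measurable lborel"
        using measurable_compose[OF Fm sec] by (simp add: g_def F)
      have "(\<integral>\<^sup>+ y. ennreal (cdens D x y) * g (x, y) \<partial>lborel) = (\<integral>\<^sup>+ y. g (x, y) \<partial>cd.law_y)"
        using gx by (subst nn_integral_density) auto
      also have "\<dots> = (\<integral>\<^sup>+ y. indicator A (x, cd.F y) \<partial>cd.law_y)" by (simp add: g_def F)
      also have "\<dots> = (\<integral>\<^sup>+ v. indicator A (x, v) \<partial>distr cd.law_y borel cd.F)"
        using sec by (intro nn_integral_distr[OF Fm, symmetric]) simp
      finally show ?case unfolding cd.distr_F .
    qed
  qed
  also have "\<dots> = emeasure (X_law \<Otimes>\<^sub>M uniform01) A"
    using AU by (subst Un.nn_integral_fst) auto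
  finally show "emeasure (distr law (XS \<Otimes>\<^sub>M borel) pit) A = emeasure (X_law \<Otimes>\<^sub>M uniform01) A" .
qed

lemma distr_pivot:
  "(\<lambda>\<omega>. (design D \<omega>, \<lambda>i\<in>{..<n}. V i \<omega>)) \<in> measurable P (PX \<Otimes>\<^sub>M PU)" (is "?m \<in> _")
  "distr P (PX \<Otimes>\<^sub>M PU) (\<lambda>\<omega>. (design D \<omega>, \<lambda>i\<in>{..<n}. V i \<omega>)) = PX \<Otimes>\<^sub>M PU"
proof -
  let ?N = "X_law \<Otimes>\<^sub>M uniform01"
  let ?PZ = "PiM {..<n} (\<lambda>_. ?N)"
  have setsN: "sets ?N = sets (XS \<Otimes>\<^sub>M borel)" by (intro sets_pair_measure_cong) auto
  have ne: "{..<n} \<noteq> {}" using n_pos by (auto simp del: n_pos)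
  define Z where "Z \<omega> = (\<lambda>i\<in>{..<n}. pit (obs i \<omega>))" for \<omega>
  have pm: "pit \<in> measurable Obs ?N" using pit_measurable measurable_cong_sets[OF refl setsN] by blast
  have po: "(\<lambda>\<omega>. pit (obs i \<omega>)) \<in> measurable P ?N" if "i < n" for i
    by (rule measurable_compose[OF obs_measurable[OF that] pm])
  have Zm: "Z \<in> measurable P ?PZ" unfolding Z_def using po by (intro measurable_restrict) auto
  have ind: "indep_vars (\<lambda>_. ?N) (\<lambda>i \<omega>. pit (obs i \<omega>)) {..<n}"
    using indep_vars_compose[OF obs_indep, of "\<lambda>_. pit" "\<lambda>_. ?N"] pm by (simp add: comp_def)
  have d1: "distr P ?N (\<lambda>\<omega>. pit (obs i \<omega>)) = ?N" if i: "i < n" for i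
  proof -
    have "distr P ?N (\<lambda>\<omega>. pit (obs i \<omega>)) = distr (distr P Obs (obs i)) ?N pit"
      using distr_distr[OF pm obs_measurable[OF i]] by (simp add: comp_def)
    also have "\<dots> = distr law (XS \<Otimes>\<^sub>M borel) pit"
      unfolding distr_obs[OF i] by (intro distr_cong refl setsN)
    finally show ?thesis unfolding distr_pit .
  qed
  have dZ: "distr P ?PZ Z = ?PZ"
  proof -
    have "distr P ?PZ Z = PiM {..<n} (\<lambda>i. distr P ?N (\<lambda>\<omega>. pit (obs i \<omega>)))"
      unfolding Z_def[abs_def]
      by (rule indep_vars_iff_distr_eq_PiM'[THEN iffD1, OF ne _ ind]) (use po in auto)
    also have "\<dots> = ?PZ" by (intro PiM_cong refl) (simp add: d1)
    finally show ?thesis .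
  qed
  \<comment> \<open>The pairs are jointly a product over observations, whereas design and uniforms
    are needed as two separate vectors; \<open>distr_zip_PiM\<close> identifies the two
    arrangements.\<close>
  let ?zip = "\<lambda>z. \<lambda>i\<in>{..<n}. (fst z i, snd z i)"
  let ?unzip = "\<lambda>z. (\<lambda>i\<in>{..<n}. fst (z i), \<lambda>i\<in>{..<n}. snd (z i))"
  have zm: "?zip \<in> measurable (PX \<Otimes>\<^sub>M PU) ?PZ"
    by (intro measurable_restrict measurable_Pair measurable_compose[OF measurable_fst]
        measurable_compose[OF measurable_snd] measurable_component_singleton)
  have um: "?unzip \<in> measurable ?PZ (PX \<Otimes>\<^sub>M PU)"
    by (intro measurable_Pair measurable_restrict measurable_compose[OF measurable_component_singleton]
        measurable_fst measurable_snd)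
  have eq: "(\<lambda>\<omega>. (design D \<omega>, \<lambda>i\<in>{..<n}. V i \<omega>)) = ?unzip \<circ> Z"
    by (auto simp: fun_eq_iff Z_def pit_obs design_def)
  show "?m \<in> measurable P (PX \<Otimes>\<^sub>M PU)" unfolding eq by (rule measurable_comp[OF Zm um])
  have "distr P (PX \<Otimes>\<^sub>M PU) (?unzip \<circ> Z) = distr (distr P ?PZ Z) (PX \<Otimes>\<^sub>M PU) ?unzip"
    by (rule distr_distr[OF um Zm, symmetric])
  also have "\<dots> = distr (distr (PX \<Otimes>\<^sub>M PU) ?PZ ?zip) (PX \<Otimes>\<^sub>M PU) ?unzip"
    unfolding dZ distr_zip_PiM[OF X_law_prob prob_space_uniform01 finite_lessThan] ..
  also have "\<dots> = distr (PX \<Otimes>\<^sub>M PU) (PX \<Otimes>\<^sub>M PU) (?unzip \<circ> ?zip)"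
    by (rule distr_distr[OF um zm])
  also have "\<dots> = distr (PX \<Otimes>\<^sub>M PU) (PX \<Otimes>\<^sub>M PU) (\<lambda>z. z)"
  proof (intro distr_cong refl)
    fix z assume "z \<in> space (PX \<Otimes>\<^sub>M PU)"
    then have "fst z \<in> extensional {..<n}" "snd z \<in> extensional {..<n}"
      by (auto simp: space_pair_measure space_PiM PiE_def)
    then show "(?unzip \<circ> ?zip) z = z"
      by (cases z) (auto simp: fun_eq_iff extensional_def)
  qed
  also have "\<dots> = PX \<Otimes>\<^sub>M PU" by simp
  finally show "distr P (PX \<Otimes>\<^sub>M PU) ?m = PX \<Otimes>\<^sub>M PU" unfolding eq .
qed

lemma PU_eq: "iid_uniform n = PU"
  by (simp add: iid_uniform_def)

lemma Lambda_section: "X \<in> space PX \<Longrightarrow> (\<lambda>v. Lambda_stat U n p X v) \<in> borel_measurable PU"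
  using measurable_compose[OF measurable_Pair1' Lambda_measurable] by simp

lemma Lambda_quantile_le_iff:
  assumes "X \<in> space PX" "0 < \<alpha>" "\<alpha> < 1"
  shows "Lambda_quantile U n p X (1 - \<alpha>) \<le> t \<longleftrightarrow>
    1 - \<alpha> \<le> measure PU {v \<in> space PU. Lambda_stat U n p X v \<le> t}"
proof -
  interpret PU: prob_space PU by (rule PU_prob)
  show ?thesis
    unfolding Lambda_quantile_def PU_eq
    using PU.quantile_le_iff[OF Lambda_section[OF assms(1)], of "1 - \<alpha>" t] assms(2,3) by simp
qed

lemma design_space: "\<omega> \<in> space P \<Longrightarrow> design D \<omega> \<in> space PX"
  using measurable_space[OF distr_pivot(1)] by (auto simp: space_pair_measure)

text \<open>The statistic is nonnegative and stays below its quantile with positive probability.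
  This is the source of a nonnegative penalty.\<close>

lemma Lambda_quantile_nonneg:
  assumes "\<omega> \<in> space P" "0 < \<alpha>" "\<alpha> < 1"
  shows "0 \<le> Lambda_quantile U n p (design D \<omega>) (1 - \<alpha>)"
proof -
  interpret PU: prob_space PU by (rule PU_prob)
  let ?q = "Lambda_quantile U n p (design D \<omega>) (1 - \<alpha>)"
  have "1 - \<alpha> \<le> measure PU {v \<in> space PU. Lambda_stat U n p (design D \<omega>) v \<le> ?q}"
    using Lambda_quantile_le_iff[OF design_space[OF assms(1)] assms(2,3), of ?q] by simp
  then have "{v \<in> space PU. Lambda_stat U n p (design D \<omega>) v \<le> ?q} \<noteq> {}" using assms by force
  then show ?thesis using Lambda_nonneg order_trans by blast
qed

text \<open>For each fixed design the statistic stays below its quantile with probability at least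
  \<open>1 - \<alpha>\<close>; Fubini averages this over the design.\<close>

lemma pivot_event:
  assumes \<alpha>: "0 < \<alpha>" "\<alpha> < 1"
  obtains E where "E \<in> sets P" "1 - \<alpha> \<le> measure P E"
    "\<And>\<omega>. \<omega> \<in> E \<Longrightarrow> Lambda_stat U n p (design D \<omega>) (\<lambda>i\<in>{..<n}. V i \<omega>)
       \<le> Lambda_quantile U n p (design D \<omega>) (1 - \<alpha>)"
proof -
  interpret PX: prob_space PX by (rule PX_prob)
  interpret PU: prob_space PU by (rule PU_prob)
  interpret PP: pair_prob_space PX PU ..
  let ?L = "\<lambda>X v. Lambda_stat U n p X v" and ?q = "\<lambda>X. Lambda_quantile U n p X (1 - \<alpha>)"
  \<comment> \<open>By \<open>Lambda_quantile_le_iff\<close> a sublevel set of the quantile is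
    described by a section probability, which is measurable in the design.\<close>
  have qm: "?q \<in> borel_measurable PX"
  proof (rule borel_measurableI_le)
    fix t
    have m: "{z \<in> space (PX \<Otimes>\<^sub>M PU). ?L (fst z) (snd z) \<le> t} \<in> sets (PX \<Otimes>\<^sub>M PU)"
      using Lambda_measurable by measurable
    have "(\<lambda>X. emeasure PU (Pair X -` {z \<in> space (PX \<Otimes>\<^sub>M PU). ?L (fst z) (snd z) \<le> t})) \<in> borel_measurable PX"
      by (rule PU.measurable_emeasure_Pair[OF m])
    then have mm: "(\<lambda>X. measure PU (Pair X -` {z \<in> space (PX \<Otimes>\<^sub>M PU). ?L (fst z) (snd z) \<le> t})) \<in> borel_measurable PX"
      unfolding measure_def by measurable
    have "{X \<in> space PX. ?q X \<le> t} = {X \<in> space PX. 1 - \<alpha> \<le> measure PU (Pair X -` {z \<in> space (PX \<Otimes>\<^sub>M PU). ?L (fst z) (snd z) \<le> t})}"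
    proof (intro Collect_cong conj_cong refl)
      fix X assume X: "X \<in> space PX"
      have "Pair X -` {z \<in> space (PX \<Otimes>\<^sub>M PU). ?L (fst z) (snd z) \<le> t} = {v \<in> space PU. ?L X v \<le> t}"
        using X by (auto simp: space_pair_measure)
      then show "?q X \<le> t \<longleftrightarrow> 1 - \<alpha> \<le> measure PU (Pair X -` {z \<in> space (PX \<Otimes>\<^sub>M PU). ?L (fst z) (snd z) \<le> t})"
        using Lambda_quantile_le_iff[OF X \<alpha>] by simp
    qed
    also have "\<dots> \<in> sets PX" using mm by measurable
    finally show "{X \<in> space PX. ?q X \<le> t} \<in> sets PX" .
  qed
  define S where "S = {z \<in> space (PX \<Otimes>\<^sub>M PU). ?L (fst z) (snd z) \<le> ?q (fst z)}"
  have qf: "(\<lambda>z. ?q (fst z)) \<in> borel_measurable (PX \<Otimes>\<^sub>M PU)"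
    by (rule measurable_compose[OF measurable_fst qm])
  have Sm: "S \<in> sets (PX \<Otimes>\<^sub>M PU)" unfolding S_def using Lambda_measurable qf by measurable
  have "ennreal (1 - \<alpha>) = (\<integral>\<^sup>+ X. ennreal (1 - \<alpha>) \<partial>PX)" by (simp add: PX.emeasure_space_1)
  also have "\<dots> \<le> (\<integral>\<^sup>+ X. emeasure PU (Pair X -` S) \<partial>PX)"
  proof (rule nn_integral_mono)
    fix X assume X: "X \<in> space PX"
    have "Pair X -` S = {v \<in> space PU. ?L X v \<le> ?q X}" using X by (auto simp: S_def space_pair_measure)
    then show "ennreal (1 - \<alpha>) \<le> emeasure PU (Pair X -` S)"
      using Lambda_quantile_le_iff[OF X \<alpha>, of "?q X"] by (simp add: PU.emeasure_eq_measure)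
  qed
  also have "\<dots> = emeasure (PX \<Otimes>\<^sub>M PU) S" by (rule PU.emeasure_pair_measure_alt[OF Sm, symmetric])
  finally have "1 - \<alpha> \<le> measure (PX \<Otimes>\<^sub>M PU) S" by (simp add: PP.P.emeasure_eq_measure)
  also have "\<dots> = measure (distr P (PX \<Otimes>\<^sub>M PU) (\<lambda>\<omega>. (design D \<omega>, \<lambda>i\<in>{..<n}. V i \<omega>))) S"
    by (simp only: distr_pivot(2))
  also have "\<dots> = measure P ((\<lambda>\<omega>. (design D \<omega>, \<lambda>i\<in>{..<n}. V i \<omega>)) -` S \<inter> space P)"
    by (rule measure_distr[OF distr_pivot(1) Sm])
  finally show thesis
    using measurable_sets[OF distr_pivot(1) Sm] by (intro that) (auto simp: S_def)
qed

text \<open>Turns the indicators in the score into those of the residuals. One direction is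
  monotonicity of \<open>F\<close>; the other needs \<open>F_strict\<close>, hence the positive
  lower bound of the density.\<close>

lemma V_le_iff:
  assumes reg: "regular (covar D i \<omega>)" and u: "u \<in> U"
  shows "V i \<omega> \<le> u \<longleftrightarrow> resp D i \<omega> \<le> dot p (covar D i \<omega>) (coef D u)"
proof -
  let ?x = "covar D i \<omega>" and ?q = "dot p (covar D i \<omega>) (coef D u)"
  interpret cd: cont_density "cdens D ?x" using reg by (simp add: regular_def)
  have F: "cd.F t = cond_cdf D ?x t" for t by (rule cdf_eq[OF cd.cont_density_axioms])
  have Fq: "cd.F ?q = u" using reg u by (simp add: regular_def F)
  have "f_lo D < cdens D ?x ?q" using reg u cdens_C1(4) by (simp add: regular_def)
  moreover have "0 < f_lo D" using D1 by (simp add: cond_D1_def)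
  ultimately have pos: "0 < cdens D ?x ?q" by simp
  show ?thesis
    unfolding V_def F[symmetric]
    using cd.F_mono[of "resp D i \<omega>" ?q] cd.F_strict[OF Fq pos, of "resp D i \<omega>"] Fq
    by (cases "resp D i \<omega> \<le> ?q") auto
qed

end

subsection \<open>Minorization of the expected loss\<close>

lemma check_loss_convex:
  assumes "0 \<le> c" "c \<le> 1"
  shows "check_loss u (e - c * v) - check_loss u e \<le> c * (check_loss u (e - v) - check_loss u e)"
proof -
  have "max (c * v - e) 0 \<le> c * max (v - e) 0 + (1 - c) * max (- e) 0"
  proof (rule max.boundedI)
    have "c * (v - e) \<le> c * max (v - e) 0" "(1 - c) * (- e) \<le> (1 - c) * max (- e) 0"
      using assms by (intro mult_left_mono; simp)+
    then show "c * v - e \<le> c * max (v - e) 0 + (1 - c) * max (- e) 0"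
      by (simp add: algebra_simps)
    show "0 \<le> c * max (v - e) 0 + (1 - c) * max (- e) 0"
      using assms by (intro add_nonneg_nonneg mult_nonneg_nonneg) auto
  qed
  then show ?thesis by (simp add: check_loss_eq algebra_simps)
qed

lemma check_loss_diff_measurable:
  "(\<lambda>y. check_loss u (y - a - v) - check_loss u (y - a)) \<in> borel_measurable borel"
  unfolding check_loss_eq by measurable

context qr_sample
begin

lemma f_lo_pos: "0 < f_lo D"
  using D1 by (simp add: cond_D1_def)

definition fq :: "real \<Rightarrow> 'a \<Rightarrow> real" where
  "fq u \<omega> = cdens D (covar D 0 \<omega>) (dot p (covar D 0 \<omega>) (coef D u))"

lemma fq_measurable[measurable]: "fq u \<in> borel_measurable P"
proof -
  have "(\<lambda>\<omega>. (covar D 0 \<omega>, dot p (covar D 0 \<omega>) (coef D u))) \<in> measurable P (X_law \<Otimes>\<^sub>M lborel)"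
    using covar_measurable[OF n_pos] covar_dot[OF n_pos] by (intro measurable_Pair) simp_all
  from measurable_compose[OF this cdens_measurable] show ?thesis by (simp add: fq_def[abs_def])
qed

lemma fq_bounds:
  assumes u: "u \<in> U"
  shows "AE \<omega> in P. f_lo D \<le> fq u \<omega> \<and> \<bar>fq u \<omega>\<bar> \<le> f_up D"
  using regular_AE_covar[OF n_pos]
proof eventually_elim
  case (elim \<omega>)
  then have "covar D 0 \<omega> \<in> cov_support D" by (simp add: regular_def)
  from cdens_C1(2)[OF this] cdens_C1(4)[OF this u] show ?case by (simp add: fq_def less_imp_le)
qed

lemma fq_weighted_integrable:
  assumes "u \<in> U" "integrable P h"
  shows "integrable P (\<lambda>\<omega>. fq u \<omega> * h \<omega>)"
proof (rule Bochner_Integration.integrable_bound)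
  show "integrable P (\<lambda>\<omega>. f_up D * h \<omega>)" using assms(2) by (rule integrable_mult_right)
  have [measurable]: "h \<in> borel_measurable P" using assms(2) by (rule borel_measurable_integrable)
  show "(\<lambda>\<omega>. fq u \<omega> * h \<omega>) \<in> borel_measurable P" by measurable
  show "AE \<omega> in P. norm (fq u \<omega> * h \<omega>) \<le> norm (f_up D * h \<omega>)"
    using fq_bounds[OF assms(1)]
  proof eventually_elim
    case (elim \<omega>)
    then have "\<bar>fq u \<omega>\<bar> \<le> \<bar>f_up D\<bar>" by linarith
    then show ?case by (simp add: abs_mult mult_right_mono)
  qed
qed

definition J_quad :: "real \<Rightarrow> (nat \<Rightarrow> real) \<Rightarrow> real" where
  "J_quad u d = (\<integral>\<omega>. fq u \<omega> * (dot p (covar D 0 \<omega>) d)\<^sup>2 \<partial>P)"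

lemma J_mat_quad:
  assumes u: "u \<in> U"
  shows "dot p d (matvec p (J_mat D u) d) = J_quad u d"
proof -
  have int: "integrable P (\<lambda>\<omega>. d j * d k * (fq u \<omega> * (covar D 0 \<omega> j * covar D 0 \<omega> k)))"
    if "j < p" "k < p" for j k
    using that by (intro integrable_mult_right fq_weighted_integrable[OF u] covar_prod_integrable)
  have "J_quad u d = (\<integral>\<omega>. (\<Sum>j<p. \<Sum>k<p. d j * d k * (fq u \<omega> * (covar D 0 \<omega> j * covar D 0 \<omega> k))) \<partial>P)"
    unfolding J_quad_def dot_sq_expand sum_distrib_left by (simp only: mult.left_commute)
  also have "\<dots> = (\<Sum>j<p. \<integral>\<omega>. (\<Sum>k<p. d j * d k * (fq u \<omega> * (covar D 0 \<omega> j * covar D 0 \<omega> k))) \<partial>P)"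
    using int by (intro Bochner_Integration.integral_sum Bochner_Integration.integrable_sum) auto
  also have "\<dots> = (\<Sum>j<p. \<Sum>k<p. \<integral>\<omega>. d j * d k * (fq u \<omega> * (covar D 0 \<omega> j * covar D 0 \<omega> k)) \<partial>P)"
    using int by (intro sum.cong refl Bochner_Integration.integral_sum) auto
  also have "\<dots> = (\<Sum>j<p. \<Sum>k<p. d j * d k * J_mat D u j k)"
    unfolding J_mat_def fq_def by (intro sum.cong refl) (simp add: mult.assoc)
  also have "\<dots> = dot p d (matvec p (J_mat D u) d)"
    by (simp add: dot_def matvec_def sum_distrib_left mult_ac)
  finally show ?thesis by simp
qed

lemma J_quad_ge:
  assumes u: "u \<in> U"
  shows "f_lo D * moment2 d \<le> J_quad u d"
proof -
  have "f_lo D * moment2 d = (\<integral>\<omega>. f_lo D * (dot p (covar D 0 \<omega>) d)\<^sup>2 \<partial>P)" by (simp add: moment2_def)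
  also have "\<dots> \<le> J_quad u d"
    unfolding J_quad_def
  proof (rule integral_mono_AE)
    show "integrable P (\<lambda>\<omega>. f_lo D * (dot p (covar D 0 \<omega>) d)\<^sup>2)" by (intro integrable_mult_right dot_sq_integrable)
    show "integrable P (\<lambda>\<omega>. fq u \<omega> * (dot p (covar D 0 \<omega>) d)\<^sup>2)" by (intro fq_weighted_integrable[OF u] dot_sq_integrable)
    show "AE \<omega> in P. f_lo D * (dot p (covar D 0 \<omega>) d)\<^sup>2 \<le> fq u \<omega> * (dot p (covar D 0 \<omega>) d)\<^sup>2"
      using fq_bounds[OF u] by eventually_elim (auto intro: mult_right_mono)
  qed
  finally show ?thesis .
qed

text \<open>Positive semidefiniteness of \<open>J_mat\<close> guarantees that the chosen root
  exists; from here on only the quadratic form is used.\<close>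

lemma J_norm_eq:
  assumes u: "u \<in> U"
  shows "J_norm D u d = sqrt (J_quad u d)"
proof -
  have "0 \<le> J_quad u v" for v
    using J_quad_ge[OF u, of v] mult_nonneg_nonneg[OF less_imp_le[OF f_lo_pos] moment2_nonneg[of v]] by linarith
  moreover have "J_mat D u i j = J_mat D u j i" for i j by (simp add: J_mat_def mult_ac)
  ultimately have "psd p (J_mat D u)" by (simp add: psd_def J_mat_quad[OF u])
  then show ?thesis unfolding J_norm_def by (simp add: norm_psd_root J_mat_quad[OF u])
qed

lemma J_norm_sq:
  assumes u: "u \<in> U"
  shows "0 \<le> J_norm D u d" "(J_norm D u d)\<^sup>2 = J_quad u d" "f_lo D * moment2 d \<le> (J_norm D u d)\<^sup>2"
proof -
  have "0 \<le> J_quad u d"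
    using J_quad_ge[OF u, of d] mult_nonneg_nonneg[OF less_imp_le[OF f_lo_pos] moment2_nonneg[of d]] by linarith
  then show "0 \<le> J_norm D u d" "(J_norm D u d)\<^sup>2 = J_quad u d" "f_lo D * moment2 d \<le> (J_norm D u d)\<^sup>2"
    using J_quad_ge[OF u, of d] by (simp_all add: J_norm_eq[OF u])
qed

text \<open>The lower bound of the density at the quantile, and the origin of the factors
  \<open>sqrt (f_lo D)\<close> in the denominators.\<close>

lemma J_norm_ge:
  assumes u: "u \<in> U"
  shows "sqrt (f_lo D) * sqrt (moment2 d) \<le> J_norm D u d"
proof -
  have "sqrt (f_lo D * moment2 d) \<le> sqrt ((J_norm D u d)\<^sup>2)"
    using J_norm_sq(3)[OF u, of d] by (rule real_sqrt_le_mono)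
  then show ?thesis using J_norm_sq(1)[OF u, of d] by (simp add: real_sqrt_mult)
qed

lemma dot_scale: "dot p x (\<lambda>j. c * d j) = c * dot p x d"
  by (simp add: dot_def sum_distrib_left mult.left_commute)

lemma J_norm_scale:
  assumes u: "u \<in> U" and c: "0 \<le> c"
  shows "J_norm D u (\<lambda>j. c * d j) = c * J_norm D u d"
proof -
  have "J_quad u (\<lambda>j. c * d j) = c\<^sup>2 * J_quad u d"
  proof -
    have e: "fq u \<omega> * (dot p (covar D 0 \<omega>) (\<lambda>j. c * d j))\<^sup>2 = c\<^sup>2 * (fq u \<omega> * (dot p (covar D 0 \<omega>) d)\<^sup>2)" for \<omega>
      by (simp add: dot_scale power_mult_distrib)
    show ?thesis unfolding J_quad_def e by simp
  qed
  then show ?thesis using c by (simp add: J_norm_eq[OF u] real_sqrt_mult)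
qed

lemma abs_moment2: "abs_moment D 2 d = moment2 d"
  by (simp add: abs_moment_def moment2_def)

lemma loss_difference_integrable:
  assumes "u \<in> U"
  shows "integrable P (\<lambda>\<omega>. check_loss u (resp D 0 \<omega> - dot p (covar D 0 \<omega>) (\<lambda>j. coef D u j + d j))
         - check_loss u (resp D 0 \<omega> - dot p (covar D 0 \<omega>) (coef D u)))"
proof (rule Bochner_Integration.integrable_bound[OF dot_integrable[of d]])
  have u01: "0 < u" "u < 1" using U_props(3)[OF assms] by auto
  have [measurable]: "(\<lambda>\<omega>. dot p (covar D 0 \<omega>) v) \<in> borel_measurable P" for v by simp
  have [measurable]: "resp D 0 \<in> borel_measurable P" by simp
  show "(\<lambda>\<omega>. check_loss u (resp D 0 \<omega> - dot p (covar D 0 \<omega>) (\<lambda>j. coef D u j + d j))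
         - check_loss u (resp D 0 \<omega> - dot p (covar D 0 \<omega>) (coef D u))) \<in> borel_measurable P"
    unfolding check_loss_eq by measurable
  have "\<bar>check_loss u (y - dot p x (\<lambda>j. coef D u j + d j)) - check_loss u (y - dot p x (coef D u))\<bar> \<le> \<bar>dot p x d\<bar>" for x y
    using check_loss_diff_le[OF u01, of "y - dot p x (coef D u)" "dot p x d"]
    by (simp add: dot_add_right algebra_simps)
  then show "AE \<omega> in P. norm (check_loss u (resp D 0 \<omega> - dot p (covar D 0 \<omega>) (\<lambda>j. coef D u j + d j))
         - check_loss u (resp D 0 \<omega> - dot p (covar D 0 \<omega>) (coef D u))) \<le> norm (dot p (covar D 0 \<omega>) d)"
    by (auto intro!: AE_I2)
qed

section \<open>Quadratic and linear lower bounds\<close>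

text \<open>Disintegration with respect to the covariates, then \<open>loss_expansion\<close> at
  each covariate value with the bound on the derivative of the density as Lipschitz
  constant.\<close>

lemma loss_increment_expansion:
  assumes u: "u \<in> U" and int3: "integrable P (\<lambda>\<omega>. \<bar>dot p (covar D 0 \<omega>) d\<bar> ^ 3)"
  shows "J_quad u d / 2 - f_up' D * abs_moment D 3 d / 6 \<le> loss_increment D u d"
proof -
  interpret X: prob_space X_law by (rule X_law_prob)
  interpret XL: pair_sigma_finite X_law lborel ..
  have u01: "0 < u" "u < 1" using U_props(3)[OF u] by auto
  let ?a = "\<lambda>x. dot p x (coef D u)" and ?v = "\<lambda>x. dot p x d"
  define h where "h x y = check_loss u (y - ?a x - ?v x) - check_loss u (y - ?a x)" for x y
  have hm: "(\<lambda>z. h (fst z) (snd z)) \<in> borel_measurable (X_law \<Otimes>\<^sub>M lborel)"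
  proof -
    have [measurable]: "(\<lambda>x. dot p x b) \<in> borel_measurable X_law" for b by simp
    show ?thesis unfolding h_def check_loss_eq by measurable
  qed
  have dist: "distributed P (X_law \<Otimes>\<^sub>M lborel) (\<lambda>\<omega>. (covar D 0 \<omega>, resp D 0 \<omega>))
      (\<lambda>z. ennreal (case z of (x, y) \<Rightarrow> cdens D x y))"
    using obs_distributed by (simp add: case_prod_unfold)
  have h_eq: "h (covar D 0 \<omega>) (resp D 0 \<omega>) = check_loss u (resp D 0 \<omega> - dot p (covar D 0 \<omega>) (\<lambda>j. coef D u j + d j))
         - check_loss u (resp D 0 \<omega> - dot p (covar D 0 \<omega>) (coef D u))" for \<omega>
    by (simp add: h_def dot_add_right algebra_simps)
  have intP: "integrable P (\<lambda>\<omega>. h (covar D 0 \<omega>) (resp D 0 \<omega>))"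
    unfolding h_eq by (rule loss_difference_integrable[OF u])
  have nn: "0 \<le> (case z of (x, y) \<Rightarrow> cdens D x y)" for z by (simp add: case_prod_beta cdens_nonneg)
  have int: "integrable (X_law \<Otimes>\<^sub>M lborel) (\<lambda>z. (case z of (x, y) \<Rightarrow> cdens D x y) * h (fst z) (snd z))"
    using distributed_integrable[OF dist hm nn] intP by simp
  have "loss_increment D u d = (\<integral>\<omega>. h (covar D 0 \<omega>) (resp D 0 \<omega>) \<partial>P)"
    unfolding loss_increment_def h_eq ..
  also have "\<dots> = (\<integral>z. (case z of (x, y) \<Rightarrow> cdens D x y) * h (fst z) (snd z) \<partial>(X_law \<Otimes>\<^sub>M lborel))"
    using distributed_integral[OF dist hm nn] by simp
  also have "\<dots> = (\<integral>x. (\<integral>y. cdens D x y * h x y \<partial>lborel) \<partial>X_law)"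
    using XL.integral_fst'[OF int] by simp
  finally have inc: "loss_increment D u d = (\<integral>x. (\<integral>y. cdens D x y * h x y \<partial>lborel) \<partial>X_law)" .
  let ?low = "\<lambda>x. (?v x)\<^sup>2 * cdens D x (?a x) / 2 - f_up' D * \<bar>?v x\<bar> ^ 3 / 6"
  have lowm: "?low \<in> borel_measurable X_law"
  proof -
    have [measurable]: "(\<lambda>x. dot p x b) \<in> borel_measurable X_law" for b by simp
    have "(\<lambda>x. (x, ?a x)) \<in> measurable X_law (X_law \<Otimes>\<^sub>M lborel)" by (intro measurable_Pair) simp_all
    from measurable_compose[OF this cdens_measurable]
    have [measurable]: "(\<lambda>x. cdens D x (?a x)) \<in> borel_measurable X_law" by simp
    show ?thesis by measurable
  qed
  have i2: "integrable P (\<lambda>\<omega>. fq u \<omega> * (dot p (covar D 0 \<omega>) d)\<^sup>2)"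
    by (rule fq_weighted_integrable[OF u dot_sq_integrable])
  have low_eq: "?low (covar D 0 \<omega>) = fq u \<omega> * (dot p (covar D 0 \<omega>) d)\<^sup>2 / 2 - f_up' D * \<bar>dot p (covar D 0 \<omega>) d\<bar> ^ 3 / 6" for \<omega>
    by (simp add: fq_def mult.commute)
  have lowP: "integrable P (\<lambda>\<omega>. ?low (covar D 0 \<omega>))"
    unfolding low_eq using i2 int3 by (intro Bochner_Integration.integrable_diff) simp_all
  have covm: "covar D 0 \<in> measurable P XS" by simp
  have low_int: "integrable X_law ?low" using lowP lowm covm by (subst integrable_distr_eq) simp_all
  have "J_quad u d / 2 - f_up' D * abs_moment D 3 d / 6 = (\<integral>\<omega>. ?low (covar D 0 \<omega>) \<partial>P)"
    unfolding low_eq using i2 int3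
    by (subst Bochner_Integration.integral_diff) (simp_all add: J_quad_def abs_moment_def)
  also have "\<dots> = (\<integral>x. ?low x \<partial>X_law)" using lowm covm by (subst integral_distr) simp_all
  also have "\<dots> \<le> (\<integral>x. (\<integral>y. cdens D x y * h x y \<partial>lborel) \<partial>X_law)"
  proof (rule integral_mono_AE[OF low_int])
    show "integrable X_law (\<lambda>x. \<integral>y. cdens D x y * h x y \<partial>lborel)" using XL.integrable_fst'[OF int] by simp
    show "AE x in X_law. ?low x \<le> (\<integral>y. cdens D x y * h x y \<partial>lborel)"
      using regular_AE
    proof eventually_elim
      case (elim x)
      interpret cd: cont_density "cdens D x" using elim by (simp add: regular_def)
      have F: "cd.F (?a x) = u" using elim u cdf_eq[OF cd.cont_density_axioms] by (simp add: regular_def)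
      have "(?v x)\<^sup>2 * cdens D x (?a x) / 2 - f_up' D * \<bar>?v x\<bar> ^ 3 / 6 \<le> (\<integral>y. h x y \<partial>cd.law_y)"
        unfolding h_def using elim
        by (intro cd.loss_expansion u01 F cdens_lipschitz f_up'_nonneg) (simp add: regular_def)
      also have "(\<integral>y. h x y \<partial>cd.law_y) = (\<integral>y. cdens D x y * h x y \<partial>lborel)"
      proof (subst integral_density)
        show "(\<lambda>y. h x y) \<in> borel_measurable lborel" unfolding h_def using check_loss_diff_measurable by simp
      qed (auto simp: cdens_nonneg)
      finally show ?case .
    qed
  qed
  finally show ?thesis unfolding inc .
qed

lemma loss_increment_convex:
  assumes u: "u \<in> U" and c: "0 \<le> c" "c \<le> 1"
  shows "loss_increment D u (\<lambda>j. c * d j) \<le> c * loss_increment D u d"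
proof -
  have "loss_increment D u (\<lambda>j. c * d j) \<le> (\<integral>\<omega>. c * (check_loss u (resp D 0 \<omega> - dot p (covar D 0 \<omega>) (\<lambda>j. coef D u j + d j))
         - check_loss u (resp D 0 \<omega> - dot p (covar D 0 \<omega>) (coef D u))) \<partial>P)"
    unfolding loss_increment_def
  proof (rule integral_mono[OF loss_difference_integrable[OF u] integrable_mult_right[OF loss_difference_integrable[OF u]]])
    fix \<omega>
    show "check_loss u (resp D 0 \<omega> - dot p (covar D 0 \<omega>) (\<lambda>j. coef D u j + c * d j))
         - check_loss u (resp D 0 \<omega> - dot p (covar D 0 \<omega>) (coef D u))
       \<le> c * (check_loss u (resp D 0 \<omega> - dot p (covar D 0 \<omega>) (\<lambda>j. coef D u j + d j))
         - check_loss u (resp D 0 \<omega> - dot p (covar D 0 \<omega>) (coef D u)))"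
      using check_loss_convex[OF c, of u "resp D 0 \<omega> - dot p (covar D 0 \<omega>) (coef D u)" "dot p (covar D 0 \<omega>) d"]
      by (simp add: dot_add_right dot_scale diff_diff_eq)
  qed
  then show ?thesis by (simp add: loss_increment_def)
qed

text \<open>The linear bound continues the quadratic one by convexity of the loss.\<close>

lemma loss_increment_minorized:
  assumes u: "u \<in> U" and q: "0 < q" and B: "0 < f_up' D"
    and ratio: "q \<le> 3 / 8 * (f_lo D powr (3 / 2) / f_up' D) * moment_ratio D d"
  shows "J_norm D u d \<le> 4 * q \<Longrightarrow> (J_norm D u d)\<^sup>2 / 4 \<le> loss_increment D u d"
    and "4 * q < J_norm D u d \<Longrightarrow> q * J_norm D u d \<le> loss_increment D u d"
proof -
  let ?J = "\<lambda>d. J_norm D u d"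
  let ?m3 = "abs_moment D 3 d"
  have m3_nonneg: "0 \<le> ?m3" by (simp add: abs_moment_def)
  have c0: "0 \<le> 3 / 8 * (f_lo D powr (3 / 2) / f_up' D)" using B by simp
  \<comment> \<open>A positive ratio excludes a zero denominator, and thereby both a vanishing and
    an infinite third moment, since the latter integrates to 0.\<close>
  have "moment_ratio D d \<noteq> 0" using ratio q by auto
  then have m3_ne: "?m3 \<noteq> 0" by (auto simp: moment_ratio_def)
  then have m3: "0 < ?m3" using m3_nonneg by simp
  have int3: "integrable P (\<lambda>\<omega>. \<bar>dot p (covar D 0 \<omega>) d\<bar> ^ 3)"
    using m3_ne not_integrable_integral_eq unfolding abs_moment_def by blast
  have J3: "f_lo D powr (3 / 2) * moment2 d powr (3 / 2) \<le> (?J d) ^ 3"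
  proof -
    have "f_lo D powr (3 / 2) * moment2 d powr (3 / 2) = (f_lo D * moment2 d) powr (3 / 2)"
      using f_lo_pos moment2_nonneg by (simp add: powr_mult)
    also have "\<dots> \<le> ((?J d)\<^sup>2) powr (3 / 2)"
      using J_norm_sq(3)[OF u, of d] f_lo_pos moment2_nonneg by (intro powr_mono2) auto
    also have "\<dots> = (?J d) ^ 3"
    proof (cases "?J d = 0")
      case False
      then have pos: "0 < ?J d" using J_norm_sq(1)[OF u, of d] by simp
      then have "((?J d)\<^sup>2) powr (3 / 2) = ((?J d) powr 2) powr (3 / 2)" by simp
      also have "\<dots> = (?J d) powr 3" by (simp add: powr_powr)
      also have "\<dots> = (?J d) ^ 3" using pos by simp
      finally show ?thesis .
    qed simp
    finally show ?thesis .
  qed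
  \<comment> \<open>The 3/8 in the definition of the ratio is tuned to this: for a norm of at most
    \<open>4 * q\<close> the cubic remainder is at most a quarter of the squared norm, half of the
    quadratic term.\<close>
  have third: "q * (f_up' D * ?m3) \<le> 3 / 8 * (?J d) ^ 3"
  proof -
    have "q * (f_up' D * ?m3) \<le> 3 / 8 * (f_lo D powr (3 / 2) / f_up' D) * moment_ratio D d * (f_up' D * ?m3)"
      using ratio m3 B by (intro mult_right_mono) auto
    also have "\<dots> = 3 / 8 * (f_lo D powr (3 / 2) * moment2 d powr (3 / 2))"
      using m3 B by (simp add: moment_ratio_def abs_moment2 field_simps)
    also have "\<dots> \<le> 3 / 8 * (?J d) ^ 3" using J3 by simp
    finally show ?thesis .
  qed
  have scaled: "(?J (\<lambda>j. c * d j))\<^sup>2 / 4 \<le> loss_increment D u (\<lambda>j. c * d j)"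
    if c: "0 \<le> c" and small: "?J (\<lambda>j. c * d j) \<le> 4 * q" for c
  proof -
    let ?e = "\<lambda>j. c * d j"
    have inte: "integrable P (\<lambda>\<omega>. \<bar>dot p (covar D 0 \<omega>) ?e\<bar> ^ 3)"
      using int3 by (simp add: dot_scale abs_mult power_mult_distrib)
    have m3e: "abs_moment D 3 ?e = c ^ 3 * ?m3"
      using c by (simp add: abs_moment_def dot_scale abs_mult power_mult_distrib)
    have Je: "?J ?e = c * ?J d" by (rule J_norm_scale[OF u c])
    have "q * (f_up' D * abs_moment D 3 ?e) = c ^ 3 * (q * (f_up' D * ?m3))"
      unfolding m3e by simp
    also have "\<dots> \<le> c ^ 3 * (3 / 8 * (?J d) ^ 3)" using third c by (intro mult_left_mono) auto
    also have "\<dots> = 3 / 8 * (?J ?e) ^ 3" by (simp add: Je power_mult_distrib)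
    also have "\<dots> = 3 / 8 * ((?J ?e)\<^sup>2 * ?J ?e)" by (simp add: power2_eq_square power3_eq_cube)
    also have "\<dots> \<le> 3 / 8 * ((?J ?e)\<^sup>2 * (4 * q))" using small by (intro mult_left_mono) auto
    also have "\<dots> = q * (3 / 2 * (?J ?e)\<^sup>2)" by simp
    finally have "f_up' D * abs_moment D 3 ?e \<le> 3 / 2 * (?J ?e)\<^sup>2" using q by (simp add: mult_le_cancel_left_pos)
    then have "(?J ?e)\<^sup>2 / 4 \<le> J_quad u ?e / 2 - f_up' D * abs_moment D 3 ?e / 6"
      using J_norm_sq(2)[OF u, of ?e] by simp
    also have "\<dots> \<le> loss_increment D u ?e" by (rule loss_increment_expansion[OF u inte])
    finally show ?thesis .
  qed
  show "(?J d)\<^sup>2 / 4 \<le> loss_increment D u d" if "?J d \<le> 4 * q"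
    using scaled[of 1] that by simp
  show "q * ?J d \<le> loss_increment D u d" if big: "4 * q < ?J d"
  proof -
    \<comment> \<open>Shrinks the error to norm \<open>4 * q\<close>, where the quadratic and the
      linear bound have the common value \<open>4 * q\<^sup>2\<close>.\<close>
    define c where "c = 4 * q / ?J d"
    have Jpos: "0 < ?J d" using big q by simp
    have c: "0 < c" "c \<le> 1" using big q Jpos by (simp_all add: c_def)
    have Je: "?J (\<lambda>j. c * d j) = 4 * q" using J_norm_scale[OF u, of c d] c Jpos by (simp add: c_def)
    have "(4 * q)\<^sup>2 / 4 \<le> loss_increment D u (\<lambda>j. c * d j)" using scaled[of c] c Je by simp
    also have "\<dots> \<le> c * loss_increment D u d" using c by (intro loss_increment_convex[OF u]) auto
    finally have "c * (q * ?J d) \<le> c * loss_increment D u d"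
      using Jpos by (simp add: c_def power2_eq_square)
    then show ?thesis using c by simp
  qed
qed

section \<open>Inequalities extracted from the infima in D.4 and D.5\<close>

lemma q_sparse_link:
  assumes D5: "cond_D5 D m" and u: "u \<in> U" and d: "d \<in> A_sparse D u m" "nonzero p d"
  shows "0 < f_up' D" "0 < q_sparse D m"
    "q_sparse D m \<le> 3 / 8 * (f_lo D powr (3 / 2) / f_up' D) * moment_ratio D d"
proof -
  define c where "c = 3 / 8 * (f_lo D powr (3 / 2) / f_up' D)"
  define I where "I = (INF u\<in>U. INF \<delta>\<in>{\<delta> \<in> A_sparse D u m. nonzero p \<delta>}. ereal (moment_ratio D \<delta>))"
  have q: "q_sparse_const D m = ereal c * I" by (simp add: q_sparse_const_def c_def I_def)
  have pos: "0 < ereal c * I" using D5 by (simp add: cond_D5_def q)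
  \<comment> \<open>If \<open>f_up' D\<close> were 0, the prefactor would be 0 because
    \<open>x / 0 = 0\<close>, and so would the product, even with an infinite infimum; positivity in
    D.5 excludes this.\<close>
  have "c \<noteq> 0" using pos by (auto simp: zero_ereal_def[symmetric])
  then have "f_up' D \<noteq> 0" by (auto simp: c_def)
  then show B: "0 < f_up' D" using f_up'_nonneg by simp
  have c: "0 < c" using B f_lo_pos by (simp add: c_def)
  have "I \<le> (INF \<delta>\<in>{\<delta> \<in> A_sparse D u m. nonzero p \<delta>}. ereal (moment_ratio D \<delta>))"
    unfolding I_def by (rule INF_lower[OF u])
  also have "\<dots> \<le> ereal (moment_ratio D d)" using d by (intro INF_lower) auto
  finally have le: "I \<le> ereal (moment_ratio D d)" .
  obtain r where r: "I = ereal r"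
  proof (cases I)
    case PInf
    then show thesis using le by simp
  next
    case MInf
    then show thesis using pos c by simp
  qed
  have "q_sparse D m = c * r" by (simp add: q_sparse_def q r)
  moreover have "0 < c * r" using pos by (simp add: r)
  moreover have "c * r \<le> c * moment_ratio D d" using le c by (simp add: r)
  ultimately show "0 < q_sparse D m" "q_sparse D m \<le> 3 / 8 * (f_lo D powr (3 / 2) / f_up' D) * moment_ratio D d"
    by (simp_all only: c_def)
qed

lemma kappa_sparse_link:
  assumes D5: "cond_D5 D m" and u: "u \<in> U" and d: "d \<in> A_sparse D u m" "nonzero p d"
  shows "0 < kappa_sparse D m" "kappa_sparse D m * l2norm p d \<le> sqrt (moment2 d)"
proof -
  have pos: "0 < kappa_sparse_sq D m" using D5 by (simp add: cond_D5_def)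
  have "kappa_sparse_sq D m \<le> (INF \<delta>\<in>{\<delta> \<in> A_sparse D u m. nonzero p \<delta>}.
        ereal (dot p \<delta> (matvec p (gram D) \<delta>) / dot p \<delta> \<delta>))"
    unfolding kappa_sparse_sq_def by (rule INF_lower[OF u])
  also have "\<dots> \<le> ereal (dot p d (matvec p (gram D) d) / dot p d d)" using d by (intro INF_lower) auto
  finally have le: "kappa_sparse_sq D m \<le> ereal (moment2 d / dot p d d)" by (simp add: gram_quad)
  then obtain r where r: "kappa_sparse_sq D m = ereal r" using pos by (cases "kappa_sparse_sq D m") auto
  have k: "kappa_sparse D m = sqrt r" by (simp add: kappa_sparse_def r)
  have rp: "0 < r" using pos r by simp
  then show "0 < kappa_sparse D m" by (simp add: k)
  have "r * dot p d d \<le> moment2 d" using le r dot_self_pos[OF d(2)] by (simp add: pos_le_divide_eq)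
  then have "sqrt (r * dot p d d) \<le> sqrt (moment2 d)" by simp
  then show "kappa_sparse D m * l2norm p d \<le> sqrt (moment2 d)" by (simp add: k l2norm_eq real_sqrt_mult)
qed

lemma l1norm_restr_zero: "l1norm p (restr T d) = 0 \<Longrightarrow> j < p \<Longrightarrow> j \<in> T \<Longrightarrow> d j = 0"
proof -
  assume z: "l1norm p (restr T d) = 0" and j: "j < p" "j \<in> T"
  have "\<bar>restr T d j\<bar> \<le> l1norm p (restr T d)"
    unfolding l1norm_def using j by (intro member_le_sum) auto
  then show "d j = 0" using z j by (simp add: restr_def)
qed

text \<open>Inside the cone, vanishing on the support forces vanishing off it. Hence the quotients
  defining \<open>kappa_sq\<close> have nonzero denominators.\<close>

lemma l2norm_restr_pos:
  assumes "d \<in> A_cone D u" "nonzero p d"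
  shows "0 < l2norm p (restr (Tset D u) d)"
proof (rule ccontr)
  assume "\<not> 0 < l2norm p (restr (Tset D u) d)"
  moreover have "0 \<le> l2norm p (restr (Tset D u) d)" by (simp add: l2norm_eq dot_self_nonneg)
  ultimately have "\<not> nonzero p (restr (Tset D u) d)"
    using dot_self_pos[of p "restr (Tset D u) d"] by (auto simp: l2norm_eq)
  then have T0: "l1norm p (restr (Tset D u) d) = 0" by (auto simp: l1norm_def nonzero_def)
  have "0 \<le> l1norm p (restr (- Tset D u) d)" by (simp add: l1norm_def sum_nonneg)
  then have "l1norm p (restr (- Tset D u) d) = 0" using assms(1) T0 by (simp add: A_cone_def)
  then have "d j = 0" if "j < p" for j
    using l1norm_restr_zero[OF T0 that] l1norm_restr_zero[of "- Tset D u" d j] that by blast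
  then show False using assms(2) by (auto simp: nonzero_def)
qed

text \<open>D.4 asserts positivity for \<open>m\<close>. Enlarging the index set enlarges the
  denominator, so the infimum for 0 is at least as large.\<close>

lemma kappa0_pos:
  assumes D4: "cond_D4 D"
  shows "0 < kappa0 D" "kappa_sq D 0 = ereal ((kappa0 D)\<^sup>2)"
proof -
  have "kappa_sq D (kap_m D) \<le> kappa_sq D 0"
    unfolding kappa_sq_def
  proof (intro INF_mono bexI)
    fix u \<delta> assume u: "u \<in> U" and d: "\<delta> \<in> {\<delta> \<in> A_cone D u. nonzero p \<delta>}"
    have p1: "0 < l2norm p (restr (Tset D u) \<delta>)" using l2norm_restr_pos d by auto
    have p2: "l2norm p (restr (Tset D u) \<delta>) \<le> l2norm p (restr (Tset D u \<union> T_largest D u \<delta> (kap_m D)) \<delta>)"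
      unfolding l2norm_eq dot_self_eq by (intro real_sqrt_le_mono sum_mono) (auto simp: restr_def)
    have "T_largest D u \<delta> 0 = {}" by (simp add: T_largest_def)
    then show "ereal (dot p \<delta> (matvec p (gram D) \<delta>) / (l2norm p (restr (Tset D u \<union> T_largest D u \<delta> (kap_m D)) \<delta>))\<^sup>2)
       \<le> ereal (dot p \<delta> (matvec p (gram D) \<delta>) / (l2norm p (restr (Tset D u \<union> T_largest D u \<delta> 0) \<delta>))\<^sup>2)"
      using p1 p2 by (auto simp: gram_quad moment2_nonneg intro!: divide_left_mono power_mono mult_pos_pos)
  qed auto
  then have "0 < kappa_sq D 0" using D4 by (auto simp: cond_D4_def)
  moreover have "kappa_sq D 0 < \<infinity>" using D4 by (simp add: cond_D4_def)
  ultimately obtain r where r: "kappa_sq D 0 = ereal r" "0 < r" by (cases "kappa_sq D 0") auto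
  then show "0 < kappa0 D" "kappa_sq D 0 = ereal ((kappa0 D)\<^sup>2)" by (simp_all add: kappa0_def)
qed

lemma kappa0_link:
  assumes D4: "cond_D4 D" and u: "u \<in> U" and d: "d \<in> A_cone D u"
  shows "kappa0 D * l2norm p (restr (Tset D u) d) \<le> sqrt (moment2 d)"
proof (cases "nonzero p d")
  case False
  then have "\<not> nonzero p (restr (Tset D u) d)" by (auto simp: nonzero_def restr_def)
  then have "l2norm p (restr (Tset D u) d) = 0" by (simp add: l2norm_eq dot_not_nonzero)
  then show ?thesis by (simp add: moment2_nonneg)
next
  case True
  have pos: "0 < l2norm p (restr (Tset D u) d)" by (rule l2norm_restr_pos[OF d True])
  have "T_largest D u d 0 = {}" by (simp add: T_largest_def)
  have "kappa_sq D 0 \<le> (INF \<delta>\<in>{\<delta> \<in> A_cone D u. nonzero p \<delta>}.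
        ereal (dot p \<delta> (matvec p (gram D) \<delta>) / (l2norm p (restr (Tset D u \<union> T_largest D u \<delta> 0) \<delta>))\<^sup>2))"
    unfolding kappa_sq_def by (rule INF_lower[OF u])
  also have "\<dots> \<le> ereal (dot p d (matvec p (gram D) d) / (l2norm p (restr (Tset D u \<union> T_largest D u d 0) d))\<^sup>2)"
    using d True by (intro INF_lower) auto
  finally have "(kappa0 D)\<^sup>2 \<le> moment2 d / (l2norm p (restr (Tset D u) d))\<^sup>2"
    using kappa0_pos(2)[OF D4] \<open>T_largest D u d 0 = {}\<close> by (simp add: gram_quad)
  then have "(kappa0 D * l2norm p (restr (Tset D u) d))\<^sup>2 \<le> moment2 d"
    using pos by (simp add: pos_le_divide_eq power_mult_distrib)
  then show ?thesis by (rule real_le_rsqrt)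
qed

text \<open>If every \<open>T\<^sub>u\<close> were empty, the cone would be trivial and \<open>\<kappa>\<^sub>0\<close> infinite.\<close>

lemma support_nonempty:
  assumes D4: "cond_D4 D"
  obtains u d where "u \<in> U" "\<And>m. d \<in> A_sparse D u m" "nonzero p d"
proof -
  have "\<exists>u\<in>U. \<exists>\<delta>. \<delta> \<in> A_cone D u \<and> nonzero p \<delta>"
  proof (rule ccontr)
    assume "\<not> ?thesis"
    then have "\<infinity> \<le> kappa_sq D 0"
      unfolding kappa_sq_def by (intro INF_greatest) blast
    then show False using D4 by (simp add: cond_D4_def)
  qed
  then obtain u \<delta> where u: "u \<in> U" and \<delta>: "\<delta> \<in> A_cone D u" "nonzero p \<delta>" by blast
  let ?d = "restr (Tset D u) \<delta>"
  have "0 < dot p ?d ?d" using l2norm_restr_pos[OF \<delta>] by (simp add: l2norm_eq)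
  then have "nonzero p ?d" using dot_not_nonzero by force
  moreover have "supp p (restr (- Tset D u) ?d) = {}" by (auto simp: supp_def restr_def)
  then have "?d \<in> A_sparse D u m" for m by (simp add: A_sparse_def l0norm_def)
  ultimately show thesis using u that by blast
qed

end

subsection \<open>The penalized estimator\<close>

lemma abs_add_small:
  fixes x h :: real
  assumes "\<bar>h\<bar> \<le> \<bar>x\<bar>" shows "\<bar>x + h\<bar> = \<bar>x\<bar> + h * sgn x"
  using assms by (auto simp: sgn_if abs_if split: if_splits)

text \<open>With more than \<open>n\<close> nonzero components, some nonzero \<open>d\<close> on the
  support is annihilated by the design. A basic solution excludes this dependence directly. For a
  unique minimizer the objective is affine along \<open>d\<close> near \<open>b\<close>, hence
  constant there by minimality, so a second minimizer appears.\<close>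

lemma penalized_estimate_sparse:
  assumes "penalized_estimate n p y X lam u b"
  shows "card (supp p b) \<le> n"
proof (rule ccontr)
  assume "\<not> card (supp p b) \<le> n"
  then have big: "card {..<n} < card (supp p b)" by simp
  have fin: "finite (supp p b)" by (simp add: supp_def)
  obtain d where d: "\<exists>j\<in>supp p b. d j \<noteq> 0" "\<forall>j. j \<notin> supp p b \<longrightarrow> d j = 0"
      "\<forall>i\<in>{..<n}. (\<Sum>j\<in>supp p b. X i j * d j) = 0"
    using homogeneous_system_nontrivial[OF _ fin big, of X] by auto
  have Xd: "dot p (X i) d = 0" if "i < n" for i
  proof -
    have "dot p (X i) d = (\<Sum>j\<in>supp p b. X i j * d j)"
      unfolding dot_def using d(2) by (intro sum.mono_neutral_right) (auto simp: supp_def)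
    then show ?thesis using d(3) that by simp
  qed
  obtain k where k: "k \<in> supp p b" "d k \<noteq> 0" using d(1) by blast
  have kp: "k < p" using k by (simp add: supp_def)
  have am: "is_arg_min (pen_loss n p y X lam u) (\<lambda>_. True) b" using assms by (simp add: penalized_estimate_def)
  consider (unique) "\<forall>b'. is_arg_min (pen_loss n p y X lam u) (\<lambda>_. True) b' \<longrightarrow> (\<forall>j<p. b' j = b j)"
    | (basic) xip xim bp bm where "lp_basic n p X (xip, xim, bp, bm)" "\<forall>j<p. b j = bp j - bm j"
    using assms unfolding penalized_estimate_def by blast
  then show False
  proof cases
    case unique
    \<comment> \<open>Small enough that no component changes sign along the segment, which makes the
      penalty affine; the summand 1 avoids division by zero.\<close>
    define r where "r = (MIN j\<in>supp p b. \<bar>b j\<bar> / (1 + \<bar>d j\<bar>))"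
    have r: "0 < r"
      unfolding r_def using fin k by (subst Min_gr_iff) (auto simp: supp_def)
    have small: "\<bar>e * d j\<bar> \<le> \<bar>b j\<bar>" if "\<bar>e\<bar> \<le> r" for e j
    proof (cases "j \<in> supp p b")
      case True
      have "\<bar>e\<bar> \<le> \<bar>b j\<bar> / (1 + \<bar>d j\<bar>)"
        using that fin True unfolding r_def by (meson Min_le finite_imageI image_eqI order_trans)
      then have "\<bar>e\<bar> * (1 + \<bar>d j\<bar>) \<le> \<bar>b j\<bar>" by (simp add: pos_le_divide_eq)
      then show ?thesis by (simp add: abs_mult distrib_left)
    next
      case False
      then show ?thesis using d(2) by simp
    qed
    define S where "S = lam * sqrt (u * (1 - u)) / real n * (\<Sum>j<p. sigma_hat n X j * (d j * sgn (b j)))"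
    have shift: "pen_loss n p y X lam u (\<lambda>j. b j + e * d j) = pen_loss n p y X lam u b + e * S"
      if e: "\<bar>e\<bar> \<le> r" for e
    proof -
      have dot: "dot p (X i) (\<lambda>j. b j + e * d j) = dot p (X i) b" if "i < n" for i
        using Xd[OF that] by (simp add: dot_add_right) (simp add: dot_def sum_distrib_left[symmetric] mult.left_commute)
      then have "emp_loss n p y X u (\<lambda>j. b j + e * d j) = emp_loss n p y X u b"
        unfolding emp_loss_def by (intro emp_mean_cong) simp
      moreover have "(\<Sum>j<p. sigma_hat n X j * \<bar>b j + e * d j\<bar>)
          = (\<Sum>j<p. sigma_hat n X j * \<bar>b j\<bar>) + e * (\<Sum>j<p. sigma_hat n X j * (d j * sgn (b j)))"
        using small[OF e] by (simp add: abs_add_small distrib_left sum.distrib sum_distrib_left mult_ac)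
      ultimately show ?thesis by (simp add: pen_loss_def S_def algebra_simps)
    qed
    have min: "pen_loss n p y X lam u b \<le> pen_loss n p y X lam u b'" for b'
      using am by (auto simp: is_arg_min_def not_less)
    have "0 \<le> r * S" "0 \<le> - r * S"
      using min[of "\<lambda>j. b j + r * d j"] shift[of r] min[of "\<lambda>j. b j + - r * d j"] shift[of "- r"] r by auto
    then have "r * S = 0" by simp
    then have "pen_loss n p y X lam u (\<lambda>j. b j + r * d j) = pen_loss n p y X lam u b" using shift[of r] r by simp
    then have "is_arg_min (pen_loss n p y X lam u) (\<lambda>_. True) (\<lambda>j. b j + r * d j)"
      using min by (simp add: is_arg_min_def not_less)
    then have "b k + r * d k = b k" using unique kp by blast
    then show False using r k by simp
  next
    case basic
    \<comment> \<open>Each component of \<open>d\<close> is charged to the positive part if that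
      variable is nonzero, otherwise to the negative part, so only columns of nonzero variables
      occur.\<close>
    define cp where "cp j = (if bp j \<noteq> 0 then d j else 0)" for j
    define cm where "cm j = (if bp j = 0 then - d j else 0)" for j
    have cd: "(\<lambda>j. cp j - cm j) = d" by (auto simp: fun_eq_iff cp_def cm_def)
    have c1: "\<forall>j<p. (bp j = 0 \<longrightarrow> cp j = 0) \<and> (bm j = 0 \<longrightarrow> cm j = 0)"
      using basic(2) d(2) by (auto simp: cp_def cm_def supp_def)
    have c2: "\<forall>i<n. 0 - 0 + dot p (X i) (\<lambda>j. cp j - cm j) = 0"
      using Xd by (simp add: cd)
    have c0: "\<forall>i<n. (xip i = 0 \<longrightarrow> (0::real) = 0) \<and> (xim i = 0 \<longrightarrow> (0::real) = 0)" by simp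
    note B = basic(1)[unfolded lp_basic_def prod.case]
    have "(\<forall>i<n. (0::real) = 0 \<and> (0::real) = 0) \<and> (\<forall>j<p. cp j = 0 \<and> cm j = 0)"
      by (rule B[THEN spec, of "\<lambda>_. 0", THEN spec, of "\<lambda>_. 0", THEN spec, of cp, THEN spec, of cm,
          THEN mp, OF c0, THEN mp, OF c1, THEN mp, OF c2])
    then have "cp k = 0" "cm k = 0" using kp by blast+
    then have "d k = 0" by (auto simp: cp_def cm_def split: if_splits)
    then show False using k by simp
  qed
qed

text \<open>The two-step argument with abstract constants: \<open>t1\<close>, \<open>t2\<close> are the errors of the penalized and
  of the post-penalized estimator, \<open>K\<close> the slope of the empirical error, \<open>b\<close> that of the penalty.\<close>

lemma quadratic_linear_bound:
  fixes t1 t2 q K b :: real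
  assumes pos: "0 \<le> t1" "0 \<le> t2" "0 < q" "0 \<le> K" "0 \<le> b" and K: "10 * K \<le> q" and b: "5 * b \<le> q"
    and min1: "t1 \<le> 4 * q \<Longrightarrow> t1\<^sup>2 / 4 \<le> K * t1 + b * t1" "4 * q < t1 \<Longrightarrow> q * t1 \<le> K * t1 + b * t1"
    and min2: "t2 \<le> 4 * q \<Longrightarrow> t2\<^sup>2 / 4 \<le> K * t2 + b * t1" "4 * q < t2 \<Longrightarrow> q * t2 \<le> K * t2 + b * t1"
  shows "t2 \<le> 6 * K + 4 * b"
proof -
  \<comment> \<open>The linear regime is impossible: it would give \<open>q \<le> K + b\<close>,
    whereas \<open>K + b\<close> is at most \<open>3 / 10 * q\<close>.\<close>
  have t1: "t1 \<le> 4 * (K + b)"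
  proof (cases "t1 \<le> 4 * q")
    case True
    show ?thesis
    proof (cases "t1 = 0")
      case False
      then have "t1 * t1 \<le> t1 * (4 * (K + b))" using min1(1)[OF True] by (simp add: power2_eq_square algebra_simps)
      then show ?thesis using False pos by (simp add: mult_le_cancel_left)
    qed (use pos in simp)
  next
    case False
    then have "0 < t1" "4 * q < t1" using pos by auto
    have "q * t1 \<le> (K + b) * t1" using min1(2)[OF \<open>4 * q < t1\<close>] by (simp add: algebra_simps)
    then have "q \<le> K + b" using \<open>0 < t1\<close> by simp
    then show ?thesis using K b pos by linarith
  qed
  have R: "b * t1 \<le> 4 * b * (K + b)" using mult_left_mono[OF t1 pos(5)] by (simp add: mult_ac)
  show ?thesis
  proof (rule ccontr)
    assume "\<not> t2 \<le> 6 * K + 4 * b"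
    then have big: "6 * K + 4 * b < t2" by simp
    show False
    proof (cases "t2 \<le> 4 * q")
      case True
      \<comment> \<open>The constants 6 and 4 are such that this product,
        \<open>12 K\<^sup>2 + 32 K b + 16 b\<^sup>2\<close>, is at least the available
        \<open>16 b K + 16 b\<^sup>2\<close>.\<close>
      have "(6 * K + 4 * b) * (2 * K + 4 * b) < t2 * (t2 - 4 * K)"
        using big pos by (intro mult_strict_mono) auto
      also have "t2 * (t2 - 4 * K) \<le> 4 * (b * t1)" using min2(1)[OF True] by (simp add: power2_eq_square algebra_simps)
      also have "\<dots> \<le> 16 * b * (K + b)" using R by simp
      finally have "12 * (K * K) + 16 * (K * b) < 0" by (simp add: algebra_simps)
      moreover have "0 \<le> K * K" "0 \<le> K * b" using pos by simp_all
      ultimately show False by linarith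
    next
      case False
      then have big2: "4 * q < t2" by simp
      \<comment> \<open>In the linear regime the left side exceeds \<open>2 * q\<^sup>2\<close>,
        whereas the penalty term is at most \<open>4 / 5 * q\<^sup>2\<close>.\<close>
      have "4 * b * (K + b) \<le> 4 * b * q" using K b pos by (intro mult_left_mono) auto
      also have "\<dots> \<le> 4 * (q / 5) * q" using b pos by (intro mult_right_mono mult_left_mono) auto
      finally have "b * t1 \<le> q * q" using R mult_nonneg_nonneg[of q q] pos by linarith
      then have "(q - K) * t2 \<le> q * q" using min2(2)[OF big2] by (simp add: algebra_simps)
      moreover have "q / 2 * (4 * q) < (q - K) * t2" using big2 K pos by (intro mult_le_less_imp_less) auto
      ultimately have "2 * (q * q) < q * q" by linarith
      then show False using mult_pos_pos[OF pos(3) pos(3)] by linarith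
    qed
  qed
qed

context qr_sample
begin

lemma emp_increment_eq:
  "emp_loss_increment D \<omega> u (\<lambda>j. b j - coef D u j)
   = emp_loss n p (responses D \<omega>) (design D \<omega>) u b - emp_loss n p (responses D \<omega>) (design D \<omega>) u (coef D u)"
  by (simp add: emp_loss_increment_def)

lemma sum_split_T:
  fixes h :: "nat \<Rightarrow> real"
  shows "(\<Sum>j<p. h j) = (\<Sum>j\<in>Tset D u. h j) + (\<Sum>j\<in>{..<p} - Tset D u. h j)"
proof -
  have "Tset D u \<subseteq> {..<p}" by (auto simp: Tset_def supp_def)
  from sum.subset_diff[OF this, of h] show ?thesis by (simp add: add.commute)
qed

lemma l1norm_restr: "T \<subseteq> {..<p} \<Longrightarrow> l1norm p (restr T d) = (\<Sum>j\<in>T. \<bar>d j\<bar>)"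
  "l1norm p (restr (- T) d) = (\<Sum>j\<in>{..<p} - T. \<bar>d j\<bar>)"
  unfolding l1norm_def by (rule sum.mono_neutral_cong_right; auto simp: restr_def)+

lemma supp_restr: "supp p (restr (- T) d) = supp p d - T"
  by (auto simp: supp_def restr_def)

lemma l1_le_l2:
  assumes u: "u \<in> U"
  shows "l1norm p (restr (Tset D u) d) \<le> sqrt (real (spars D)) * l2norm p (restr (Tset D u) d)"
proof -
  let ?T = "Tset D u"
  have T: "?T \<subseteq> {..<p}" by (auto simp: Tset_def supp_def)
  have "(\<Sum>j\<in>?T. \<bar>d j\<bar>) \<le> sqrt (\<Sum>j\<in>?T. (1::real)\<^sup>2) * sqrt (\<Sum>j\<in>?T. (\<bar>d j\<bar>)\<^sup>2)"
    using sum_mult_le_sqrt[of "\<lambda>_. 1" "\<lambda>j. \<bar>d j\<bar>" ?T] by (simp add: sum_nonneg)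
  also have "(\<Sum>j\<in>?T. (1::real)\<^sup>2) = real (card ?T)" by simp
  also have "(\<Sum>j\<in>?T. (\<bar>d j\<bar>)\<^sup>2) = dot p (restr ?T d) (restr ?T d)"
    unfolding dot_self_eq using T by (intro sum.mono_neutral_cong_left) (auto simp: restr_def)
  finally have "(\<Sum>j\<in>?T. \<bar>d j\<bar>) \<le> sqrt (real (card ?T)) * l2norm p (restr ?T d)" by (simp add: l2norm_eq)
  also have "\<dots> \<le> sqrt (real (spars D)) * l2norm p (restr ?T d)"
    using setting u by (intro mult_right_mono) (auto simp: qr_setting_def l2norm_eq dot_self_nonneg)
  finally show ?thesis using T by (simp add: l1norm_restr)
qed

section \<open>Basic inequality and cone condition\<close>

text \<open>By convexity the increment lies above its linearization at the true coefficients. The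
  gradient there is the score at the variables \<open>V\<close>, so it is paired with the weighted
  l1-norm of the error.\<close>

lemma emp_increment_score_bound:
  assumes u: "u \<in> U" and reg: "\<And>i. i < n \<Longrightarrow> regular (covar D i \<omega>)"
    and sig: "\<And>j. j < p \<Longrightarrow> 0 < sigma_hat n (design D \<omega>) j"
  shows "- (Lambda_stat U n p (design D \<omega>) (\<lambda>i\<in>{..<n}. V i \<omega>) * (sqrt (u * (1 - u)) / real n)
            * (\<Sum>j<p. sigma_hat n (design D \<omega>) j * \<bar>d j\<bar>))
    \<le> emp_loss_increment D \<omega> u d"
proof -
  have u01: "0 < u" "u < 1" using U_props(3)[OF u] by auto
  let ?X = "design D \<omega>" and ?v = "\<lambda>i\<in>{..<n}. V i \<omega>"
  let ?\<sigma> = "sigma_hat n ?X" and ?r = "sqrt (u * (1 - u))"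
  let ?\<Lambda> = "Lambda_stat U n p ?X ?v"
  define g where "g j = emp_mean n (\<lambda>i. ?X i j * (u - of_bool (?v i \<le> u)))" for j
  have r: "0 < ?r" using u01 by simp
  have gb: "\<bar>g j\<bar> \<le> ?\<sigma> j * (?\<Lambda> * (?r / real n))" if j: "j < p" for j
  proof -
    have "g j = (?\<sigma> j * ?r) * emp_mean n (\<lambda>i. ?X i j * (u - of_bool (?v i \<le> u)) / (?\<sigma> j * ?r))"
      using sig[OF j] r u01 unfolding g_def emp_mean_def by (simp add: sum_divide_distrib[symmetric])
    then have "\<bar>g j\<bar> = (?\<sigma> j * ?r) * score ?X ?v j u" using sig[OF j] r by (simp add: abs_mult)
    also have "\<dots> \<le> (?\<sigma> j * ?r) * (?\<Lambda> / real n)"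
      using score_le_Lambda[OF u j, of ?X ?v] sig[OF j] r n_pos
      by (intro mult_left_mono) (auto simp: field_simps)
    finally show ?thesis by (simp add: mult_ac)
  qed
  have "- (\<Sum>j<p. \<bar>d j\<bar> * (?\<sigma> j * (?\<Lambda> * (?r / real n)))) \<le> - (\<Sum>j<p. d j * g j)"
  proof -
    have "(\<Sum>j<p. d j * g j) \<le> (\<Sum>j<p. \<bar>d j\<bar> * (?\<sigma> j * (?\<Lambda> * (?r / real n))))"
    proof (rule sum_mono)
      fix j assume "j \<in> {..<p}"
      then have "\<bar>d j\<bar> * \<bar>g j\<bar> \<le> \<bar>d j\<bar> * (?\<sigma> j * (?\<Lambda> * (?r / real n)))" using gb by (intro mult_left_mono) auto
      then show "d j * g j \<le> \<bar>d j\<bar> * (?\<sigma> j * (?\<Lambda> * (?r / real n)))"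
        using abs_ge_self[of "d j * g j"] by (simp add: abs_mult)
    qed
    then show ?thesis by simp
  qed
  also have "- (\<Sum>j<p. d j * g j) = emp_mean n (\<lambda>i. - dot p (?X i) d * (u - of_bool (?v i \<le> u)))"
  proof -
    have "(\<Sum>j<p. d j * g j) = emp_mean n (\<lambda>i. \<Sum>j<p. d j * (?X i j * (u - of_bool (?v i \<le> u))))"
      unfolding g_def by (rule emp_mean_sum[symmetric])
    also have "\<dots> = emp_mean n (\<lambda>i. dot p (?X i) d * (u - of_bool (?v i \<le> u)))"
      by (intro emp_mean_cong) (simp only: dot_def sum_distrib_right mult_ac)
    finally show ?thesis by (simp add: emp_mean_def sum_negf)
  qed
  also have "\<dots> \<le> emp_mean n (\<lambda>i. check_loss u (responses D \<omega> i - dot p (?X i) (\<lambda>j. coef D u j + d j))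
      - check_loss u (responses D \<omega> i - dot p (?X i) (coef D u)))"
  proof (rule emp_mean_mono)
    fix i assume i: "i < n"
    have "?v i \<le> u \<longleftrightarrow> responses D \<omega> i - dot p (?X i) (coef D u) \<le> 0"
      using V_le_iff[OF reg[OF i] u] i by (simp add: responses_def design_def)
    then show "- dot p (?X i) d * (u - of_bool (?v i \<le> u))
      \<le> check_loss u (responses D \<omega> i - dot p (?X i) (\<lambda>j. coef D u j + d j)) - check_loss u (responses D \<omega> i - dot p (?X i) (coef D u))"
      using check_loss_subgradient[of "dot p (?X i) d" u "responses D \<omega> i - dot p (?X i) (coef D u)"]
      by (simp add: dot_add_right diff_diff_eq)
  qed
  also have "\<dots> = emp_loss_increment D \<omega> u d"
    by (simp add: emp_loss_increment_def emp_loss_def emp_mean_def sum_subtractf right_diff_distrib)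
  finally have low: "- (\<Sum>j<p. \<bar>d j\<bar> * (?\<sigma> j * (?\<Lambda> * (?r / real n)))) \<le> emp_loss_increment D \<omega> u d" .
  have "(\<Sum>j<p. \<bar>d j\<bar> * (?\<sigma> j * (?\<Lambda> * (?r / real n)))) = ?\<Lambda> * (?r / real n) * (\<Sum>j<p. ?\<sigma> j * \<bar>d j\<bar>)"
    unfolding sum_distrib_left by (intro sum.cong refl) (simp only: mult_ac)
  then show ?thesis using low by (simp only:)
qed

text \<open>Optimality against the true coefficients. Off their support the penalty of the estimate
  is that of the error, hence the negative sum; on it the triangle inequality is used.\<close>

lemma penalized_increment_le:
  assumes u: "u \<in> U" and lam: "0 \<le> lam" and b: "penalized_estimate n p (responses D \<omega>) (design D \<omega>) lam u b"
  defines "d \<equiv> \<lambda>j. b j - coef D u j"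
  shows "emp_loss_increment D \<omega> u d \<le> lam * (sqrt (u * (1 - u)) / real n) *
    ((\<Sum>j\<in>Tset D u. sigma_hat n (design D \<omega>) j * \<bar>d j\<bar>)
     - (\<Sum>j\<in>{..<p} - Tset D u. sigma_hat n (design D \<omega>) j * \<bar>d j\<bar>))"
proof -
  let ?\<sigma> = "sigma_hat n (design D \<omega>)"
  let ?w = "lam * (sqrt (u * (1 - u)) / real n)"
  have u01: "0 < u" "u < 1" using U_props(3)[OF u] by auto
  have s0: "0 \<le> ?\<sigma> j" for j by (simp add: sigma_hat_def emp_mean_nonneg)
  have w: "0 \<le> ?w" using lam u01 by simp
  have "pen_loss n p (responses D \<omega>) (design D \<omega>) lam u b \<le> pen_loss n p (responses D \<omega>) (design D \<omega>) lam u (coef D u)"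
    using b by (auto simp: penalized_estimate_def is_arg_min_def not_less)
  then have "emp_loss_increment D \<omega> u d \<le> ?w * (\<Sum>j<p. ?\<sigma> j * \<bar>coef D u j\<bar>) - ?w * (\<Sum>j<p. ?\<sigma> j * \<bar>b j\<bar>)"
    unfolding d_def emp_increment_eq pen_loss_def by simp
  also have "\<dots> = ?w * (\<Sum>j<p. ?\<sigma> j * (\<bar>coef D u j\<bar> - \<bar>b j\<bar>))"
    by (simp add: right_diff_distrib sum_subtractf)
  also have "\<dots> \<le> ?w * ((\<Sum>j\<in>Tset D u. ?\<sigma> j * \<bar>d j\<bar>) - (\<Sum>j\<in>{..<p} - Tset D u. ?\<sigma> j * \<bar>d j\<bar>))"
  proof (rule mult_left_mono[OF _ w])
    have "(\<Sum>j\<in>Tset D u. ?\<sigma> j * (\<bar>coef D u j\<bar> - \<bar>b j\<bar>)) \<le> (\<Sum>j\<in>Tset D u. ?\<sigma> j * \<bar>d j\<bar>)"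
      using s0 by (intro sum_mono mult_left_mono) (auto simp: d_def)
    moreover have "(\<Sum>j\<in>{..<p} - Tset D u. ?\<sigma> j * (\<bar>coef D u j\<bar> - \<bar>b j\<bar>)) = - (\<Sum>j\<in>{..<p} - Tset D u. ?\<sigma> j * \<bar>d j\<bar>)"
      unfolding sum_negf[symmetric] by (intro sum.cong refl) (auto simp: d_def Tset_def supp_def)
    ultimately show "(\<Sum>j<p. ?\<sigma> j * (\<bar>coef D u j\<bar> - \<bar>b j\<bar>))
        \<le> (\<Sum>j\<in>Tset D u. ?\<sigma> j * \<bar>d j\<bar>) - (\<Sum>j\<in>{..<p} - Tset D u. ?\<sigma> j * \<bar>d j\<bar>)"
      unfolding sum_split_T[of "\<lambda>j. ?\<sigma> j * (\<bar>coef D u j\<bar> - \<bar>b j\<bar>)" u] by linarith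
  qed
  finally show ?thesis .
qed

text \<open>For \<open>\<lambda> = 0\<close> the error need not lie in the cone, but then the penalized estimator minimizes
  the empirical loss and the bound holds with left-hand side at most \<open>0\<close>.\<close>

lemma penalized_increment_slope:
  assumes D4: "cond_D4 D" and u: "u \<in> U" and reg: "\<And>i. i < n \<Longrightarrow> regular (covar D i \<omega>)"
    and sig: "\<And>j. j < p \<Longrightarrow> \<bar>sigma_hat n (design D \<omega>) j - 1\<bar> \<le> 1 / 2"
    and lam0: "0 \<le> lam"
    and lam: "(cone_c D + 3) / (cone_c D - 3) * Lambda_stat U n p (design D \<omega>) (\<lambda>i\<in>{..<n}. V i \<omega>) \<le> lam"
    and lam_up: "lam \<le> C * W_of U * sqrt (real n * ln (real p))"
    and b: "penalized_estimate n p (responses D \<omega>) (design D \<omega>) lam u b"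
  defines "d \<equiv> \<lambda>j. b j - coef D u j"
  shows "emp_loss_increment D \<omega> u d
    \<le> 3 / 4 * (C * W_of U * sqrt (real (spars D) * log_np D / real n) / (sqrt (f_lo D) * kappa0 D)) * J_norm D u d"
proof -
  let ?\<sigma> = "sigma_hat n (design D \<omega>)" and ?T = "Tset D u" and ?c = "cone_c D"
  let ?\<Lambda> = "Lambda_stat U n p (design D \<omega>) (\<lambda>i\<in>{..<n}. V i \<omega>)"
  define w where "w = sqrt (u * (1 - u)) / real n"
  define A where "A = (\<Sum>j\<in>?T. ?\<sigma> j * \<bar>d j\<bar>)"
  define B where "B = (\<Sum>j\<in>{..<p} - ?T. ?\<sigma> j * \<bar>d j\<bar>)"
  define a where "a = l1norm p (restr ?T d)"
  define a' where "a' = l1norm p (restr (- ?T) d)"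
  define K where "K = C * W_of U * sqrt (real (spars D) * log_np D / real n) / (sqrt (f_lo D) * kappa0 D)"
  have u01: "0 < u" "u < 1" using U_props(3)[OF u] by auto
  have T: "?T \<subseteq> {..<p}" by (auto simp: Tset_def supp_def)
  have w: "0 < w" using u01 n_pos by (simp add: w_def)
  have s: "1 / 2 \<le> ?\<sigma> j" "?\<sigma> j \<le> 3 / 2" if "j < p" for j
    using abs_le_iff[THEN iffD1, OF sig[OF that]] by linarith+
  have c9: "9 \<le> ?c" using D4 by (simp add: cond_D4_def)
  have k0: "0 < kappa0 D" by (rule kappa0_pos(1)[OF D4])
  have Aup: "A \<le> 3 / 2 * a"
    unfolding A_def a_def l1norm_restr(1)[OF T] sum_distrib_left using s T by (intro sum_mono mult_right_mono) auto
  have Blow: "a' / 2 \<le> B"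
    unfolding B_def a'_def l1norm_restr(2) sum_divide_distrib
  proof (rule sum_mono)
    fix j assume "j \<in> {..<p} - ?T"
    then have "1 / 2 * \<bar>d j\<bar> \<le> ?\<sigma> j * \<bar>d j\<bar>" using s(1)[of j] by (intro mult_right_mono) auto
    then show "\<bar>d j\<bar> / 2 \<le> ?\<sigma> j * \<bar>d j\<bar>" by simp
  qed
  have a0: "0 \<le> a" "0 \<le> a'" by (simp_all add: a_def a'_def l1norm_def sum_nonneg)
  have B0: "0 \<le> B" using Blow a0 by linarith
  have A0: "0 \<le> A"
  proof -
    have "0 \<le> ?\<sigma> j" if "j < p" for j using s(1)[OF that] by linarith
    then show ?thesis unfolding A_def using T by (intro sum_nonneg mult_nonneg_nonneg) auto
  qed
  have up: "emp_loss_increment D \<omega> u d \<le> lam * w * (A - B)"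
    using penalized_increment_le[OF u lam0 b] by (simp add: d_def A_def B_def w_def)
  have np: "0 < ln (real p)" "ln (real p) \<le> log_np D"
    using np3 by (auto simp: log_np_def intro!: ln_mono)
  show ?thesis
  proof (cases "lam = 0")
    case True
    have "0 < W_of U * sqrt (real n * ln (real p))"
      using W_of_pos[OF quantile_indices_U] np n_pos by (intro mult_pos_pos) auto
    then have "0 \<le> C" using lam_up True by (simp add: zero_le_mult_iff mult.assoc)
    moreover have "0 \<le> log_np D" using np by linarith
    ultimately have "0 \<le> K" unfolding K_def
      using W_of_pos[OF quantile_indices_U] f_lo_pos k0
      by (intro divide_nonneg_nonneg mult_nonneg_nonneg real_sqrt_ge_zero) auto
    then have "0 \<le> 3 / 4 * K * J_norm D u d" using J_norm_sq(1)[OF u] by simp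
    then show ?thesis using up True by (simp add: K_def)
  next
    case False
    then have lampos: "0 < lam" using lam0 by simp
    have low: "- (?\<Lambda> * w * (A + B)) \<le> emp_loss_increment D \<omega> u d"
    proof -
      have "0 < ?\<sigma> j" if "j < p" for j using s(1)[OF that] by linarith
      from emp_increment_score_bound[OF u reg this, of d]
      show ?thesis unfolding sum_split_T[of _ u] w_def A_def B_def by simp
    qed
    have "w * (- (?\<Lambda> * (A + B))) \<le> w * (lam * (A - B))" using low up by (simp add: algebra_simps)
    then have "- (?\<Lambda> * (A + B)) \<le> lam * (A - B)" using w by (simp only: mult_le_cancel_left_pos)
    then have basic: "(lam - ?\<Lambda>) * B \<le> (lam + ?\<Lambda>) * A" by (simp add: algebra_simps)
    \<comment> \<open>The factor \<open>(c0 + 3) / (c0 - 3)\<close> makes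
      \<open>lam + \<Lambda>\<close> at most \<open>c0 / 3\<close> times
      \<open>lam - \<Lambda>\<close>. The bounds 1/2 and 3/2 for \<open>sigma_hat\<close> cost
      another factor 3, which yields exactly the cone with constant \<open>c0\<close>.\<close>
    have L: "(?c + 3) * ?\<Lambda> \<le> (?c - 3) * lam" using lam c9 by (simp add: field_simps)
    have e1: "6 * lam * B \<le> (?c + 3) * ((lam - ?\<Lambda>) * B)"
    proof -
      have "6 * lam \<le> (?c + 3) * (lam - ?\<Lambda>)" using L by (simp add: algebra_simps)
      from mult_right_mono[OF this B0] show ?thesis by (simp add: mult.assoc)
    qed
    have e2: "(?c + 3) * ((lam + ?\<Lambda>) * A) \<le> 2 * ?c * lam * A"
    proof -
      have "(?c + 3) * (lam + ?\<Lambda>) \<le> 2 * ?c * lam" using L by (simp add: algebra_simps)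
      from mult_right_mono[OF this A0] show ?thesis by (simp add: mult.assoc)
    qed
    have "(?c + 3) * ((lam - ?\<Lambda>) * B) \<le> (?c + 3) * ((lam + ?\<Lambda>) * A)" using basic c9 by (intro mult_left_mono) auto
    then have "lam * (6 * B) \<le> lam * (2 * ?c * A)" using e1 e2 by (simp add: mult_ac)
    then have BA: "6 * B \<le> 2 * ?c * A" using lampos by simp
    have "3 * a' \<le> 6 * B" using Blow by simp
    also have "\<dots> \<le> 2 * ?c * (3 / 2 * a)" using BA Aup c9 by (meson mult_left_mono order_trans mult_nonneg_nonneg zero_le_numeral)
    finally have cone_l1: "a' \<le> ?c * a" by (simp add: mult.commute)
    \<comment> \<open>The cone also limits the number of components off the support to
      \<open>n\<close>; here the sparsity of basic solutions enters.\<close>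
    have "card (supp p d - ?T) \<le> card (supp p b)"
      by (intro card_mono) (auto simp: supp_def d_def Tset_def)
    also have "\<dots> \<le> n" by (rule penalized_estimate_sparse[OF b])
    finally have cone: "d \<in> A_cone D u"
      using cone_l1 by (simp add: A_cone_def a_def a'_def l0norm_def supp_restr)
    have l2: "l2norm p (restr ?T d) \<le> J_norm D u d / (sqrt (f_lo D) * kappa0 D)"
    proof -
      have "sqrt (f_lo D) * (kappa0 D * l2norm p (restr ?T d)) \<le> sqrt (f_lo D) * sqrt (moment2 d)"
        using kappa0_link[OF D4 u cone] f_lo_pos by (intro mult_left_mono) auto
      also have "\<dots> \<le> J_norm D u d" by (rule J_norm_ge[OF u])
      finally show ?thesis using f_lo_pos k0 by (simp add: pos_le_divide_eq mult_ac)
    qed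
    have a_up: "a \<le> sqrt (real (spars D)) * (J_norm D u d / (sqrt (f_lo D) * kappa0 D))"
    proof -
      have "a \<le> sqrt (real (spars D)) * l2norm p (restr ?T d)" unfolding a_def by (rule l1_le_l2[OF u])
      also have "\<dots> \<le> sqrt (real (spars D)) * (J_norm D u d / (sqrt (f_lo D) * kappa0 D))"
        using l2 by (intro mult_left_mono) auto
      finally show ?thesis .
    qed
    \<comment> \<open>The maximum 1/2 of \<open>sqrt (u * (1 - u))\<close>, times the 3/2 from
      \<open>sigma_hat\<close>, gives the 3/4 in the conclusion.\<close>
    have half: "w \<le> 1 / (2 * real n)"
    proof -
      have "u * (1 - u) \<le> (1 / 2)\<^sup>2" using zero_le_power2[of "u - 1 / 2"] by (simp add: power2_eq_square algebra_simps)
      then have "sqrt (u * (1 - u)) \<le> 1 / 2" by (intro real_le_lsqrt) auto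
      then show ?thesis using n_pos by (simp add: w_def field_simps)
    qed
    have "emp_loss_increment D \<omega> u d \<le> lam * w * A" using up B0 lam0 w
      by (smt (verit) mult_left_mono mult_nonneg_nonneg)
    also have "\<dots> \<le> lam * w * (3 / 2 * a)" using Aup lam0 w by (intro mult_left_mono) auto
    also have "\<dots> \<le> (C * W_of U * sqrt (real n * ln (real p))) * (1 / (2 * real n)) *
        (3 / 2 * (sqrt (real (spars D)) * (J_norm D u d / (sqrt (f_lo D) * kappa0 D))))"
      using lam_up half a_up lam0 w a0 by (intro mult_mono) auto
    also have "\<dots> = 3 / 4 * (C * W_of U * (sqrt (real n * ln (real p)) * sqrt (real (spars D)) / real n) / (sqrt (f_lo D) * kappa0 D)) * J_norm D u d"
      by simp
    also have "\<dots> \<le> 3 / 4 * K * J_norm D u d"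
    proof -
      have "0 < C * W_of U * sqrt (real n * ln (real p))" using lam_up lampos by simp
      moreover have "0 < sqrt (real n * ln (real p))" using np(1) n_pos by simp
      ultimately have CW: "0 \<le> C * W_of U" by (metis less_imp_le zero_less_mult_pos2)
      have "sqrt (real n * ln (real p)) * sqrt (real (spars D)) / real n = sqrt (real (spars D) * ln (real p) / real n)"
        using n_pos by (simp add: real_sqrt_mult real_sqrt_divide field_simps)
      also have "\<dots> \<le> sqrt (real (spars D) * log_np D / real n)"
        using np by (intro real_sqrt_le_mono divide_right_mono mult_left_mono) auto
      finally show ?thesis
        unfolding K_def using CW f_lo_pos k0 J_norm_sq(1)[OF u]
        by (intro mult_right_mono mult_left_mono divide_right_mono) auto
    qed
    finally show ?thesis unfolding K_def .
  qed
qed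

end

subsection \<open>The post-penalized estimator\<close>

lemma AE_null_set:
  assumes "AE x in M. P x" shows "\<exists>N\<in>null_sets M. \<forall>x\<in>space M - N. P x"
proof -
  from assms obtain N where "N \<in> null_sets M" "{x \<in> space M. \<not> P x} \<subseteq> N"
    unfolding eventually_ae_filter by auto
  then show ?thesis by (intro bexI[of _ N]) auto
qed

context qr_sample
begin

lemma log_np_alt: "ln (real (max n p)) = log_np D" "ln (real (max p n)) = log_np D"
  by (simp_all add: log_np_def max.commute)

text \<open>The supremum of natural numbers is genuine because all of them are at most
  \<open>n\<close>, by sparsity of the estimates.\<close>

lemma m_hat_bounds:
  assumes "\<And>u. u \<in> U \<Longrightarrow> card (supp p (bh u)) \<le> n"
  shows "u \<in> U \<Longrightarrow> card (supp p (bh u) - Tset D u) \<le> m_hat D bh" "m_hat D bh \<le> n"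
proof -
  have le: "card (supp p (bh u) - Tset D u) \<le> n" if "u \<in> U" for u
    using card_mono[of "supp p (bh u)" "supp p (bh u) - Tset D u"] assms[OF that] by (simp add: supp_def)
  have m: "m_hat D bh = (SUP u\<in>U. card (supp p (bh u) - Tset D u))"
    by (simp add: m_hat_def l0norm_def supp_restr)
  have bdd: "bdd_above ((\<lambda>u. card (supp p (bh u) - Tset D u)) ` U)"
    using le by (intro bdd_aboveI2[where M = n])
  show "u \<in> U \<Longrightarrow> card (supp p (bh u) - Tset D u) \<le> m_hat D bh"
    unfolding m by (rule cSUP_upper[OF _ bdd])
  show "m_hat D bh \<le> n" unfolding m using le by (intro cSUP_least U_props(2))
qed

lemma missed_cases: "missed D bh = 0 \<and> (\<forall>u\<in>U. Tset D u \<subseteq> supp p (bh u)) \<or> missed D bh = 1"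
proof (cases "\<forall>u\<in>U. Tset D u \<subseteq> supp p (bh u)")
  case True
  then have "missed D bh = (SUP u\<in>U. 0)" unfolding missed_def by (intro SUP_cong refl) simp
  then show ?thesis using True U_props(2) by simp
next
  case False
  then obtain u where u: "u \<in> U" "\<not> Tset D u \<subseteq> supp p (bh u)" by blast
  have bdd: "bdd_above ((\<lambda>u. of_bool (\<not> Tset D u \<subseteq> supp p (bh u)) :: real) ` U)"
    by (intro bdd_aboveI2[where M = 1]) simp
  have "1 \<le> missed D bh" unfolding missed_def using cSUP_upper[OF u(1) bdd] u(2) by simp
  moreover have "missed D bh \<le> 1" unfolding missed_def by (intro cSUP_least U_props(2)) simp
  ultimately show ?thesis by simp
qed

text \<open>Extends the lower bounds to the zero vector, which the infima of D.5 leave out.\<close>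

lemma sparse_minorized:
  assumes D4: "cond_D4 D" and D5: "cond_D5 D m" and u: "u \<in> U" and d: "d \<in> A_sparse D u m"
  shows "J_norm D u d \<le> 4 * q_sparse D m \<Longrightarrow> (J_norm D u d)\<^sup>2 / 4 \<le> loss_increment D u d"
    and "4 * q_sparse D m < J_norm D u d \<Longrightarrow> q_sparse D m * J_norm D u d \<le> loss_increment D u d"
    and "0 < q_sparse D m" "0 < kappa_sparse D m"
    and "sqrt (f_lo D) * kappa_sparse D m * l2norm p d \<le> J_norm D u d"
proof -
  \<comment> \<open>Since \<open>d\<close> may be zero, positivity of the constants is read off at
    another vector; its existence rules out infinite infima, which the conversion to
    \<open>real\<close> would send to 0.\<close>
  obtain u' d' where d': "u' \<in> U" "d' \<in> A_sparse D u' m" "nonzero p d'"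
    using support_nonempty[OF D4] by metis
  show q: "0 < q_sparse D m" by (rule q_sparse_link(2)[OF D5 d'])
  show k: "0 < kappa_sparse D m" by (rule kappa_sparse_link(1)[OF D5 d'])
  have zero: "J_norm D u d = 0" "loss_increment D u d = 0" "l2norm p d = 0" if "\<not> nonzero p d"
    using dot_not_nonzero[OF that]
    by (simp_all add: J_norm_eq[OF u] J_quad_def loss_increment_def dot_add_right l2norm_eq)
  show "(J_norm D u d)\<^sup>2 / 4 \<le> loss_increment D u d" if "J_norm D u d \<le> 4 * q_sparse D m"
  proof (cases "nonzero p d")
    case True
    from loss_increment_minorized(1)[OF u q q_sparse_link(1)[OF D5 u d True] q_sparse_link(3)[OF D5 u d True] that]
    show ?thesis .
  qed (simp add: zero)
  show "q_sparse D m * J_norm D u d \<le> loss_increment D u d" if "4 * q_sparse D m < J_norm D u d"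
  proof (cases "nonzero p d")
    case True
    from loss_increment_minorized(2)[OF u q q_sparse_link(1)[OF D5 u d True] q_sparse_link(3)[OF D5 u d True] that]
    show ?thesis .
  qed (simp add: zero)
  show "sqrt (f_lo D) * kappa_sparse D m * l2norm p d \<le> J_norm D u d"
  proof (cases "nonzero p d")
    case True
    have "sqrt (f_lo D) * (kappa_sparse D m * l2norm p d) \<le> sqrt (f_lo D) * sqrt (moment2 d)"
      using kappa_sparse_link(2)[OF D5 u d True] f_lo_pos by (intro mult_left_mono) auto
    also have "\<dots> \<le> J_norm D u d" by (rule J_norm_ge[OF u])
    finally show ?thesis by (simp add: mult.assoc)
  qed (simp add: zero)
qed

text \<open>Both errors have at most \<open>m\<close> components off the true support, so the
  deviation bound at size \<open>k = m\<close> covers both, and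
  \<open>quadratic_linear_bound\<close> combines them with the penalty slope.\<close>

lemma post_penalized_bound:
  fixes \<epsilon> A C lam :: real and \<omega> :: 'a and bh bt :: "real \<Rightarrow> nat \<Rightarrow> real"
  assumes D4: "cond_D4 D" and A: "1 < A"
    and reg: "\<And>i. i < n \<Longrightarrow> regular (covar D i \<omega>)"
    and sig: "\<And>j. j < p \<Longrightarrow> \<bar>sigma_hat n (design D \<omega>) j - 1\<bar> \<le> 1 / 2"
    and lam0: "0 \<le> lam"
    and lam: "(cone_c D + 3) / (cone_c D - 3) * Lambda_stat U n p (design D \<omega>) (\<lambda>i\<in>{..<n}. V i \<omega>) \<le> lam"
    and lam_up: "lam \<le> C * W_of U * sqrt (real n * ln (real p))"
    and pen: "\<And>u. u \<in> U \<Longrightarrow> penalized_estimate n p (responses D \<omega>) (design D \<omega>) lam u (bh u)"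
    and post: "\<And>u. u \<in> U \<Longrightarrow> post_estimate n p (responses D \<omega>) (design D \<omega>) u (supp p (bh u)) (bt u)"
    and Kc: "0 < Kc"
    and emp: "\<And>u k \<delta>. \<lbrakk>u \<in> U; k \<le> n; card (supp p \<delta> - Tset D u) \<le> k\<rbrakk> \<Longrightarrow>
       \<bar>emp_loss_increment D \<omega> u \<delta> - loss_increment D u \<delta>\<bar>
       \<le> 8 * sqrt (Kc * rate k / real n) * sqrt (phi D \<omega> (k + spars D)) * l2norm p \<delta>"
  defines "m \<equiv> m_hat D bh"
  assumes D5: "cond_D5 D m"
    and growth: "q_sparse D m * (80 * sqrt Kc * sqrt (rate m * phi D \<omega> (m + spars D))
            / (sqrt (real n) * sqrt (f_lo D) * kappa_sparse D m))
          + missed D bh * (2 * A * (1 + cone_c D) * C\<^sup>2 * (W_of U)\<^sup>2 *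
              (real (spars D) * log_np D / (real n * f_lo D * (kappa0 D)\<^sup>2)))
          \<le> (q_sparse D m)\<^sup>2"
    and u: "u \<in> U"
  shows "(\<lambda>j. bt u j - coef D u j) \<in> A_sparse D u m"
    and "J_norm D u (\<lambda>j. bt u j - coef D u j)
      \<le> 4 * (80 * sqrt Kc) * sqrt (phi D \<omega> (m + spars D)) / (sqrt (f_lo D) * kappa_sparse D m) * sqrt (rate m / real n)
        + missed D bh * (4 * sqrt (2 * (1 + cone_c D) * A) / (sqrt (f_lo D) * kappa0 D))
            * (C * W_of U * sqrt (real (spars D) * log_np D / real n))"
proof -
  let ?T = "Tset D u" and ?S = "supp p (bh u)" and ?c = "cone_c D"
  let ?q = "q_sparse D m" and ?\<kappa> = "kappa_sparse D m" and ?f = "sqrt (f_lo D)" and ?\<phi> = "phi D \<omega> (m + spars D)"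
  define d1 where "d1 = (\<lambda>j. bh u j - coef D u j)"
  define d2 where "d2 = (\<lambda>j. bt u j - coef D u j)"
  have card_n: "card (supp p (bh u)) \<le> n" if "u \<in> U" for u by (rule penalized_estimate_sparse[OF pen[OF that]])
  have m: "card (?S - ?T) \<le> m" "m \<le> n" unfolding m_def using m_hat_bounds[where bh = bh, OF card_n] u by blast+
  have bt0: "bt u j = 0" if "j < p" "j \<notin> ?S" for j
    using post[OF u] that by (simp add: post_estimate_def is_arg_min_def)
  have finS: "finite (?S - ?T)" by (simp add: supp_def)
  have "supp p d1 - ?T \<subseteq> ?S - ?T" by (auto simp: d1_def supp_def Tset_def)
  then have s1: "card (supp p d1 - ?T) \<le> m" using card_mono[OF finS] m(1) by (meson order_trans)
  have "supp p d2 - ?T \<subseteq> ?S - ?T" using bt0 by (auto simp: d2_def supp_def Tset_def)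
  then have s2: "card (supp p d2 - ?T) \<le> m" using card_mono[OF finS] m(1) by (meson order_trans)
  have A1: "d1 \<in> A_sparse D u m" using s1 by (simp add: A_sparse_def l0norm_def supp_restr)
  have A2: "d2 \<in> A_sparse D u m" using s2 by (simp add: A_sparse_def l0norm_def supp_restr)
  then show "(\<lambda>j. bt u j - coef D u j) \<in> A_sparse D u m" by (simp add: d2_def)
  note M1 = sparse_minorized[OF D4 D5 u A1] and M2 = sparse_minorized[OF D4 D5 u A2]
  have q: "0 < ?q" and \<kappa>: "0 < ?\<kappa>" by (rule M1(3), rule M1(4))
  have f: "0 < ?f" using f_lo_pos by simp
  have k0: "0 < kappa0 D" by (rule kappa0_pos(1)[OF D4])
  have c9: "9 \<le> ?c" using D4 by (simp add: cond_D4_def)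
  have n0: "0 < real n" by simp
  have \<phi>: "0 \<le> ?\<phi>" using spars_pos by (intro phi_nonneg) simp
  have r: "0 < rate m" using rate_ge_1[of m] by simp
  have L: "0 \<le> log_np D" using ln_n_ge_1 ln_n_le_log_np by simp
  \<comment> \<open>The slope of the deviation with respect to the \<open>J_norm\<close>; dividing
    by \<open>sqrt (f_lo D)\<close> and \<open>kappa_sparse\<close> converts the Euclidean
    norm.\<close>
  define K1 where "K1 = 8 * sqrt (Kc * rate m / real n) * sqrt ?\<phi> / (?f * ?\<kappa>)"
  have K1: "0 \<le> K1" unfolding K1_def using Kc r \<phi> f \<kappa> n0 by (intro divide_nonneg_nonneg mult_nonneg_nonneg) auto
  define X where "X = sqrt (real (spars D) * log_np D / real n)"
  have X: "0 \<le> X" using L by (simp add: X_def)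
  define b where "b = 3 / 4 * (C * W_of U * X / (?f * kappa0 D))"
  have W: "0 < W_of U" by (rule W_of_pos[OF quantile_indices_U])
  have C: "0 \<le> C"
  proof -
    have "0 < W_of U * sqrt (real n * ln (real p))" using W np3 by (intro mult_pos_pos) auto
    moreover have "0 \<le> C * (W_of U * sqrt (real n * ln (real p)))" using lam0 lam_up by (simp add: mult.assoc)
    ultimately show ?thesis by (simp add: zero_le_mult_iff)
  qed
  have b: "0 \<le> b" unfolding b_def using C W X f k0 by (intro mult_nonneg_nonneg divide_nonneg_nonneg) auto
  have near: "loss_increment D u \<delta> \<le> emp_loss_increment D \<omega> u \<delta> + K1 * J_norm D u \<delta>"
    if \<delta>: "\<delta> \<in> A_sparse D u m" "card (supp p \<delta> - ?T) \<le> m" for \<delta>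
  proof -
    have "l2norm p \<delta> \<le> J_norm D u \<delta> / (?f * ?\<kappa>)"
      using sparse_minorized(5)[OF D4 D5 u \<delta>(1)] f \<kappa> by (simp add: pos_le_divide_eq mult_ac)
    then have "8 * sqrt (Kc * rate m / real n) * sqrt ?\<phi> * l2norm p \<delta>
        \<le> 8 * sqrt (Kc * rate m / real n) * sqrt ?\<phi> * (J_norm D u \<delta> / (?f * ?\<kappa>))"
      using Kc r \<phi> n0 by (intro mult_left_mono mult_nonneg_nonneg) auto
    also have "\<dots> = K1 * J_norm D u \<delta>" by (simp add: K1_def)
    finally show ?thesis using emp[OF u m(2) \<delta>(2)] by linarith
  qed
  have e1: "emp_loss_increment D \<omega> u d1 \<le> b * J_norm D u d1"
    using penalized_increment_slope[OF D4 u reg sig lam0 lam lam_up pen[OF u]]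
    by (simp add: b_def X_def d1_def)
  have arg: "emp_loss n p (responses D \<omega>) (design D \<omega>) u (bt u) \<le> emp_loss n p (responses D \<omega>) (design D \<omega>) u b'"
    if "\<forall>j<p. j \<notin> ?S \<longrightarrow> b' j = 0" for b'
    using post[OF u] that by (auto simp: post_estimate_def is_arg_min_def not_less)
  have J0: "0 \<le> J_norm D u d1" "0 \<le> J_norm D u d2" by (rule J_norm_sq(1)[OF u])+
  have e2: "emp_loss_increment D \<omega> u d2 \<le> b * J_norm D u d1"
  proof -
    have "emp_loss_increment D \<omega> u d2 \<le> emp_loss_increment D \<omega> u d1"
      unfolding d1_def d2_def emp_increment_eq using arg[of "bh u"] by (simp add: supp_def)
    then show ?thesis using e1 by simp
  qed
  have e2': "emp_loss_increment D \<omega> u d2 \<le> 0" if "?T \<subseteq> ?S"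
    unfolding d2_def emp_increment_eq using arg[of "coef D u"] that by (auto simp: Tset_def supp_def)
  \<comment> \<open>Origin of the 80 in front of \<open>sqrt Kc\<close>: ten times the 8 of the
    deviation bound, so that the growth condition contains \<open>10 * K1 \<le> q\<close>.\<close>
  have KK: "80 * sqrt Kc * sqrt (rate m * ?\<phi>) / (sqrt (real n) * ?f * ?\<kappa>) = 10 * K1"
    unfolding K1_def using Kc r \<phi> n0 by (simp add: real_sqrt_mult real_sqrt_divide field_simps)
  have KK2: "4 * (80 * sqrt Kc) * sqrt ?\<phi> / (?f * ?\<kappa>) * sqrt (rate m / real n) = 40 * K1"
    unfolding K1_def using Kc r \<phi> n0 by (simp add: real_sqrt_mult real_sqrt_divide field_simps)
  define Y where "Y = C\<^sup>2 * (W_of U)\<^sup>2 * (real (spars D) * log_np D / (real n * f_lo D * (kappa0 D)\<^sup>2))"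
  have bb: "b\<^sup>2 = 9 / 16 * Y"
  proof -
    have "X\<^sup>2 = real (spars D) * log_np D / real n" using L by (simp add: X_def)
    moreover have "?f\<^sup>2 = f_lo D" using f_lo_pos by simp
    ultimately show ?thesis
      by (simp add: b_def Y_def power_mult_distrib power_divide)
  qed
  have Y: "0 \<le> Y" unfolding Y_def using L f_lo_pos by simp
  have AC: "20 \<le> 2 * A * (1 + ?c)"
  proof -
    have "1 * 10 \<le> A * (1 + ?c)" using A c9 by (intro mult_mono) auto
    then show ?thesis by simp
  qed
  have growth': "?q * (10 * K1) + missed D bh * (2 * A * (1 + ?c) * Y) \<le> ?q\<^sup>2"
    using growth unfolding KK Y_def by (simp add: mult.assoc)
  have sq: "1 \<le> sqrt (2 * (1 + ?c) * A)" using AC by (simp add: mult_ac)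
  have goal: "J_norm D u d2 \<le> 40 * K1 + missed D bh * (4 * sqrt (2 * (1 + ?c) * A) / (?f * kappa0 D)) * (C * W_of U * X)"
    using missed_cases[of bh]
  proof
    \<comment> \<open>The true coefficients now compete with the post-penalized estimate, so the
      penalized error drops out and the bound is used with \<open>t1 = 0\<close> and
      \<open>b = 0\<close>.\<close>
    assume mi: "missed D bh = 0 \<and> (\<forall>u\<in>U. Tset D u \<subseteq> supp p (bh u))"
    then have "?q * (10 * K1) \<le> ?q * ?q" using growth' by (simp add: power2_eq_square)
    then have Kq: "10 * K1 \<le> ?q" using q by (simp only: mult_le_cancel_left_pos)
    have inc: "loss_increment D u d2 \<le> K1 * J_norm D u d2"
      using near[OF A2 s2] e2' mi u by fastforce
    have "J_norm D u d2 \<le> 6 * K1 + 4 * 0"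
    proof (rule quadratic_linear_bound[where q = ?q and ?t1.0 = 0 and b = 0])
      show "J_norm D u d2 \<le> 4 * ?q \<Longrightarrow> (J_norm D u d2)\<^sup>2 / 4 \<le> K1 * J_norm D u d2 + 0 * 0"
        using M2(1) inc by simp
      show "4 * ?q < J_norm D u d2 \<Longrightarrow> ?q * J_norm D u d2 \<le> K1 * J_norm D u d2 + 0 * 0"
        using M2(2) inc by simp
    qed (use q K1 Kq J0 in auto)
    then show ?thesis using mi K1 by simp
  next
    assume mi: "missed D bh = 1"
    \<comment> \<open>From \<open>1 < A\<close> and \<open>9 \<le> c0\<close>, \<open>20 * Y\<close>
      is within the growth condition; it exceeds \<open>25 * b\<^sup>2\<close>, which is
      \<open>225 / 16 * Y\<close>. Hence \<open>5 * b \<le> q\<close>.\<close>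
    have "20 * Y \<le> 2 * A * (1 + ?c) * Y" using AC Y by (rule mult_right_mono)
    moreover have "25 * b\<^sup>2 \<le> 20 * Y" using bb Y by simp
    moreover have "0 \<le> ?q * (10 * K1)" using q K1 by simp
    ultimately have g1: "25 * b\<^sup>2 \<le> ?q\<^sup>2" and g2: "?q * (10 * K1) \<le> ?q\<^sup>2"
      using growth'[unfolded mi mult_1] Y by linarith+
    have "(5 * b)\<^sup>2 \<le> ?q\<^sup>2" using g1 by (simp add: power_mult_distrib)
    then have bq: "5 * b \<le> ?q" by (rule power2_le_imp_le) (use q in simp)
    have "?q * (10 * K1) \<le> ?q * ?q" using g2 by (simp add: power2_eq_square)
    then have Kq: "10 * K1 \<le> ?q" using q by (simp only: mult_le_cancel_left_pos)
    have inc1: "loss_increment D u d1 \<le> K1 * J_norm D u d1 + b * J_norm D u d1"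
      using near[OF A1 s1] e1 by simp
    have inc2: "loss_increment D u d2 \<le> K1 * J_norm D u d2 + b * J_norm D u d1"
      using near[OF A2 s2] e2 by simp
    have "J_norm D u d2 \<le> 6 * K1 + 4 * b"
      using M1(1,2) M2(1,2) inc1 inc2
      by (intro quadratic_linear_bound[where q = ?q and ?t1.0 = "J_norm D u d1"] J0 q K1 b Kq bq)
        (meson order_trans)+
    also have "\<dots> \<le> 40 * K1 + (4 * sqrt (2 * (1 + ?c) * A)) * (4 / 3 * b)"
    proof (rule add_mono)
      show "6 * K1 \<le> 40 * K1" using K1 by simp
      have "4 * b \<le> 4 * (4 / 3 * b)" using b by simp
      also have "\<dots> \<le> (4 * sqrt (2 * (1 + ?c) * A)) * (4 / 3 * b)" using sq b by (intro mult_right_mono) auto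
      finally show "4 * b \<le> (4 * sqrt (2 * (1 + ?c) * A)) * (4 / 3 * b)" .
    qed
    also have "(4 * sqrt (2 * (1 + ?c) * A)) * (4 / 3 * b)
        = missed D bh * (4 * sqrt (2 * (1 + ?c) * A) / (?f * kappa0 D)) * (C * W_of U * X)"
      by (simp add: mi b_def)
    finally show ?thesis .
  qed
  then show "J_norm D u (\<lambda>j. bt u j - coef D u j)
      \<le> 4 * (80 * sqrt Kc) * sqrt ?\<phi> / (?f * ?\<kappa>) * sqrt (rate m / real n)
        + missed D bh * (4 * sqrt (2 * (1 + ?c) * A) / (?f * kappa0 D))
            * (C * W_of U * sqrt (real (spars D) * log_np D / real n))"
    unfolding KK2 d2_def X_def .
qed

section \<open>Assembling the good event\<close>

text \<open>All that randomness contributes, collected for one outcome; the bounds follow from it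
  deterministically.\<close>

definition good_sample ::
  "real \<Rightarrow> real \<Rightarrow> real \<Rightarrow> (real \<Rightarrow> nat \<Rightarrow> real) \<Rightarrow> (real \<Rightarrow> nat \<Rightarrow> real) \<Rightarrow> 'a \<Rightarrow> bool" where
  "good_sample C Kc lam bh bt \<omega> \<longleftrightarrow>
     (\<forall>i<n. regular (covar D i \<omega>)) \<and>
     (\<forall>j<p. \<bar>sigma_hat n (design D \<omega>) j - 1\<bar> \<le> 1 / 2) \<and>
     0 \<le> lam \<and>
     (cone_c D + 3) / (cone_c D - 3) * Lambda_stat U n p (design D \<omega>) (\<lambda>i\<in>{..<n}. V i \<omega>) \<le> lam \<and>
     lam \<le> C * W_of U * sqrt (real n * ln (real p)) \<and>
     (\<forall>u\<in>U. penalized_estimate n p (responses D \<omega>) (design D \<omega>) lam u (bh u)) \<and>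
     (\<forall>u\<in>U. post_estimate n p (responses D \<omega>) (design D \<omega>) u (supp p (bh u)) (bt u)) \<and>
     (\<forall>u\<in>U. \<forall>k \<delta>. k \<le> n \<longrightarrow> card (supp p \<delta> - Tset D u) \<le> k \<longrightarrow>
       \<bar>emp_loss_increment D \<omega> u \<delta> - loss_increment D u \<delta>\<bar>
       \<le> 8 * sqrt (Kc * rate k / real n) * sqrt (phi D \<omega> (k + spars D)) * l2norm p \<delta>) \<and>
     cond_D5 D (m_hat D bh)"

lemma good_sample_bounds:
  fixes A C Kc lam :: real and bh bt :: "real \<Rightarrow> nat \<Rightarrow> real"
  assumes D4: "cond_D4 D" and A: "1 < A" and Kc: "0 < Kc" and g: "good_sample C Kc lam bh bt \<omega>"
  defines "m \<equiv> m_hat D bh" and "err \<equiv> \<lambda>u j. bt u j - coef D u j"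
  defines "r \<equiv> real m * ln (real (max n p)) + real (spars D) * ln (real n)"
  assumes growth: "q_sparse D m * (80 * sqrt Kc * sqrt (r * phi D \<omega> (m + spars D))
            / (sqrt (real n) * sqrt (f_lo D) * kappa_sparse D m))
          + missed D bh * (2 * A * (1 + cone_c D) * C\<^sup>2 * (W_of U)\<^sup>2 *
              (real (spars D) * ln (real (max p n)) / (real n * f_lo D * (kappa0 D)\<^sup>2)))
          \<le> (q_sparse D m)\<^sup>2"
  shows "(SUP u\<in>U. ereal (J_norm D u (err u)))
          \<le> ereal (4 * (80 * sqrt Kc) * sqrt (phi D \<omega> (m + spars D)) / (sqrt (f_lo D) * kappa_sparse D m)
                     * sqrt (r / real n)
                   + missed D bh * (4 * sqrt (2 * (1 + cone_c D) * A) / (sqrt (f_lo D) * kappa0 D))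
                     * (C * W_of U * sqrt (real (spars D) * ln (real (max n p)) / real n)))" (is ?first)
    and "(SUP u\<in>U. ereal (sqrt (\<integral>\<omega>'. (dot p (covar D 0 \<omega>') (err u))\<^sup>2 \<partial>P)))
          \<le> (SUP u\<in>U. ereal (J_norm D u (err u))) / ereal (sqrt (f_lo D))" (is ?second)
    and "(SUP u\<in>U. ereal (l2norm p (err u)))
          \<le> (SUP u\<in>U. ereal (J_norm D u (err u))) / ereal (sqrt (f_lo D) * kappa_sparse D m)" (is ?third)
proof -
  have r: "r = rate m" by (simp add: r_def rate_def log_np_alt)
  have growth': "q_sparse D m * (80 * sqrt Kc * sqrt (rate m * phi D \<omega> (m + spars D))
            / (sqrt (real n) * sqrt (f_lo D) * kappa_sparse D m))
          + missed D bh * (2 * A * (1 + cone_c D) * C\<^sup>2 * (W_of U)\<^sup>2 *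
              (real (spars D) * log_np D / (real n * f_lo D * (kappa0 D)\<^sup>2)))
          \<le> (q_sparse D m)\<^sup>2"
    using growth unfolding r log_np_alt .
  note G = g[unfolded good_sample_def]
  have D5: "cond_D5 D m" using G by (simp add: m_def)
  have b: "err u \<in> A_sparse D u m"
    "J_norm D u (err u)
      \<le> 4 * (80 * sqrt Kc) * sqrt (phi D \<omega> (m + spars D)) / (sqrt (f_lo D) * kappa_sparse D m) * sqrt (rate m / real n)
        + missed D bh * (4 * sqrt (2 * (1 + cone_c D) * A) / (sqrt (f_lo D) * kappa0 D))
            * (C * W_of U * sqrt (real (spars D) * log_np D / real n))" if u: "u \<in> U" for u
  proof -
    note pb = post_penalized_bound[where \<omega> = \<omega> and lam = lam and C = C and Kc = Kc and A = A
        and bh = bh and bt = bt and u = u, folded m_def]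
    show "err u \<in> A_sparse D u m" unfolding err_def
      by (rule pb(1)[OF D4 A]) (use G Kc D5 growth' u in \<open>assumption | blast\<close>)+
    show "J_norm D u (err u)
      \<le> 4 * (80 * sqrt Kc) * sqrt (phi D \<omega> (m + spars D)) / (sqrt (f_lo D) * kappa_sparse D m) * sqrt (rate m / real n)
        + missed D bh * (4 * sqrt (2 * (1 + cone_c D) * A) / (sqrt (f_lo D) * kappa0 D))
            * (C * W_of U * sqrt (real (spars D) * log_np D / real n))" unfolding err_def
      by (rule pb(2)[OF D4 A]) (use G Kc D5 growth' u in \<open>assumption | blast\<close>)+
  qed
  have f: "0 < sqrt (f_lo D)" using f_lo_pos by simp
  show ?first
    unfolding r log_np_alt by (intro SUP_least) (simp only: ereal_less_eq b(2))
  have upper: "ereal (J_norm D u (err u)) \<le> (SUP u\<in>U. ereal (J_norm D u (err u)))" if "u \<in> U" for u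
    using that by (rule SUP_upper)
  show ?second
  proof (rule SUP_least)
    fix u assume u: "u \<in> U"
    have "ereal (sqrt (f_lo D)) * ereal (sqrt (\<integral>\<omega>'. (dot p (covar D 0 \<omega>') (err u))\<^sup>2 \<partial>P)) \<le> ereal (J_norm D u (err u))"
      using J_norm_ge[OF u, of "err u"] by (simp add: moment2_def)
    also note upper[OF u]
    finally show "ereal (sqrt (\<integral>\<omega>'. (dot p (covar D 0 \<omega>') (err u))\<^sup>2 \<partial>P))
        \<le> (SUP u\<in>U. ereal (J_norm D u (err u))) / ereal (sqrt (f_lo D))"
      using f by (subst ereal_le_divide_pos) auto
  qed
  show ?third
  proof (rule SUP_least)
    fix u assume u: "u \<in> U"
    note s = sparse_minorized(4,5)[OF D4 D5 u b(1)[OF u]]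
    have "ereal (sqrt (f_lo D) * kappa_sparse D m) * ereal (l2norm p (err u)) \<le> ereal (J_norm D u (err u))"
      using s(2) by simp
    also note upper[OF u]
    finally show "ereal (l2norm p (err u))
        \<le> (SUP u\<in>U. ereal (J_norm D u (err u))) / ereal (sqrt (f_lo D) * kappa_sparse D m)"
      using f s(1) by (subst ereal_le_divide_pos) auto
  qed
qed

text \<open>The excluded probabilities are \<alpha> for the pivot, \<open>gam\<close> for
  \<open>sigma_hat\<close>, one \<epsilon> for the sparse deviations and one for D.5; everything
  else holds almost surely.\<close>

lemma good_sample_event:
  fixes \<epsilon> \<alpha> C :: real and lam :: "(nat \<Rightarrow> nat \<Rightarrow> real) \<Rightarrow> real"
    and bhat btil :: "'a \<Rightarrow> real \<Rightarrow> nat \<Rightarrow> real"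
  assumes D4: "cond_D4 D" and eps: "0 < \<epsilon>" and \<alpha>: "0 < \<alpha>" "\<alpha> < 1"
    and lam: "AE \<omega> in P.
         (cone_c D + 3) / (cone_c D - 3) * Lambda_quantile U n p (design D \<omega>) (1 - \<alpha>) \<le> lam (design D \<omega>) \<and>
         lam (design D \<omega>) \<le> C * W_of U * sqrt (real n * ln (real p))"
    and V: "card (\<Union>u\<in>U. Tset D u) \<le> n"
    and pen: "AE \<omega> in P. \<forall>u\<in>U.
         penalized_estimate n p (responses D \<omega>) (design D \<omega>) (lam (design D \<omega>)) u (bhat \<omega> u)"
    and post: "AE \<omega> in P. \<forall>u\<in>U.
         post_estimate n p (responses D \<omega>) (design D \<omega>) u (supp p (bhat \<omega> u)) (btil \<omega> u)"
    and D5: "holds_with_prob P (1 - \<epsilon>) (\<lambda>\<omega>. cond_D5 D (m_hat D (bhat \<omega>)))"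
  defines "Kc \<equiv> 80 * (16 + max 0 (ln (1 / \<epsilon>)))"
  shows "holds_with_prob P (1 - \<alpha> - gam D n - 2 * \<epsilon>)
    (\<lambda>\<omega>. good_sample C Kc (lam (design D \<omega>)) (bhat \<omega>) (btil \<omega>) \<omega>)"
proof -
  define E2 where "E2 = {\<omega> \<in> space P. (MAX j\<in>{..<p}. \<bar>sigma_hat n (design D \<omega>) j - 1\<bar>) \<le> 1 / 2}"
  have m2: "1 - gam D n \<le> measure P E2" using D3 by (simp add: cond_D3_def E2_def)
  show ?thesis
  \<comment> \<open>D.3 does not state that this set is measurable. Otherwise its measure is 0 by
    convention, the required probability is not positive, and the empty event serves.\<close>
  proof (cases "E2 \<in> sets P")
    case False
    then have "measure P E2 = 0" by (rule measure_notin_sets)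
    then have "1 - \<alpha> - gam D n - 2 * \<epsilon> \<le> measure P {}" using m2 \<alpha> eps by simp
    then show ?thesis unfolding holds_with_prob_def by (intro bexI[of _ "{}"]) auto
  next
    case True
    obtain E1 where E1: "E1 \<in> sets P" "1 - \<alpha> \<le> measure P E1"
      "\<And>\<omega>. \<omega> \<in> E1 \<Longrightarrow> Lambda_stat U n p (design D \<omega>) (\<lambda>i\<in>{..<n}. V i \<omega>)
         \<le> Lambda_quantile U n p (design D \<omega>) (1 - \<alpha>)"
      using pivot_event[OF \<alpha>] by metis
    obtain E3 where E3: "E3 \<in> sets P" "1 - \<epsilon> \<le> measure P E3" "\<And>\<omega>. \<omega> \<in> E3 \<Longrightarrow> cond_D5 D (m_hat D (bhat \<omega>))"
      using D5 unfolding holds_with_prob_def by blast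
    obtain E4 where E4: "E4 \<in> sets P" "measure P E4 \<le> \<epsilon>" and emp: "\<And>\<omega> u k \<delta>. \<lbrakk>\<omega> \<in> space P - E4; u \<in> U; k \<le> n; card (supp p \<delta> - Tset D u) \<le> k\<rbrakk> \<Longrightarrow>
       \<bar>emp_loss_increment D \<omega> u \<delta> - loss_increment D u \<delta>\<bar>
       \<le> 8 * sqrt (Kc * rate k / real n) * sqrt (phi D \<omega> (k + spars D)) * l2norm p \<delta>"
      using sparse_increment_event[OF eps V] unfolding Kc_def by blast
    have "AE \<omega> in P. \<forall>i\<in>{..<n}. regular (covar D i \<omega>)"
      using regular_AE_covar by (intro AE_finite_allI) auto
    with lam pen post have "AE \<omega> in P. (\<forall>i\<in>{..<n}. regular (covar D i \<omega>)) \<and>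
         ((cone_c D + 3) / (cone_c D - 3) * Lambda_quantile U n p (design D \<omega>) (1 - \<alpha>) \<le> lam (design D \<omega>) \<and>
         lam (design D \<omega>) \<le> C * W_of U * sqrt (real n * ln (real p))) \<and>
         (\<forall>u\<in>U. penalized_estimate n p (responses D \<omega>) (design D \<omega>) (lam (design D \<omega>)) u (bhat \<omega> u)) \<and>
         (\<forall>u\<in>U. post_estimate n p (responses D \<omega>) (design D \<omega>) u (supp p (bhat \<omega> u)) (btil \<omega> u))"
      by eventually_elim blast
    from AE_null_set[OF this] obtain N where N: "N \<in> null_sets P" and
      AE: "\<forall>\<omega>\<in>space P - N. (\<forall>i\<in>{..<n}. regular (covar D i \<omega>)) \<and>
         ((cone_c D + 3) / (cone_c D - 3) * Lambda_quantile U n p (design D \<omega>) (1 - \<alpha>) \<le> lam (design D \<omega>) \<and>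
         lam (design D \<omega>) \<le> C * W_of U * sqrt (real n * ln (real p))) \<and>
         (\<forall>u\<in>U. penalized_estimate n p (responses D \<omega>) (design D \<omega>) (lam (design D \<omega>)) u (bhat \<omega> u)) \<and>
         (\<forall>u\<in>U. post_estimate n p (responses D \<omega>) (design D \<omega>) u (supp p (bhat \<omega> u)) (btil \<omega> u))"
      by (rule bexE)
    have N0: "measure P N = 0" "N \<in> sets P" using N by (simp_all add: null_sets_def measure_def)
    define B where "B = (space P - E1) \<union> ((space P - E2) \<union> ((space P - E3) \<union> (E4 \<union> N)))"
    have Bm: "B \<in> sets P" unfolding B_def using E1(1) True E3(1) E4(1) N0(2) by blast
    have "measure P B \<le> measure P (space P - E1) + (measure P (space P - E2) + (measure P (space P - E3) + (measure P E4 + measure P N)))"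
      unfolding B_def using E1(1) True E3(1) E4(1) N0(2)
      by (intro order_trans[OF measure_Un_le] add_left_mono) auto
    also have "\<dots> \<le> \<alpha> + gam D n + 2 * \<epsilon>"
      using E1(2) m2 E3(2) E4(2) N0(1) prob_compl[OF E1(1)] prob_compl[OF True] prob_compl[OF E3(1)] by simp
    finally have "1 - \<alpha> - gam D n - 2 * \<epsilon> \<le> measure P (space P - B)"
      using prob_compl[OF Bm] by simp
    moreover have "good_sample C Kc (lam (design D \<omega>)) (bhat \<omega>) (btil \<omega>) \<omega>" if \<omega>: "\<omega> \<in> space P - B" for \<omega>
    proof -
      have mem: "\<omega> \<in> space P" "\<omega> \<in> E1" "\<omega> \<in> E2" "\<omega> \<in> E3" "\<omega> \<in> space P - E4" "\<omega> \<in> space P - N"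
        using \<omega> by (auto simp: B_def)
      note a = bspec[OF AE mem(6)]
      have c9: "9 \<le> cone_c D" using D4 by (simp add: cond_D4_def)
      let ?q = "Lambda_quantile U n p (design D \<omega>) (1 - \<alpha>)"
      have cc: "0 \<le> (cone_c D + 3) / (cone_c D - 3)" using c9 by simp
      have "0 \<le> (cone_c D + 3) / (cone_c D - 3) * ?q"
        using cc Lambda_quantile_nonneg[OF mem(1) \<alpha>] by (rule mult_nonneg_nonneg)
      then have l0: "0 \<le> lam (design D \<omega>)" using a by linarith
      have "(cone_c D + 3) / (cone_c D - 3) * Lambda_stat U n p (design D \<omega>) (\<lambda>i\<in>{..<n}. V i \<omega>)
          \<le> (cone_c D + 3) / (cone_c D - 3) * ?q"
        using E1(3)[OF mem(2)] cc by (rule mult_left_mono)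
      then have l1: "(cone_c D + 3) / (cone_c D - 3) * Lambda_stat U n p (design D \<omega>) (\<lambda>i\<in>{..<n}. V i \<omega>) \<le> lam (design D \<omega>)"
        using a by linarith
      have sig: "\<bar>sigma_hat n (design D \<omega>) j - 1\<bar> \<le> 1 / 2" if j: "j < p" for j
      proof -
        have "\<bar>sigma_hat n (design D \<omega>) j - 1\<bar> \<le> (MAX j\<in>{..<p}. \<bar>sigma_hat n (design D \<omega>) j - 1\<bar>)"
          using j by (intro Max_ge) auto
        also have "\<dots> \<le> 1 / 2" using mem(3) by (simp add: E2_def)
        finally show ?thesis .
      qed
      show ?thesis unfolding good_sample_def using a l0 l1 sig emp[OF mem(5)] E3(3)[OF mem(4)] by auto
    qed
    ultimately show ?thesis
      unfolding holds_with_prob_def using Bm by (intro bexI[of _ "space P - B"]) auto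
  qed
qed

lemma gam_nonneg: "0 \<le> gam D n"
proof -
  have "1 - gam D n \<le> measure P {\<omega> \<in> space P. (MAX j\<in>{..<p}. \<bar>sigma_hat n (design D \<omega>) j - 1\<bar>) \<le> 1 / 2}"
    using D3 by (simp add: cond_D3_def)
  also have "\<dots> \<le> 1" by (rule prob_le_1)
  finally show ?thesis by simp
qed

end

lemma holds_with_prob_mono:
  assumes "holds_with_prob M r P" "r' \<le> r" "\<And>\<omega>. P \<omega> \<Longrightarrow> Q \<omega>"
  shows "holds_with_prob M r' Q"
  using assms unfolding holds_with_prob_def by (meson order_trans)

text \<open>\<open>C_eps\<close> is fixed by \<epsilon> before the model is given, so it cannot
  depend on sample size or dimension. The growth condition involves the random size of the selected
  model and is therefore a premise for each outcome, inside the probability statement.\<close>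

theorem theorem5:
  fixes C_Lambda C_E :: real
  assumes "Lambda_constant C_Lambda"
    and "\<And>(D :: 'a qr_model) t A.
           \<lbrakk>qr_setting D; cond_D1 D; cond_D2 D; cond_D3 D; cond_D4 D; 0 < t; 1 < A\<rbrakk>
           \<Longrightarrow> emp_error_bound D C_E t A"
  shows "\<forall>\<epsilon>>0. \<exists>C_eps>0.
    \<forall>(D :: 'a qr_model) \<alpha> A C (lam :: (nat \<Rightarrow> nat \<Rightarrow> real) \<Rightarrow> real)
       (bhat :: 'a \<Rightarrow> real \<Rightarrow> nat \<Rightarrow> real) (btil :: 'a \<Rightarrow> real \<Rightarrow> nat \<Rightarrow> real).
      let n = nobs D; p = dimp D; U = qset D; s = spars D; W = W_of U; c0 = cone_c D;
          m = (\<lambda>\<omega>. m_hat D (bhat \<omega>));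
          err = (\<lambda>\<omega> u j. btil \<omega> u j - coef D u j);
          rate = (\<lambda>\<omega>. real (m \<omega>) * ln (real (max n p)) + real s * ln (real n))
      in
      0 < \<alpha> \<and> \<alpha> < 1 \<and> 1 < A \<and>
      qr_setting D \<and> cond_D1 D \<and> cond_D2 D \<and> cond_D3 D \<and> cond_D4 D \<and>
      max (2 * C_Lambda * sqrt (1 + ln (1 / \<alpha>) / ln (real p)))
          (C_E * sqrt (max 1 (C_L D + C_f D + 1 / 2))) < C \<and>
      (AE \<omega> in Pr D.
         (c0 + 3) / (c0 - 3) * Lambda_quantile U n p (design D \<omega>) (1 - \<alpha>) \<le> lam (design D \<omega>) \<and>
         lam (design D \<omega>) \<le> C * W * sqrt (real n * ln (real p))) \<and>
      ereal (2 * C * (1 + c0) * W * A * sqrt (real s * ln (real (max p n))))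
        < q_const D * ereal (sqrt (f_lo D) * kappa0 D * sqrt (real n)) \<and>
      card (\<Union>u\<in>U. Tset D u) \<le> n \<and>
      (AE \<omega> in Pr D. \<forall>u\<in>U.
         penalized_estimate n p (responses D \<omega>) (design D \<omega>) (lam (design D \<omega>)) u (bhat \<omega> u)) \<and>
      (AE \<omega> in Pr D. \<forall>u\<in>U.
         post_estimate n p (responses D \<omega>) (design D \<omega>) u (supp p (bhat \<omega> u)) (btil \<omega> u)) \<and>
      holds_with_prob (Pr D) (1 - \<epsilon>) (\<lambda>\<omega>. cond_D5 D (m \<omega>))
      \<longrightarrow>
      holds_with_prob (Pr D) (1 - \<alpha> - 3 * gam D n - 3 * real p powr (- A\<^sup>2) - 2 * \<epsilon>) (\<lambda>\<omega>.
        q_sparse D (m \<omega>) * (C_eps * sqrt (rate \<omega> * phi D \<omega> (m \<omega> + s))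
            / (sqrt (real n) * sqrt (f_lo D) * kappa_sparse D (m \<omega>)))
          + missed D (bhat \<omega>) * (2 * A * (1 + c0) * C\<^sup>2 * W\<^sup>2 *
              (real s * ln (real (max p n)) / (real n * f_lo D * (kappa0 D)\<^sup>2)))
          \<le> (q_sparse D (m \<omega>))\<^sup>2
        \<longrightarrow>
        (SUP u\<in>U. ereal (J_norm D u (err \<omega> u)))
          \<le> ereal (4 * C_eps * sqrt (phi D \<omega> (m \<omega> + s)) / (sqrt (f_lo D) * kappa_sparse D (m \<omega>))
                     * sqrt (rate \<omega> / real n)
                   + missed D (bhat \<omega>) * (4 * sqrt (2 * (1 + c0) * A) / (sqrt (f_lo D) * kappa0 D))
                     * (C * W * sqrt (real s * ln (real (max n p)) / real n))) \<and>
        (SUP u\<in>U. ereal (sqrt (\<integral>\<omega>'. (dot p (covar D 0 \<omega>') (err \<omega> u))\<^sup>2 \<partial>Pr D)))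
          \<le> (SUP u\<in>U. ereal (J_norm D u (err \<omega> u))) / ereal (sqrt (f_lo D)) \<and>
        (SUP u\<in>U. ereal (l2norm p (err \<omega> u)))
          \<le> (SUP u\<in>U. ereal (J_norm D u (err \<omega> u)))
              / ereal (sqrt (f_lo D) * kappa_sparse D (m \<omega>)))"
proof (intro allI impI, goal_cases)
  case (1 \<epsilon>)
  define Kc where "Kc = 80 * (16 + max 0 (ln (1 / \<epsilon>)))"
  have "0 < 16 + max 0 (ln (1 / \<epsilon>))" by (rule add_pos_nonneg) auto
  then have Kc: "0 < Kc" by (simp add: Kc_def)
  show ?case
    unfolding Let_def
  proof (intro exI[of _ "80 * sqrt Kc"] conjI allI impI, goal_cases)
    case 1
    then show ?case using Kc by simp
  next
    case (2 D \<alpha> A C lam bhat btil)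
    then have \<alpha>: "0 < \<alpha>" "\<alpha> < 1" and A: "1 < A"
      and D: "qr_setting D" "cond_D1 D" "cond_D2 D" "cond_D3 D" and D4: "cond_D4 D"
      by blast+
    interpret qr_sample D by (unfold_locales) (fact D)+
    have E: "holds_with_prob P (1 - \<alpha> - gam D n - 2 * \<epsilon>)
        (\<lambda>\<omega>. good_sample C Kc (lam (design D \<omega>)) (bhat \<omega>) (btil \<omega>) \<omega>)"
      unfolding Kc_def by (rule good_sample_event[OF D4 \<open>0 < \<epsilon>\<close> \<alpha>]) (use 2 in blast)+
    \<comment> \<open>The event has at least the required probability, since \<open>gam\<close> and
      the power of \<open>p\<close> are nonnegative.\<close>
    have prob: "1 - \<alpha> - 3 * gam D n - 3 * real p powr (- A\<^sup>2) - 2 * \<epsilon> \<le> 1 - \<alpha> - gam D n - 2 * \<epsilon>"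
      using gam_nonneg powr_ge_zero[of "real p" "- A\<^sup>2"] by linarith
    show ?case
      by (rule holds_with_prob_mono[OF E prob]) (intro impI conjI good_sample_bounds[OF D4 A Kc]; assumption)
  qed
qed

end
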